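(* Let $U:\mathbb{R}^d\to\mathbb{R}$ be strongly convex and satisfy the piecewise Lipschitz assumption (with constant $L>0$) and the strong monotonicity assumption (with constant $\mu>0$) given in the context, and let the $\mathbb{R}^d$-valued random variable $\xi$ satisfy the initial condition assumption given in the context. Let $p\geq 1$ and $\beta>0$, and let $\pi_\beta$ be the probability measure on $\mathbb{R}^d$ with density proportional to $e^{-\beta U}$ (the invariant measure of the overdamped Langevin SDE $dY_t=-\nabla U(Y_t)dt+\sqrt{2/\beta}\,dW_t$). Let $\gamma_0\in(0,\frac{\mu}{2L^2})$. Then there exists $c>0$ such that for every $\gamma\in(0,\gamma_0)$ and every $n\in\mathbb{N}$ the unadjusted Langevin algorithm $$x_{n+1}=x_n-\gamma\nabla U(x_n)+\sqrt{\tfrac{2\gamma}{\beta}}\,z_{n+1},\qquad x_0=\xi,$$ where $(z_n)_{n\ge1}$ are i.i.d. standard Gaussians on $\mathbb{R}^d$ independent of $\xi$, satisfies $$W_p(\pi_\beta,\mathcal{L}(x_n))\leq W_p(\mathcal{L}(\xi),\pi_\beta)\,e^{-\mu\gamma n}+c\gamma^{1/2}.$$ The constant $c$ does not depend on $\gamma$ or $n$.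
   Context: $\mathcal{L}(Z)$ denotes the law of a random variable $Z$. $W_p(\nu_1,\nu_2)=\inf (E|Z_1-Z_2|^p)^{1/p}$ over all couplings with $\mathcal{L}(Z_i)=\nu_i$ is the Wasserstein-$p$ distance. Piecewise Lipschitz assumption: there exist bounded regions $M_j\subset\mathbb{R}^d$ and compact, orientable, connected, $C^3$ hypersurfaces $\Sigma_j\subset\mathbb{R}^d$ such that $\Sigma_j=\partial M_j$, $j=1,\dots,n_2$. Furthermore there exist disjoint open sets $\Phi_i\subset\mathbb{R}^d$, $i=1,\dots,n_1$, such that $\bigcup_{i=1}^{n_1}\overline{\Phi}_i=\mathbb{R}^d$ and $\bigcup_{i=1}^{n_1}\partial\Phi_i\subset\bigcup_{j=1}^{n_2}\Sigma_j$. The gradient $\nabla U$ is well defined on every $\Phi_i$, and there exists $L>0$ such that $|\nabla U(x)-\nabla U(y)|\le L|x-y|$ for all $x,y\in\Phi_i$, $i=1,\dots,n_1$. ($\nabla U$ need not be defined on $\bigcup_j\Sigma_j$; the hypersurfaces may intersect arbitrarily.) Strong monotonicity assumption: there exists $\mu>0$ such that $\langle\nabla U(x)-\nabla U(y),x-y\rangle\ge\mu|x-y|^2$ for all $x,y\in\mathbb{R}^d$ at which $\nabla U$ is well defined. Initial condition assumption: $P(\xi\in\{x\in\mathbb{R}^d:\nabla U(x)\text{ well defined}\})=1$, and $E|\xi|^p<\infty$ for every $p>0$. Under these assumptions each $x_n$ almost surely lies in the set where $\nabla U$ is well defined, so the algorithm is almost surely well defined. *)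

theory Defs
  imports "HOL-Probability.Probability"
begin

definition has_gradient :: "('a::euclidean_space \<Rightarrow> real) \<Rightarrow> 'a \<Rightarrow> bool" where
  "has_gradient f x \<longleftrightarrow> (\<exists>D. GDERIV f x :> D)"

text \<open>Where \<open>f\<close> is not differentiable the value of \<open>gradient f\<close> is one fixed unspecified
  vector.\<close>

definition gradient :: "('a::euclidean_space \<Rightarrow> real) \<Rightarrow> 'a \<Rightarrow> 'a" where
  "gradient f x = (THE D. GDERIV f x :> D)"

text \<open>To be used with an open set \<open>S\<close>: \<open>C_k k f S\<close> says that all partial derivatives of \<open>f\<close> up
  to order \<open>k\<close> exist and are continuous on \<open>S\<close>.\<close>

primrec C_k :: "nat \<Rightarrow> ('a::euclidean_space \<Rightarrow> real) \<Rightarrow> 'a set \<Rightarrow> bool" where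
  "C_k 0 f S \<longleftrightarrow> continuous_on S f"
| "C_k (Suc k) f S \<longleftrightarrow>
     (\<forall>x\<in>S. has_gradient f x) \<and> (\<forall>b\<in>Basis. C_k k (\<lambda>x. gradient f x \<bullet> b) S)"

text \<open>Embedded hypersurfaces without boundary, given locally as regular level sets.\<close>

definition hypersurface :: "nat \<Rightarrow> 'a::euclidean_space set \<Rightarrow> bool" where
  "hypersurface k S \<longleftrightarrow>
     (\<forall>x\<in>S. \<exists>V f. open V \<and> x \<in> V \<and> C_k k f V \<and> S \<inter> V = {y \<in> V. f y = 0} \<and>
        (\<forall>y \<in> S \<inter> V. gradient f y \<noteq> 0))"

definition tangent_vectors :: "'a::euclidean_space set \<Rightarrow> 'a \<Rightarrow> 'a set" where
  "tangent_vectors S x =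
     {v. \<exists>g :: real \<Rightarrow> 'a. g 0 = x \<and> (\<forall>\<^sub>F t in nhds 0. g t \<in> S) \<and>
           (g has_vector_derivative v) (at 0)}"

text \<open>A hypersurface in Euclidean space is orientable iff it has a continuous unit normal field.\<close>

definition orientable :: "'a::euclidean_space set \<Rightarrow> bool" where
  "orientable S \<longleftrightarrow>
     (\<exists>\<nu> :: 'a \<Rightarrow> 'a. continuous_on S \<nu> \<and>
        (\<forall>x\<in>S. norm (\<nu> x) = 1 \<and> (\<forall>v \<in> tangent_vectors S x. \<nu> x \<bullet> v = 0)))"

definition region :: "'a::euclidean_space set \<Rightarrow> bool" where
  "region M \<longleftrightarrow> open M \<and> connected M \<and> M \<noteq> {}"

definition strongly_convex :: "('a::euclidean_space \<Rightarrow> real) \<Rightarrow> bool" where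
  "strongly_convex U \<longleftrightarrow>
     (\<exists>m>0. \<forall>x y. \<forall>t\<in>{0..1}.
        U ((1 - t) *\<^sub>R x + t *\<^sub>R y)
          \<le> (1 - t) * U x + t * U y - m / 2 * t * (1 - t) * (norm (x - y))\<^sup>2)"

definition piecewise_lipschitz_gradient :: "('a::euclidean_space \<Rightarrow> real) \<Rightarrow> real \<Rightarrow> bool" where
  "piecewise_lipschitz_gradient U L \<longleftrightarrow> L > 0 \<and>
     (\<exists>(n1::nat) (n2::nat) (\<Phi> :: nat \<Rightarrow> 'a set) (M :: nat \<Rightarrow> 'a set) (\<Sigma> :: nat \<Rightarrow> 'a set).
        (\<forall>j\<in>{1..n2}. bounded (M j) \<and> region (M j) \<and> compact (\<Sigma> j) \<and> orientable (\<Sigma> j) \<and>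
           connected (\<Sigma> j) \<and> hypersurface 3 (\<Sigma> j) \<and> \<Sigma> j = frontier (M j)) \<and>
        (\<forall>i\<in>{1..n1}. open (\<Phi> i)) \<and>
        disjoint_family_on \<Phi> {1..n1} \<and>
        (\<Union>i\<in>{1..n1}. closure (\<Phi> i)) = UNIV \<and>
        (\<Union>i\<in>{1..n1}. frontier (\<Phi> i)) \<subseteq> (\<Union>j\<in>{1..n2}. \<Sigma> j) \<and>
        (\<forall>i\<in>{1..n1}. (\<forall>x\<in>\<Phi> i. has_gradient U x) \<and>
           (\<forall>x\<in>\<Phi> i. \<forall>y\<in>\<Phi> i. norm (gradient U x - gradient U y) \<le> L * norm (x - y))))"

definition strongly_monotone_gradient :: "('a::euclidean_space \<Rightarrow> real) \<Rightarrow> real \<Rightarrow> bool" where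
  "strongly_monotone_gradient U \<mu> \<longleftrightarrow> \<mu> > 0 \<and>
     (\<forall>x y. has_gradient U x \<longrightarrow> has_gradient U y \<longrightarrow>
        (gradient U x - gradient U y) \<bullet> (x - y) \<ge> \<mu> * (norm (x - y))\<^sup>2)"

definition admissible_initial ::
  "'b measure \<Rightarrow> ('a::euclidean_space \<Rightarrow> real) \<Rightarrow> ('b \<Rightarrow> 'a) \<Rightarrow> bool" where
  "admissible_initial P U \<xi> \<longleftrightarrow>
     \<xi> \<in> borel_measurable P \<and>
     (AE \<omega> in P. has_gradient U (\<xi> \<omega>)) \<and>
     (\<forall>q>0. integrable P (\<lambda>\<omega>. norm (\<xi> \<omega>) powr q))"

definition std_gaussian_density :: "'a::euclidean_space \<Rightarrow> real" where
  "std_gaussian_density x = (\<Prod>b\<in>Basis. std_normal_density (x \<bullet> b))"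

text \<open>Mutual independence of \<open>\<xi>, z 1, z 2, \<dots>\<close> expresses that the \<open>z n\<close>, \<open>n \<ge> 1\<close>, are
  independent and that the whole sequence is independent of \<open>\<xi>\<close>. The value \<open>z 0\<close> plays no role.\<close>

definition gaussian_noise ::
  "'b measure \<Rightarrow> ('b \<Rightarrow> 'a::euclidean_space) \<Rightarrow> (nat \<Rightarrow> 'b \<Rightarrow> 'a) \<Rightarrow> bool" where
  "gaussian_noise P \<xi> z \<longleftrightarrow>
     (\<forall>n\<ge>1. distributed P lborel (z n) (\<lambda>x. ennreal (std_gaussian_density x))) \<and>
     prob_space.indep_vars P (\<lambda>_. borel) (\<lambda>n. if n = 0 then \<xi> else z n) (UNIV :: nat set)"

primrec ula :: "('a::euclidean_space \<Rightarrow> real) \<Rightarrow> real \<Rightarrow> real \<Rightarrow> ('b \<Rightarrow> 'a) \<Rightarrow> (nat \<Rightarrow> 'b \<Rightarrow> 'a)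
    \<Rightarrow> nat \<Rightarrow> 'b \<Rightarrow> 'a" where
  "ula U \<beta> \<gamma> \<xi> z 0 \<omega> = \<xi> \<omega>"
| "ula U \<beta> \<gamma> \<xi> z (Suc n) \<omega> =
     ula U \<beta> \<gamma> \<xi> z n \<omega> - \<gamma> *\<^sub>R gradient U (ula U \<beta> \<gamma> \<xi> z n \<omega>)
       + sqrt (2 * \<gamma> / \<beta>) *\<^sub>R z (Suc n) \<omega>"

definition gibbs_measure :: "('a::euclidean_space \<Rightarrow> real) \<Rightarrow> real \<Rightarrow> 'a measure" where
  "gibbs_measure U \<beta> =
     density lborel (\<lambda>x. ennreal (exp (- \<beta> * U x) / (\<integral>y. exp (- \<beta> * U y) \<partial>lborel)))"

definition couplings ::
  "'a::euclidean_space measure \<Rightarrow> 'a measure \<Rightarrow> ('a \<times> 'a) measure set" where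
  "couplings \<nu>1 \<nu>2 =
     {Q. prob_space Q \<and> sets Q = sets (borel \<Otimes>\<^sub>M borel) \<and>
         distr Q borel fst = \<nu>1 \<and> distr Q borel snd = \<nu>2}"

definition ennreal_root :: "real \<Rightarrow> ennreal \<Rightarrow> ennreal" where
  "ennreal_root p r = (if r = \<top> then \<top> else ennreal (enn2real r powr (1 / p)))"

definition wasserstein ::
  "real \<Rightarrow> 'a::euclidean_space measure \<Rightarrow> 'a measure \<Rightarrow> ennreal" where
  "wasserstein p \<nu>1 \<nu>2 =
     (INF Q\<in>couplings \<nu>1 \<nu>2.
        ennreal_root p (\<integral>\<^sup>+ w. ennreal (norm (fst w - snd w) powr p) \<partial>Q))"

end

theory Submission
  imports Defs
begin

text \<open>The law of the algorithm is compared with \<open>\<pi>\<close>, the law with density proportional to \<open>exp (-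
\<beta> U)\<close>, through a stationary Markov chain in discrete time. This chain takes the place of the
Langevin diffusion. Throughout \<open>\<sigma>\<^sup>2 = \<gamma> / \<beta>\<close>, and the noise of one step of
the algorithm is split as \<open>\<sigma> (z1 + z2)\<close> with independent standard Gaussian \<open>z1\<close> and \<open>z2\<close>.

The stationary chain. Given \<open>y\<close> with law \<open>\<pi>\<close>, put \<open>yt = y + \<sigma> z1\<close> and redraw \<open>y\<close> from its
conditional law given \<open>yt\<close>, whose density is proportional to \<open>exp (- \<beta> U y' - |y' - yt|\<^sup>2 /
(2 \<sigma>\<^sup>2))\<close>; this leaves \<open>\<pi>\<close> invariant (\<open>RG_exchangeable\<close>). The conditional law is a
perturbation of the law of \<open>yt + \<sigma> z2\<close>, and the new point has to be a function of the same \<open>z2\<close>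
that drives the algorithm. For this an independent exact sample of the conditional law is refreshed
coordinate by coordinate, each time with the monotone map that sends the standard normal law to the
conditional law on a line (\<open>gibbs_sweep\<close>). A monotone map between two densities on the line whose
ratio has a controlled logarithmic slope moves every point only a little
(\<open>normal_quantile_map_displacement\<close>). For a locally Lipschitz \<open>U\<close> this gives \<open>y' = yt + \<sigma> z2 +
O(\<gamma>)\<close>.

The order one half. Compare \<open>y'\<close> with the step of the algorithm from \<open>yt + \<sigma> z2\<close>. The difference
is \<open>\<gamma>\<close> times a remainder that need not be small, because the gradient jumps. Its conditional
mean given \<open>yt\<close>, however, is of order \<open>\<sigma>\<close> (\<open>remainder_mean_bound\<close>): to first order the mean of the
conditional law is computed by Gaussian integration by parts, and this holds for locally Lipschitz
functions, which are differentiable only almost everywhere (\<open>gauss_stein_potential\<close>). An expansion of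
even powers of the norm then shows that the distance \<open>D\<close> between the chain and a copy of the algorithm
started in the same point satisfies \<open>E |D'| ^ (2 m + 2) \<le> (1 - c \<gamma>) E |D| ^ (2 m + 2) + C
\<gamma> ^ (m + 2)\<close> (\<open>one_step_contraction\<close>). So \<open>D\<close> stays of order \<open>sqrt \<gamma>\<close> in all \<open>L\<^sup>p\<close>.

The exponential rate. Two copies of the algorithm driven by the same noise contract by the factor
\<open>\<rho>\<close> with \<open>\<rho>\<^sup>2 = 1 - 2 \<mu> \<gamma> + O(\<gamma>\<^sup>2)\<close> in each step, up to an error
of order \<open>\<gamma>\<^sup>2\<close> in the squared distance caused by the jumps of the gradient; the function
\<open>excess\<close> removes this error. The difference between \<open>\<rho>\<^sup>n\<close> and \<open>exp (- \<mu> \<gamma> n)\<close> is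
\<open>O(\<gamma>)\<close> uniformly in \<open>n\<close> (\<open>synchronous_rate_vs_exponential\<close>). The triangle inequality in \<open>L\<^sup>p\<close>
finishes the case of small step sizes (\<open>chain_cost\<close>, \<open>small_step_bound\<close>). For step sizes bounded away
from zero the moments of the algorithm are bounded uniformly (\<open>uniform_moment_bound\<close>), which is enough
as then \<open>sqrt \<gamma>\<close> is bounded below.\<close>

section \<open>The standard Gaussian measure\<close>

abbreviation gauss :: "'a::euclidean_space measure" where
  "gauss \<equiv> density lborel (\<lambda>x. ennreal (std_gaussian_density x))"

lemma std_gaussian_density_eq:
  "std_gaussian_density (x::'a::euclidean_space) = exp (- (norm x)\<^sup>2 / 2) / sqrt (2 * pi) ^ DIM('a)"
proof -
  have "(\<Sum>b\<in>Basis. - (x \<bullet> b)\<^sup>2 / 2) = - (norm x)\<^sup>2 / 2"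
    by (simp add: norm_eq_sqrt_inner euclidean_inner[of x x] power2_eq_square sum_negf sum_divide_distrib[symmetric] sum_nonneg)
  then show ?thesis unfolding std_gaussian_density_def std_normal_density_def
    by (simp add: prod_dividef exp_sum[symmetric] prod.distrib)
qed

lemma std_gaussian_density_pos: "0 < std_gaussian_density x"
  by (simp add: std_gaussian_density_eq)

lemma std_gaussian_density_measurable[measurable]: "std_gaussian_density \<in> borel_measurable borel"
  unfolding std_gaussian_density_def[abs_def] by measurable

lemma prob_space_gauss: "prob_space (gauss :: 'a::euclidean_space measure)"
proof (rule prob_spaceI)
  have "(\<integral>\<^sup>+s. ennreal (std_normal_density s) \<partial>lborel) = 1"
    using prob_space.emeasure_space_1[OF prob_space_normal_density[of 1 0]] by (simp add: emeasure_density)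
  then have "(\<integral>\<^sup>+x. (\<Prod>b\<in>Basis. ennreal (std_normal_density (x \<bullet> b))) \<partial>(lborel::'a measure)) = 1"
    by (subst nn_integral_lborel_prod) auto
  then show "emeasure (gauss::'a measure) (space gauss) = 1"
    by (simp add: emeasure_density std_gaussian_density_def prod_ennreal)
qed

interpretation gauss: prob_space "gauss :: 'a::euclidean_space measure"
  by (rule prob_space_gauss)

interpretation gauss: pair_sigma_finite "gauss :: 'a::euclidean_space measure" "gauss :: 'a measure" ..

lemma nn_integral_lborel_affine:
  fixes f :: "'a::euclidean_space \<Rightarrow> ennreal"
  assumes [measurable]: "f \<in> borel_measurable borel" and "c \<noteq> 0"
  shows "(\<integral>\<^sup>+x. f x \<partial>lborel) = ennreal (\<bar>c\<bar> ^ DIM('a)) * (\<integral>\<^sup>+x. f (t + c *\<^sub>R x) \<partial>lborel)"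
  by (subst lborel_affine[OF \<open>c \<noteq> 0\<close>, of t])
     (simp add: nn_integral_density nn_integral_distr nn_integral_cmult)

lemma nn_integral_lborel_translate:
  fixes f :: "'a::euclidean_space \<Rightarrow> ennreal"
  assumes [measurable]: "f \<in> borel_measurable borel"
  shows "(\<integral>\<^sup>+x. f (x + t) \<partial>lborel) = (\<integral>\<^sup>+x. f x \<partial>lborel)"
  using nn_integral_lborel_affine[of f 1 t] assms by (simp add: add.commute)

lemma integrable_exp_neg_norm_square:
  assumes "0 < a"
  shows "integrable lborel (\<lambda>x::'a::euclidean_space. exp (- a * (norm x)\<^sup>2))"
proof (rule integrableI_nonneg)
  define \<sigma> where "\<sigma> = 1 / sqrt (2 * a)"
  have \<sigma>: "0 < \<sigma>" "2 * \<sigma>\<^sup>2 = 1 / a" using assms by (auto simp: \<sigma>_def power_divide)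
  have "exp (- a * s\<^sup>2) = sqrt (2 * pi * \<sigma>\<^sup>2) * normal_density 0 \<sigma> s" for s
    using \<sigma> by (simp add: normal_density_def)
  then have "(\<integral>\<^sup>+s. ennreal (exp (- a * s\<^sup>2)) \<partial>lborel) = ennreal (sqrt (2 * pi * \<sigma>\<^sup>2)) * (\<integral>\<^sup>+s. ennreal (normal_density 0 \<sigma> s) \<partial>lborel)"
    by (simp add: ennreal_mult nn_integral_cmult)
  also have "(\<integral>\<^sup>+s. ennreal (normal_density 0 \<sigma> s) \<partial>lborel) = 1"
    using prob_space.emeasure_space_1[OF prob_space_normal_density[OF \<sigma>(1), of 0]] by (simp add: emeasure_density)
  finally have fin: "(\<integral>\<^sup>+s. ennreal (exp (- a * s\<^sup>2)) \<partial>lborel) < \<infinity>" by simp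
  have "exp (- a * (norm x)\<^sup>2) = (\<Prod>b\<in>Basis. exp (- a * (x \<bullet> b)\<^sup>2))" for x :: 'a
    by (simp add: exp_sum[symmetric] norm_eq_sqrt_inner euclidean_inner[of x x] power2_eq_square sum_distrib_left sum_nonneg sum_negf)
  then have "(\<integral>\<^sup>+x. ennreal (exp (- a * (norm x)\<^sup>2)) \<partial>(lborel::'a measure)) = (\<integral>\<^sup>+x. (\<Prod>b\<in>Basis. ennreal (exp (- a * (x \<bullet> b)\<^sup>2))) \<partial>(lborel::'a measure))"
    by (simp add: prod_ennreal)
  also have "\<dots> = (\<Prod>b\<in>(Basis::'a set). (\<integral>\<^sup>+s. ennreal (exp (- a * s\<^sup>2)) \<partial>lborel))"
    by (rule nn_integral_lborel_prod) auto
  also have "\<dots> < \<infinity>" using fin by (simp add: power_less_top_ennreal)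
  finally show "(\<integral>\<^sup>+x. ennreal (exp (- a * (norm x)\<^sup>2)) \<partial>(lborel::'a measure)) < \<infinity>" .
qed auto

text \<open>Completing the square: a Gaussian factor absorbs every power and every exponential of the norm at
the price of half its exponent.\<close>

lemma poly_exp_le_exp_square:
  fixes r :: real
  assumes "0 < a" "0 \<le> r"
  shows "(1 + r) ^ k * exp (c * r - a * r\<^sup>2) \<le> exp ((real k + c)\<^sup>2 / (2 * a)) * exp (- (a / 2) * r\<^sup>2)"
proof -
  have "(1 + r) ^ k \<le> exp r ^ k" using assms by (intro power_mono exp_ge_add_one_self) auto
  then have "(1 + r) ^ k * exp (c * r - a * r\<^sup>2) \<le> exp (k * r) * exp (c * r - a * r\<^sup>2)"
    by (simp add: exp_of_nat_mult)
  also have "\<dots> = exp ((k + c) * r - a * r\<^sup>2)" by (simp add: exp_add[symmetric] algebra_simps)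
  also have "\<dots> \<le> exp ((k + c)\<^sup>2 / (2 * a) - (a / 2) * r\<^sup>2)"
  proof -
    have "0 \<le> (a * r - (k + c))\<^sup>2 / (2 * a)" using assms by simp
    also have "\<dots> = (k + c)\<^sup>2 / (2 * a) - (k + c) * r + (a / 2) * r\<^sup>2"
      using assms by (simp add: power2_eq_square field_simps)
    finally show ?thesis by (simp add: algebra_simps)
  qed
  also have "\<dots> = exp ((real k + c)\<^sup>2 / (2 * a)) * exp (- (a / 2) * r\<^sup>2)" by (simp add: exp_add[symmetric])
  finally show ?thesis .
qed

lemma integrable_poly_exp_neg_norm_square:
  assumes "0 < a"
  shows "integrable lborel (\<lambda>x::'a::euclidean_space. (1 + norm x) ^ k * exp (c * norm x - a * (norm x)\<^sup>2))"
proof (rule Bochner_Integration.integrable_bound)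
  show "integrable lborel (\<lambda>x::'a. exp ((real k + c)\<^sup>2 / (2 * a)) * exp (- (a / 2) * (norm x)\<^sup>2))"
    using integrable_exp_neg_norm_square[of "a/2"] assms by (intro integrable_mult_right) auto
  show "AE x::'a in lborel. norm ((1 + norm x) ^ k * exp (c * norm x - a * (norm x)\<^sup>2))
     \<le> norm (exp ((real k + c)\<^sup>2 / (2 * a)) * exp (- (a / 2) * (norm x)\<^sup>2))"
  proof (intro AE_I2)
    fix x :: 'a
    show "norm ((1 + norm x) ^ k * exp (c * norm x - a * (norm x)\<^sup>2))
     \<le> norm (exp ((real k + c)\<^sup>2 / (2 * a)) * exp (- (a / 2) * (norm x)\<^sup>2))"
      using poly_exp_le_exp_square[OF assms norm_ge_zero[of x], of k c] by (simp add: abs_mult)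
  qed
qed simp

lemma integrable_gauss_poly_exp:
  "integrable gauss (\<lambda>z::'a::euclidean_space. (1 + norm z) ^ k * exp (c * norm z))"
proof -
  have "std_gaussian_density z *\<^sub>R ((1 + norm z) ^ k * exp (c * norm z))
     = (1 / sqrt (2 * pi) ^ DIM('a)) * ((1 + norm z) ^ k * exp (c * norm z - (1/2) * (norm z)\<^sup>2))" for z :: 'a
  proof -
    have "exp (c * norm z - (1/2) * (norm z)\<^sup>2) = exp (- (norm z)\<^sup>2 / 2) * exp (c * norm z)"
      unfolding exp_add[symmetric] by (rule arg_cong[where f=exp]) simp
    then show ?thesis by (simp add: std_gaussian_density_eq)
  qed
  moreover have "integrable lborel (\<lambda>z::'a. (1 / sqrt (2 * pi) ^ DIM('a)) * ((1 + norm z) ^ k * exp (c * norm z - (1/2) * (norm z)\<^sup>2)))"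
    by (intro integrable_mult_right integrable_poly_exp_neg_norm_square) simp
  ultimately have "integrable lborel (\<lambda>z::'a. std_gaussian_density z *\<^sub>R ((1 + norm z) ^ k * exp (c * norm z)))" by simp
  then show ?thesis
    by (subst integrable_density) (auto simp: less_imp_le[OF std_gaussian_density_pos])
qed

lemma gauss_bounded_growth_integrable:
  fixes f :: "'a::euclidean_space \<Rightarrow> 'c::{banach, second_countable_topology}"
  assumes "f \<in> borel_measurable borel" and "\<And>z. norm (f z) \<le> K * ((1 + norm z) ^ k * exp (c * norm z))"
  shows "integrable gauss f"
proof (rule Bochner_Integration.integrable_bound)
  show "integrable gauss (\<lambda>z::'a. K * ((1 + norm z) ^ k * exp (c * norm z)))"
    by (intro integrable_mult_right integrable_gauss_poly_exp)
  show "AE x in gauss. norm (f x) \<le> norm (K * ((1 + norm x) ^ k * exp (c * norm x)))"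
    using assms(2) by (intro AE_I2) (auto intro: order.trans[OF _ abs_ge_self])
qed (use assms in auto)

text \<open>This is how the exceptional set of the gradient is avoided: after the addition of Gaussian noise
every point almost surely lies outside a given null set, wherever it started.\<close>

lemma AE_gauss_affine:
  fixes D :: "'a::euclidean_space set"
  assumes "AE x in lborel. x \<in> D" and "D \<in> sets borel" and "c \<noteq> 0"
  shows "AE z in gauss. a + c *\<^sub>R z \<in> D"
proof -
  have [measurable]: "D \<in> sets borel" by fact
  have "0 = (\<integral>\<^sup>+x. indicator (- D) x \<partial>lborel)"
    using assms(1) by (subst eq_commute, subst nn_integral_0_iff_AE) auto
  also have "\<dots> = ennreal (\<bar>c\<bar> ^ DIM('a)) * (\<integral>\<^sup>+x. indicator (- D) (a + c *\<^sub>R x) \<partial>lborel)"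
    using assms by (intro nn_integral_lborel_affine) auto
  finally have "(\<integral>\<^sup>+x. indicator (- D) (a + c *\<^sub>R x) \<partial>lborel) = 0" using assms by auto
  then have "AE x in lborel. a + c *\<^sub>R x \<in> D"
    by (subst (asm) nn_integral_0_iff_AE) (auto elim!: eventually_mono split: split_indicator_asm)
  then show ?thesis by (subst AE_density) auto
qed

text \<open>The sum of two independent standard Gaussians is \<open>sqrt 2\<close> times a standard Gaussian. The proof is a
rotation by 45 degrees: after the substitution \<open>z2 = - z1 + sqrt 2 w\<close> the product of the densities is
symmetric in \<open>z1\<close> and \<open>w\<close>.\<close>

lemma nn_integral_gauss_add:
  fixes F :: "'a::euclidean_space \<Rightarrow> ennreal"
  assumes [measurable]: "F \<in> borel_measurable borel"
  shows "(\<integral>\<^sup>+z1. \<integral>\<^sup>+z2. F (z1 + z2) \<partial>gauss \<partial>gauss) = (\<integral>\<^sup>+z. F (sqrt 2 *\<^sub>R z) \<partial>gauss)"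
proof -
  let ?g = "\<lambda>x::'a. ennreal (std_gaussian_density x)"
  have "(\<integral>\<^sup>+z1. \<integral>\<^sup>+z2. F (z1 + z2) \<partial>gauss \<partial>gauss) = (\<integral>\<^sup>+z1. \<integral>\<^sup>+z2. ?g z1 * (?g z2 * F (z1 + z2)) \<partial>lborel \<partial>lborel)"
    by (simp add: nn_integral_density nn_integral_cmult)
  also have "\<dots> = (\<integral>\<^sup>+z1. ennreal (sqrt 2 ^ DIM('a)) * (\<integral>\<^sup>+w. ?g z1 * (?g (- z1 + sqrt 2 *\<^sub>R w) * F (sqrt 2 *\<^sub>R w)) \<partial>lborel) \<partial>lborel)"
  proof (intro nn_integral_cong)
    fix z1 :: 'a
    show "(\<integral>\<^sup>+z2. ?g z1 * (?g z2 * F (z1 + z2)) \<partial>lborel) = ennreal (sqrt 2 ^ DIM('a)) * (\<integral>\<^sup>+w. ?g z1 * (?g (- z1 + sqrt 2 *\<^sub>R w) * F (sqrt 2 *\<^sub>R w)) \<partial>lborel)"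
      by (subst nn_integral_lborel_affine[of _ "sqrt 2" "- z1"]) (auto simp: abs_of_nonneg)
  qed
  also have "\<dots> = (\<integral>\<^sup>+z1. \<integral>\<^sup>+w. ennreal (sqrt 2 ^ DIM('a)) * (?g w * ?g (- w + sqrt 2 *\<^sub>R z1) * F (sqrt 2 *\<^sub>R w)) \<partial>lborel \<partial>lborel)"
  proof (intro nn_integral_cong)
    fix z1 :: 'a
    have e: "(norm z1)\<^sup>2 + (norm (- z1 + sqrt 2 *\<^sub>R w))\<^sup>2 = (norm w)\<^sup>2 + (norm (- w + sqrt 2 *\<^sub>R z1))\<^sup>2" for w
      by (simp add: power2_norm_eq_inner inner_simps algebra_simps inner_commute)
    have gg: "std_gaussian_density z1 * std_gaussian_density (- z1 + sqrt 2 *\<^sub>R w) = std_gaussian_density w * std_gaussian_density (- w + sqrt 2 *\<^sub>R z1)" for w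
    proof -
      have "exp (- (norm z1)\<^sup>2 / 2) * exp (- (norm (- z1 + sqrt 2 *\<^sub>R w))\<^sup>2 / 2) = exp (- (norm w)\<^sup>2 / 2) * exp (- (norm (- w + sqrt 2 *\<^sub>R z1))\<^sup>2 / 2)"
        unfolding exp_add[symmetric] using e[of w] by (simp add: field_simps)
      then show ?thesis unfolding std_gaussian_density_eq by simp
    qed
    have "?g z1 * (?g (- z1 + sqrt 2 *\<^sub>R w) * F (sqrt 2 *\<^sub>R w)) = ?g w * ?g (- w + sqrt 2 *\<^sub>R z1) * F (sqrt 2 *\<^sub>R w)" for w
      unfolding mult.assoc[symmetric] ennreal_mult[symmetric, OF less_imp_le less_imp_le, OF std_gaussian_density_pos std_gaussian_density_pos] gg ..
    then show "ennreal (sqrt 2 ^ DIM('a)) * (\<integral>\<^sup>+w. ?g z1 * (?g (- z1 + sqrt 2 *\<^sub>R w) * F (sqrt 2 *\<^sub>R w)) \<partial>lborel) =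
       (\<integral>\<^sup>+w. ennreal (sqrt 2 ^ DIM('a)) * (?g w * ?g (- w + sqrt 2 *\<^sub>R z1) * F (sqrt 2 *\<^sub>R w)) \<partial>lborel)"
      by (simp add: nn_integral_cmult)
  qed
  also have "\<dots> = (\<integral>\<^sup>+w. \<integral>\<^sup>+z1. ennreal (sqrt 2 ^ DIM('a)) * (?g w * ?g (- w + sqrt 2 *\<^sub>R z1) * F (sqrt 2 *\<^sub>R w)) \<partial>lborel \<partial>lborel)"
    by (rule lborel_pair.Fubini') measurable
  also have "\<dots> = (\<integral>\<^sup>+w. ?g w * F (sqrt 2 *\<^sub>R w) \<partial>lborel)"
  proof (intro nn_integral_cong)
    fix w :: 'a
    have "ennreal (sqrt 2 ^ DIM('a)) * (\<integral>\<^sup>+z1. ?g (- w + sqrt 2 *\<^sub>R z1) \<partial>lborel) = (\<integral>\<^sup>+z1. ?g z1 \<partial>lborel)"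
      by (subst (2) nn_integral_lborel_affine[of _ "sqrt 2" "- w"]) (auto simp: abs_of_nonneg)
    also have "\<dots> = 1" using gauss.emeasure_space_1[where 'a='a] by (simp add: emeasure_density)
    finally have *: "ennreal (sqrt 2 ^ DIM('a)) * (\<integral>\<^sup>+z1. ?g (- w + sqrt 2 *\<^sub>R z1) \<partial>lborel) = 1" .
    have "(\<integral>\<^sup>+z1. ennreal (sqrt 2 ^ DIM('a)) * (?g w * ?g (- w + sqrt 2 *\<^sub>R z1) * F (sqrt 2 *\<^sub>R w)) \<partial>lborel)
      = (?g w * F (sqrt 2 *\<^sub>R w)) * (ennreal (sqrt 2 ^ DIM('a)) * (\<integral>\<^sup>+z1. ?g (- w + sqrt 2 *\<^sub>R z1) \<partial>lborel))"
      by (simp add: nn_integral_cmult[symmetric] mult_ac)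
    then show "(\<integral>\<^sup>+z1. ennreal (sqrt 2 ^ DIM('a)) * (?g w * ?g (- w + sqrt 2 *\<^sub>R z1) * F (sqrt 2 *\<^sub>R w)) \<partial>lborel) = ?g w * F (sqrt 2 *\<^sub>R w)"
      unfolding * by simp
  qed
  finally show ?thesis by (simp add: nn_integral_density)
qed

text \<open>Resampling a point with density \<open>w\<close> along the line in direction \<open>b\<close> through it, from the restriction of
\<open>w\<close> to that line, leaves the measure \<open>w\<close> invariant. The normalising integral is constant along each
line, so this follows from translation invariance of Lebesgue measure and Tonelli's theorem.\<close>

lemma line_resampling_invariant:
  fixes w F :: "'a::euclidean_space \<Rightarrow> ennreal" and b :: 'a
  assumes [measurable]: "w \<in> borel_measurable borel" "F \<in> borel_measurable borel"
    and Z: "\<And>y. (\<integral>\<^sup>+t. w (y + t *\<^sub>R b) \<partial>lborel) \<noteq> 0" "\<And>y. (\<integral>\<^sup>+t. w (y + t *\<^sub>R b) \<partial>lborel) \<noteq> \<top>"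
  shows "(\<integral>\<^sup>+y. ((\<integral>\<^sup>+t. F (y + t *\<^sub>R b) * w (y + t *\<^sub>R b) \<partial>lborel) / (\<integral>\<^sup>+t. w (y + t *\<^sub>R b) \<partial>lborel)) * w y \<partial>lborel)
    = (\<integral>\<^sup>+y. F y * w y \<partial>lborel)"
proof -
  define Z where "Z y = (\<integral>\<^sup>+t. w (y + t *\<^sub>R b) \<partial>lborel)" for y
  have [measurable]: "Z \<in> borel_measurable borel" unfolding Z_def[abs_def] by measurable
  have Zt: "Z (y + t *\<^sub>R b) = Z y" for y t
    using nn_integral_lborel_translate[of "\<lambda>s. w (y + s *\<^sub>R b)" t]
    by (simp add: Z_def scaleR_add_left add_ac)
  have "(\<integral>\<^sup>+y. ((\<integral>\<^sup>+t. F (y + t *\<^sub>R b) * w (y + t *\<^sub>R b) \<partial>lborel) / Z y) * w y \<partial>lborel)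
    = (\<integral>\<^sup>+y. \<integral>\<^sup>+t. (F (y + t *\<^sub>R b) * w (y + t *\<^sub>R b) / Z (y + t *\<^sub>R b)) * w y \<partial>lborel \<partial>lborel)"
    by (simp add: nn_integral_divide nn_integral_multc Zt)
  also have "\<dots> = (\<integral>\<^sup>+t. \<integral>\<^sup>+y. (F (y + t *\<^sub>R b) * w (y + t *\<^sub>R b) / Z (y + t *\<^sub>R b)) * w y \<partial>lborel \<partial>lborel)"
    by (rule lborel_pair.Fubini') measurable
  also have "\<dots> = (\<integral>\<^sup>+t. \<integral>\<^sup>+y. (F y * w y / Z y) * w (y - t *\<^sub>R b) \<partial>lborel \<partial>lborel)"
  proof (rule nn_integral_cong)
    fix t
    show "(\<integral>\<^sup>+y. (F (y + t *\<^sub>R b) * w (y + t *\<^sub>R b) / Z (y + t *\<^sub>R b)) * w y \<partial>lborel) = (\<integral>\<^sup>+y. (F y * w y / Z y) * w (y - t *\<^sub>R b) \<partial>lborel)"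
      using nn_integral_lborel_translate[of "\<lambda>y. (F y * w y / Z y) * w (y - t *\<^sub>R b)" "t *\<^sub>R b"] by simp
  qed
  also have "\<dots> = (\<integral>\<^sup>+y. \<integral>\<^sup>+t. (F y * w y / Z y) * w (y - t *\<^sub>R b) \<partial>lborel \<partial>lborel)"
    by (rule lborel_pair.Fubini') measurable
  also have "\<dots> = (\<integral>\<^sup>+y. F y * w y \<partial>lborel)"
  proof (intro nn_integral_cong)
    fix y
    have "(\<integral>\<^sup>+t. w (y - t *\<^sub>R b) \<partial>lborel) = Z y"
      unfolding Z_def by (subst (2) nn_integral_real_affine[of _ "-1" 0]) auto
    then have "(\<integral>\<^sup>+t. (F y * w y / Z y) * w (y - t *\<^sub>R b) \<partial>lborel) = (F y * w y / Z y) * Z y"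
      by (simp add: nn_integral_cmult)
    then show "(\<integral>\<^sup>+t. (F y * w y / Z y) * w (y - t *\<^sub>R b) \<partial>lborel) = F y * w y"
      using Z[of y] unfolding Z_def[symmetric] by (simp add: ennreal_divide_times less_top)
  qed
  finally show ?thesis unfolding Z_def .
qed

section \<open>One-dimensional quantile maps from the normal law\<close>

text \<open>The normalisation is part of the definition, so that unnormalised conditional densities can be used
for \<open>f\<close>.\<close>

definition density_cdf :: "(real \<Rightarrow> real) \<Rightarrow> real \<Rightarrow> real" where
  "density_cdf f t = (\<integral>s. indicator {..t} s * f s \<partial>lborel) / (\<integral>s. f s \<partial>lborel)"

text \<open>The increasing map that transports the standard normal law to the law with density proportional to
\<open>f\<close>.\<close>

definition normal_quantile_map :: "(real \<Rightarrow> real) \<Rightarrow> real \<Rightarrow> real" where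
  "normal_quantile_map f z = Inf {t. density_cdf std_normal_density z \<le> density_cdf f t}"

lemma integral_pos_density:
  fixes f :: "'a::euclidean_space \<Rightarrow> real"
  assumes f: "integrable lborel f" and pos: "\<And>s. 0 < f s"
  shows "0 < (\<integral>s. f s \<partial>lborel)"
proof -
  have "(\<integral>s. f s \<partial>lborel) \<noteq> 0"
  proof
    assume "(\<integral>s. f s \<partial>lborel) = 0"
    then have "AE s in lborel. f s = 0"
      using integral_nonneg_eq_0_iff_AE[OF f] pos by (simp add: less_imp_le)
    then have "AE s in (lborel::'a measure). (False::bool)"
      by (rule AE_mp) (use pos in \<open>auto simp: less_le\<close>)
    then show False by (simp add: AE_iff_measurable[OF _ refl])
  qed
  then show ?thesis using Bochner_Integration.integral_nonneg[where M=lborel and f=f] pos by (simp add: less_le)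
qed

lemma real_distribution_density:
  fixes f :: "real \<Rightarrow> real"
  assumes f: "integrable lborel f" and pos: "\<And>s. 0 < f s"
  defines "\<nu> \<equiv> density lborel (\<lambda>s. ennreal (f s / (\<integral>s. f s \<partial>lborel)))"
  shows "real_distribution \<nu>" "density_cdf f t = cdf \<nu> t"
proof -
  note Z = integral_pos_density[OF f pos]
  have [measurable]: "f \<in> borel_measurable borel" using f by auto
  have fi: "integrable lborel (\<lambda>s. f s / (\<integral>s. f s \<partial>lborel))" using f by simp
  have "emeasure \<nu> (space \<nu>) = (\<integral>\<^sup>+s. ennreal (f s / (\<integral>s. f s \<partial>lborel)) \<partial>lborel)"
    unfolding \<nu>_def by (simp add: emeasure_density)
  also have "\<dots> = ennreal (\<integral>s. f s / (\<integral>s. f s \<partial>lborel) \<partial>lborel)"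
    using fi Z pos by (intro nn_integral_eq_integral) (auto intro!: AE_I2 less_imp_le)
  also have "\<dots> = 1" using Z by simp
  finally have "prob_space \<nu>" by (rule prob_spaceI)
  then show R: "real_distribution \<nu>"
    unfolding real_distribution_def real_distribution_axioms_def \<nu>_def by simp
  have "emeasure \<nu> {..t} = (\<integral>\<^sup>+s. ennreal (f s / (\<integral>s. f s \<partial>lborel)) * indicator {..t} s \<partial>lborel)"
    unfolding \<nu>_def by (simp add: emeasure_density)
  also have "\<dots> = (\<integral>\<^sup>+s. ennreal (indicator {..t} s * f s / (\<integral>s. f s \<partial>lborel)) \<partial>lborel)"
    by (intro nn_integral_cong) (simp split: split_indicator)
  also have "\<dots> = ennreal (\<integral>s. indicator {..t} s * f s / (\<integral>s. f s \<partial>lborel) \<partial>lborel)"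
    using f Z pos
    by (intro nn_integral_eq_integral integrable_divide_zero AE_I2)
       (use integrable_mult_indicator[where A="{..t}" and M=lborel and f=f] f Z pos in
         \<open>auto intro!: divide_nonneg_pos mult_nonneg_nonneg simp: less_imp_le split: split_indicator\<close>)
  finally have "emeasure \<nu> {..t} = ennreal (density_cdf f t)"
    by (simp add: density_cdf_def)
  moreover have "0 \<le> density_cdf f t" unfolding density_cdf_def
    using Z pos by (intro divide_nonneg_pos integral_nonneg) (auto simp: less_imp_le)
  ultimately show "density_cdf f t = cdf \<nu> t"
    unfolding cdf_def by (simp add: measure_def)
qed

lemma density_cdf_strict_mono:
  fixes f :: "real \<Rightarrow> real"
  assumes f: "integrable lborel f" and pos: "\<And>s. 0 < f s" and "t < u"
  shows "density_cdf f t < density_cdf f u"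
proof -
  note Z = integral_pos_density[OF f pos]
  have i1: "integrable lborel (\<lambda>s. indicator {..x} s * f s)" for x
    using integrable_mult_indicator[where A="{..x}" and M=lborel and f=f] f by simp
  have "0 < (\<integral>s. indicator {..u} s * f s - indicator {..t} s * f s \<partial>lborel)"
  proof -
    let ?d = "\<lambda>s. indicator {..u} s * f s - indicator {..t} s * f s"
    have nn: "0 \<le> ?d s" for s using \<open>t<u\<close> pos[of s] by (auto split: split_indicator)
    have "(\<integral>s. ?d s \<partial>lborel) \<noteq> 0"
    proof
      assume "(\<integral>s. ?d s \<partial>lborel) = 0"
      then have "AE s in lborel. ?d s = 0"
        using integral_nonneg_eq_0_iff_AE[where M=lborel and f="?d"] i1 nn by simp
      then have "AE s in lborel. s \<notin> {t<..u}"
        by eventually_elim (use pos in \<open>auto split: split_indicator_asm simp: less_le\<close>)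
      then have "emeasure lborel {t<..u} = 0"
        by (subst (asm) AE_iff_measurable[OF _ refl]) (auto simp: greaterThanAtMost_def greaterThan_def atMost_def Int_def)
      then show False using \<open>t<u\<close> by simp
    qed
    then show ?thesis using Bochner_Integration.integral_nonneg[where M=lborel and f="?d"] nn by (simp add: less_le)
  qed
  then have "(\<integral>s. indicator {..t} s * f s \<partial>lborel) < (\<integral>s. indicator {..u} s * f s \<partial>lborel)"
    using i1 by (simp add: Bochner_Integration.integral_diff)
  then show ?thesis unfolding density_cdf_def using Z by (rule divide_strict_right_mono)
qed

lemma continuous_density_cdf:
  fixes f :: "real \<Rightarrow> real"
  assumes f: "integrable lborel f" and pos: "\<And>s. 0 < f s"
  shows "isCont (density_cdf f) t"
proof -
  let ?\<nu> = "density lborel (\<lambda>s. ennreal (f s / (\<integral>s. f s \<partial>lborel)))"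
  have [measurable]: "f \<in> borel_measurable borel" using f by auto
  interpret real_distribution ?\<nu> by (rule real_distribution_density[OF f pos])
  have eq: "density_cdf f = cdf ?\<nu>" using real_distribution_density(2)[OF f pos] by auto
  have "emeasure ?\<nu> {t} = 0"
    by (simp add: emeasure_density nn_integral_0_iff_AE)
  then show ?thesis unfolding eq isCont_cdf by (simp add: measure_def)
qed

lemma density_cdf_limits:
  fixes f :: "real \<Rightarrow> real"
  assumes f: "integrable lborel f" and pos: "\<And>s. 0 < f s"
  shows "(density_cdf f \<longlongrightarrow> 0) at_bot" "(density_cdf f \<longlongrightarrow> 1) at_top"
    "0 < density_cdf f t" "density_cdf f t < 1"
proof -
  let ?\<nu> = "density lborel (\<lambda>s. ennreal (f s / (\<integral>s. f s \<partial>lborel)))"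
  interpret real_distribution ?\<nu> by (rule real_distribution_density[OF f pos])
  have eq: "density_cdf f = cdf ?\<nu>" using real_distribution_density(2)[OF f pos] by auto
  show "(density_cdf f \<longlongrightarrow> 0) at_bot" "(density_cdf f \<longlongrightarrow> 1) at_top"
    unfolding eq by (rule cdf_lim_at_bot cdf_lim_at_top_prob)+
  have "0 \<le> density_cdf f (t - 1)" "density_cdf f (t + 1) \<le> 1"
    unfolding eq by (rule cdf_nonneg cdf_bounded_prob)+
  then show "0 < density_cdf f t" "density_cdf f t < 1"
    using density_cdf_strict_mono[OF f pos, of "t-1" t] density_cdf_strict_mono[OF f pos, of t "t+1"] by auto
qed

lemma density_cdf_surj:
  fixes f :: "real \<Rightarrow> real"
  assumes f: "integrable lborel f" and pos: "\<And>s. 0 < f s" and c: "0 < c" "c < 1"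
  obtains t where "density_cdf f t = c"
proof -
  have "eventually (\<lambda>t. density_cdf f t < c) at_bot"
    using density_cdf_limits(1)[OF f pos] c order_tendstoD(2) by blast
  then obtain l where l: "\<And>t. t \<le> l \<Longrightarrow> density_cdf f t < c" by (auto simp: eventually_at_bot_linorder)
  have "eventually (\<lambda>t. density_cdf f t > c) at_top"
    using density_cdf_limits(2)[OF f pos] c order_tendstoD(1) by blast
  then obtain u where u: "\<And>t. t \<ge> u \<Longrightarrow> density_cdf f t > c" by (auto simp: eventually_at_top_linorder)
  have "\<exists>t. l \<le> t \<and> t \<le> max l u \<and> density_cdf f t = c"
    by (rule IVT) (use l[of l] u[of "max l u"] continuous_density_cdf[OF f pos] in auto)
  then show ?thesis using that by auto
qed

lemma std_normal_density_integrable: "integrable lborel std_normal_density"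
  using prob_space_normal_density[of 1 0] integrable_normal_density by (metis zero_less_one)

lemma normal_quantile_map_eq:
  fixes f :: "real \<Rightarrow> real"
  assumes f: "integrable lborel f" and pos: "\<And>s. 0 < f s"
  shows "density_cdf f (normal_quantile_map f z) = density_cdf std_normal_density z"
    and "normal_quantile_map f z \<le> t \<longleftrightarrow> density_cdf std_normal_density z \<le> density_cdf f t"
proof -
  have n: "integrable lborel std_normal_density" "\<And>s. 0 < std_normal_density s"
    by (auto simp: std_normal_density_integrable normal_density_pos)
  obtain u where u: "density_cdf f u = density_cdf std_normal_density z"
    using density_cdf_surj[OF f pos density_cdf_limits(3,4)[OF n]] by blast
  have iff: "density_cdf f u \<le> density_cdf f t \<longleftrightarrow> u \<le> t" for t
    using density_cdf_strict_mono[OF f pos, of u t] density_cdf_strict_mono[OF f pos, of t u]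
    by (cases u t rule: linorder_cases) auto
  have "normal_quantile_map f z = Inf {u..}"
    unfolding normal_quantile_map_def u[symmetric] iff by (simp add: atLeast_def)
  then have q: "normal_quantile_map f z = u" by simp
  show "density_cdf f (normal_quantile_map f z) = density_cdf std_normal_density z" using u q by simp
  show "normal_quantile_map f z \<le> t \<longleftrightarrow> density_cdf std_normal_density z \<le> density_cdf f t"
    using iff[of t] u q by simp
qed

lemma density_cdf_measurable:
  fixes f :: "'b \<Rightarrow> real \<Rightarrow> real"
  assumes [measurable]: "(\<lambda>(\<theta>, s). f \<theta> s) \<in> borel_measurable (M \<Otimes>\<^sub>M borel)"
  shows "(\<lambda>\<theta>. density_cdf (f \<theta>) t) \<in> borel_measurable M"
  unfolding density_cdf_def by measurable

text \<open>Joint measurability in a parameter is needed because the transported density will depend on the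
other coordinates.\<close>

lemma normal_quantile_map_measurable:
  fixes f :: "'b \<Rightarrow> real \<Rightarrow> real"
  assumes m[measurable]: "(\<lambda>(\<theta>, s). f \<theta> s) \<in> borel_measurable (M \<Otimes>\<^sub>M borel)"
    and f: "\<And>\<theta>. \<theta> \<in> space M \<Longrightarrow> integrable lborel (f \<theta>)" and pos: "\<And>\<theta> s. 0 < f \<theta> s"
  shows "(\<lambda>(\<theta>, z). normal_quantile_map (f \<theta>) z) \<in> borel_measurable (M \<Otimes>\<^sub>M borel)"
proof (subst borel_measurable_iff_le, intro allI)
  fix t
  have n: "density_cdf std_normal_density \<in> borel_measurable borel"
    by (intro borel_measurable_continuous_onI continuous_at_imp_continuous_on ballI continuous_density_cdf
      std_normal_density_integrable normal_density_pos) simp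
  have [measurable]: "(\<lambda>\<theta>. density_cdf (f \<theta>) t) \<in> borel_measurable M" by (rule density_cdf_measurable) fact
  have "{w \<in> space (M \<Otimes>\<^sub>M borel). (case w of (\<theta>, z) \<Rightarrow> normal_quantile_map (f \<theta>) z) \<le> t}
    = {w \<in> space (M \<Otimes>\<^sub>M borel). density_cdf std_normal_density (snd w) \<le> density_cdf (f (fst w)) t}"
    by (auto simp: space_pair_measure normal_quantile_map_eq(2)[OF f pos])
  also have "\<dots> \<in> sets (M \<Otimes>\<^sub>M borel)" using n by measurable
  finally show "{w \<in> space (M \<Otimes>\<^sub>M borel). (case w of (\<theta>, z) \<Rightarrow> normal_quantile_map (f \<theta>) z) \<le> t} \<in> sets (M \<Otimes>\<^sub>M borel)" .
qed

lemma distr_normal_quantile_map: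
  fixes f :: "real \<Rightarrow> real"
  assumes f: "integrable lborel f" and pos: "\<And>s. 0 < f s"
  shows "distr (density lborel std_normal_density) borel (normal_quantile_map f)
      = density lborel (\<lambda>s. ennreal (f s / (\<integral>s. f s \<partial>lborel)))"
proof -
  let ?\<nu> = "density lborel (\<lambda>s. ennreal (f s / (\<integral>s. f s \<partial>lborel)))"
  let ?N = "density lborel std_normal_density"
  have n: "integrable lborel std_normal_density" "\<And>s. 0 < std_normal_density s"
    by (auto simp: std_normal_density_integrable normal_density_pos)
  have [measurable]: "f \<in> borel_measurable borel" using f by auto
  have "(\<lambda>(\<theta>, z). normal_quantile_map f z) \<in> borel_measurable (count_space {()} \<Otimes>\<^sub>M borel)"
    by (rule normal_quantile_map_measurable) (auto simp: f pos)
  from measurable_compose[OF measurable_Pair1'[of "()"] this]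
  have m[measurable]: "normal_quantile_map f \<in> borel_measurable borel" by simp
  have NN: "density lborel (\<lambda>s. ennreal (std_normal_density s / (\<integral>s. std_normal_density s \<partial>lborel))) = ?N"
    by (simp add: integral_std_normal_moment_even[of 0, simplified])
  interpret N: real_distribution ?N using real_distribution_density(1)[OF n] unfolding NN .
  show ?thesis
  proof (rule cdf_unique)
    show "real_distribution ?\<nu>" by (rule real_distribution_density[OF f pos])
    show "real_distribution (distr ?N borel (normal_quantile_map f))"
      by (intro N.real_distribution_distr) simp
    show "cdf (distr ?N borel (normal_quantile_map f)) = cdf ?\<nu>"
    proof
      fix t
      obtain u where u: "density_cdf std_normal_density u = density_cdf f t"
        using density_cdf_surj[OF n density_cdf_limits(3,4)[OF f pos]] by blast
      have "normal_quantile_map f -` {..t} = {..u}"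
        using density_cdf_strict_mono[OF n]
        by (auto simp: normal_quantile_map_eq(2)[OF f pos] u[symmetric])
           (metis linorder_not_le order_le_less)+
      then have "cdf (distr ?N borel (normal_quantile_map f)) t = cdf ?N u"
        by (simp add: cdf_def measure_distr)
      also have "\<dots> = density_cdf std_normal_density u"
        using real_distribution_density(2)[OF n, of u] unfolding NN by simp
      also have "\<dots> = cdf ?\<nu> t" using real_distribution_density(2)[OF f pos, of t] u by simp
      finally show "cdf (distr ?N borel (normal_quantile_map f)) t = cdf ?\<nu> t" .
    qed
  qed
qed

text \<open>Transport \<open>n\<close> by the increasing map \<open>S\<close> and let \<open>r w\<close> be the ratio of \<open>f\<close>, pulled back by \<open>S\<close>, and \<open>n\<close>. If \<open>r\<close>
decreases, then \<open>f\<close> has, relative to \<open>n\<close>, at least \<open>r z\<close> of mass below \<open>S z\<close> and at most \<open>r z\<close> above it;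
cross-multiplication compares the distribution functions, so \<open>S\<close> lies above the transport map.\<close>

lemma crossing_density_cdf_le:
  fixes f S S' :: "real \<Rightarrow> real"
  assumes f: "integrable lborel f" and pos: "\<And>s. 0 < f s"
    and n: "integrable lborel n" and npos: "\<And>s. 0 < n s"
    and der: "\<And>w. (S has_real_derivative S' w) (at w)" and S'pos: "\<And>w. 0 < S' w"
    and surj: "surj S"
    and anti: "\<And>v w. v \<le> w \<Longrightarrow> f (S w) * S' w / n w \<le> f (S v) * S' v / n v"
  shows "density_cdf n z \<le> density_cdf f (S z)"
proof -
  have mono: "strict_mono S"
    using DERIV_pos_imp_increasing[of _ _ S] der S'pos by (metis strict_monoI)
  have inj: "inj_on S A" for A using strict_mono_imp_inj_on[OF mono] inj_on_subset by blast
  have img: "S ` {..z} = {..S z}" "S ` {z<..} = {S z<..}"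
  proof -
    have "y \<in> S ` {..z} \<longleftrightarrow> y \<le> S z" "y \<in> S ` {z<..} \<longleftrightarrow> S z < y" for y
    proof -
      obtain x where y: "y = S x" using surj by (metis surjD)
      show "y \<in> S ` {..z} \<longleftrightarrow> y \<le> S z" "y \<in> S ` {z<..} \<longleftrightarrow> S z < y"
        unfolding y by (auto simp: strict_mono_less_eq[OF mono] strict_mono_less[OF mono] strict_mono_eq[OF mono])
    qed
    then show "S ` {..z} = {..S z}" "S ` {z<..} = {S z<..}" by auto
  qed
  define r where "r w = f (S w) * S' w / n w" for w
  have sub: "set_integrable lborel X h \<Longrightarrow> h absolutely_integrable_on X \<and> (LINT s:X|lborel. h s) = integral X h"
    if "X \<in> sets borel" for X and h :: "real \<Rightarrow> real"
    using that set_borel_integral_eq_integral[of X h] unfolding set_integrable_def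
    by (auto simp: integrable_completion)
  have si: "set_integrable lborel X h" if "X \<in> sets borel" "integrable lborel h" for X and h :: "real \<Rightarrow> real"
    using that unfolding set_integrable_def by (intro integrable_mult_indicator) auto
  have cv: "(\<lambda>w. \<bar>S' w\<bar> * f (S w)) absolutely_integrable_on X \<and> integral X (\<lambda>w. \<bar>S' w\<bar> * f (S w)) = integral (S ` X) f"
    if "X \<in> sets borel" "S ` X \<in> sets borel" for X
  proof -
    have X: "X \<in> sets lebesgue" using that(1) by simp
    have d: "(S has_field_derivative S' x) (at x within X)" if "x \<in> X" for x
      by (rule has_field_derivative_at_within[OF der])
    show ?thesis
      using has_absolute_integral_change_of_variables_1'[OF X d inj, of f "integral (S ` X) f"]
        sub[OF that(2) si[OF that(2) f]] by simp
  qed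
  have rn: "\<bar>S' w\<bar> * f (S w) = r w * n w" for w using S'pos[of w] npos[of w] by (simp add: r_def)
  define A where "A = (LINT s:{..S z}|lborel. f s)"
  define B where "B = (LINT s:{S z<..}|lborel. f s)"
  define \<Phi> where "\<Phi> = (LINT s:{..z}|lborel. n s)"
  define \<Psi> where "\<Psi> = (LINT s:{z<..}|lborel. n s)"
  have A: "r z * \<Phi> \<le> A"
  proof -
    have "r z * \<Phi> = integral {..z} (\<lambda>w. r z * n w)"
      unfolding \<Phi>_def using sub[of "{..z}" n] si[of "{..z}" n] n by simp
    also have "\<dots> \<le> integral {..z} (\<lambda>w. \<bar>S' w\<bar> * f (S w))"
    proof (rule integral_le)
      show "(\<lambda>w. r z * n w) integrable_on {..z}"
        using sub[of "{..z}" n] si[of "{..z}" n] n set_lebesgue_integral_eq_integral(1) by auto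
      show "(\<lambda>w. \<bar>S' w\<bar> * f (S w)) integrable_on {..z}"
        using cv[of "{..z}"] set_lebesgue_integral_eq_integral(1) by (auto simp: img)
      show "r z * n w \<le> \<bar>S' w\<bar> * f (S w)" if "w \<in> {..z}" for w
        unfolding rn using anti[of w z] that npos[of w] by (simp add: r_def[symmetric] mult_right_mono)
    qed
    also have "\<dots> = A" unfolding A_def using cv[of "{..z}"] sub[of "{..S z}" f] si[of "{..S z}" f] f by (simp add: img)
    finally show ?thesis .
  qed
  have B: "B \<le> r z * \<Psi>"
  proof -
    have "B = integral {z<..} (\<lambda>w. \<bar>S' w\<bar> * f (S w))"
      unfolding B_def using cv[of "{z<..}"] sub[of "{S z<..}" f] si[of "{S z<..}" f] f by (simp add: img)
    also have "\<dots> \<le> integral {z<..} (\<lambda>w. r z * n w)"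
    proof (rule integral_le)
      show "(\<lambda>w. r z * n w) integrable_on {z<..}"
        using sub[of "{z<..}" n] si[of "{z<..}" n] n set_lebesgue_integral_eq_integral(1) by auto
      show "(\<lambda>w. \<bar>S' w\<bar> * f (S w)) integrable_on {z<..}"
        using cv[of "{z<..}"] set_lebesgue_integral_eq_integral(1) by (auto simp: img)
      show "\<bar>S' w\<bar> * f (S w) \<le> r z * n w" if "w \<in> {z<..}" for w
        unfolding rn using anti[of z w] that npos[of w] by (simp add: r_def[symmetric] mult_right_mono)
    qed
    also have "\<dots> = r z * \<Psi>"
      unfolding \<Psi>_def using sub[of "{z<..}" n] si[of "{z<..}" n] n by simp
    finally show ?thesis .
  qed
  have split: "(\<integral>s. h s \<partial>lborel) = (LINT s:{..x}|lborel. h s) + (LINT s:{x<..}|lborel. h s)"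
    if "integrable lborel h" for h :: "real \<Rightarrow> real" and x
  proof -
    have "(LINT s:{..x} \<union> {x<..}|lborel. h s) = (LINT s:{..x}|lborel. h s) + (LINT s:{x<..}|lborel. h s)"
      using that by (intro set_integral_Un si) auto
    moreover have "{..x} \<union> {x<..} = UNIV" by auto
    ultimately show ?thesis by (simp add: set_lebesgue_integral_def)
  qed
  have "0 \<le> \<Phi>" "0 \<le> \<Psi>" unfolding \<Phi>_def \<Psi>_def set_lebesgue_integral_def
    using npos by (auto intro!: integral_nonneg simp: less_imp_le)
  then have "\<Phi> * B \<le> \<Psi> * A"
    using mult_left_mono[OF A, of \<Psi>] mult_left_mono[OF B, of \<Phi>] by (simp add: mult_ac)
  moreover have "0 < A + B" "0 < \<Phi> + \<Psi>"
    using integral_pos_density[OF f pos] integral_pos_density[OF n npos]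
    unfolding A_def B_def \<Phi>_def \<Psi>_def by (simp_all add: split[symmetric] f n)
  ultimately have "\<Phi> / (\<Phi> + \<Psi>) \<le> A / (A + B)" by (simp add: field_simps)
  then show ?thesis
    unfolding density_cdf_def split[OF f, of "S z"] split[OF n, of z]
    by (simp add: A_def B_def \<Phi>_def \<Psi>_def set_lebesgue_integral_def)
qed

text \<open>The assumption says that \<open>ln f + w\<^sup>2 / 2\<close> has slope at most \<open>a + 2 b |w|\<close>, in a form that needs
no derivative of \<open>f\<close>. The shifted map \<open>S z = z + 2 a + 16 b + 4 b sqrt (1 + z\<^sup>2)\<close> is steep enough
for the ratio in \<open>crossing_density_cdf_le\<close> to decrease. The square root replaces \<open>|z|\<close> to make \<open>S\<close> smooth.\<close>

lemma log_slope_quantile_shift: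
  fixes f :: "real \<Rightarrow> real"
  assumes f: "integrable lborel f" and pos: "\<And>s. 0 < f s"
    and ab: "0 \<le> a" "0 \<le> b" "b \<le> 1 / 16"
    and slope: "\<And>v w. v \<le> w \<Longrightarrow> f w * exp (w\<^sup>2 / 2 - a * w - b * w * \<bar>w\<bar>) \<le> f v * exp (v\<^sup>2 / 2 - a * v - b * v * \<bar>v\<bar>)"
  shows "density_cdf std_normal_density z \<le> density_cdf f (z + 2 * a + 16 * b + 4 * b * sqrt (1 + z\<^sup>2))"
proof -
  \<comment> \<open>The root with factor \<open>4 b\<close> compensates the slope \<open>2 b |w|\<close>; for \<open>b \<le> 1/16\<close> the shift \<open>16 b\<close>
    outweighs the derivative of \<open>ln S'\<close>, which is at most \<open>16 b / 3\<close>.\<close>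
  define S where "S z = z + 2 * a + 16 * b + 4 * b * sqrt (1 + z\<^sup>2)" for z
  define S' where "S' z = 1 + 4 * b * (z / sqrt (1 + z\<^sup>2))" for z
  define S'' where "S'' z = 4 * b * (1 / ((1 + z\<^sup>2) * sqrt (1 + z\<^sup>2)))" for z
  have pos1: "0 < 1 + z\<^sup>2" for z :: real by (simp add: add_pos_nonneg)
  have zs: "\<bar>z / sqrt (1 + z\<^sup>2)\<bar> \<le> 1" for z :: real
    using pos1[of z] by (simp add: abs_le_square_iff[symmetric] real_le_rsqrt abs_divide)
  have zs': "- 1 \<le> z / sqrt (1 + z\<^sup>2)" "z / sqrt (1 + z\<^sup>2) \<le> 1" for z :: real using zs[of z] by linarith+
  have sq: "sqrt (1 + w\<^sup>2) * sqrt (1 + w\<^sup>2) = 1 + w\<^sup>2" for w :: real using pos1[of w] by simp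
  have der_sqrt: "((\<lambda>z. sqrt (1 + z\<^sup>2)) has_real_derivative w / sqrt (1 + w\<^sup>2)) (at w)" for w :: real
  proof -
    have "((\<lambda>z. 1 + z\<^sup>2) has_real_derivative 2 * w) (at w)" by (auto intro!: derivative_eq_intros)
    from DERIV_chain2[OF DERIV_real_sqrt[OF pos1] this] show ?thesis by (simp add: field_simps)
  qed
  have der: "(S has_real_derivative S' w) (at w)" for w
  proof -
    have "((\<lambda>z. z + (2 * a + 16 * b) + 4 * b * sqrt (1 + z\<^sup>2)) has_real_derivative 1 + 0 + 4 * b * (w / sqrt (1 + w\<^sup>2))) (at w)"
      by (intro DERIV_add DERIV_cmult der_sqrt DERIV_ident DERIV_const)
    then show ?thesis unfolding S_def[abs_def] S'_def by (simp add: add.assoc)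
  qed
  have der': "(S' has_real_derivative S'' w) (at w)" for w
  proof -
    define r where "r = sqrt (1 + w\<^sup>2)"
    have r: "r * r = 1 + w\<^sup>2" "0 < r" unfolding r_def using sq pos1[of w] by auto
    have "((\<lambda>z. 1 + 4 * b * (z / sqrt (1 + z\<^sup>2))) has_real_derivative
        0 + 4 * b * ((1 * r - w * (w / r)) / (r * r))) (at w)"
      unfolding r_def
      by (intro DERIV_add DERIV_cmult DERIV_divide der_sqrt DERIV_ident DERIV_const) (use pos1[of w] in auto)
    moreover have "(1 * r - w * (w / r)) / (r * r) = 1 / ((r * r) * r)"
    proof -
      have "1 * r - w * (w / r) = (r * r - w\<^sup>2) / r" using r(2) by (simp add: field_simps power2_eq_square)
      also have "\<dots> = 1 / r" using r by simp
      finally show ?thesis by simp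
    qed
    moreover have "S'' w = 4 * b * (1 / ((r * r) * r))" unfolding S''_def by (simp only: r(1) r_def[symmetric])
    ultimately have "((\<lambda>z. 1 + 4 * b * (z / sqrt (1 + z\<^sup>2))) has_real_derivative S'' w) (at w)" by (simp only: add_0)
    then show ?thesis unfolding S'_def[abs_def] .
  qed
  have S'b: "1 - 4 * b \<le> S' w" "S' w \<le> 1 + 4 * b" for w
    using mult_left_mono[OF zs'(1)[of w], of "4*b"] mult_left_mono[OF zs'(2)[of w], of "4*b"] ab unfolding S'_def by auto
  have S'pos: "0 < S' w" for w using S'b[of w] ab by linarith
  \<comment> \<open>Up to constants and the decreasing factor provided by \<open>slope\<close>, \<open>W\<close> is the logarithm of the
    ratio that has to decrease.\<close>
  define W where "W w = - (S w)\<^sup>2 / 2 + a * S w + b * S w * \<bar>S w\<bar> + ln (S' w) + w\<^sup>2 / 2" for w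
  have dabs: "((\<lambda>s. s * \<bar>s\<bar>) has_real_derivative 2 * \<bar>s\<bar>) (at s)" for s :: real
  proof (cases "s = 0")
    case True
    have "((\<lambda>h. \<bar>h\<bar>) \<longlongrightarrow> 0) (at (0::real))" by (rule tendsto_eq_intros | simp)+
    then have "((\<lambda>h. (h * \<bar>h\<bar>) / h) \<longlongrightarrow> 0) (at (0::real))"
      by (rule Lim_transform_eventually) (auto simp: eventually_at_filter)
    then show ?thesis using True by (simp add: DERIV_def)
  next
    case False
    then consider "0 < s" | "s < 0" by linarith
    then show ?thesis
    proof cases
      case 1
      have "((\<lambda>s. s * s) has_real_derivative 2 * \<bar>s\<bar>) (at s)" using 1 by (auto intro!: derivative_eq_intros)
      then show ?thesis
        by (rule has_field_derivative_transform_within_open[where S="{0<..}"]) (use 1 in auto)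
    next
      case 2
      have "((\<lambda>s. - (s * s)) has_real_derivative 2 * \<bar>s\<bar>) (at s)" using 2 by (auto intro!: derivative_eq_intros)
      then show ?thesis
        by (rule has_field_derivative_transform_within_open[where S="{..<0}"]) (use 2 in auto)
    qed
  qed
  have derW: "(W has_real_derivative (- S w + a + 2 * b * \<bar>S w\<bar>) * S' w + S'' w / S' w + w) (at w)" for w
  proof -
    have "((\<lambda>w. b * (S w * \<bar>S w\<bar>)) has_real_derivative b * (2 * \<bar>S w\<bar> * S' w)) (at w)"
      by (intro DERIV_cmult DERIV_chain2[OF dabs der])
    then have *: "((\<lambda>w. b * S w * \<bar>S w\<bar>) has_real_derivative b * (2 * \<bar>S w\<bar> * S' w)) (at w)" by (simp add: mult.assoc)
    have "((\<lambda>w. (- 1 / 2) * (S w * S w) + a * S w + b * S w * \<bar>S w\<bar> + ln (S' w) + (1 / 2) * (w * w)) has_real_derivative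
       (- 1 / 2) * (S' w * S w + S' w * S w) + a * S' w + b * (2 * \<bar>S w\<bar> * S' w) + 1 / S' w * S'' w + (1/2) * (1 * w + 1 * w)) (at w)"
      by (intro DERIV_add DERIV_cmult DERIV_mult DERIV_ident DERIV_const * der DERIV_chain2[OF DERIV_ln_divide der'] S'pos)
    moreover have "W = (\<lambda>w. (- 1 / 2) * (S w * S w) + a * S w + b * S w * \<bar>S w\<bar> + ln (S' w) + (1 / 2) * (w * w))"
      unfolding W_def by (auto simp: power2_eq_square)
    ultimately show ?thesis by (simp add: algebra_simps)
  qed
  have Wneg: "(- S w + a + 2 * b * \<bar>S w\<bar>) * S' w + S'' w / S' w + w \<le> 0" for w
  proof -
    define s where "s = sqrt (1 + w\<^sup>2)"
    have s: "1 \<le> s" "\<bar>w\<bar> \<le> s" by (auto simp: s_def real_le_rsqrt)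
    have "\<bar>S w\<bar> \<le> \<bar>w\<bar> + 2 * a + 16 * b + 4 * b * s"
      unfolding S_def s_def[symmetric] using ab s by (intro order.trans[OF abs_triangle_ineq] add_mono) auto
    then have "\<bar>S w\<bar> \<le> 2 * s + 2 * a + 16 * b"
      using s ab mult_right_mono[of "4 * b" 1 s] by linarith
    then have "S w - a - 2 * b * \<bar>S w\<bar> \<ge> S w - a - 2 * b * (2 * s + 2 * a + 16 * b)"
      using ab by (intro diff_left_mono mult_left_mono) auto
    also have "S w - a - 2 * b * (2 * s + 2 * a + 16 * b) = w + a * (1 - 4 * b) + 16 * b * (1 - 2 * b)"
      unfolding S_def s_def[symmetric] by (simp add: algebra_simps)
    also have "\<dots> \<ge> w + 14 * b"
    proof -
      have "0 \<le> a * (1 - 4 * b)" using ab by (intro mult_nonneg_nonneg) auto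
      moreover have "16 * b * (14 / 16) \<le> 16 * b * (1 - 2 * b)" using ab by (intro mult_left_mono) auto
      ultimately show ?thesis by linarith
    qed
    finally have "(w + 14 * b) * S' w \<le> (S w - a - 2 * b * \<bar>S w\<bar>) * S' w"
      using S'pos[of w] by (intro mult_right_mono) auto
    moreover have "w + 14 * b * (3 / 4) \<le> (w + 14 * b) * S' w"
    proof -
      have "w * S' w = w + 4 * b * (w\<^sup>2 / s)" unfolding S'_def s_def by (simp add: algebra_simps power2_eq_square)
      then have "w \<le> w * S' w" using ab s by simp
      moreover have "14 * b * (3 / 4) \<le> 14 * b * S' w" using S'b[of w] ab by (intro mult_left_mono) auto
      ultimately show ?thesis by (simp add: distrib_right)
    qed
    moreover have "S'' w / S' w \<le> 4 * b / (3 / 4)"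
    proof (rule frac_le)
      have "1 * 1 \<le> (1 + w\<^sup>2) * s" using s by (intro mult_mono) auto
      then have "1 / ((1 + w\<^sup>2) * s) \<le> 1" by simp
      then show "S'' w \<le> 4 * b" unfolding S''_def s_def[symmetric] using ab mult_left_mono[of "1 / ((1 + w\<^sup>2) * s)" 1 "4 * b"] by simp
    qed (use S'b[of w] ab in auto)
    moreover have "14 * b * (3/4) \<ge> 4 * b / (3 / 4)" using ab by simp
    ultimately show ?thesis by (simp add: algebra_simps)
  qed
  have W: "W w \<le> W v" if "v \<le> w" for v w
    using DERIV_nonpos_imp_nonincreasing[OF that, of W] derW Wneg by blast
  have Smono: "S v \<le> S w" if "v \<le> w" for v w
    using DERIV_nonneg_imp_nondecreasing[OF that, of S] der S'pos less_imp_le by blast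
  have Sb: "w \<le> S w" for w unfolding S_def using ab by simp
  have "surj S"
  proof -
    have "\<exists>x. S x = y" for y
    proof -
      define l where "l = - \<bar>2 * y\<bar> - 4 * a - 40 * b"
      have "sqrt (1 + l\<^sup>2) \<le> 1 + \<bar>l\<bar>" by (rule real_le_lsqrt) (auto simp: power2_eq_square algebra_simps)
      then have "S l \<le> l + 2 * a + 16 * b + 4 * b * (1 + \<bar>l\<bar>)"
        unfolding S_def using ab by (intro add_left_mono mult_left_mono) auto
      also have "\<dots> \<le> l + 2 * a + 20 * b + (1/4) * \<bar>l\<bar>"
        using ab mult_right_mono[of "4 * b" "1/4" "\<bar>l\<bar>"] by (simp add: algebra_simps)
      also have "\<dots> \<le> y"
      proof -
        have "\<bar>l\<bar> = - l" unfolding l_def using ab by simp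
        then have "l + 2 * a + 20 * b + (1/4) * \<bar>l\<bar> = (3/4) * l + 2 * a + 20 * b" by linarith
        also have "\<dots> = - (3/2) * \<bar>y\<bar> - a - 10 * b" unfolding l_def by (simp add: abs_mult algebra_simps)
        also have "\<dots> \<le> y" using ab abs_ge_minus_self[of y] by linarith
        finally show ?thesis .
      qed
      finally have "S l \<le> y" .
      moreover have "l \<le> y" unfolding l_def using ab by linarith
      ultimately have "\<exists>x. l \<le> x \<and> x \<le> y \<and> S x = y"
        by (intro IVT) (auto intro: Sb DERIV_isCont[OF der])
      then show ?thesis by blast
    qed
    then show ?thesis by (metis surjI surj_def)
  qed
  have "density_cdf std_normal_density z \<le> density_cdf f (S z)"
  proof (rule crossing_density_cdf_le[OF f pos std_normal_density_integrable _ der S'pos \<open>surj S\<close>])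
    show "0 < std_normal_density s" for s by (rule normal_density_pos) simp
    fix v w :: real assume "v \<le> w"
    have eq: "f (S w) * S' w / std_normal_density w
      = (f (S w) * exp ((S w)\<^sup>2 / 2 - a * S w - b * S w * \<bar>S w\<bar>)) * exp (W w) * sqrt (2 * pi)" for w
    proof -
      have "exp ((S w)\<^sup>2 / 2 - a * S w - b * S w * \<bar>S w\<bar>) * exp (W w) = exp (ln (S' w) + w\<^sup>2 / 2)"
        unfolding exp_add[symmetric] W_def by simp
      also have "\<dots> = S' w * exp (w\<^sup>2 / 2)" using S'pos[of w] by (simp add: exp_add)
      finally have "f (S w) * exp ((S w)\<^sup>2 / 2 - a * S w - b * S w * \<bar>S w\<bar>) * exp (W w) = f (S w) * (S' w * exp (w\<^sup>2 / 2))"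
        by (simp add: mult.assoc)
      moreover have "std_normal_density w = inverse (exp (w\<^sup>2 / 2) * sqrt (2 * pi))"
        unfolding std_normal_density_def minus_divide_left[symmetric] exp_minus
        by (simp only: divide_inverse inverse_mult_distrib mult_1_left mult.commute)
      ultimately show ?thesis by (simp only: divide_inverse inverse_inverse_eq mult.assoc)
    qed
    show "f (S w) * S' w / std_normal_density w \<le> f (S v) * S' v / std_normal_density v"
      unfolding eq
    proof (rule mult_right_mono[OF mult_mono[OF slope[OF Smono[OF \<open>v \<le> w\<close>]]]])
      show "exp (W w) \<le> exp (W v)" using W[OF \<open>v \<le> w\<close>] by simp
    qed (auto simp: less_imp_le[OF pos])
  qed
  then show ?thesis by (simp add: S_def)
qed

lemma std_normal_density_even: "std_normal_density (- s) = std_normal_density s"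
  by (simp add: normal_density_def)

text \<open>Reflection turns a bound from above on the transport map into a bound from below.\<close>

lemma density_cdf_reflect:
  fixes f :: "real \<Rightarrow> real"
  assumes f: "integrable lborel f" and pos: "\<And>s. 0 < f s"
  shows "density_cdf (\<lambda>s. f (- s)) t = 1 - density_cdf f (- t)"
proof -
  note Z = integral_pos_density[OF f pos]
  have i: "integrable lborel (\<lambda>s. indicator {..x} s * f s)" for x
    using integrable_mult_indicator[where A="{..x}" and M=lborel and f=f] f by simp
  have r: "(\<integral>s. g (- s) \<partial>lborel) = (\<integral>s. g s \<partial>lborel)" for g :: "real \<Rightarrow> real"
    using lborel_integral_real_affine[of "-1" g 0] by simp
  have "(\<integral>s. indicator {..t} s * f (- s) \<partial>lborel) = (\<integral>s. indicator {..t} (- s) * f s \<partial>lborel)"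
    using r[of "\<lambda>s. indicator {..t} (- s) * f s"] by simp
  also have "\<dots> = (\<integral>s. f s - indicator {..-t} s * f s \<partial>lborel)"
    using f by (intro integral_cong_AE)
      (auto intro!: AE_I[where N="{-t}"] split: split_indicator_asm split_indicator)
  also have "\<dots> = (\<integral>s. f s \<partial>lborel) - (\<integral>s. indicator {..-t} s * f s \<partial>lborel)"
    using f i by (intro Bochner_Integration.integral_diff)
  finally show ?thesis unfolding density_cdf_def r[of f] using Z by (simp add: diff_divide_distrib)
qed

text \<open>If the logarithm of the density differs from that of the normal density by a function with slope at
most \<open>a + 2 b |w|\<close> in absolute value, then the transport map moves a point by \<open>O(a + b + b |z|)\<close>. This
linear dependence on the perturbation is what makes the coordinate updates follow the driving noise
up to \<open>O(\<gamma>)\<close>.\<close>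

lemma normal_quantile_map_displacement:
  fixes f :: "real \<Rightarrow> real"
  assumes f: "integrable lborel f" and pos: "\<And>s. 0 < f s"
    and ab: "0 \<le> a" "0 \<le> b" "b \<le> 1 / 16"
    and upper: "\<And>v w. v \<le> w \<Longrightarrow> f w * exp (w\<^sup>2 / 2 - a * w - b * w * \<bar>w\<bar>) \<le> f v * exp (v\<^sup>2 / 2 - a * v - b * v * \<bar>v\<bar>)"
    and lower: "\<And>v w. v \<le> w \<Longrightarrow> f v * exp (v\<^sup>2 / 2 + a * v + b * v * \<bar>v\<bar>) \<le> f w * exp (w\<^sup>2 / 2 + a * w + b * w * \<bar>w\<bar>)"
  shows "\<bar>normal_quantile_map f z - z\<bar> \<le> 2 * a + 20 * b + 4 * b * \<bar>z\<bar>"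
proof -
  let ?\<delta> = "2 * a + 16 * b + 4 * b * sqrt (1 + z\<^sup>2)"
  have up: "normal_quantile_map f z \<le> z + ?\<delta>"
    using log_slope_quantile_shift[OF f pos ab upper, of z] normal_quantile_map_eq(2)[OF f pos, of z "z + ?\<delta>"] by (simp add: add.assoc)
  let ?h = "\<lambda>s. f (- s)"
  have h: "integrable lborel ?h" using lborel_integrable_real_affine[OF f, of "-1" 0] by simp
  have "density_cdf std_normal_density (- z) \<le> density_cdf ?h (- z + 2 * a + 16 * b + 4 * b * sqrt (1 + (- z)\<^sup>2))"
  proof (rule log_slope_quantile_shift[OF h pos ab])
    fix v w :: real assume "v \<le> w"
    then show "?h w * exp (w\<^sup>2 / 2 - a * w - b * w * \<bar>w\<bar>) \<le> ?h v * exp (v\<^sup>2 / 2 - a * v - b * v * \<bar>v\<bar>)"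
      using lower[of "-w" "-v"] by simp
  qed
  moreover have "density_cdf std_normal_density (- z) = 1 - density_cdf std_normal_density z"
    using density_cdf_reflect[OF std_normal_density_integrable, of "-z"]
    by (simp add: normal_density_pos std_normal_density_even)
  moreover have "density_cdf ?h (- z + 2 * a + 16 * b + 4 * b * sqrt (1 + (- z)\<^sup>2)) = 1 - density_cdf f (z - ?\<delta>)"
    using density_cdf_reflect[OF f pos, of "- z + 2 * a + 16 * b + 4 * b * sqrt (1 + (- z)\<^sup>2)"] by (simp add: algebra_simps)
  ultimately have "density_cdf f (z - ?\<delta>) \<le> density_cdf std_normal_density z" by simp
  then have "density_cdf f (z - ?\<delta>) \<le> density_cdf f (normal_quantile_map f z)"
    by (simp add: normal_quantile_map_eq(1)[OF f pos])
  then have "z - ?\<delta> \<le> normal_quantile_map f z"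
    using density_cdf_strict_mono[OF f pos, of "normal_quantile_map f z" "z - ?\<delta>"] by linarith
  moreover have "sqrt (1 + z\<^sup>2) \<le> 1 + \<bar>z\<bar>" by (rule real_le_lsqrt) (auto simp: power2_eq_square algebra_simps)
  then have "4 * b * sqrt (1 + z\<^sup>2) \<le> 4 * b * (1 + \<bar>z\<bar>)" using ab by (intro mult_left_mono) auto
  ultimately show ?thesis using up by (simp add: algebra_simps abs_le_iff)
qed

section \<open>Consequences of the assumptions on the potential\<close>

lemma GDERIV_unique:
  assumes "GDERIV f x :> D" "GDERIV f x :> E"
  shows "D = E"
proof -
  have "(\<lambda>h. h \<bullet> D) = (\<lambda>h. h \<bullet> E)"
    using has_derivative_unique assms unfolding gderiv_def by blast
  then show ?thesis by (metis inner_commute vector_eq_ldot)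
qed

lemma GDERIV_gradient: "has_gradient f x \<Longrightarrow> GDERIV f x :> gradient f x"
  unfolding has_gradient_def gradient_def by (metis GDERIV_unique theI')

text \<open>The algorithm also evaluates the gradient where it does not exist; there it takes one fixed vector,
so it remains bounded on bounded sets.\<close>

lemma gradient_undefined:
  obtains u where "\<And>x. \<not> has_gradient f x \<Longrightarrow> gradient f x = u"
proof
  fix x assume "\<not> has_gradient f x"
  then have "(\<lambda>D. GDERIV f x :> D) = (\<lambda>D. False)" by (auto simp: has_gradient_def)
  then show "gradient f x = (THE D. False)" unfolding gradient_def by simp
qed

text \<open>Thin slabs around a hyperplane fill a vanishing fraction of the unit ball.\<close>

lemma measure_slab_tendsto_0:
  fixes n :: "'a::euclidean_space"
  assumes "n \<noteq> 0"
  shows "(\<lambda>k::nat. measure lborel {w \<in> ball 0 1. \<bar>w \<bullet> n\<bar> \<le> inverse (Suc k)}) \<longlonglongrightarrow> 0"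
proof -
  let ?A = "\<lambda>k::nat. {w \<in> ball 0 1. \<bar>w \<bullet> n\<bar> \<le> inverse (Suc k)}"
  have m: "?A k \<in> sets borel" for k by measurable
  have fin: "emeasure lborel (?A k) \<noteq> \<infinity>" for k
  proof -
    have "emeasure lborel (?A k) \<le> emeasure lborel (ball 0 1 :: 'a set)" by (rule emeasure_mono) auto
    also have "\<dots> < \<infinity>" by (rule emeasure_bounded_finite) simp
    finally show ?thesis by simp
  qed
  have "(\<lambda>k. measure lborel (?A k)) \<longlonglongrightarrow> measure lborel (\<Inter>k. ?A k)"
  proof (rule Lim_measure_decseq)
    show "decseq ?A"
      by (rule decseq_SucI) (auto elim!: order.trans simp: le_imp_inverse_le)
  qed (use m fin in auto)
  moreover have "(\<Inter>k. ?A k) \<subseteq> {w. n \<bullet> w = 0}"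
  proof
    fix w assume w: "w \<in> (\<Inter>k. ?A k)"
    have "\<bar>w \<bullet> n\<bar> \<le> e" if e: "0 < e" for e
    proof -
      obtain k :: nat where "inverse (real (Suc k)) < e" using reals_Archimedean[OF e] by auto
      moreover have "\<bar>w \<bullet> n\<bar> \<le> inverse (Suc k)" using w by blast
      ultimately show ?thesis by simp
    qed
    then have "\<bar>w \<bullet> n\<bar> \<le> 0" by (meson dense_le field_le_epsilon le_add_same_cancel2 order_trans zero_less_abs_iff not_le)
    then show "w \<in> {w. n \<bullet> w = 0}" by (simp add: inner_commute)
  qed
  then have "negligible (\<Inter>k. ?A k)"
    using negligible_hyperplane[of n 0] assms negligible_subset by blast
  then have "measure lebesgue (\<Inter>k. ?A k) = 0" by (rule negligible_imp_measure0)
  then have "measure lborel (\<Inter>k. ?A k) = 0" using m by (simp add: measure_completion)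
  ultimately show ?thesis by simp
qed

lemma measure_affine_ball_subset:
  fixes A :: "'a::euclidean_space set"
  assumes A: "A \<in> sets borel" "0 < d"
  shows "measure lborel ((\<lambda>w. x + d *\<^sub>R w) ` A) = d ^ DIM('a) * measure lborel A"
    and "(\<lambda>w. x + d *\<^sub>R w) ` A \<in> sets borel"
proof -
  let ?B = "(\<lambda>w. x + d *\<^sub>R w) ` A"
  have inv: "x + d *\<^sub>R w \<in> ?B \<longleftrightarrow> w \<in> A" for w using A by auto
  have eq: "?B = (\<lambda>y. (1 / d) *\<^sub>R (y - x)) -` A"
  proof (intro set_eqI iffI)
    fix y assume "y \<in> (\<lambda>y. (1 / d) *\<^sub>R (y - x)) -` A"
    then show "y \<in> ?B" using A by (intro image_eqI[of _ _ "(1 / d) *\<^sub>R (y - x)"]) auto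
  qed (use A in auto)
  have "(\<lambda>y. (1 / d) *\<^sub>R (y - x)) \<in> borel_measurable borel" by measurable
  from measurable_sets[OF this A(1)] show B[measurable]: "?B \<in> sets borel" unfolding eq by simp
  have "emeasure lborel ?B = (\<integral>\<^sup>+y. indicator ?B y \<partial>lborel)" using B by simp
  also have "\<dots> = ennreal (d ^ DIM('a)) * (\<integral>\<^sup>+w. indicator ?B (x + d *\<^sub>R w) \<partial>lborel)"
    using assms(2) by (subst nn_integral_lborel_affine[of _ d x]) (auto simp: abs_of_pos)
  also have "(\<lambda>w. indicator ?B (x + d *\<^sub>R w) :: ennreal) = indicator A"
    using inv by (auto simp: indicator_def fun_eq_iff)
  finally have "emeasure lborel ?B = ennreal (d ^ DIM('a)) * emeasure lborel A" using A by simp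
  then show "measure lborel ?B = d ^ DIM('a) * measure lborel A"
    using A by (simp add: measure_def enn2real_mult)
qed

text \<open>Near each of its points the set lies in a slab around the tangent hyperplane that is thin compared
to the radius, so its density there is zero; a set with density zero at each of its points is a null
set.\<close>

lemma negligible_regular_zero_set:
  fixes S :: "'a::euclidean_space set"
  assumes "\<And>x. x \<in> S \<Longrightarrow> \<exists>V f D. open V \<and> x \<in> V \<and> GDERIV f x :> D \<and> D \<noteq> 0 \<and> (\<forall>y\<in>S \<inter> V. f y = (0::real))"
  shows "negligible S"
  unfolding negligible_eq_zero_density
proof (intro ballI allI impI)
  fix x r e assume "x \<in> S" "0 < (r::real)" "0 < (e::real)"
  obtain V f D where V: "open V" "x \<in> V" and D: "GDERIV f x :> D" "D \<noteq> 0" and f: "\<And>y. y \<in> S \<Longrightarrow> y \<in> V \<Longrightarrow> f y = (0::real)"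
    using assms[OF \<open>x \<in> S\<close>] by blast
  let ?A = "\<lambda>k::nat. {w \<in> ball 0 1. \<bar>w \<bullet> D\<bar> \<le> inverse (Suc k)}"
  have b: "0 < measure lborel (ball (0::'a) 1)" using content_ball_pos[of 1 "0::'a"] by (simp add: measure_completion)
  have "eventually (\<lambda>k. measure lborel (?A k) < e * measure lborel (ball (0::'a) 1)) sequentially"
    using measure_slab_tendsto_0[OF D(2)] b \<open>0 < e\<close> by (intro order_tendstoD(2)) auto
  then obtain k where k: "measure lborel (?A k) < e * measure lborel (ball (0::'a) 1)"
    by (auto simp: eventually_sequentially)
  obtain d1 where d1: "0 < d1" "\<And>y. norm (y - x) < d1 \<Longrightarrow> norm (f y - f x - (y - x) \<bullet> D) \<le> inverse (Suc k) * norm (y - x)"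
    using D(1) unfolding gderiv_def has_derivative_at_alt by (metis inverse_positive_iff_positive of_nat_0_less_iff zero_less_Suc)
  obtain d2 where d2: "0 < d2" "ball x d2 \<subseteq> V" using V openE by blast
  define d where "d = min r (min d1 d2)"
  have d: "0 < d" "d \<le> r" "d \<le> d1" "d \<le> d2" using \<open>0 < r\<close> d1 d2 by (auto simp: d_def)
  let ?B = "(\<lambda>w. x + d *\<^sub>R w) ` ?A k"
  have Am: "?A k \<in> sets borel" by measurable
  have ballm: "measure lborel (ball x d) = d ^ DIM('a) * measure lborel (ball (0::'a) 1)"
    using measure_affine_ball_subset(1)[of "ball 0 1" d x] d
    by (simp add: image_add_ball[symmetric] ball_scale image_image[symmetric])
  have "S \<inter> ball x d \<subseteq> ?B"
  proof
    fix y assume y: "y \<in> S \<inter> ball x d"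
    have n: "norm (y - x) < d" using y by (simp add: dist_norm norm_minus_commute)
    have "y \<in> V" using y d d2 by (auto simp: subset_iff)
    then have "f y = 0" "f x = 0" using f[of y] f[of x] y V \<open>x \<in> S\<close> by auto
    then have "\<bar>(y - x) \<bullet> D\<bar> \<le> inverse (Suc k) * norm (y - x)" using d1(2)[of y] n d by simp
    also have "\<dots> \<le> inverse (Suc k) * d" using n by (intro mult_left_mono) auto
    finally have "\<bar>(y - x) \<bullet> D\<bar> / d \<le> inverse (Suc k)" using d by (simp add: pos_divide_le_eq)
    moreover have "\<bar>((1/d) *\<^sub>R (y - x)) \<bullet> D\<bar> = \<bar>(y - x) \<bullet> D\<bar> / d" using d by (simp only: inner_scaleR_left abs_mult) simp
    ultimately have "\<bar>((1/d) *\<^sub>R (y - x)) \<bullet> D\<bar> \<le> inverse (Suc k)" by (simp only:)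
    moreover have "(1/d) *\<^sub>R (y - x) \<in> ball 0 1" unfolding mem_ball_0 norm_scaleR using n d by simp
    moreover have "y = x + d *\<^sub>R ((1/d) *\<^sub>R (y - x))" using d by simp
    ultimately show "y \<in> ?B" by blast
  qed
  moreover have "?B \<in> sets borel" using measure_affine_ball_subset(2)[OF Am d(1)] .
  moreover have "measure lborel ?B < e * measure lborel (ball x d)"
    unfolding measure_affine_ball_subset(1)[OF Am d(1)] ballm using k d(1) by (simp add: mult.left_commute)
  moreover have "emeasure lborel ?B < \<infinity>"
  proof (rule emeasure_bounded_finite)
    show "bounded ?B" by (rule bounded_subset[of "(\<lambda>w. x + d *\<^sub>R w) ` ball 0 1"])
      (auto intro!: bounded_translation bounded_scaling simp: image_image[of "\<lambda>y. x + y" "\<lambda>w. d *\<^sub>R w", symmetric])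
  qed
  ultimately show "\<exists>d>0. d \<le> r \<and> (\<exists>U. S \<inter> ball x d \<subseteq> U \<and> U \<in> lmeasurable \<and> measure lebesgue U < e * measure lebesgue (ball x d))"
    using d by (intro exI[of _ d] conjI exI[of _ ?B]) (auto simp: fmeasurable_def measure_completion)
qed

lemma negligible_hypersurface:
  assumes "hypersurface (Suc k) S"
  shows "negligible S"
proof (rule negligible_regular_zero_set)
  fix x assume "x \<in> S"
  then obtain V f where V: "open V" "x \<in> V" "C_k (Suc k) f V" "S \<inter> V = {y \<in> V. f y = 0}" "\<And>y. y \<in> S \<inter> V \<Longrightarrow> gradient f y \<noteq> 0"
    using assms unfolding hypersurface_def by meson
  then have "has_gradient f x" "gradient f x \<noteq> 0" using \<open>x \<in> S\<close> by auto
  then show "\<exists>V f D. open V \<and> x \<in> V \<and> GDERIV f x :> D \<and> D \<noteq> 0 \<and> (\<forall>y\<in>S \<inter> V. f y = (0::real))"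
    using V GDERIV_gradient by blast
qed

text \<open>The form in which the piecewise Lipschitz assumption enters the proof. The last conclusion is a
global Lipschitz bound with an additive error. If \<open>x\<close> and \<open>y\<close> lie in different pieces, the segment
between them meets the boundary of either piece, hence the bounded union of the surfaces; there the
gradients are bounded, and within the pieces the Lipschitz bound applies. Each piece may contribute
the full length of the segment, whence the factor \<open>2 L\<close>.\<close>

lemma piecewise_lipschitz_gradient_good_set:
  fixes U :: "'a::euclidean_space \<Rightarrow> real"
  assumes "piecewise_lipschitz_gradient U L"
  obtains D C B where "open D" "closure D = UNIV" "AE x in lborel. x \<in> D" "0 < L" "0 \<le> C" "0 \<le> B"
    "\<And>x. x \<in> D \<Longrightarrow> has_gradient U x"
    "\<And>x. x \<in> D \<Longrightarrow> norm (gradient U x) \<le> C + L * norm x"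
    "\<And>x y. x \<in> D \<Longrightarrow> y \<in> D \<Longrightarrow> norm (gradient U x - gradient U y) \<le> 2 * L * norm (x - y) + B"
proof -
  obtain n1 n2 :: nat and \<Phi> M \<Sigma> :: "nat \<Rightarrow> 'a set" where L: "0 < L"
    and \<Sigma>: "\<And>j. j \<in> {1..n2} \<Longrightarrow> compact (\<Sigma> j)" "\<And>j. j \<in> {1..n2} \<Longrightarrow> hypersurface 3 (\<Sigma> j)"
    and \<Phi>: "\<And>i. i \<in> {1..n1} \<Longrightarrow> open (\<Phi> i)" "disjoint_family_on \<Phi> {1..n1}"
      "(\<Union>i\<in>{1..n1}. closure (\<Phi> i)) = UNIV" "(\<Union>i\<in>{1..n1}. frontier (\<Phi> i)) \<subseteq> (\<Union>j\<in>{1..n2}. \<Sigma> j)"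
    and g: "\<And>i x. i \<in> {1..n1} \<Longrightarrow> x \<in> \<Phi> i \<Longrightarrow> has_gradient U x"
      "\<And>i x y. i \<in> {1..n1} \<Longrightarrow> x \<in> \<Phi> i \<Longrightarrow> y \<in> \<Phi> i \<Longrightarrow> norm (gradient U x - gradient U y) \<le> L * norm (x - y)"
    proof -
    note a = assms[unfolded piecewise_lipschitz_gradient_def]
    obtain n1 n2 :: nat and \<Phi> M \<Sigma> :: "nat \<Rightarrow> 'a set" where "(\<forall>j\<in>{1..n2}. bounded (M j) \<and> region (M j) \<and> compact (\<Sigma> j) \<and> orientable (\<Sigma> j) \<and>
           connected (\<Sigma> j) \<and> hypersurface 3 (\<Sigma> j) \<and> \<Sigma> j = frontier (M j)) \<and>
        (\<forall>i\<in>{1..n1}. open (\<Phi> i)) \<and>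
        disjoint_family_on \<Phi> {1..n1} \<and>
        (\<Union>i\<in>{1..n1}. closure (\<Phi> i)) = UNIV \<and>
        (\<Union>i\<in>{1..n1}. frontier (\<Phi> i)) \<subseteq> (\<Union>j\<in>{1..n2}. \<Sigma> j) \<and>
        (\<forall>i\<in>{1..n1}. (\<forall>x\<in>\<Phi> i. has_gradient U x) \<and>
           (\<forall>x\<in>\<Phi> i. \<forall>y\<in>\<Phi> i. norm (gradient U x - gradient U y) \<le> L * norm (x - y)))"
      using a[THEN conjunct2] by (elim exE) (rule that)
    note H = this
    note \<Sigma>' = H[THEN conjunct1, THEN bspec] and H' = H[THEN conjunct2, THEN conjunct2, THEN conjunct2, THEN conjunct2, THEN conjunct2, THEN bspec]
    show ?thesis
      by (rule that[OF a[THEN conjunct1] \<Sigma>'[THEN conjunct2, THEN conjunct2, THEN conjunct1] \<Sigma>'[THEN conjunct2, THEN conjunct2, THEN conjunct2, THEN conjunct2, THEN conjunct2, THEN conjunct1]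
        H[THEN conjunct2, THEN conjunct1, THEN bspec] H[THEN conjunct2, THEN conjunct2, THEN conjunct1] H[THEN conjunct2, THEN conjunct2, THEN conjunct2, THEN conjunct1]
        H[THEN conjunct2, THEN conjunct2, THEN conjunct2, THEN conjunct2, THEN conjunct1] H'[THEN conjunct1, THEN bspec] H'[THEN conjunct2, THEN bspec, THEN bspec]])
  qed
  define D where "D = (\<Union>i\<in>{1..n1}. \<Phi> i)"
  have "open D" unfolding D_def using \<Phi>(1) by blast
  have "closure D = UNIV"
  proof -
    have "closure (\<Phi> i) \<subseteq> closure D" if "i \<in> {1..n1}" for i
      unfolding D_def using that by (intro closure_mono) blast
    then show ?thesis using \<Phi>(3) by blast
  qed
  have compl: "- D \<subseteq> (\<Union>j\<in>{1..n2}. \<Sigma> j)"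
  proof
    fix x assume x: "x \<in> - D"
    obtain i where i: "i \<in> {1..n1}" "x \<in> closure (\<Phi> i)" using \<Phi>(3) by blast
    moreover have "x \<notin> interior (\<Phi> i)" using x i interior_subset unfolding D_def by blast
    ultimately show "x \<in> (\<Union>j\<in>{1..n2}. \<Sigma> j)" using \<Phi>(4) unfolding frontier_def by blast
  qed
  have "negligible (\<Sigma> j)" if "j \<in> {1..n2}" for j
    using negligible_hypersurface[of 2] \<Sigma>(2)[OF that] by (simp add: numeral_eq_Suc)
  then have "negligible (\<Union>(\<Sigma> ` {1..n2}))" by (intro negligible_Union) auto
  then have "negligible (- D)" by (rule negligible_subset[OF _ compl])
  then have "- D \<in> null_sets lborel"
    using \<open>open D\<close> by (simp add: negligible_iff_null_sets null_sets_completion_iff)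
  then have "AE x in lborel. x \<notin> - D" by (rule AE_not_in)
  then have AED: "AE x in lborel. x \<in> D" by simp
  have "bounded (\<Union>j\<in>{1..n2}. \<Sigma> j)" using \<Sigma>(1) by (intro bounded_UN compact_imp_bounded) auto
  then obtain R where R: "\<And>x. x \<in> (\<Union>j\<in>{1..n2}. \<Sigma> j) \<Longrightarrow> norm x \<le> R" unfolding bounded_iff by blast
  define c where "c i = (if \<Phi> i = {} then 0 else norm (gradient U (SOME x. x \<in> \<Phi> i)) + L * norm (SOME x. x \<in> \<Phi> i))" for i
  define C where "C = (\<Sum>i\<in>{1..n1}. c i)"
  have c0: "0 \<le> c i" for i using L by (auto simp: c_def)
  then have "0 \<le> C" unfolding C_def by (intro sum_nonneg) auto
  have growth: "norm (gradient U x) \<le> C + L * norm x" if x: "x \<in> D" for x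
  proof -
    obtain i where i: "i \<in> {1..n1}" "x \<in> \<Phi> i" using x unfolding D_def by blast
    define z where "z = (SOME x. x \<in> \<Phi> i)"
    have z: "z \<in> \<Phi> i" unfolding z_def using i by (metis someI)
    have "norm (gradient U x) \<le> norm (gradient U z) + norm (gradient U x - gradient U z)"
      using norm_triangle_ineq[of "gradient U z" "gradient U x - gradient U z"] by simp
    also have "\<dots> \<le> norm (gradient U z) + L * (norm x + norm z)"
      using g(2)[OF i z] L norm_triangle_ineq4[of x z] mult_left_mono[of "norm (x - z)" "norm x + norm z" L] by linarith
    also have "\<dots> = c i + L * norm x" using i by (auto simp: c_def z_def[symmetric] algebra_simps)
    also have "c i \<le> C" unfolding C_def using i c0 by (intro member_le_sum) auto
    finally show ?thesis by simp
  qed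
  \<comment> \<open>\<open>2 L\<close> for stepping from the boundary into the piece, the rest for the gradients near the
    surfaces.\<close>
  define B where "B = 2 * L + 2 * (C + L * (\<bar>R\<bar> + 1))"
  have B0: "0 \<le> B" using L \<open>0 \<le> C\<close> by (simp add: B_def)
  have exit: "\<exists>s \<in> \<Phi> i. norm (x - s) \<le> norm (x - y) + 1 \<and> norm s \<le> \<bar>R\<bar> + 1"
    if i: "i \<in> {1..n1}" and x: "x \<in> \<Phi> i" and y: "y \<notin> \<Phi> i" for i x y
  proof -
    have "closed_segment x y \<inter> frontier (\<Phi> i) \<noteq> {}"
      using x y by (intro connected_Int_frontier) auto
    then obtain s where s: "s \<in> closed_segment x y" "s \<in> frontier (\<Phi> i)" by blast
    then have "s \<in> closure (\<Phi> i)" by (simp add: frontier_def)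
    then obtain s' where s': "s' \<in> \<Phi> i" "dist s' s < 1" unfolding closure_approachable by (metis zero_less_one)
    have "norm s \<le> R" using R \<Phi>(4) s i by blast
    moreover have "norm (s - x) \<le> norm (y - x)" by (rule segment_bound(1)[OF s(1)])
    moreover have "norm s' \<le> norm s + norm (s' - s)" using norm_triangle_ineq[of s "s' - s"] by simp
    moreover have "norm (x - s') \<le> norm (s - x) + norm (s' - s)"
      using norm_triangle_ineq4[of "s - x" "s - s'"] by (simp add: norm_minus_commute)
    ultimately show ?thesis using s' by (intro bexI[of _ s']) (auto simp: dist_norm norm_minus_commute)
  qed
  have coarse_lipschitz: "norm (gradient U x - gradient U y) \<le> 2 * L * norm (x - y) + B" if "x \<in> D" "y \<in> D" for x y
  proof -
    obtain i j where ij: "i \<in> {1..n1}" "x \<in> \<Phi> i" "j \<in> {1..n1}" "y \<in> \<Phi> j" using \<open>x \<in> D\<close> \<open>y \<in> D\<close> unfolding D_def by blast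
    show ?thesis
    proof (cases "i = j")
      case True
      then have "norm (gradient U x - gradient U y) \<le> L * norm (x - y)" using g(2) ij by blast
      moreover have "0 \<le> L * norm (x - y)" using L by simp
      ultimately show ?thesis using B0 by linarith
    next
      case False
      then have dis: "\<Phi> i \<inter> \<Phi> j = {}" using \<Phi>(2) ij unfolding disjoint_family_on_def by blast
      obtain s where s: "s \<in> \<Phi> i" "norm (x - s) \<le> norm (x - y) + 1" "norm s \<le> \<bar>R\<bar> + 1"
        using exit[OF ij(1,2), of y] ij dis by blast
      obtain t where t: "t \<in> \<Phi> j" "norm (y - t) \<le> norm (x - y) + 1" "norm t \<le> \<bar>R\<bar> + 1"
        using exit[OF ij(3,4), of x] ij dis by (metis disjoint_iff norm_minus_commute)
      have 1: "norm (gradient U x - gradient U s) \<le> L * (norm (x - y) + 1)"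
        using g(2)[OF ij(1,2) s(1)] mult_left_mono[OF s(2), of L] L by linarith
      have 2: "norm (gradient U y - gradient U t) \<le> L * (norm (x - y) + 1)"
        using g(2)[OF ij(3,4) t(1)] mult_left_mono[OF t(2), of L] L by linarith
      have "s \<in> D" "t \<in> D" using s t ij unfolding D_def by auto
      then have 3: "norm (gradient U s) \<le> C + L * (\<bar>R\<bar> + 1)" "norm (gradient U t) \<le> C + L * (\<bar>R\<bar> + 1)"
        using growth[of s] growth[of t] mult_left_mono[OF s(3), of L] mult_left_mono[OF t(3), of L] L by linarith+
      define p q r where "p = gradient U x - gradient U s" and "q = gradient U y - gradient U t"
        and "r = gradient U s - gradient U t"
      have "gradient U x - gradient U y = p - q + r" by (simp add: p_def q_def r_def)
      moreover have "norm (p - q + r) \<le> norm p + norm q + norm r"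
        using norm_triangle_ineq[of "p - q" r] norm_triangle_ineq4[of p q] by linarith
      moreover have "norm r \<le> norm (gradient U s) + norm (gradient U t)"
        unfolding r_def by (rule norm_triangle_ineq4)
      ultimately have "norm (gradient U x - gradient U y) \<le> norm p + norm q + (norm (gradient U s) + norm (gradient U t))"
        by simp
      then show ?thesis using 1 2 3 unfolding B_def p_def q_def by (simp add: algebra_simps)
    qed
  qed
  show ?thesis
    by (rule that[OF \<open>open D\<close> \<open>closure D = UNIV\<close> AED L \<open>0 \<le> C\<close> B0 _ growth coarse_lipschitz]) (use g(1) in \<open>auto simp: D_def\<close>)
qed

lemma convex_above_gradient:
  fixes U :: "'a::euclidean_space \<Rightarrow> real"
  assumes U: "convex_on UNIV U" and D: "GDERIV U x :> D"
  shows "U x + (y - x) \<bullet> D \<le> U y"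
proof -
  define f where "f t = U (x + t *\<^sub>R (y - x))" for t
  have "convex_on UNIV f"
  proof (rule convex_onI)
    fix t r s :: real assume t: "0 < t" "t < 1"
    have "x + ((1 - t) *\<^sub>R r + t *\<^sub>R s) *\<^sub>R (y - x) = (1 - t) *\<^sub>R (x + r *\<^sub>R (y - x)) + t *\<^sub>R (x + s *\<^sub>R (y - x))"
      by (simp add: algebra_simps)
    then show "f ((1 - t) *\<^sub>R r + t *\<^sub>R s) \<le> (1 - t) * f r + t * f s"
      unfolding f_def using convex_onD[OF U, of t] t by simp
  qed simp
  moreover have "(f has_real_derivative (y - x) \<bullet> D) (at 0)"
  proof -
    have "((\<lambda>t. x + t *\<^sub>R (y - x)) has_derivative (\<lambda>t. t *\<^sub>R (y - x))) (at 0)"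
      by (auto intro!: derivative_eq_intros)
    moreover have "(U has_derivative (\<lambda>h. h \<bullet> D)) (at (x + 0 *\<^sub>R (y - x)))" using D by (simp add: gderiv_def)
    ultimately have "((\<lambda>t. U (x + t *\<^sub>R (y - x))) has_derivative (\<lambda>t. (t *\<^sub>R (y - x)) \<bullet> D)) (at 0)"
      by (rule has_derivative_compose)
    then show ?thesis unfolding f_def[abs_def] has_field_derivative_def
      by (rule has_derivative_eq_rhs) (auto simp: mult.commute)
  qed
  ultimately have "f 1 - f 0 \<ge> ((y - x) \<bullet> D) * (1 - 0)"
    by (intro convex_on_imp_above_tangent[of UNIV]) auto
  then show ?thesis by (simp add: f_def)
qed

text \<open>Where the gradient exists it is a limit of difference quotients. Differentiability with a candidate
for the gradient is tested on a countable dense set of increments, by continuity.\<close>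

lemma borel_measurable_gradient:
  fixes U :: "'a::euclidean_space \<Rightarrow> real"
  assumes U: "continuous_on UNIV U"
  shows "{x. has_gradient U x} \<in> sets borel" "gradient U \<in> borel_measurable borel"
proof -
  have Um[measurable]: "U \<in> borel_measurable borel" using U by (rule borel_measurable_continuous_onI)
  define G where "G x = (\<Sum>b\<in>Basis. lim (\<lambda>n::nat. real (Suc n) * (U (x + inverse (Suc n) *\<^sub>R b) - U x)) *\<^sub>R b)" for x
  have [measurable]: "G \<in> borel_measurable borel" unfolding G_def[abs_def] by measurable
  have G: "GDERIV U x :> D \<Longrightarrow> G x = D" for x D
  proof -
    assume D: "GDERIV U x :> D"
    have "lim (\<lambda>n::nat. real (Suc n) * (U (x + inverse (Suc n) *\<^sub>R b) - U x)) = D \<bullet> b" for b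
    proof (rule limI)
      have "((\<lambda>t. U (x + t *\<^sub>R b)) has_derivative (\<lambda>t. (t *\<^sub>R b) \<bullet> D)) (at 0)"
        by (rule has_derivative_compose[where g=U]) (use D in \<open>auto intro!: derivative_eq_intros simp: gderiv_def\<close>)
      then have "((\<lambda>t. U (x + t *\<^sub>R b)) has_real_derivative D \<bullet> b) (at 0)"
        unfolding has_field_derivative_def by (rule has_derivative_eq_rhs) (auto simp: mult.commute inner_commute)
      then have "((\<lambda>t. (U (x + t *\<^sub>R b) - U x) / t) \<longlongrightarrow> D \<bullet> b) (at 0)" by (simp add: DERIV_def)
      moreover have "filterlim (\<lambda>n. inverse (real (Suc n))) (at 0) sequentially"
        by (rule filterlim_atI) (use LIMSEQ_inverse_real_of_nat in auto)
      ultimately have "((\<lambda>n. (U (x + inverse (real (Suc n)) *\<^sub>R b) - U x) / inverse (real (Suc n))) \<longlongrightarrow> D \<bullet> b) sequentially"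
        by (rule filterlim_compose)
      then show "(\<lambda>n. real (Suc n) * (U (x + inverse (Suc n) *\<^sub>R b) - U x)) \<longlonglongrightarrow> D \<bullet> b"
        by (simp add: divide_inverse mult.commute)
    qed
    then show "G x = D" unfolding G_def by (simp add: euclidean_representation)
  qed
  obtain Q :: "'a set" where Q: "countable Q" "\<And>X. open X \<Longrightarrow> X \<noteq> {} \<Longrightarrow> \<exists>d\<in>Q. d \<in> X"
    using countable_dense_setE by metis
  have iff: "has_gradient U x \<longleftrightarrow> (\<forall>k::nat. \<exists>m::nat. \<forall>h\<in>Q. norm h < inverse (Suc m) \<longrightarrow> \<bar>U (x + h) - U x - h \<bullet> G x\<bar> \<le> inverse (Suc k) * norm h)"
    (is "_ \<longleftrightarrow> ?R x") for x
  proof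
    assume "has_gradient U x"
    then have "GDERIV U x :> G x" using G GDERIV_gradient by metis
    then have d: "\<And>e. e > 0 \<Longrightarrow> \<exists>d>0. \<forall>y. norm (y - x) < d \<longrightarrow> norm (U y - U x - (y - x) \<bullet> G x) \<le> e * norm (y - x)"
      unfolding gderiv_def has_derivative_at_alt by blast
    show "?R x"
    proof
      fix k :: nat
      obtain d where d: "d > 0" "\<And>y. norm (y - x) < d \<Longrightarrow> norm (U y - U x - (y - x) \<bullet> G x) \<le> inverse (Suc k) * norm (y - x)"
        using d[of "inverse (Suc k)"] by auto
      obtain m where m: "inverse (real (Suc m)) < d" using reals_Archimedean[OF d(1)] by blast
      show "\<exists>m::nat. \<forall>h\<in>Q. norm h < inverse (Suc m) \<longrightarrow> \<bar>U (x + h) - U x - h \<bullet> G x\<bar> \<le> inverse (Suc k) * norm h"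
        using d(2)[of "x + _"] m by (intro exI[of _ m]) auto
    qed
  next
    assume R: "?R x"
    have "GDERIV U x :> G x" unfolding gderiv_def has_derivative_at_alt
    proof (intro conjI allI impI)
      show "bounded_linear (\<lambda>h. h \<bullet> G x)" by (rule bounded_linear_inner_left)
      fix e :: real assume "0 < e"
      then obtain k where k: "inverse (real (Suc k)) < e" using reals_Archimedean by blast
      obtain m where m: "\<And>h. h \<in> Q \<Longrightarrow> norm h < inverse (Suc m) \<Longrightarrow> \<bar>U (x + h) - U x - h \<bullet> G x\<bar> \<le> inverse (Suc k) * norm h"
        using R by blast
      have "\<bar>U (x + h) - U x - h \<bullet> G x\<bar> \<le> inverse (Suc k) * norm h" if h: "norm h < inverse (Suc m)" for h
      proof (rule ccontr)
        assume a: "\<not> ?thesis"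
        let ?X = "{h. norm h < inverse (real (Suc m))} \<inter> {h. inverse (real (Suc k)) * norm h < \<bar>U (x + h) - U x - h \<bullet> G x\<bar>}"
        have "continuous_on UNIV (\<lambda>h. U (x + h))"
          by (rule continuous_on_compose2[OF U]) (auto intro!: continuous_intros)
        then have "open ?X" by (intro open_Int open_Collect_less continuous_intros)
        moreover have "h \<in> ?X" using a h by auto
        ultimately obtain q where "q \<in> Q" "q \<in> ?X" using Q(2) by blast
        then show False using m[of q] by auto
      qed
      then have close: "\<bar>U y - U x - (y - x) \<bullet> G x\<bar> \<le> e * norm (y - x)" if "norm (y - x) < inverse (1 + real m)" for y
        using that k mult_right_mono[of "inverse (real (Suc k))" e "norm (y - x)"] by (force dest!: spec[of _ "y - x"])
      show "\<exists>d>0. \<forall>y. norm (y - x) < d \<longrightarrow> norm (U y - U x - (y - x) \<bullet> G x) \<le> e * norm (y - x)"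
        using k by (intro exI[of _ "inverse (real (Suc m))"])
         (auto intro!: close)
    qed
    then show "has_gradient U x" unfolding has_gradient_def by blast
  qed
  show hm: "{x. has_gradient U x} \<in> sets borel"
  proof -
    have "{x. has_gradient U x} = (\<Inter>k. \<Union>m. \<Inter>h\<in>{h \<in> Q. norm h < inverse (real (Suc m))}.
        {x. \<bar>U (x + h) - U x - h \<bullet> G x\<bar> \<le> inverse (real (Suc k)) * norm h})"
      by (simp only: iff) blast
    also have "\<dots> \<in> sets borel"
    proof (intro sets.countable_INT'' sets.countable_UN'' countableI_type)
      fix k m :: nat and h assume "h \<in> {h \<in> Q. norm h < inverse (real (Suc m))}"
      show "{x. \<bar>U (x + h) - U x - h \<bullet> G x\<bar> \<le> inverse (real (Suc k)) * norm h} \<in> sets borel"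
        by measurable
    next
      fix m :: nat
      show "countable {h \<in> Q. norm h < inverse (real (Suc m))}"
        using Q(1) by (rule countable_subset[rotated]) auto
    qed auto
    finally show ?thesis .
  qed
  obtain u where u: "\<And>x. \<not> has_gradient U x \<Longrightarrow> gradient U x = u" using gradient_undefined[of U] by blast
  have "gradient U = (\<lambda>x. if has_gradient U x then G x else u)"
    using u G[OF GDERIV_gradient] by (auto simp: fun_eq_iff)
  moreover have "(\<lambda>x. if has_gradient U x then G x else u) \<in> borel_measurable borel"
    using hm by (intro measurable_If) auto
  ultimately show "gradient U \<in> borel_measurable borel" by simp
qed

lemma strongly_convex_imp_convex:
  fixes U :: "'a::euclidean_space \<Rightarrow> real"
  assumes "strongly_convex U" shows "convex_on UNIV U"
proof (rule convex_onI)
  fix t :: real and x y :: 'a assume t: "0 < t" "t < 1"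
  obtain m where m: "m > 0" "\<And>x y t. t \<in> {0..1} \<Longrightarrow> U ((1 - t) *\<^sub>R x + t *\<^sub>R y)
      \<le> (1 - t) * U x + t * U y - m / 2 * t * (1 - t) * (norm (x - y))\<^sup>2"
    using assms unfolding strongly_convex_def by blast
  have "0 \<le> m / 2 * t * (1 - t) * (norm (x - y))\<^sup>2" using m t by simp
  then show "U ((1 - t) *\<^sub>R x + t *\<^sub>R y) \<le> (1 - t) * U x + t * U y" using m(2)[of t x y] t by auto
qed simp

text \<open>A bound on the gradient on a dense set gives a local Lipschitz bound for a convex function, by the
inequality for tangents on that set and continuity elsewhere.\<close>

lemma convex_difference_bound:
  fixes U :: "'a::euclidean_space \<Rightarrow> real"
  assumes U: "convex_on UNIV U" and D: "closure D = UNIV"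
    and g: "\<And>x. x \<in> D \<Longrightarrow> has_gradient U x" "\<And>x. x \<in> D \<Longrightarrow> norm (gradient U x) \<le> C + L * norm x"
  shows "U x - U y \<le> (C + L * norm x) * norm (x - y)"
proof -
  have c: "continuous_on UNIV U" using convex_on_continuous[OF _ U] by simp
  have "closed {x. U x - U y \<le> (C + L * norm x) * norm (x - y)}"
    by (intro closed_Collect_le continuous_intros c)
  moreover have "D \<subseteq> {x. U x - U y \<le> (C + L * norm x) * norm (x - y)}"
  proof
    fix x assume x: "x \<in> D"
    have "U x + (y - x) \<bullet> gradient U x \<le> U y"
      by (rule convex_above_gradient[OF U GDERIV_gradient[OF g(1)[OF x]]])
    moreover have "- ((y - x) \<bullet> gradient U x) \<le> norm (x - y) * norm (gradient U x)"
      using Cauchy_Schwarz_ineq2[of "y - x" "gradient U x"] by (simp add: norm_minus_commute)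
    moreover have "norm (x - y) * norm (gradient U x) \<le> norm (x - y) * (C + L * norm x)"
      using g(2)[OF x] by (intro mult_left_mono) auto
    ultimately show "x \<in> {x. U x - U y \<le> (C + L * norm x) * norm (x - y)}" by (simp add: mult.commute)
  qed
  ultimately have "UNIV \<subseteq> {x. U x - U y \<le> (C + L * norm x) * norm (x - y)}"
    using closure_minimal D by metis
  then show ?thesis by auto
qed

text \<open>The gradient may also exist at points of the surfaces, where no Lipschitz bound is assumed. There
convexity bounds it: moving in its direction increases \<open>U\<close> at least at the rate of its norm.\<close>

lemma convex_gradient_growth:
  fixes U :: "'a::euclidean_space \<Rightarrow> real"
  assumes U: "convex_on UNIV U" and L: "0 < L"
    and diff: "\<And>x y. U x - U y \<le> (C + L * norm x) * norm (x - y)"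
    and x: "has_gradient U x"
  shows "norm (gradient U x) \<le> C + L * norm x"
proof (cases "gradient U x = 0")
  case True
  have "0 \<le> C + L * norm x"
  proof -
    obtain b :: 'a where b: "norm b = 1" using vector_choose_size[of 1] by auto
    show ?thesis
    proof (rule field_le_epsilon)
      fix e :: real assume "0 < e"
      let ?y = "x + (e / L) *\<^sub>R b"
      have "U x \<le> U ?y" using convex_above_gradient[OF U GDERIV_gradient[OF x], of ?y] True by simp
      then have "0 \<le> (C + L * norm ?y) * norm (?y - x)" using diff[of ?y x] by linarith
      moreover have p: "0 < norm (?y - x)" using b L \<open>0 < e\<close> by simp
      ultimately have "0 \<le> C + L * norm ?y" by (rule mult_right_le_imp_le[of 0, simplified])
      also have "\<dots> \<le> C + L * (norm x + e / L)"
        using L b \<open>0 < e\<close> norm_triangle_ineq[of x "(e / L) *\<^sub>R b"] by (intro add_left_mono mult_left_mono) auto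
      also have "\<dots> = C + L * norm x + e" using L by (simp add: algebra_simps)
      finally show "0 \<le> C + L * norm x + e" .
    qed
  qed
  then show ?thesis using True by simp
next
  case False
  define n where "n = norm (gradient U x)"
  have n: "0 < n" using False by (simp add: n_def)
  show ?thesis
  proof (rule field_le_epsilon)
    fix e :: real assume e: "0 < e"
    define t where "t = e / (L * n)"
    have t: "0 < t" using e L n by (simp add: t_def)
    let ?y = "x + t *\<^sub>R gradient U x"
    have "U x + (?y - x) \<bullet> gradient U x \<le> U ?y" by (rule convex_above_gradient[OF U GDERIV_gradient[OF x]])
    then have "t * n * n \<le> U ?y - U x" by (simp add: n_def dot_square_norm power2_eq_square mult.assoc)
    also have "\<dots> \<le> (C + L * norm ?y) * (t * n)" using diff[of ?y x] t by (simp add: n_def abs_of_pos)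
    finally have "n * (t * n) \<le> (C + L * norm ?y) * (t * n)" by (simp add: mult_ac)
    then have "n \<le> C + L * norm ?y" using t n by (simp add: mult_le_cancel_right)
    also have "\<dots> \<le> C + L * (norm x + t * n)"
      using L t norm_triangle_ineq[of x "t *\<^sub>R gradient U x"] by (intro add_left_mono mult_left_mono) (auto simp: n_def)
    also have "\<dots> = C + L * norm x + e" using L n by (simp add: t_def algebra_simps)
    finally show "norm (gradient U x) \<le> C + L * norm x + e" by (simp add: n_def)
  qed
qed

lemma strongly_convex_coercive:
  fixes U :: "'a::euclidean_space \<Rightarrow> real"
  assumes U: "strongly_convex U"
    and diff: "\<And>x y. U x - U y \<le> (C + L * norm x) * norm (x - y)"
  obtains m where "0 < m" "\<And>x. U 0 - C * norm x + m * (norm x)\<^sup>2 \<le> U x"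
proof -
  obtain m where m: "m > 0" "\<And>x y t. t \<in> {0..1} \<Longrightarrow> U ((1 - t) *\<^sub>R x + t *\<^sub>R y)
      \<le> (1 - t) * U x + t * U y - m / 2 * t * (1 - t) * (norm (x - y))\<^sup>2"
    using U unfolding strongly_convex_def by blast
  have "U 0 - C * norm x + (m / 4) * (norm x)\<^sup>2 \<le> U x" for x
    using m(2)[of "1/2" 0 x] diff[of 0 "(1/2) *\<^sub>R x"] by (simp add: field_simps)
  then show ?thesis using that[of "m/4"] m by simp
qed

text \<open>What the rest of the proof needs to know about \<open>U\<close> and its gradient \<open>g\<close>. The set \<open>D\<close> has full measure,
the growth bound holds everywhere, and \<open>B\<close> bounds the jumps of \<open>g\<close>.\<close>

locale langevin_potential =
  fixes U :: "'a::euclidean_space \<Rightarrow> real" and g :: "'a \<Rightarrow> 'a" and D :: "'a set"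
    and \<beta> L \<mu> C B \<kappa> :: real
  assumes \<beta>: "0 < \<beta>" and L: "0 < L" and \<mu>: "0 < \<mu>" and C: "0 < C" and B: "0 \<le> B" and \<kappa>: "0 < \<kappa>"
    and U_diff: "\<And>x y. U x - U y \<le> (C + L * norm x) * norm (x - y)"
    and U_lower: "\<And>x. U 0 - C * norm x + \<kappa> * (norm x)\<^sup>2 \<le> U x"
    and U_cont: "continuous_on UNIV U"
    and g_meas[measurable]: "g \<in> borel_measurable borel"
    and D_sets[measurable]: "D \<in> sets borel" and D_AE: "AE x in lborel. x \<in> D" and D_ne: "D \<noteq> {}"
    and deriv: "\<And>x. x \<in> D \<Longrightarrow> GDERIV U x :> g x"
    and growth: "\<And>x. norm (g x) \<le> C + L * norm x"
    and mono: "\<And>x y. x \<in> D \<Longrightarrow> y \<in> D \<Longrightarrow> \<mu> * (norm (x - y))\<^sup>2 \<le> (g x - g y) \<bullet> (x - y)"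
    and coarse_lipschitz: "\<And>x y. x \<in> D \<Longrightarrow> y \<in> D \<Longrightarrow> norm (g x - g y) \<le> 2 * L * norm (x - y) + B"

lemma langevin_potential_gradient:
  fixes U :: "'a::euclidean_space \<Rightarrow> real"
  assumes sc: "strongly_convex U" and pl: "piecewise_lipschitz_gradient U L"
    and sm: "strongly_monotone_gradient U \<mu>" and "0 < \<beta>"
  obtains D C B m where "langevin_potential U (gradient U) D \<beta> L \<mu> C B m"
proof -
  obtain D C B where D: "open D" "closure D = UNIV" "AE x in lborel. x \<in> D" and c: "0 < L" "0 \<le> C" "0 \<le> B"
    and hg: "\<And>x. x \<in> D \<Longrightarrow> has_gradient U x"
    and gr: "\<And>x. x \<in> D \<Longrightarrow> norm (gradient U x) \<le> C + L * norm x"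
    and coarse_lipschitz: "\<And>x y. x \<in> D \<Longrightarrow> y \<in> D \<Longrightarrow> norm (gradient U x - gradient U y) \<le> 2 * L * norm (x - y) + B"
    using piecewise_lipschitz_gradient_good_set[OF pl] by metis
  note cv = strongly_convex_imp_convex[OF sc]
  have cont: "continuous_on UNIV U" using convex_on_continuous[OF _ cv] by simp
  note diff = convex_difference_bound[OF cv D(2) hg gr]
  obtain u where u: "\<And>x. \<not> has_gradient U x \<Longrightarrow> gradient U x = u" using gradient_undefined[of U] by blast
  \<comment> \<open>Enlarged by the value of the gradient where it does not exist, and to be positive.\<close>
  define C' where "C' = C + norm u + 1"
  have C': "C \<le> C'" "norm u \<le> C'" "0 < C'" using c by (auto simp: C'_def add_nonneg_pos)
  have diff': "U x - U y \<le> (C' + L * norm x) * norm (x - y)" for x y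
    using diff[of x y] C'(1) mult_right_mono[of "C + L * norm x" "C' + L * norm x" "norm (x - y)"] by simp
  obtain m where m: "0 < m" "\<And>x. U 0 - C' * norm x + m * (norm x)\<^sup>2 \<le> U x"
    using strongly_convex_coercive[OF sc diff'] by metis
  have gr': "norm (gradient U x) \<le> C' + L * norm x" for x
  proof (cases "has_gradient U x")
    case True
    then show ?thesis using convex_gradient_growth[OF cv c(1) diff True] C'(1) by simp
  next
    case False
    have "0 \<le> L * norm x" using c by simp
    then show ?thesis using u[OF False] C'(2) by simp
  qed
  have "langevin_potential U (gradient U) D \<beta> L \<mu> C' B m"
  proof (unfold_locales)
    show "D \<noteq> {}" using D(2) by auto
    show "GDERIV U x :> gradient U x" if "x \<in> D" for x using GDERIV_gradient[OF hg[OF that]] .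
    show "\<mu> * (norm (x - y))\<^sup>2 \<le> (gradient U x - gradient U y) \<bullet> (x - y)" if "x \<in> D" "y \<in> D" for x y
      using sm hg that unfolding strongly_monotone_gradient_def by blast
  qed (use assms c C' m D diff' cont gr' coarse_lipschitz borel_measurable_gradient[OF cont] in
      \<open>auto simp: strongly_monotone_gradient_def\<close>)
  then show ?thesis by (rule that)
qed

section \<open>The Gibbs measure and its proximal kernel\<close>

context langevin_potential
begin

lemma U_measurable[measurable]: "U \<in> borel_measurable borel"
  using U_cont by (rule borel_measurable_continuous_onI)

text \<open>On balls, \<open>U\<close> has a Lipschitz constant that grows linearly with the radius.\<close>

lemma U_lipschitz: "norm x \<le> r \<Longrightarrow> norm y \<le> r \<Longrightarrow> \<bar>U x - U y\<bar> \<le> (C + L * r) * norm (x - y)"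
  using U_diff[of x y] U_diff[of y x] L mult_right_mono[of "C + L * norm x" "C + L * r" "norm (x - y)"]
    mult_right_mono[of "C + L * norm y" "C + L * r" "norm (x - y)"]
  by (simp add: abs_le_iff norm_minus_commute)

definition Umin where "Umin = U 0 - C\<^sup>2 / (2 * \<kappa>)"

lemma U_ge: "Umin + \<kappa> / 2 * (norm x)\<^sup>2 \<le> U x"
proof -
  have "0 \<le> (\<kappa> * norm x - C)\<^sup>2 / (2 * \<kappa>)" using \<kappa> by simp
  also have "\<dots> = \<kappa> / 2 * (norm x)\<^sup>2 - C * norm x + C\<^sup>2 / (2 * \<kappa>)"
    using \<kappa> by (simp add: power2_eq_square field_simps)
  finally show ?thesis using U_lower[of x] by (simp add: Umin_def field_simps)
qed

lemma exp_U_le: "exp (- \<beta> * U x) \<le> exp (- \<beta> * Umin) * exp (- (\<beta> * \<kappa> / 2) * (norm x)\<^sup>2)"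
  unfolding exp_add[symmetric] using mult_left_mono[OF U_ge[of x], of \<beta>] \<beta> by (simp add: algebra_simps)

lemma integrable_moment_exp_U: "integrable lborel (\<lambda>x. (1 + norm x) ^ k * exp (- \<beta> * U x))"
proof (rule Bochner_Integration.integrable_bound)
  show "integrable lborel (\<lambda>x::'a. exp (- \<beta> * Umin) * ((1 + norm x) ^ k * exp (0 * norm x - (\<beta> * \<kappa> / 2) * (norm x)\<^sup>2)))"
    using \<beta> \<kappa> by (intro integrable_mult_right integrable_poly_exp_neg_norm_square) auto
  show "AE x in lborel. norm ((1 + norm x) ^ k * exp (- \<beta> * U x))
      \<le> norm (exp (- \<beta> * Umin) * ((1 + norm x) ^ k * exp (0 * norm x - (\<beta> * \<kappa> / 2) * (norm x)\<^sup>2)))"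
  proof (rule AE_I2)
    fix x :: 'a
    have "(1 + norm x) ^ k * exp (- \<beta> * U x) \<le> (1 + norm x) ^ k * (exp (- \<beta> * Umin) * exp (- (\<beta> * \<kappa> / 2) * (norm x)\<^sup>2))"
      by (intro mult_left_mono exp_U_le) auto
    then show "norm ((1 + norm x) ^ k * exp (- \<beta> * U x))
      \<le> norm (exp (- \<beta> * Umin) * ((1 + norm x) ^ k * exp (0 * norm x - (\<beta> * \<kappa> / 2) * (norm x)\<^sup>2)))"
      by (simp add: abs_mult mult_ac)
  qed
qed simp

definition Z\<pi> where "Z\<pi> = (\<integral>y. exp (- \<beta> * U y) \<partial>lborel)"

lemma Z\<pi>_pos: "0 < Z\<pi>"
  unfolding Z\<pi>_def using integrable_moment_exp_U[of 0] by (intro integral_pos_density) auto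

abbreviation "\<pi> \<equiv> gibbs_measure U \<beta>"

lemma gibbs_eq: "\<pi> = density lborel (\<lambda>x. ennreal (exp (- \<beta> * U x) / Z\<pi>))"
  by (simp add: gibbs_measure_def Z\<pi>_def)

lemma prob_space_gibbs: "prob_space \<pi>"
proof (rule prob_spaceI)
  have "(\<integral>\<^sup>+x. ennreal (exp (- \<beta> * U x) / Z\<pi>) \<partial>lborel) = ennreal (\<integral>x. exp (- \<beta> * U x) / Z\<pi> \<partial>lborel)"
    using integrable_moment_exp_U[of 0] Z\<pi>_pos by (intro nn_integral_eq_integral) auto
  also have "\<dots> = 1" using Z\<pi>_pos by (simp add: Z\<pi>_def)
  finally show "emeasure \<pi> (space \<pi>) = 1" by (simp add: gibbs_eq emeasure_density)
qed

lemma sets_gibbs[simp, measurable_cong]: "sets \<pi> = sets borel" by (simp add: gibbs_eq)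
lemma integrable_gibbs_moment: "integrable \<pi> (\<lambda>x. (1 + norm x) ^ k)"
  unfolding gibbs_eq using integrable_moment_exp_U[of k] Z\<pi>_pos
  by (subst integrable_density) (auto simp: mult.commute)

end

text \<open>\<open>\<sigma>\<^sup>2\<close> is the step size divided by \<open>\<beta>\<close>. The condition on \<open>\<beta> L \<sigma>\<^sup>2\<close>
makes the linear growth of the gradient small compared to the quadratic exponent of the Gaussian of
variance \<open>\<sigma>\<^sup>2\<close>.\<close>

locale restricted_gaussian = langevin_potential +
  fixes \<sigma> :: real
  assumes \<sigma>: "0 < \<sigma>" "\<sigma> \<le> 1" and step_small: "\<beta> * L * \<sigma>\<^sup>2 \<le> 1 / 32"
begin

text \<open>The unnormalised density of the proximal law \<open>RG yt\<close>, which is the conditional law of \<open>y\<close> given \<open>yt = y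
+ \<sigma> z\<close> when \<open>y\<close> has law \<open>\<pi>\<close> and \<open>z\<close> is an independent standard Gaussian.\<close>

definition \<omega> :: "'a \<Rightarrow> 'a \<Rightarrow> real" where
  "\<omega> yt y = exp (- \<beta> * U y) * exp (- (norm (y - yt))\<^sup>2 / (2 * \<sigma>\<^sup>2))"

lemma \<omega>_pos: "0 < \<omega> yt y" by (simp add: \<omega>_def)

lemma \<omega>_measurable[measurable]: "(\<lambda>(yt, y). \<omega> yt y) \<in> borel_measurable (borel \<Otimes>\<^sub>M borel)"
  unfolding \<omega>_def by measurable

lemma \<omega>_le: "\<omega> yt y \<le> exp (- \<beta> * U y)"
  unfolding \<omega>_def by (simp add: mult_le_cancel_left1)

lemma integrable_\<omega>_moment: "integrable lborel (\<lambda>y. (1 + norm y) ^ k * \<omega> yt y)"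
proof (rule Bochner_Integration.integrable_bound[OF integrable_moment_exp_U[of k]])
  show "AE y in lborel. norm ((1 + norm y) ^ k * \<omega> yt y) \<le> norm ((1 + norm y) ^ k * exp (- \<beta> * U y))"
    using \<omega>_le less_imp_le[OF \<omega>_pos] by (intro AE_I2) (auto simp: abs_mult intro!: mult_left_mono)
qed simp

definition Zt where "Zt yt = (\<integral>y. \<omega> yt y \<partial>lborel)"

lemma Zt_pos: "0 < Zt yt"
  unfolding Zt_def using integrable_\<omega>_moment[of 0 yt] \<omega>_pos by (intro integral_pos_density) auto

lemma Zt_measurable[measurable]: "Zt \<in> borel_measurable borel"
  unfolding Zt_def[abs_def] by measurable

lemma nn_integral_\<omega>: "(\<integral>\<^sup>+y. ennreal (\<omega> yt y) \<partial>lborel) = ennreal (Zt yt)"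
  unfolding Zt_def using integrable_\<omega>_moment[of 0 yt] less_imp_le[OF \<omega>_pos] by (intro nn_integral_eq_integral) auto

definition RG :: "'a \<Rightarrow> 'a measure" where
  "RG yt = density lborel (\<lambda>y. ennreal (\<omega> yt y / Zt yt))"

lemma sets_RG[simp, measurable_cong]: "sets (RG yt) = sets borel" by (simp add: RG_def)
lemma space_RG[simp]: "space (RG yt) = UNIV" by (simp add: RG_def)

lemma nn_integral_RG:
  assumes [measurable]: "F \<in> borel_measurable borel"
  shows "(\<integral>\<^sup>+y. F y \<partial>RG yt) = (\<integral>\<^sup>+y. F y * ennreal (\<omega> yt y) \<partial>lborel) / ennreal (Zt yt)"
proof -
  have "(\<integral>\<^sup>+y. F y \<partial>RG yt) = (\<integral>\<^sup>+y. F y * ennreal (\<omega> yt y) / ennreal (Zt yt) \<partial>lborel)"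
    unfolding RG_def using Zt_pos[of yt] less_imp_le[OF \<omega>_pos]
    by (simp add: nn_integral_density divide_ennreal[symmetric] ennreal_times_divide mult.commute)
  then show ?thesis by (simp add: nn_integral_divide)
qed

lemma prob_space_RG: "prob_space (RG yt)"
proof (rule prob_spaceI)
  have "emeasure (RG yt) (space (RG yt)) = (\<integral>\<^sup>+y. 1 \<partial>RG yt)" by simp
  also have "\<dots> = 1" using Zt_pos[of yt] by (subst nn_integral_RG) (auto simp: nn_integral_\<omega> less_top[symmetric])
  finally show "emeasure (RG yt) (space (RG yt)) = 1" .
qed

lemma RG_kernel[measurable]: "RG \<in> measurable borel (subprob_algebra borel)"
proof (rule measurable_subprob_algebra)
  fix yt :: 'a
  show "subprob_space (RG yt)" using prob_space_RG by (rule prob_space_imp_subprob_space)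
next
  fix A :: "'a set" assume [measurable]: "A \<in> sets borel"
  have "(\<lambda>yt. emeasure (RG yt) A) = (\<lambda>yt. \<integral>\<^sup>+y. ennreal (\<omega> yt y / Zt yt) * indicator A y \<partial>lborel)"
    by (simp add: RG_def emeasure_density)
  also have "\<dots> \<in> borel_measurable borel" by measurable
  finally show "(\<lambda>yt. emeasure (RG yt) A) \<in> borel_measurable borel" .
qed simp

text \<open>The joint law of \<open>(y + \<sigma> z, y)\<close> has density proportional to \<open>\<omega>\<close>.\<close>

lemma nn_integral_gibbs_gauss:
  assumes [measurable]: "(\<lambda>(yt, y). H yt y) \<in> borel_measurable (borel \<Otimes>\<^sub>M borel)"
  shows "(\<integral>\<^sup>+y. \<integral>\<^sup>+z. H (y + \<sigma> *\<^sub>R z) y \<partial>gauss \<partial>\<pi>)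
    = (\<integral>\<^sup>+yt. \<integral>\<^sup>+y. H yt y * ennreal (\<omega> yt y) \<partial>lborel \<partial>lborel) / ennreal (Z\<pi> * (sqrt (2 * pi) * \<sigma>) ^ DIM('a))"
proof -
  let ?c = "(sqrt (2 * pi) * \<sigma>) ^ DIM('a)"
  have c: "0 < ?c" using \<sigma> by simp
  have 1: "(\<integral>\<^sup>+z. H (y + \<sigma> *\<^sub>R z) y \<partial>gauss) = (\<integral>\<^sup>+yt. H yt y * ennreal (exp (- (norm (y - yt))\<^sup>2 / (2 * \<sigma>\<^sup>2))) \<partial>lborel) / ennreal ?c" for y
  proof -
    have e: "exp (- (norm (y - (y + \<sigma> *\<^sub>R z)))\<^sup>2 / (2 * \<sigma>\<^sup>2)) = exp (- (norm z)\<^sup>2 / 2)" for z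
      using \<sigma> by (simp add: power_mult_distrib)
    have "(\<integral>\<^sup>+yt. H yt y * ennreal (exp (- (norm (y - yt))\<^sup>2 / (2 * \<sigma>\<^sup>2))) \<partial>lborel)
       = ennreal (\<sigma> ^ DIM('a)) * (\<integral>\<^sup>+z. H (y + \<sigma> *\<^sub>R z) y * ennreal (exp (- (norm z)\<^sup>2 / 2)) \<partial>lborel)"
      using \<sigma> by (subst nn_integral_lborel_affine[of _ \<sigma> y]) (auto simp only: e, auto)
    also have "(\<integral>\<^sup>+z. H (y + \<sigma> *\<^sub>R z) y * ennreal (exp (- (norm z)\<^sup>2 / 2)) \<partial>lborel)
       = (\<integral>\<^sup>+z. ennreal (sqrt (2 * pi) ^ DIM('a)) * (ennreal (std_gaussian_density z) * H (y + \<sigma> *\<^sub>R z) y) \<partial>lborel)"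
    proof (rule nn_integral_cong)
      fix z :: 'a
      have "exp (- (norm z)\<^sup>2 / 2) = sqrt (2 * pi) ^ DIM('a) * std_gaussian_density z"
        by (simp add: std_gaussian_density_eq)
      then show "H (y + \<sigma> *\<^sub>R z) y * ennreal (exp (- (norm z)\<^sup>2 / 2)) = ennreal (sqrt (2 * pi) ^ DIM('a)) * (ennreal (std_gaussian_density z) * H (y + \<sigma> *\<^sub>R z) y)"
        by (simp add: ennreal_mult less_imp_le[OF std_gaussian_density_pos] mult_ac)
    qed
    also have "\<dots> = ennreal (sqrt (2 * pi) ^ DIM('a)) * (\<integral>\<^sup>+z. H (y + \<sigma> *\<^sub>R z) y \<partial>gauss)"
      by (simp add: nn_integral_density nn_integral_cmult)
    finally have "(\<integral>\<^sup>+yt. H yt y * ennreal (exp (- (norm (y - yt))\<^sup>2 / (2 * \<sigma>\<^sup>2))) \<partial>lborel) = ennreal ?c * (\<integral>\<^sup>+z. H (y + \<sigma> *\<^sub>R z) y \<partial>gauss)"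
      using \<sigma> by (simp add: power_mult_distrib ennreal_mult mult_ac)
    then show ?thesis using \<sigma> by (simp only: mult.commute[of "ennreal ?c"]) (subst mult_divide_eq_ennreal; simp)
  qed
  have "(\<integral>\<^sup>+y. \<integral>\<^sup>+z. H (y + \<sigma> *\<^sub>R z) y \<partial>gauss \<partial>\<pi>)
    = (\<integral>\<^sup>+y. ennreal (exp (- \<beta> * U y) / Z\<pi>) * ((\<integral>\<^sup>+yt. H yt y * ennreal (exp (- (norm (y - yt))\<^sup>2 / (2 * \<sigma>\<^sup>2))) \<partial>lborel) / ennreal ?c) \<partial>lborel)"
    unfolding 1 gibbs_eq by (subst nn_integral_density) auto
  also have "\<dots> = (\<integral>\<^sup>+y. (\<integral>\<^sup>+yt. H yt y * ennreal (\<omega> yt y) \<partial>lborel) / ennreal (Z\<pi> * ?c) \<partial>lborel)"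
  proof (rule nn_integral_cong)
    fix y
    have "(\<integral>\<^sup>+yt. H yt y * ennreal (\<omega> yt y) \<partial>lborel) = ennreal (exp (- \<beta> * U y)) * (\<integral>\<^sup>+yt. H yt y * ennreal (exp (- (norm (y - yt))\<^sup>2 / (2 * \<sigma>\<^sup>2))) \<partial>lborel)"
      by (subst nn_integral_cmult[symmetric]) (auto simp: \<omega>_def ennreal_mult mult_ac)
    then show "ennreal (exp (- \<beta> * U y) / Z\<pi>) * ((\<integral>\<^sup>+yt. H yt y * ennreal (exp (- (norm (y - yt))\<^sup>2 / (2 * \<sigma>\<^sup>2))) \<partial>lborel) / ennreal ?c)
      = (\<integral>\<^sup>+yt. H yt y * ennreal (\<omega> yt y) \<partial>lborel) / ennreal (Z\<pi> * ?c)"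
      using Z\<pi>_pos c by (simp add: divide_ennreal[symmetric] ennreal_times_divide ennreal_divide_times ennreal_mult divide_mult_eq mult_ac ennreal_inverse_mult divide_ennreal_def)
  qed
  also have "\<dots> = (\<integral>\<^sup>+y. \<integral>\<^sup>+yt. H yt y * ennreal (\<omega> yt y) \<partial>lborel \<partial>lborel) / ennreal (Z\<pi> * ?c)"
    by (simp add: nn_integral_divide)
  also have "(\<integral>\<^sup>+y. \<integral>\<^sup>+yt. H yt y * ennreal (\<omega> yt y) \<partial>lborel \<partial>lborel) = (\<integral>\<^sup>+yt. \<integral>\<^sup>+y. H yt y * ennreal (\<omega> yt y) \<partial>lborel \<partial>lborel)"
    by (rule lborel_pair.Fubini') measurable
  finally show ?thesis .
qed

text \<open>The defining property of a conditional law: a redrawn point has the same joint law with \<open>y +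
\<sigma> z\<close> as the original one. In particular redrawing preserves \<open>\<pi>\<close>.\<close>

lemma RG_exchangeable:
  assumes [measurable]: "(\<lambda>(yt, y). H yt y) \<in> borel_measurable (borel \<Otimes>\<^sub>M borel)"
  shows "(\<integral>\<^sup>+y. \<integral>\<^sup>+z. \<integral>\<^sup>+ys. H (y + \<sigma> *\<^sub>R z) ys \<partial>RG (y + \<sigma> *\<^sub>R z) \<partial>gauss \<partial>\<pi>) = (\<integral>\<^sup>+y. \<integral>\<^sup>+z. H (y + \<sigma> *\<^sub>R z) y \<partial>gauss \<partial>\<pi>)"
proof -
  have [measurable]: "(\<lambda>yt. \<integral>\<^sup>+ys. H yt ys \<partial>RG yt) \<in> borel_measurable borel"
    by (rule nn_integral_measurable_subprob_algebra2[where N=borel]) auto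
  have "(\<integral>\<^sup>+ys. H yt ys \<partial>RG yt) * ennreal (Zt yt) = (\<integral>\<^sup>+y. H yt y * ennreal (\<omega> yt y) \<partial>lborel)" for yt
    using Zt_pos[of yt] by (subst nn_integral_RG) (auto simp: ennreal_divide_times less_top[symmetric])
  then have "(\<integral>\<^sup>+y. (\<integral>\<^sup>+ys. H yt ys \<partial>RG yt) * ennreal (\<omega> yt y) \<partial>lborel) = (\<integral>\<^sup>+y. H yt y * ennreal (\<omega> yt y) \<partial>lborel)" for yt
    by (simp add: nn_integral_cmult nn_integral_\<omega>)
  then show ?thesis
    using nn_integral_gibbs_gauss[of "\<lambda>yt y. \<integral>\<^sup>+ys. H yt ys \<partial>RG yt"] nn_integral_gibbs_gauss[of H] by simp
qed

end

section \<open>Refreshing one coordinate of the proximal law\<close>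

lemma std_gaussian_line:
  assumes b: "b \<in> Basis"
  shows "std_gaussian_density (z + t *\<^sub>R b) * std_normal_density (z \<bullet> b) = std_gaussian_density z * std_normal_density (z \<bullet> b + t)"
proof -
  have "(norm (z + t *\<^sub>R b))\<^sup>2 = (norm z)\<^sup>2 + 2 * (z \<bullet> b) * t + t\<^sup>2"
    unfolding power2_norm_eq_inner
    using b by (simp add: inner_add_left inner_add_right inner_commute power2_eq_square algebra_simps)
  then have e: "- (norm (z + t *\<^sub>R b))\<^sup>2 / 2 + - (z \<bullet> b)\<^sup>2 / 2 = - (norm z)\<^sup>2 / 2 + - (z \<bullet> b + t)\<^sup>2 / 2"
    using power2_sum[of "z \<bullet> b" t] by linarith
  have "exp (- (norm (z + t *\<^sub>R b))\<^sup>2 / 2) * exp (- (z \<bullet> b)\<^sup>2 / 2) = exp (- (norm z)\<^sup>2 / 2) * exp (- (z \<bullet> b + t)\<^sup>2 / 2)"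
    unfolding exp_add[symmetric] e ..
  then show ?thesis unfolding std_gaussian_density_eq std_normal_density_def by simp
qed

text \<open>One coordinate of a standard Gaussian may be replaced by an independent standard normal variable.
This is resampling along lines, applied to the Gaussian density itself.\<close>

lemma gauss_coordinate_refresh:
  fixes H :: "'a::euclidean_space \<Rightarrow> ennreal"
  assumes [measurable]: "H \<in> borel_measurable borel" and b: "b \<in> Basis"
  shows "(\<integral>\<^sup>+z. \<integral>\<^sup>+s. H (z + (s - z \<bullet> b) *\<^sub>R b) * ennreal (std_normal_density s) \<partial>lborel \<partial>gauss) = (\<integral>\<^sup>+z. H z \<partial>gauss)"
proof -
  let ?w = "\<lambda>z::'a. ennreal (std_gaussian_density z)"
  have w: "?w (z + t *\<^sub>R b) = ?w z / ennreal (std_normal_density (z \<bullet> b)) * ennreal (std_normal_density (z \<bullet> b + t))" for z t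
  proof -
    have "std_gaussian_density (z + t *\<^sub>R b) = std_gaussian_density z / std_normal_density (z \<bullet> b) * std_normal_density (z \<bullet> b + t)"
      using std_gaussian_line[OF b, of z t] normal_density_pos[of 1 0 "z \<bullet> b"] by (simp add: field_simps)
    then show ?thesis
      by (simp only:) (subst ennreal_mult; simp add: divide_ennreal normal_density_pos less_imp_le std_gaussian_density_pos)
  qed
  have n1: "(\<integral>\<^sup>+s. ennreal (std_normal_density s) \<partial>lborel) = 1"
    using prob_space.emeasure_space_1[OF prob_space_normal_density[of 1 0]] by (simp add: emeasure_density)
  have sh: "(\<integral>\<^sup>+t. F (z \<bullet> b + t) \<partial>lborel) = (\<integral>\<^sup>+s. F s \<partial>lborel)" if [measurable]: "F \<in> borel_measurable borel" for F :: "real \<Rightarrow> ennreal" and z :: 'a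
    using nn_integral_lborel_translate[of F "z \<bullet> b"] that by (simp add: add.commute)
  define q where "q z = ?w z / ennreal (std_normal_density (z \<bullet> b))" for z
  have q0: "q z \<noteq> 0" "q z \<noteq> \<top>" for z
    using std_gaussian_density_pos[of z] normal_density_pos[of 1 0 "z \<bullet> b"]
    by (auto simp: q_def divide_ennreal)
  have Z: "(\<integral>\<^sup>+t. ?w (z + t *\<^sub>R b) \<partial>lborel) = q z" for z
    unfolding w q_def[symmetric] by (simp add: nn_integral_cmult sh[of "\<lambda>s. ennreal (std_normal_density s)"] n1)
  have I: "(\<integral>\<^sup>+t. H (z + t *\<^sub>R b) * ?w (z + t *\<^sub>R b) \<partial>lborel) / q z = (\<integral>\<^sup>+s. H (z + (s - z \<bullet> b) *\<^sub>R b) * ennreal (std_normal_density s) \<partial>lborel)" for z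
  proof -
    have "(\<integral>\<^sup>+t. H (z + t *\<^sub>R b) * ?w (z + t *\<^sub>R b) \<partial>lborel) = (\<integral>\<^sup>+t. q z * (H (z + t *\<^sub>R b) * ennreal (std_normal_density (z \<bullet> b + t))) \<partial>lborel)"
      unfolding w q_def[symmetric] by (simp add: mult_ac)
    also have "\<dots> = q z * (\<integral>\<^sup>+t. H (z + t *\<^sub>R b) * ennreal (std_normal_density (z \<bullet> b + t)) \<partial>lborel)"
      by (simp add: nn_integral_cmult)
    also have "(\<integral>\<^sup>+t. H (z + t *\<^sub>R b) * ennreal (std_normal_density (z \<bullet> b + t)) \<partial>lborel) = (\<integral>\<^sup>+s. H (z + (s - z \<bullet> b) *\<^sub>R b) * ennreal (std_normal_density s) \<partial>lborel)"
      using sh[of "\<lambda>s. H (z + (s - z \<bullet> b) *\<^sub>R b) * ennreal (std_normal_density s)" z] by simp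
    finally show ?thesis using q0[of z] by (simp only: mult.commute[of "q z"]) (subst mult_divide_eq_ennreal; simp)
  qed
  have "(\<integral>\<^sup>+z. ((\<integral>\<^sup>+t. H (z + t *\<^sub>R b) * ?w (z + t *\<^sub>R b) \<partial>lborel) / (\<integral>\<^sup>+t. ?w (z + t *\<^sub>R b) \<partial>lborel)) * ?w z \<partial>lborel)
     = (\<integral>\<^sup>+z. H z * ?w z \<partial>lborel)"
    by (rule line_resampling_invariant) (use Z q0 in auto)
  then show ?thesis unfolding Z I by (simp add: nn_integral_density mult.commute)
qed

context restricted_gaussian
begin

text \<open>The restriction of \<open>\<omega> yt\<close> to the line through \<open>y\<close> in direction \<open>b\<close>. The parameter \<open>t\<close> is centred at
the coordinate of \<open>yt\<close> and scaled by \<open>\<sigma>\<close>, so that for constant \<open>U\<close> the density is proportional to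
the standard normal one.\<close>

definition line_density :: "'a \<Rightarrow> 'a \<Rightarrow> 'a \<Rightarrow> real \<Rightarrow> real" where
  "line_density b yt y t = \<omega> yt (y + (\<sigma> * t + (yt - y) \<bullet> b) *\<^sub>R b)"

definition refresh :: "'a \<Rightarrow> 'a \<Rightarrow> 'a \<Rightarrow> real \<Rightarrow> 'a" where
  "refresh b yt y s = y + (\<sigma> * normal_quantile_map (line_density b yt y) s + (yt - y) \<bullet> b) *\<^sub>R b"

lemma line_density_eq:
  assumes b: "b \<in> Basis"
  defines "y0 \<equiv> \<lambda>yt y. y + ((yt - y) \<bullet> b) *\<^sub>R b"
  shows "line_density b yt y t = exp (- (norm (y0 yt y - yt))\<^sup>2 / (2 * \<sigma>\<^sup>2)) * exp (- \<beta> * U (y0 yt y + (\<sigma> * t) *\<^sub>R b)) * exp (- t\<^sup>2 / 2)"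
proof -
  have p: "y + (\<sigma> * t + (yt - y) \<bullet> b) *\<^sub>R b = y0 yt y + (\<sigma> * t) *\<^sub>R b" unfolding y0_def by (simp add: algebra_simps)
  define p where "p = y0 yt y - yt"
  have pb: "p \<bullet> b = 0" using b unfolding p_def y0_def by (simp add: inner_simps)
  have pe: "y0 yt y + (\<sigma> * t) *\<^sub>R b - yt = p + (\<sigma> * t) *\<^sub>R b" by (simp add: p_def)
  have "(norm (y0 yt y + (\<sigma> * t) *\<^sub>R b - yt))\<^sup>2 = (norm (y0 yt y - yt))\<^sup>2 + \<sigma>\<^sup>2 * t\<^sup>2"
    unfolding pe p_def[symmetric] using norm_add_Pythagorean[of p "(\<sigma> * t) *\<^sub>R b"] pb b
    by (simp add: orthogonal_def power_mult_distrib)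
  then have "- (norm (y0 yt y + (\<sigma> * t) *\<^sub>R b - yt))\<^sup>2 / (2 * \<sigma>\<^sup>2) = - (norm (y0 yt y - yt))\<^sup>2 / (2 * \<sigma>\<^sup>2) + - t\<^sup>2 / 2"
    using \<sigma> by (simp add: field_simps)
  then show ?thesis unfolding line_density_def p \<omega>_def by (simp only: exp_add mult_ac)
qed

lemma line_density_pos: "0 < line_density b yt y t"
  by (simp add: line_density_def \<omega>_pos)

lemma line_density_measurable[measurable]:
  "(\<lambda>((yt, y), t). line_density b yt y t) \<in> borel_measurable ((borel \<Otimes>\<^sub>M borel) \<Otimes>\<^sub>M borel)"
  unfolding line_density_def case_prod_unfold by measurable

lemma line_density_integrable:
  assumes b: "b \<in> Basis"
  shows "integrable lborel (line_density b yt y)"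
proof (rule Bochner_Integration.integrable_bound)
  let ?y0 = "y + ((yt - y) \<bullet> b) *\<^sub>R b"
  let ?c = "exp (- (norm (?y0 - yt))\<^sup>2 / (2 * \<sigma>\<^sup>2)) * exp (- \<beta> * Umin)"
  have "integrable lborel (\<lambda>t::real. exp (- (1/2) * (norm t)\<^sup>2))" by (rule integrable_exp_neg_norm_square) simp
  then show "integrable lborel (\<lambda>t::real. ?c * exp (- (1/2) * t\<^sup>2))" by simp
  show "AE t in lborel. norm (line_density b yt y t) \<le> norm (?c * exp (- (1/2) * t\<^sup>2))"
  proof (rule AE_I2)
    fix t :: real
    have "\<beta> * Umin \<le> \<beta> * U (?y0 + (\<sigma> * t) *\<^sub>R b)"
      using U_ge[of "?y0 + (\<sigma> * t) *\<^sub>R b"] \<kappa> \<beta> by (intro mult_left_mono) (auto intro: order.trans[rotated])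
    then show "norm (line_density b yt y t) \<le> norm (?c * exp (- (1/2) * t\<^sup>2))"
      unfolding line_density_eq[OF b] by (simp add: abs_mult)
  qed
qed (unfold line_density_def[abs_def], measurable)

lemma refresh_measurable[measurable]:
  assumes b: "b \<in> Basis"
  shows "(\<lambda>((yt, y), s). refresh b yt y s) \<in> borel_measurable ((borel \<Otimes>\<^sub>M borel) \<Otimes>\<^sub>M borel)"
proof -
  have "(\<lambda>(\<theta>, s). normal_quantile_map (case \<theta> of (yt, y) \<Rightarrow> line_density b yt y) s) \<in> borel_measurable ((borel \<Otimes>\<^sub>M borel) \<Otimes>\<^sub>M borel)"
    by (rule normal_quantile_map_measurable)
       (auto simp: line_density_integrable[OF b] line_density_pos case_prod_unfold split_beta' split: prod.split
         intro!: line_density_measurable[unfolded case_prod_unfold])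
  then have [measurable]: "(\<lambda>p. normal_quantile_map (line_density b (fst (fst p)) (snd (fst p))) (snd p)) \<in> borel_measurable ((borel \<Otimes>\<^sub>M borel) \<Otimes>\<^sub>M borel)"
    by (simp add: case_prod_unfold)
  show ?thesis unfolding refresh_def case_prod_unfold by measurable
qed

lemma refresh_other_coordinate: "b \<in> Basis \<Longrightarrow> b' \<in> Basis \<Longrightarrow> b \<noteq> b' \<Longrightarrow> refresh b yt y s \<bullet> b' = y \<bullet> b'"
  by (simp add: refresh_def inner_add_left inner_not_same_Basis)

text \<open>The primitive \<open>w |w|\<close> of \<open>2 |w|\<close> controls the variation of a function whose Lipschitz constant grows
linearly.\<close>

lemma max_abs_le_signed_squares:
  fixes v w :: real assumes "v \<le> w"
  shows "(w - v) * max \<bar>v\<bar> \<bar>w\<bar> \<le> 2 * (w * \<bar>w\<bar> - v * \<bar>v\<bar>)"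
proof -
  consider "0 \<le> v" | "w \<le> 0" | "v < 0" "0 < w" by linarith
  then show ?thesis
  proof cases
    case 1
    have "(w - v) * w \<le> 2 * ((w - v) * (w + v))"
      using 1 assms mult_nonneg_nonneg[of "w - v" "w + 2 * v"] by (simp add: algebra_simps)
    then show ?thesis using 1 assms by (simp add: algebra_simps max_def)
  next
    case 2
    have "(w - v) * (- v) \<le> 2 * ((w - v) * (- w - v))"
      using 2 assms mult_nonneg_nonneg[of "w - v" "- v - 2 * w"] by (simp add: algebra_simps)
    moreover have "max \<bar>v\<bar> \<bar>w\<bar> = - v" "\<bar>v\<bar> = - v" "\<bar>w\<bar> = - w" using 2 assms by auto
    ultimately show ?thesis by (simp add: algebra_simps)
  next
    case 3
    have "(w - v) * M \<le> 2 * (w * w + v * v)" if "M = w \<or> M = - v" for M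
    proof -
      have nn: "0 \<le> ((w + v) * (w + v) + w * w + v * v) / 2 + v * v" "0 \<le> ((w + v) * (w + v) + w * w + v * v) / 2 + w * w"
        by (simp_all add: add_nonneg_nonneg)
      have "2 * (w * w + v * v) - (w - v) * M = ((w + v) * (w + v) + w * w + v * v) / 2 + v * v
          \<or> 2 * (w * w + v * v) - (w - v) * M = ((w + v) * (w + v) + w * w + v * v) / 2 + w * w"
        using that by (auto simp: field_simps)
      then have "0 \<le> 2 * (w * w + v * v) - (w - v) * M" using nn by presburger
      then show ?thesis by simp
    qed
    then show ?thesis using 3 by (simp add: max_def)
  qed
qed

text \<open>In the scaled coordinate the potential \<open>\<beta> U\<close> has slope \<open>O(\<sigma> + \<sigma>\<^sup>2 |t|)\<close>,
which is the perturbation allowed by \<open>normal_quantile_map_displacement\<close>.\<close>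

lemma line_quantile_displacement:
  assumes b: "b \<in> Basis"
  shows "\<bar>normal_quantile_map (line_density b yt y) s - s\<bar>
     \<le> 2 * (\<beta> * \<sigma> * (C + L * (2 * norm y + norm yt))) + 20 * (2 * (\<beta> * L * \<sigma>\<^sup>2)) + 4 * (2 * (\<beta> * L * \<sigma>\<^sup>2)) * \<bar>s\<bar>"
proof -
  let ?y0 = "y + ((yt - y) \<bullet> b) *\<^sub>R b"
  let ?k = "exp (- (norm (?y0 - yt))\<^sup>2 / (2 * \<sigma>\<^sup>2))"
  let ?a = "\<beta> * \<sigma> * (C + L * (2 * norm y + norm yt))"
  let ?c = "2 * (\<beta> * L * \<sigma>\<^sup>2)"
  let ?u = "\<lambda>t. U (?y0 + (\<sigma> * t) *\<^sub>R b)"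
  have y0: "norm ?y0 \<le> 2 * norm y + norm yt"
  proof -
    have "norm ?y0 \<le> norm y + \<bar>(yt - y) \<bullet> b\<bar> * norm b" using norm_triangle_ineq[of y "((yt - y) \<bullet> b) *\<^sub>R b"] by simp
    also have "\<dots> \<le> norm y + norm (yt - y)" using b Basis_le_norm[OF b, of "yt - y"] by simp
    also have "\<dots> \<le> 2 * norm y + norm yt" using norm_triangle_ineq4[of yt y] by simp
    finally show ?thesis .
  qed
  have key: "\<bar>\<beta> * ?u v - \<beta> * ?u w\<bar> \<le> ?a * (w - v) + ?c * (w * \<bar>w\<bar> - v * \<bar>v\<bar>)" if "v \<le> w" for v w
  proof -
    let ?M = "max \<bar>v\<bar> \<bar>w\<bar>"
    have r: "norm (?y0 + (\<sigma> * t) *\<^sub>R b) \<le> 2 * norm y + norm yt + \<sigma> * ?M" if "\<bar>t\<bar> \<le> ?M" for t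
    proof -
      have "norm ((\<sigma> * t) *\<^sub>R b) = \<sigma> * \<bar>t\<bar>" using b \<sigma> by (simp add: abs_mult)
      moreover have "\<sigma> * \<bar>t\<bar> \<le> \<sigma> * ?M" using that \<sigma> by (intro mult_left_mono) auto
      ultimately show ?thesis using norm_triangle_ineq[of ?y0 "(\<sigma> * t) *\<^sub>R b"] y0 by linarith
    qed
    have "\<bar>?u v - ?u w\<bar> \<le> (C + L * (2 * norm y + norm yt + \<sigma> * ?M)) * norm ((?y0 + (\<sigma> * v) *\<^sub>R b) - (?y0 + (\<sigma> * w) *\<^sub>R b))"
      by (rule U_lipschitz; rule r) auto
    also have "norm ((?y0 + (\<sigma> * v) *\<^sub>R b) - (?y0 + (\<sigma> * w) *\<^sub>R b)) = \<sigma> * (w - v)"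
      using that b \<sigma> by (simp add: scaleR_diff_left[symmetric] right_diff_distrib[symmetric] abs_mult)
    finally have "\<beta> * \<bar>?u v - ?u w\<bar> \<le> \<beta> * ((C + L * (2 * norm y + norm yt + \<sigma> * ?M)) * (\<sigma> * (w - v)))"
      using \<beta> by (intro mult_left_mono) auto
    also have "\<dots> = ?a * (w - v) + \<beta> * L * \<sigma>\<^sup>2 * ((w - v) * ?M)" by (simp add: algebra_simps power2_eq_square)
    also have "\<dots> \<le> ?a * (w - v) + \<beta> * L * \<sigma>\<^sup>2 * (2 * (w * \<bar>w\<bar> - v * \<bar>v\<bar>))"
      using max_abs_le_signed_squares[OF that] \<beta> L by (intro add_left_mono mult_left_mono) auto
    also have "\<dots> = ?a * (w - v) + ?c * (w * \<bar>w\<bar> - v * \<bar>v\<bar>)" by simp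
    finally show ?thesis unfolding right_diff_distrib[symmetric] abs_mult using \<beta> by simp
  qed
  define a c u k where "a = ?a" and "c = ?c" and "u = ?u" and "k = ?k"
  note key = key[folded a_def c_def u_def]
  have ld: "line_density b yt y t = k * (exp (- (\<beta> * u t)) * exp (- (t\<^sup>2 / 2)))" for t
    unfolding line_density_eq[OF b] k_def u_def by simp
  have k: "0 < k" by (simp add: k_def)
  have 1: "line_density b yt y t * exp (t\<^sup>2 / 2 - a * t - c * t * \<bar>t\<bar>) = k * exp (- (\<beta> * u t) - a * t - c * (t * \<bar>t\<bar>))" for t
    unfolding ld mult.assoc exp_add[symmetric] by simp
  have 2: "line_density b yt y t * exp (t\<^sup>2 / 2 + a * t + c * t * \<bar>t\<bar>) = k * exp (- (\<beta> * u t) + a * t + c * (t * \<bar>t\<bar>))" for t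
    unfolding ld mult.assoc exp_add[symmetric] by simp
  show ?thesis unfolding a_def[symmetric] c_def[symmetric]
  proof (rule normal_quantile_map_displacement[OF line_density_integrable[OF b] line_density_pos])
    show "0 \<le> a" using \<beta> \<sigma> C L by (simp add: a_def)
    show "0 \<le> c" using \<beta> L by (simp add: c_def)
    show "c \<le> 1 / 16" using step_small by (simp add: c_def)
  next
    fix v w :: real assume vw: "v \<le> w"
    have e: "a * (w - v) = a * w - a * v" "c * (w * \<bar>w\<bar> - v * \<bar>v\<bar>) = c * (w * \<bar>w\<bar>) - c * (v * \<bar>v\<bar>)"
      by (rule right_diff_distrib)+
    have ineq: "\<beta> * u v - \<beta> * u w \<le> a * w - a * v + (c * (w * \<bar>w\<bar>) - c * (v * \<bar>v\<bar>))"
        "\<beta> * u w - \<beta> * u v \<le> a * w - a * v + (c * (w * \<bar>w\<bar>) - c * (v * \<bar>v\<bar>))"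
      using key[OF vw] unfolding e by (auto simp: abs_le_iff u_def)
    have "- (\<beta> * u w) - a * w - c * (w * \<bar>w\<bar>) \<le> - (\<beta> * u v) - a * v - c * (v * \<bar>v\<bar>)"
      using ineq(1) by linarith
    then show "line_density b yt y w * exp (w\<^sup>2 / 2 - a * w - c * w * \<bar>w\<bar>) \<le> line_density b yt y v * exp (v\<^sup>2 / 2 - a * v - c * v * \<bar>v\<bar>)"
      unfolding 1 using k by simp
    have "- (\<beta> * u v) + a * v + c * (v * \<bar>v\<bar>) \<le> - (\<beta> * u w) + a * w + c * (w * \<bar>w\<bar>)"
      using ineq(2) by linarith
    then show "line_density b yt y v * exp (v\<^sup>2 / 2 + a * v + c * v * \<bar>v\<bar>) \<le> line_density b yt y w * exp (w\<^sup>2 / 2 + a * w + c * w * \<bar>w\<bar>)"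
      unfolding 2 using k by simp
  qed
qed

lemma refresh_invariant:
  assumes [measurable]: "F \<in> borel_measurable borel" and b: "b \<in> Basis"
  shows "(\<integral>\<^sup>+y. (\<integral>\<^sup>+s. F (refresh b yt y s) * ennreal (std_normal_density s) \<partial>lborel) * ennreal (\<omega> yt y) \<partial>lborel) = (\<integral>\<^sup>+y. F y * ennreal (\<omega> yt y) \<partial>lborel)"
proof -
  let ?w = "\<lambda>y. ennreal (\<omega> yt y)"
  have [measurable]: "line_density b yt y \<in> borel_measurable borel" for y using line_density_integrable[OF b] by auto
  have sub: "(\<integral>\<^sup>+u. G (y + u *\<^sub>R b) \<partial>lborel) = ennreal \<sigma> * (\<integral>\<^sup>+t. G (y + (\<sigma> * t + (yt - y) \<bullet> b) *\<^sub>R b) \<partial>lborel)"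
    if [measurable]: "G \<in> borel_measurable borel" for G y
    using \<sigma> by (subst nn_integral_real_affine[of _ \<sigma> "(yt - y) \<bullet> b"]) (auto simp: add.commute)
  have line: "(\<integral>\<^sup>+t. ennreal (line_density b yt y t) \<partial>lborel) = ennreal (\<integral>t. line_density b yt y t \<partial>lborel)" for y
    using line_density_integrable[OF b] less_imp_le[OF line_density_pos] by (intro nn_integral_eq_integral) auto
  define I where "I y = (\<integral>t. line_density b yt y t \<partial>lborel)" for y
  have I: "0 < I y" for y unfolding I_def by (intro integral_pos_density line_density_integrable[OF b] line_density_pos)
  have Z: "(\<integral>\<^sup>+u. ?w (y + u *\<^sub>R b) \<partial>lborel) = ennreal (\<sigma> * I y)" for y
    using \<sigma> I[of y] by (subst sub) (auto simp: line_density_def[symmetric] line I_def[symmetric] ennreal_mult)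
  have eq: "(\<integral>\<^sup>+u. F (y + u *\<^sub>R b) * ?w (y + u *\<^sub>R b) \<partial>lborel) / (\<integral>\<^sup>+u. ?w (y + u *\<^sub>R b) \<partial>lborel)
     = (\<integral>\<^sup>+s. F (refresh b yt y s) * ennreal (std_normal_density s) \<partial>lborel)" for y
  proof -
    have q[measurable]: "normal_quantile_map (line_density b yt y) \<in> borel_measurable borel"
    proof -
      have "(\<lambda>(\<theta>, z). normal_quantile_map (line_density b yt y) z) \<in> borel_measurable (count_space {()} \<Otimes>\<^sub>M borel)"
        by (rule normal_quantile_map_measurable) (auto simp: line_density_pos line_density_integrable[OF b])
      from measurable_compose[OF measurable_Pair1'[of "()"] this] show ?thesis by simp
    qed
    let ?G = "\<lambda>t. F (y + (\<sigma> * t + (yt - y) \<bullet> b) *\<^sub>R b)"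
    have "(\<integral>\<^sup>+s. F (refresh b yt y s) * ennreal (std_normal_density s) \<partial>lborel) = (\<integral>\<^sup>+t. ?G t \<partial>distr (density lborel std_normal_density) borel (normal_quantile_map (line_density b yt y)))"
      by (simp add: nn_integral_distr nn_integral_density refresh_def mult.commute)
    also have "\<dots> = (\<integral>\<^sup>+t. ?G t * ennreal (line_density b yt y t) / ennreal (I y) \<partial>lborel)"
      unfolding distr_normal_quantile_map[OF line_density_integrable[OF b] line_density_pos] I_def[symmetric]
    proof (subst nn_integral_density)
      have "ennreal (line_density b yt y t / I y) * ?G t = ?G t * ennreal (line_density b yt y t) / ennreal (I y)" for t
        using divide_ennreal[OF less_imp_le[OF line_density_pos] I, of b yt y t y]
        by (metis ennreal_times_divide mult.commute)
      then show "(\<integral>\<^sup>+t. ennreal (line_density b yt y t / I y) * ?G t \<partial>lborel) = (\<integral>\<^sup>+t. ?G t * ennreal (line_density b yt y t) / ennreal (I y) \<partial>lborel)"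
        by simp
    qed auto
    also have "\<dots> = (\<integral>\<^sup>+t. ?G t * ennreal (line_density b yt y t) \<partial>lborel) / ennreal (I y)" by (simp add: nn_integral_divide)
    also have "\<dots> = (ennreal \<sigma> * (\<integral>\<^sup>+t. ?G t * ennreal (line_density b yt y t) \<partial>lborel)) / (ennreal \<sigma> * ennreal (I y))"
    proof -
      have "ennreal \<sigma> * inverse (ennreal (\<sigma> * I y)) = inverse (ennreal (I y))"
        using I[of y] \<sigma> by (simp add: inverse_ennreal ennreal_mult[symmetric])
      then show ?thesis using I[of y] \<sigma> unfolding divide_ennreal_def
        by (simp add: ennreal_mult[symmetric] mult.assoc mult.left_commute[of "ennreal \<sigma>"])
    qed
    finally show ?thesis unfolding Z using \<sigma> I[of y]
      by (subst sub) (auto simp: line_density_def ennreal_mult)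
  qed
  show ?thesis
    using line_resampling_invariant[of ?w F b] Z \<sigma> I unfolding eq by (simp add: ennreal_eq_0_iff not_le)
qed

end

section \<open>The Gibbs sweep\<close>

lemma power_add_le_two_power:
  fixes x y :: real
  assumes "0 \<le> x" "0 \<le> y"
  shows "(x + y) ^ q \<le> 2 ^ q * (x ^ q + y ^ q)"
proof -
  have "(x + y) ^ q \<le> (2 * max x y) ^ q" using assms by (intro power_mono) auto
  also have "\<dots> = 2 ^ q * (max x y) ^ q" by (simp add: power_mult_distrib)
  also have "\<dots> \<le> 2 ^ q * (x ^ q + y ^ q)" using assms by (intro mult_left_mono) (auto simp: max_def)
  finally show ?thesis .
qed

context restricted_gaussian
begin

primrec sweep :: "'a \<Rightarrow> 'a list \<Rightarrow> 'a \<Rightarrow> 'a \<Rightarrow> 'a" where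
  "sweep yt [] y z = y"
| "sweep yt (b # bs) y z = sweep yt bs (refresh b yt y (z \<bullet> b)) z"

text \<open>The points from which the coordinates are refreshed enter the bounds for the displacement, and each
of them has the proximal law if the first one has it, so that moments of this sum are available.\<close>

primrec sweep_sum :: "('a \<Rightarrow> real) \<Rightarrow> 'a \<Rightarrow> 'a list \<Rightarrow> 'a \<Rightarrow> 'a \<Rightarrow> real" where
  "sweep_sum h yt [] y z = 0"
| "sweep_sum h yt (b # bs) y z = h y + sweep_sum h yt bs (refresh b yt y (z \<bullet> b)) z"

lemma sweep_measurable:
  assumes "set bs \<subseteq> Basis"
  shows "(\<lambda>((yt, y), z). sweep yt bs y z) \<in> borel_measurable ((borel \<Otimes>\<^sub>M borel) \<Otimes>\<^sub>M borel)"
  using assms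
proof (induction bs)
  case (Cons b bs)
  then have b: "b \<in> Basis" and [measurable]: "(\<lambda>((yt, y), z). sweep yt bs y z) \<in> borel_measurable ((borel \<Otimes>\<^sub>M borel) \<Otimes>\<^sub>M borel)" by auto
  note [measurable] = refresh_measurable[OF b]
  have "(\<lambda>p. (\<lambda>((yt, y), z). sweep yt bs y z) ((fst (fst p), (\<lambda>((yt, y), s). refresh b yt y s) (fst p, snd p \<bullet> b)), snd p)) \<in> borel_measurable ((borel \<Otimes>\<^sub>M borel) \<Otimes>\<^sub>M borel)"
    by measurable
  then show ?case by (simp add: case_prod_unfold)
qed (simp add: case_prod_unfold)

lemma sweep_sum_measurable:
  assumes "set bs \<subseteq> Basis" and [measurable]: "h \<in> borel_measurable borel"
  shows "(\<lambda>((yt, y), z). sweep_sum h yt bs y z) \<in> borel_measurable ((borel \<Otimes>\<^sub>M borel) \<Otimes>\<^sub>M borel)"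
  using assms(1)
proof (induction bs)
  case (Cons b bs)
  then have b: "b \<in> Basis" and [measurable]: "(\<lambda>((yt, y), z). sweep_sum h yt bs y z) \<in> borel_measurable ((borel \<Otimes>\<^sub>M borel) \<Otimes>\<^sub>M borel)" by auto
  note [measurable] = refresh_measurable[OF b]
  have "(\<lambda>p. h (snd (fst p)) + (\<lambda>((yt, y), z). sweep_sum h yt bs y z) ((fst (fst p), (\<lambda>((yt, y), s). refresh b yt y s) (fst p, snd p \<bullet> b)), snd p)) \<in> borel_measurable ((borel \<Otimes>\<^sub>M borel) \<Otimes>\<^sub>M borel)"
    by measurable
  then show ?case by (simp add: case_prod_unfold)
qed (simp add: case_prod_unfold)

lemma sweep_cong:
  assumes "\<And>b. b \<in> set bs \<Longrightarrow> z \<bullet> b = z' \<bullet> b"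
  shows "sweep yt bs y z = sweep yt bs y z'" "sweep_sum h yt bs y z = sweep_sum h yt bs y z'"
  using assms by (induction bs arbitrary: y) auto

lemma sweep_line_shift:
  assumes "set (b # bs) \<subseteq> Basis" "b \<notin> set bs"
  shows "sweep yt bs y (z + t *\<^sub>R b) = sweep yt bs y z" "sweep_sum h yt bs y (z + t *\<^sub>R b) = sweep_sum h yt bs y z"
proof -
  have "(z + t *\<^sub>R b) \<bullet> b' = z \<bullet> b'" if "b' \<in> set bs" for b'
    using assms that inner_not_same_Basis[of b b'] by (auto simp: inner_add_left)
  then show "sweep yt bs y (z + t *\<^sub>R b) = sweep yt bs y z" "sweep_sum h yt bs y (z + t *\<^sub>R b) = sweep_sum h yt bs y z"
    by (intro sweep_cong; simp)+
qed

text \<open>The refreshed point may be followed by anything that does not look at the coordinate of the noise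
that has been used. This independence is expressed by translation invariance of \<open>\<Psi>\<close> in direction
\<open>b\<close>.\<close>

lemma refresh_gauss_invariant:
  assumes \<Psi>[measurable]: "(\<lambda>(y, z). \<Psi> y z) \<in> borel_measurable (borel \<Otimes>\<^sub>M borel)" and b: "b \<in> Basis"
    and indep: "\<And>y z t. \<Psi> y (z + t *\<^sub>R b) = (\<Psi> y z :: ennreal)"
  shows "(\<integral>\<^sup>+z. \<integral>\<^sup>+y. \<Psi> (refresh b yt y (z \<bullet> b)) z * ennreal (\<omega> yt y) \<partial>lborel \<partial>gauss) = (\<integral>\<^sup>+z. \<integral>\<^sup>+y. \<Psi> y z * ennreal (\<omega> yt y) \<partial>lborel \<partial>gauss)"
proof -
  have r[measurable]: "(\<lambda>(y, s). refresh b yt y s) \<in> borel_measurable (borel \<Otimes>\<^sub>M borel)"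
  proof -
    have "(\<lambda>p. (\<lambda>((yt, y), s). refresh b yt y s) ((yt, fst p), snd p)) \<in> borel_measurable (borel \<Otimes>\<^sub>M borel)"
      using refresh_measurable[OF b] by measurable
    then show ?thesis by (simp add: case_prod_unfold)
  qed
  define H where "H z = (\<integral>\<^sup>+y. \<Psi> (refresh b yt y (z \<bullet> b)) z * ennreal (\<omega> yt y) \<partial>lborel)" for z
  have Hm[measurable]: "H \<in> borel_measurable borel" unfolding H_def[abs_def] by measurable
  have "(\<integral>\<^sup>+z. H z \<partial>gauss) = (\<integral>\<^sup>+z. \<integral>\<^sup>+s. H (z + (s - z \<bullet> b) *\<^sub>R b) * ennreal (std_normal_density s) \<partial>lborel \<partial>gauss)"
    by (rule gauss_coordinate_refresh[symmetric]) (use b in auto)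
  also have "\<dots> = (\<integral>\<^sup>+z. \<integral>\<^sup>+y. \<Psi> y z * ennreal (\<omega> yt y) \<partial>lborel \<partial>gauss)"
  proof (rule nn_integral_cong)
    fix z :: 'a
    have [measurable]: "(\<lambda>y. \<Psi> y z) \<in> borel_measurable borel" by measurable
    have [measurable]: "(\<lambda>s. refresh b yt y s) \<in> borel_measurable borel" for y
      using measurable_compose[OF measurable_Pair1'[of y] r] by simp
    have e: "(z + (s - z \<bullet> b) *\<^sub>R b) \<bullet> b = s" for s using b by (simp add: inner_add_left)
    have "(\<integral>\<^sup>+s. H (z + (s - z \<bullet> b) *\<^sub>R b) * ennreal (std_normal_density s) \<partial>lborel)
       = (\<integral>\<^sup>+s. \<integral>\<^sup>+y. \<Psi> (refresh b yt y s) z * ennreal (\<omega> yt y) * ennreal (std_normal_density s) \<partial>lborel \<partial>lborel)"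
      unfolding H_def indep e by (simp add: nn_integral_multc)
    also have "\<dots> = (\<integral>\<^sup>+y. \<integral>\<^sup>+s. \<Psi> (refresh b yt y s) z * ennreal (\<omega> yt y) * ennreal (std_normal_density s) \<partial>lborel \<partial>lborel)"
      by (rule lborel_pair.Fubini') measurable
    also have "\<dots> = (\<integral>\<^sup>+y. (\<integral>\<^sup>+s. \<Psi> (refresh b yt y s) z * ennreal (std_normal_density s) \<partial>lborel) * ennreal (\<omega> yt y) \<partial>lborel)"
      by (simp add: nn_integral_multc[symmetric] mult_ac(3) mult.assoc mult.commute[of "ennreal (\<omega> yt _)"])
    also have "\<dots> = (\<integral>\<^sup>+y. \<Psi> y z * ennreal (\<omega> yt y) \<partial>lborel)"
      by (rule refresh_invariant[OF _ b]) measurable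
    finally show "(\<integral>\<^sup>+s. H (z + (s - z \<bullet> b) *\<^sub>R b) * ennreal (std_normal_density s) \<partial>lborel) = (\<integral>\<^sup>+y. \<Psi> y z * ennreal (\<omega> yt y) \<partial>lborel)" .
  qed
  finally show ?thesis unfolding H_def .
qed

lemma sweep_fixed_measurable:
  assumes "set bs \<subseteq> Basis"
  shows "(\<lambda>(y, z). sweep yt bs y z) \<in> borel_measurable (borel \<Otimes>\<^sub>M borel)"
proof -
  have "(\<lambda>p. (\<lambda>((yt, y), z). sweep yt bs y z) ((yt, fst p), snd p)) \<in> borel_measurable (borel \<Otimes>\<^sub>M borel)"
    using sweep_measurable[OF assms] by measurable
  then show ?thesis by (simp add: case_prod_unfold)
qed

lemma sweep_sum_fixed_measurable:
  assumes "set bs \<subseteq> Basis" "h \<in> borel_measurable borel"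
  shows "(\<lambda>(y, z). sweep_sum h yt bs y z) \<in> borel_measurable (borel \<Otimes>\<^sub>M borel)"
proof -
  have "(\<lambda>p. (\<lambda>((yt, y), z). sweep_sum h yt bs y z) ((yt, fst p), snd p)) \<in> borel_measurable (borel \<Otimes>\<^sub>M borel)"
    using sweep_sum_measurable[OF assms] by measurable
  then show ?thesis by (simp add: case_prod_unfold)
qed

lemma sweep_invariant:
  assumes "set bs \<subseteq> Basis" "distinct bs" and [measurable]: "F \<in> borel_measurable borel"
  shows "(\<integral>\<^sup>+z. \<integral>\<^sup>+y. F (sweep yt bs y z) * ennreal (\<omega> yt y) \<partial>lborel \<partial>gauss) = (\<integral>\<^sup>+y. F y * ennreal (\<omega> yt y) \<partial>lborel)"
  using assms(1,2)
proof (induction bs)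
  case Nil
  then show ?case by (simp add: gauss.emeasure_space_1[simplified])
next
  case (Cons b bs)
  note [measurable] = sweep_fixed_measurable[of bs yt]
  have "(\<integral>\<^sup>+z. \<integral>\<^sup>+y. F (sweep yt bs (refresh b yt y (z \<bullet> b)) z) * ennreal (\<omega> yt y) \<partial>lborel \<partial>gauss) = (\<integral>\<^sup>+z. \<integral>\<^sup>+y. F (sweep yt bs y z) * ennreal (\<omega> yt y) \<partial>lborel \<partial>gauss)"
    using Cons.prems by (intro refresh_gauss_invariant[where \<Psi>="\<lambda>y z. F (sweep yt bs y z)"]) (auto simp: sweep_line_shift)
  then show ?case using Cons by simp
qed

lemma sweep_sum_nonneg: "(\<And>y. 0 \<le> h y) \<Longrightarrow> 0 \<le> sweep_sum h yt bs y z"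
  by (induction bs arbitrary: y) auto

text \<open>Each summand is a function of a point with the proximal law.\<close>

lemma sweep_sum_mean:
  assumes "set bs \<subseteq> Basis" "distinct bs" and [measurable]: "h \<in> borel_measurable borel" and h: "\<And>y. 0 \<le> h y"
  shows "(\<integral>\<^sup>+z. \<integral>\<^sup>+y. ennreal (sweep_sum h yt bs y z) * ennreal (\<omega> yt y) \<partial>lborel \<partial>gauss) = of_nat (length bs) * (\<integral>\<^sup>+y. ennreal (h y) * ennreal (\<omega> yt y) \<partial>lborel)"
  using assms(1,2)
proof (induction bs)
  case (Cons b bs)
  then have b: "b \<in> Basis" by simp
  note [measurable] = sweep_sum_fixed_measurable[of bs h yt] refresh_measurable[OF b]
  have [measurable]: "(\<lambda>(y, s). refresh b yt y s) \<in> borel_measurable (borel \<Otimes>\<^sub>M borel)"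
  proof -
    have "(\<lambda>p. (\<lambda>((yt, y), s). refresh b yt y s) ((yt, fst p), snd p)) \<in> borel_measurable (borel \<Otimes>\<^sub>M borel)"
      by measurable
    then show ?thesis by (simp add: case_prod_unfold)
  qed
  have "(\<integral>\<^sup>+z. \<integral>\<^sup>+y. ennreal (sweep_sum h yt (b # bs) y z) * ennreal (\<omega> yt y) \<partial>lborel \<partial>gauss)
     = (\<integral>\<^sup>+z. (\<integral>\<^sup>+y. ennreal (h y) * ennreal (\<omega> yt y) \<partial>lborel) + (\<integral>\<^sup>+y. ennreal (sweep_sum h yt bs (refresh b yt y (z \<bullet> b)) z) * ennreal (\<omega> yt y) \<partial>lborel) \<partial>gauss)"
    using Cons.prems
    by (subst nn_integral_add[symmetric]) (auto simp: ennreal_plus h sweep_sum_nonneg distrib_right intro!: nn_integral_cong)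
  also have "\<dots> = (\<integral>\<^sup>+y. ennreal (h y) * ennreal (\<omega> yt y) \<partial>lborel) + (\<integral>\<^sup>+z. \<integral>\<^sup>+y. ennreal (sweep_sum h yt bs (refresh b yt y (z \<bullet> b)) z) * ennreal (\<omega> yt y) \<partial>lborel \<partial>gauss)"
    using Cons.prems
    by (subst nn_integral_add) (auto simp: gauss.emeasure_space_1[simplified])
  also have "(\<integral>\<^sup>+z. \<integral>\<^sup>+y. ennreal (sweep_sum h yt bs (refresh b yt y (z \<bullet> b)) z) * ennreal (\<omega> yt y) \<partial>lborel \<partial>gauss) = (\<integral>\<^sup>+z. \<integral>\<^sup>+y. ennreal (sweep_sum h yt bs y z) * ennreal (\<omega> yt y) \<partial>lborel \<partial>gauss)"
    using Cons.prems by (intro refresh_gauss_invariant[where \<Psi>="\<lambda>y z. ennreal (sweep_sum h yt bs y z)"]) (auto simp: sweep_line_shift)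
  also have "\<dots> = of_nat (length bs) * (\<integral>\<^sup>+y. ennreal (h y) * ennreal (\<omega> yt y) \<partial>lborel)" using Cons by simp
  finally show ?case by (simp add: distrib_right)
qed simp

lemma sweep_sum_power:
  assumes h: "\<And>y. 0 \<le> h y"
  shows "(sweep_sum h yt bs y z) ^ q \<le> (2 ^ q) ^ length bs * (if q = 0 \<and> bs = [] then 1 else sweep_sum (\<lambda>y. h y ^ q) yt bs y z)"
proof (induction bs arbitrary: y)
  case Nil
  then show ?case by (simp add: power_0_left)
next
  case (Cons b bs)
  let ?y = "refresh b yt y (z \<bullet> b)"
  let ?S = "sweep_sum h yt bs ?y z" and ?T = "sweep_sum (\<lambda>y. h y ^ q) yt bs ?y z"
  have T: "0 \<le> ?T" using h by (intro sweep_sum_nonneg) auto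
  show ?case
  proof (cases "q = 0 \<and> bs = []")
    case True
    then show ?thesis by simp
  next
    case False
    have "(h y + ?S) ^ q \<le> 2 ^ q * (h y ^ q + ?S ^ q)"
      using h by (intro power_add_le_two_power sweep_sum_nonneg)
    also have "\<dots> \<le> 2 ^ q * (h y ^ q + (2 ^ q) ^ length bs * ?T)"
      using Cons.IH[of ?y] False by (intro mult_left_mono add_left_mono) auto
    also have "\<dots> \<le> 2 ^ q * ((2 ^ q) ^ length bs * h y ^ q + (2 ^ q) ^ length bs * ?T)"
      using h mult_right_mono[of 1 "(2 ^ q) ^ length bs" "h y ^ q"] by (intro mult_left_mono add_right_mono) auto
    also have "\<dots> = (2 ^ q) ^ length (b # bs) * (h y ^ q + ?T)" by (simp add: algebra_simps)
    finally show ?thesis by simp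
  qed
qed

lemma sweep_fixed_coordinate:
  assumes "set bs \<subseteq> Basis" "b \<in> Basis" "b \<notin> set bs"
  shows "sweep yt bs y z \<bullet> b = y \<bullet> b"
  using assms by (induction bs arbitrary: y) (auto simp: refresh_other_coordinate)

text \<open>The refreshed coordinate agrees with that of \<open>yt + \<sigma> z\<close> up to order \<open>\<sigma>\<^sup>2\<close>.\<close>

lemma refresh_displacement:
  assumes b: "b \<in> Basis"
  shows "\<bar>(refresh b yt y (z \<bullet> b) - yt - \<sigma> *\<^sub>R z) \<bullet> b\<bar> \<le> \<beta> * \<sigma>\<^sup>2 * ((2 * C + 40 * L) * ((1 + norm y) + norm yt + norm z))"
proof -
  define s where "s = z \<bullet> b"
  define T where "T = normal_quantile_map (line_density b yt y) s"
  have "(refresh b yt y s - yt - \<sigma> *\<^sub>R z) \<bullet> b = \<sigma> * (T - s)"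
    using b by (simp add: refresh_def T_def[symmetric] s_def[symmetric] inner_simps algebra_simps)
  then have "\<bar>(refresh b yt y s - yt - \<sigma> *\<^sub>R z) \<bullet> b\<bar> = \<sigma> * \<bar>T - s\<bar>" using \<sigma> by (simp add: abs_mult)
  also have "\<dots> \<le> \<sigma> * (2 * (\<beta> * \<sigma> * (C + L * (2 * norm y + norm yt))) + 20 * (2 * (\<beta> * L * \<sigma>\<^sup>2)) + 4 * (2 * (\<beta> * L * \<sigma>\<^sup>2)) * \<bar>s\<bar>)"
    unfolding T_def using line_quantile_displacement[OF b] \<sigma> by (intro mult_left_mono) auto
  also have "\<dots> = \<beta> * \<sigma>\<^sup>2 * (2 * C + 2 * L * (2 * norm y + norm yt) + \<sigma> * (40 * L + 8 * L * \<bar>s\<bar>))"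
    by (simp add: power2_eq_square algebra_simps)
  also have "\<dots> \<le> \<beta> * \<sigma>\<^sup>2 * ((2 * C + 40 * L) * ((1 + norm y) + norm yt + norm z))"
  proof (intro mult_left_mono)
    have "\<sigma> * (40 * L + 8 * L * \<bar>s\<bar>) \<le> 1 * (40 * L + 8 * L * norm z)"
      using \<sigma> L Basis_le_norm[OF b, of z] by (intro mult_mono add_mono mult_left_mono) (auto simp: s_def)
    moreover have "0 \<le> C * norm y" "0 \<le> C * norm yt" "0 \<le> C * norm z" "0 \<le> L * norm y" "0 \<le> L * norm yt" "0 \<le> L * norm z"
      using C L by auto
    ultimately show "2 * C + 2 * L * (2 * norm y + norm yt) + \<sigma> * (40 * L + 8 * L * \<bar>s\<bar>) \<le> (2 * C + 40 * L) * ((1 + norm y) + norm yt + norm z)"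
      by (simp add: algebra_simps)
  qed (use \<beta> in auto)
  finally show ?thesis by (simp add: s_def)
qed

text \<open>A coordinate is not touched after it has been refreshed, so the bound from its own refreshment
survives.\<close>

lemma sweep_displacement_coordinate:
  assumes "set bs \<subseteq> Basis" "distinct bs" "b \<in> set bs"
  shows "\<bar>(sweep yt bs y z - yt - \<sigma> *\<^sub>R z) \<bullet> b\<bar> \<le> \<beta> * \<sigma>\<^sup>2 * ((2 * C + 40 * L) * (sweep_sum (\<lambda>y. 1 + norm y) yt bs y z + norm yt + norm z))"
  using assms
proof (induction bs arbitrary: y)
  case (Cons c bs)
  let ?y = "refresh c yt y (z \<bullet> c)"
  let ?S = "sweep_sum (\<lambda>y. 1 + norm y) yt bs ?y z"
  have S: "0 \<le> ?S" by (intro sweep_sum_nonneg) auto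
  have mono: "\<beta> * \<sigma>\<^sup>2 * ((2 * C + 40 * L) * x) \<le> \<beta> * \<sigma>\<^sup>2 * ((2 * C + 40 * L) * x')" if "x \<le> x'" for x x'
    using that \<beta> C L by (intro mult_left_mono) auto
  show ?case
  proof (cases "b = c")
    case True
    have "sweep yt bs ?y z \<bullet> b = ?y \<bullet> b" using Cons.prems True by (intro sweep_fixed_coordinate) auto
    then have "(sweep yt bs ?y z - yt - \<sigma> *\<^sub>R z) \<bullet> b = (?y - yt - \<sigma> *\<^sub>R z) \<bullet> b" by (simp add: inner_diff_left)
    then have "\<bar>(sweep yt bs ?y z - yt - \<sigma> *\<^sub>R z) \<bullet> b\<bar> \<le> \<beta> * \<sigma>\<^sup>2 * ((2 * C + 40 * L) * ((1 + norm y) + norm yt + norm z))"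
      using refresh_displacement[of b yt y z] Cons.prems True by simp
    also have "\<dots> \<le> \<beta> * \<sigma>\<^sup>2 * ((2 * C + 40 * L) * ((1 + norm y + ?S) + norm yt + norm z))"
      using S by (intro mono) auto
    finally show ?thesis by simp
  next
    case False
    then have "\<bar>(sweep yt bs ?y z - yt - \<sigma> *\<^sub>R z) \<bullet> b\<bar> \<le> \<beta> * \<sigma>\<^sup>2 * ((2 * C + 40 * L) * (?S + norm yt + norm z))"
      using Cons by simp
    also have "\<dots> \<le> \<beta> * \<sigma>\<^sup>2 * ((2 * C + 40 * L) * ((1 + norm y + ?S) + norm yt + norm z))"
      by (intro mono) auto
    finally show ?thesis by simp
  qed
qed simp

text \<open>An arbitrary but fixed order of the coordinates for the sweep.\<close>

definition "basis_list = (SOME bs :: 'a list. set bs = Basis \<and> distinct bs)"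

lemma basis_list: "set basis_list = (Basis :: 'a set)" "distinct (basis_list :: 'a list)" "length (basis_list :: 'a list) = DIM('a)"
proof -
  have "set basis_list = (Basis :: 'a set) \<and> distinct (basis_list :: 'a list)"
    unfolding basis_list_def by (rule someI_ex) (use finite_distinct_list[OF finite_Basis] in blast)
  then show "set basis_list = (Basis :: 'a set)" "distinct (basis_list :: 'a list)" by auto
  then show "length (basis_list :: 'a list) = DIM('a)" by (metis distinct_card)
qed

text \<open>If \<open>y\<close> has law \<open>RG yt\<close> and \<open>z\<close> is an independent Gaussian, then the swept point has law \<open>RG yt\<close> again, but
it follows \<open>yt + \<sigma> z\<close> up to an error of order \<open>\<sigma>\<^sup>2\<close> times \<open>sweep_size\<close>.\<close>

definition gibbs_sweep :: "'a \<Rightarrow> 'a \<Rightarrow> 'a \<Rightarrow> 'a" where "gibbs_sweep yt y z = sweep yt basis_list y z"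
definition sweep_size :: "'a \<Rightarrow> 'a \<Rightarrow> 'a \<Rightarrow> real" where
  "sweep_size yt y z = sweep_sum (\<lambda>y. 1 + norm y) yt basis_list y z + norm yt + norm z"

lemma gibbs_sweep_measurable[measurable]: "(\<lambda>((yt, y), z). gibbs_sweep yt y z) \<in> borel_measurable ((borel \<Otimes>\<^sub>M borel) \<Otimes>\<^sub>M borel)"
  unfolding gibbs_sweep_def using basis_list by (intro sweep_measurable) auto

lemma sweep_size_measurable[measurable]: "(\<lambda>((yt, y), z). sweep_size yt y z) \<in> borel_measurable ((borel \<Otimes>\<^sub>M borel) \<Otimes>\<^sub>M borel)"
proof -
  have [measurable]: "(\<lambda>((yt, y), z). sweep_sum (\<lambda>y. 1 + norm y) yt basis_list y z) \<in> borel_measurable ((borel \<Otimes>\<^sub>M borel) \<Otimes>\<^sub>M borel)"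
    using basis_list by (intro sweep_sum_measurable) auto
  have "(\<lambda>p. (\<lambda>((yt, y), z). sweep_sum (\<lambda>y. 1 + norm y) yt basis_list y z) p + norm (fst (fst p)) + norm (snd p)) \<in> borel_measurable ((borel \<Otimes>\<^sub>M borel) \<Otimes>\<^sub>M borel)"
    by measurable
  then show ?thesis unfolding sweep_size_def by (simp add: case_prod_unfold)
qed

lemma gibbs_sweep_displacement:
  "norm (gibbs_sweep yt y z - yt - \<sigma> *\<^sub>R z) \<le> \<beta> * \<sigma>\<^sup>2 * (DIM('a) * (2 * C + 40 * L) * sweep_size yt y z)"
proof -
  have "norm (gibbs_sweep yt y z - yt - \<sigma> *\<^sub>R z) \<le> (\<Sum>b\<in>Basis. \<bar>(gibbs_sweep yt y z - yt - \<sigma> *\<^sub>R z) \<bullet> b\<bar>)"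
    by (rule norm_le_l1)
  also have "\<dots> \<le> (\<Sum>b\<in>(Basis::'a set). \<beta> * \<sigma>\<^sup>2 * ((2 * C + 40 * L) * sweep_size yt y z))"
    unfolding gibbs_sweep_def sweep_size_def using basis_list by (intro sum_mono sweep_displacement_coordinate) auto
  finally show ?thesis by (simp add: mult_ac)
qed

lemma gibbs_sweep_law:
  assumes [measurable]: "F \<in> borel_measurable borel"
  shows "(\<integral>\<^sup>+z. \<integral>\<^sup>+y. F (gibbs_sweep yt y z) \<partial>RG yt \<partial>gauss) = (\<integral>\<^sup>+y. F y \<partial>RG yt)"
proof -
  have [measurable]: "(\<lambda>(y, z). gibbs_sweep yt y z) \<in> borel_measurable (borel \<Otimes>\<^sub>M borel)"
    unfolding gibbs_sweep_def using basis_list by (intro sweep_fixed_measurable) auto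
  have "(\<integral>\<^sup>+z. \<integral>\<^sup>+y. F (gibbs_sweep yt y z) * ennreal (\<omega> yt y) \<partial>lborel \<partial>gauss) = (\<integral>\<^sup>+y. F y * ennreal (\<omega> yt y) \<partial>lborel)"
    unfolding gibbs_sweep_def using basis_list by (intro sweep_invariant) auto
  then show ?thesis
    by (simp add: nn_integral_RG nn_integral_divide)
qed

lemma sweep_sum_moment:
  "(\<integral>\<^sup>+z. \<integral>\<^sup>+y. ennreal ((sweep_sum (\<lambda>y. 1 + norm y) yt basis_list y z) ^ q) \<partial>RG yt \<partial>gauss)
    \<le> ennreal ((2 ^ q) ^ DIM('a) * DIM('a)) * (\<integral>\<^sup>+y. ennreal ((1 + norm y) ^ q) \<partial>RG yt)"
proof -
  interpret RG: prob_space "RG yt" by (rule prob_space_RG)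
  let ?h = "\<lambda>y::'a. (1 + norm y) ^ q"
  have [measurable]: "(\<lambda>(y, z). sweep_sum ?h yt basis_list y z) \<in> borel_measurable (borel \<Otimes>\<^sub>M borel)"
    using basis_list by (intro sweep_sum_fixed_measurable) auto
  have ne: "basis_list \<noteq> ([]::'a list)" using basis_list(3) by auto
  have "(\<integral>\<^sup>+z. \<integral>\<^sup>+y. ennreal ((sweep_sum (\<lambda>y. 1 + norm y) yt basis_list y z) ^ q) \<partial>RG yt \<partial>gauss)
    \<le> (\<integral>\<^sup>+z. \<integral>\<^sup>+y. ennreal ((2 ^ q) ^ DIM('a)) * ennreal (sweep_sum ?h yt basis_list y z) \<partial>RG yt \<partial>gauss)"
    using sweep_sum_power[of "\<lambda>y. 1 + norm y" yt basis_list _ _ q] ne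
    by (intro nn_integral_mono) (auto simp: ennreal_mult[symmetric] sweep_sum_nonneg basis_list intro!: ennreal_leI)
  also have "\<dots> = ennreal ((2 ^ q) ^ DIM('a)) * (\<integral>\<^sup>+z. \<integral>\<^sup>+y. ennreal (sweep_sum ?h yt basis_list y z) \<partial>RG yt \<partial>gauss)"
    by (simp add: nn_integral_cmult)
  also have "(\<integral>\<^sup>+z. \<integral>\<^sup>+y. ennreal (sweep_sum ?h yt basis_list y z) \<partial>RG yt \<partial>gauss) = of_nat DIM('a) * (\<integral>\<^sup>+y. ennreal (?h y) \<partial>RG yt)"
  proof -
    have "(\<integral>\<^sup>+z. \<integral>\<^sup>+y. ennreal (sweep_sum ?h yt basis_list y z) \<partial>RG yt \<partial>gauss) = (\<integral>\<^sup>+z. \<integral>\<^sup>+y. ennreal (sweep_sum ?h yt basis_list y z) * ennreal (\<omega> yt y) \<partial>lborel \<partial>gauss) / ennreal (Zt yt)"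
      by (simp add: nn_integral_RG nn_integral_divide)
    also have "\<dots> = of_nat DIM('a) * (\<integral>\<^sup>+y. ennreal (?h y) * ennreal (\<omega> yt y) \<partial>lborel) / ennreal (Zt yt)"
      by (subst sweep_sum_mean) (auto simp: basis_list)
    finally show ?thesis by (simp add: nn_integral_RG ennreal_times_divide)
  qed
  finally show ?thesis by (simp add: ennreal_mult ennreal_of_nat_eq_real_of_nat mult.assoc)
qed

end

section \<open>The mean of the one-step remainder\<close>

lemma abs_exp_minus_one_le:
  fixes x :: real assumes "x \<le> k" "0 \<le> k" shows "\<bar>exp x - 1\<bar> \<le> \<bar>x\<bar> * exp k"
proof (cases "0 \<le> x")
  case True
  have "exp x - 1 \<le> x * exp x" using exp_ge_add_one_self[of "-x"] mult_left_mono[of "1 - x" "exp (-x)" "exp x"]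
    by (simp add: algebra_simps exp_minus_inverse)
  also have "\<dots> \<le> x * exp k" using True assms by (intro mult_left_mono) auto
  finally show ?thesis using True by simp
next
  case False
  have "1 - exp x \<le> - x" using exp_ge_add_one_self[of x] by linarith
  also have "\<dots> \<le> (- x) * exp k" using False assms mult_left_mono[of 1 "exp k" "-x"] by simp
  finally show ?thesis using False by (simp add: abs_if)
qed

lemma abs_exp_taylor_le:
  fixes x :: real assumes "x \<le> k" "0 \<le> k" shows "\<bar>exp x - 1 - x\<bar> \<le> x\<^sup>2 * exp k"
proof -
  have pos: "0 \<le> exp x - 1 - x" using exp_ge_add_one_self[of x] by linarith
  have "exp x - 1 - x \<le> x * (exp x - 1)"
    using exp_ge_add_one_self[of "-x"] mult_left_mono[of "1 - x" "exp (-x)" "exp x"]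
    by (simp add: algebra_simps exp_minus_inverse)
  also have "\<dots> \<le> \<bar>x\<bar> * \<bar>exp x - 1\<bar>" by (metis abs_ge_self abs_mult)
  also have "\<dots> \<le> \<bar>x\<bar> * (\<bar>x\<bar> * exp k)" using abs_exp_minus_one_le[OF assms] by (intro mult_left_mono) auto
  finally show ?thesis using pos by (simp add: power2_eq_square abs_mult[symmetric])
qed

lemma gauss_cameron_martin:
  fixes u :: "'a::euclidean_space \<Rightarrow> real"
  assumes [measurable]: "u \<in> borel_measurable borel" and b: "b \<in> Basis"
  shows "(\<integral>z. u (z + t *\<^sub>R b) \<partial>gauss) = (\<integral>z. u z * exp (t * (z \<bullet> b) - t\<^sup>2 / 2) \<partial>gauss)"
proof -
  have d: "std_gaussian_density (z - t *\<^sub>R b) = std_gaussian_density z * exp (t * (z \<bullet> b) - t\<^sup>2 / 2)" for z :: 'a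
  proof -
    have "(norm (z - t *\<^sub>R b))\<^sup>2 = (norm z)\<^sup>2 - 2 * (t * (z \<bullet> b)) + t\<^sup>2"
      unfolding power2_norm_eq_inner
      using b by (simp add: inner_diff_left inner_diff_right inner_commute power2_eq_square algebra_simps)
    then have "- (norm (z - t *\<^sub>R b))\<^sup>2 / 2 = - (norm z)\<^sup>2 / 2 + (t * (z \<bullet> b) - t\<^sup>2 / 2)" by (simp add: field_simps)
    then show ?thesis unfolding std_gaussian_density_eq by (simp only: exp_add times_divide_eq_left)
  qed
  have "(\<integral>z. u (z + t *\<^sub>R b) \<partial>gauss) = (\<integral>z. std_gaussian_density z * u (z + t *\<^sub>R b) \<partial>lborel)"
    by (subst integral_density) (auto simp: less_imp_le[OF std_gaussian_density_pos])
  also have "\<dots> = (\<integral>z. std_gaussian_density z * u (z + t *\<^sub>R b) \<partial>distr lborel borel ((+) (- t *\<^sub>R b)))"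
    by (simp add: lborel_distr_plus)
  also have "\<dots> = (\<integral>z. std_gaussian_density (z - t *\<^sub>R b) * u z \<partial>lborel)"
    by (subst integral_distr) (auto simp: add.commute)
  also have "\<dots> = (\<integral>z. std_gaussian_density z * (u z * exp (t * (z \<bullet> b) - t\<^sup>2 / 2)) \<partial>lborel)"
    by (simp add: d mult_ac)
  also have "\<dots> = (\<integral>z. u z * exp (t * (z \<bullet> b) - t\<^sup>2 / 2) \<partial>gauss)"
    by (subst integral_density) (auto simp: less_imp_le[OF std_gaussian_density_pos])
  finally show ?thesis .
qed

lemma gauss_odd_zero:
  fixes b :: "'a::euclidean_space" assumes "b \<in> Basis"
  shows "(\<integral>z. z \<bullet> b \<partial>gauss) = 0"
proof -
  have d: "std_gaussian_density (- z) = std_gaussian_density z" for z :: 'a by (simp add: std_gaussian_density_eq)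
  have "(\<integral>z. z \<bullet> b \<partial>gauss) = (\<integral>z. std_gaussian_density z * (z \<bullet> b) \<partial>lborel)"
    by (subst integral_density) (auto simp: less_imp_le[OF std_gaussian_density_pos])
  also have "\<dots> = (\<integral>z. std_gaussian_density z * (z \<bullet> b) \<partial>distr lborel borel uminus)"
    using lborel_affine[of "-1" "0::'a"] by (simp add: density_1)
  also have "\<dots> = - (\<integral>z. std_gaussian_density z * (z \<bullet> b) \<partial>lborel)"
    by (subst integral_distr) (auto simp: d)
  also have "(\<integral>z. std_gaussian_density z * (z \<bullet> b) \<partial>lborel) = (\<integral>z. z \<bullet> b \<partial>gauss)"
    by (subst integral_density) (auto simp: less_imp_le[OF std_gaussian_density_pos])
  finally show ?thesis by simp
qed

context langevin_potential
begin

lemma U_shift_growth: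
  assumes "0 \<le> \<sigma>" "\<sigma> \<le> 1"
  shows "\<bar>U (yt + \<sigma> *\<^sub>R z)\<bar> \<le> (\<bar>U 0\<bar> + (C + L) * (1 + norm yt)\<^sup>2) * (1 + norm z)\<^sup>2"
proof -
  let ?p = "yt + \<sigma> *\<^sub>R z"
  define q where "q = (1 + norm yt) * (1 + norm z)"
  have q1: "1 \<le> q" unfolding q_def using mult_mono[of 1 "1 + norm yt" 1 "1 + norm z"] by simp
  have "norm ?p \<le> norm yt + \<sigma> * norm z" using norm_triangle_ineq[of yt "\<sigma> *\<^sub>R z"] assms by simp
  also have "\<dots> \<le> norm yt + 1 * norm z" using assms by (intro add_left_mono mult_right_mono) auto
  also have "\<dots> \<le> q" unfolding q_def by (simp add: algebra_simps)
  finally have p: "norm ?p \<le> q" .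
  have "\<bar>U ?p - U 0\<bar> \<le> (C + L * q) * norm (?p - 0)" using p q1 by (intro U_lipschitz) auto
  also have "\<dots> \<le> (C * q + L * q) * q"
  proof (intro mult_mono add_mono)
    show "C \<le> C * q" using C q1 by simp
  qed (use p L C q1 in auto)
  also have "\<dots> = ((C + L) * (1 + norm yt)\<^sup>2) * (1 + norm z)\<^sup>2" unfolding q_def by (simp add: power2_eq_square algebra_simps)
  finally have "\<bar>U ?p\<bar> \<le> \<bar>U 0\<bar> * 1 + ((C + L) * (1 + norm yt)\<^sup>2) * (1 + norm z)\<^sup>2" by simp
  also have "\<bar>U 0\<bar> * 1 \<le> \<bar>U 0\<bar> * (1 + norm z)\<^sup>2" by (intro mult_left_mono) auto
  finally show ?thesis by (simp add: distrib_right)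
qed

lemma U_gauss_integrable:
  assumes s: "0 \<le> \<sigma>" "\<sigma> \<le> 1" and w[measurable]: "w \<in> borel_measurable borel"
    and wb: "\<And>z. \<bar>w z\<bar> \<le> K * ((1 + norm z) ^ k * exp (c * norm z))"
  shows "integrable gauss (\<lambda>z. w z * U (yt + \<sigma> *\<^sub>R z))"
proof (rule gauss_bounded_growth_integrable)
  fix z :: 'a
  show "norm (w z * U (yt + \<sigma> *\<^sub>R z)) \<le> (K * (\<bar>U 0\<bar> + (C + L) * (1 + norm yt)\<^sup>2)) * ((1 + norm z) ^ (k + 2) * exp (c * norm z))"
    using mult_mono[OF wb[of z] U_shift_growth[OF s, of yt z] order_trans[OF abs_ge_zero wb[of z]]]
    by (simp add: abs_mult power_add mult_ac power2_eq_square)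
qed measurable

text \<open>Gaussian integration by parts for \<open>U\<close>. The difference quotient of the shifted Gaussian integral is
computed in two ways: on \<open>U\<close>, where the derivative exists almost everywhere and the local Lipschitz
bound dominates, and on the density, by the formula of Cameron and Martin.\<close>

lemma gauss_stein_potential:
  assumes s: "0 < \<sigma>" "\<sigma> \<le> 1" and b: "b \<in> Basis"
  shows "(\<integral>z. (z \<bullet> b) * U (yt + \<sigma> *\<^sub>R z) \<partial>gauss) = \<sigma> * (\<integral>z. g (yt + \<sigma> *\<^sub>R z) \<bullet> b \<partial>gauss)"
proof -
  define u where "u z = U (yt + \<sigma> *\<^sub>R z)" for z
  have [measurable]: "u \<in> borel_measurable borel" unfolding u_def[abs_def] by measurable
  define t where "t n = inverse (real (Suc n))" for n
  have t: "0 < t n" "t n \<le> 1" for n by (auto simp: t_def field_simps)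
  have t0: "filterlim t (at 0) sequentially" unfolding t_def[abs_def]
    by (rule filterlim_atI) (use LIMSEQ_inverse_real_of_nat in auto)
  have b1: "norm b = 1" using b by simp
  have zb: "\<bar>z \<bullet> b\<bar> \<le> norm z" for z using Basis_le_norm[OF b] .
  have s': "0 \<le> \<sigma>" using s by simp
  let ?A = "\<lambda>n. \<integral>z. (u (z + t n *\<^sub>R b) - u z) / t n \<partial>gauss"
  let ?e = "\<lambda>t z. (exp (t * (z \<bullet> b) - t\<^sup>2 / 2) - 1) / t"
  have lim1: "?A \<longlonglongrightarrow> (\<integral>z. \<sigma> * (g (yt + \<sigma> *\<^sub>R z) \<bullet> b) \<partial>gauss)"
  proof (rule integral_dominated_convergence)
    show "integrable gauss (\<lambda>z::'a. (C + L * (norm yt + norm z + 1)))"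
    proof (rule gauss_bounded_growth_integrable)
      fix z :: 'a
      have "C + L * (norm yt + norm z + 1) \<le> (C + L * (norm yt + 1)) * (1 + norm z)"
        using C L mult_nonneg_nonneg[of C "norm z"] mult_nonneg_nonneg[of "L * norm yt" "norm z"] by (simp add: algebra_simps)
      then show "norm (C + L * (norm yt + norm z + 1)) \<le> (C + L * (norm yt + 1)) * ((1 + norm z) ^ 1 * exp (0 * norm z))"
        using C L by simp
    qed measurable
    show "AE z in gauss. (\<lambda>n. (u (z + t n *\<^sub>R b) - u z) / t n) \<longlonglongrightarrow> \<sigma> * (g (yt + \<sigma> *\<^sub>R z) \<bullet> b)"
    proof (rule AE_mp[OF AE_gauss_affine[OF D_AE D_sets, of \<sigma> yt]], use s in simp, intro AE_I2 impI)
      fix z assume z: "yt + \<sigma> *\<^sub>R z \<in> D"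
      have "((\<lambda>r. U ((yt + \<sigma> *\<^sub>R z) + r *\<^sub>R (\<sigma> *\<^sub>R b))) has_derivative (\<lambda>r. (r *\<^sub>R (\<sigma> *\<^sub>R b)) \<bullet> g (yt + \<sigma> *\<^sub>R z))) (at 0)"
        by (rule has_derivative_compose[where g=U]) (use deriv[OF z] in \<open>auto intro!: derivative_eq_intros simp: gderiv_def\<close>)
      then have "((\<lambda>r. u (z + r *\<^sub>R b)) has_derivative (\<lambda>r. r * (\<sigma> * (b \<bullet> g (yt + \<sigma> *\<^sub>R z))))) (at 0)"
        by (simp add: u_def scaleR_add_right add.assoc mult.assoc inner_commute mult.commute[of \<sigma>])
      then have "((\<lambda>r. u (z + r *\<^sub>R b)) has_real_derivative \<sigma> * (g (yt + \<sigma> *\<^sub>R z) \<bullet> b)) (at 0)"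
        unfolding has_field_derivative_def by (rule has_derivative_eq_rhs) (auto simp: mult.commute inner_commute)
      then have "((\<lambda>r. (u (z + r *\<^sub>R b) - u z) / r) \<longlongrightarrow> \<sigma> * (g (yt + \<sigma> *\<^sub>R z) \<bullet> b)) (at 0)" by (simp add: DERIV_def)
      then show "(\<lambda>n. (u (z + t n *\<^sub>R b) - u z) / t n) \<longlonglongrightarrow> \<sigma> * (g (yt + \<sigma> *\<^sub>R z) \<bullet> b)"
        using t0 by (rule filterlim_compose)
    qed
    fix n
    show "AE z in gauss. norm ((u (z + t n *\<^sub>R b) - u z) / t n) \<le> C + L * (norm yt + norm z + 1)"
    proof (rule AE_I2)
      fix z :: 'a
      have n1: "norm (yt + \<sigma> *\<^sub>R w) \<le> norm yt + norm z + 1" if "norm w \<le> norm z + 1" for w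
      proof -
        have "norm (yt + \<sigma> *\<^sub>R w) \<le> norm yt + \<sigma> * norm w" using norm_triangle_ineq[of yt "\<sigma> *\<^sub>R w"] s by simp
        also have "\<sigma> * norm w \<le> 1 * norm w" using s by (intro mult_right_mono) auto
        finally show ?thesis using that by simp
      qed
      have "\<bar>u (z + t n *\<^sub>R b) - u z\<bar> \<le> (C + L * (norm yt + norm z + 1)) * norm ((yt + \<sigma> *\<^sub>R (z + t n *\<^sub>R b)) - (yt + \<sigma> *\<^sub>R z))"
        unfolding u_def using norm_triangle_ineq[of z "t n *\<^sub>R b"] b1 t[of n]
        by (intro U_lipschitz n1) auto
      also have "norm ((yt + \<sigma> *\<^sub>R (z + t n *\<^sub>R b)) - (yt + \<sigma> *\<^sub>R z)) = \<sigma> * t n"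
        using b1 s t[of n] by (simp add: scaleR_add_right)
      also have "(C + L * (norm yt + norm z + 1)) * (\<sigma> * t n) \<le> (C + L * (norm yt + norm z + 1)) * (1 * t n)"
        using s t[of n] C L by (intro mult_left_mono mult_right_mono) auto
      finally show "norm ((u (z + t n *\<^sub>R b) - u z) / t n) \<le> C + L * (norm yt + norm z + 1)"
        using t[of n] by (simp add: pos_divide_le_eq)
    qed
  qed measurable
  have A: "?A n = (\<integral>z. u z * ?e (t n) z \<partial>gauss)" for n
  proof -
    have i1: "integrable gauss u" using U_gauss_integrable[OF s' s(2), of "\<lambda>_. 1" 1 0 0 yt] unfolding u_def[abs_def] by simp
    have i2: "integrable gauss (\<lambda>z. u z * exp (t n * (z \<bullet> b) - (t n)\<^sup>2 / 2))"
    proof -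
      have "\<bar>exp (t n * (z \<bullet> b) - (t n)\<^sup>2 / 2)\<bar> \<le> 1 * ((1 + norm z) ^ 0 * exp (1 * norm z))" for z
      proof -
        have "t n * (z \<bullet> b) \<le> t n * norm z" using t[of n] zb[of z] by (intro mult_left_mono) auto
        also have "\<dots> \<le> 1 * norm z" using t[of n] by (intro mult_right_mono) auto
        finally have "t n * (z \<bullet> b) \<le> 1 * norm z" .
        moreover have "0 \<le> (t n)\<^sup>2 / 2" by simp
        ultimately have "t n * (z \<bullet> b) - (t n)\<^sup>2 / 2 \<le> 1 * norm z" by linarith
        then show ?thesis by simp
      qed
      from U_gauss_integrable[OF s' s(2) _ this, of yt] show ?thesis unfolding u_def[abs_def] by (simp add: mult.commute)
    qed
    have i3: "integrable gauss (\<lambda>z. u (z + t n *\<^sub>R b))"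
    proof -
      have "u (z + t n *\<^sub>R b) = U ((yt + (\<sigma> * t n) *\<^sub>R b) + \<sigma> *\<^sub>R z)" for z by (simp add: u_def algebra_simps)
      then show ?thesis using U_gauss_integrable[OF s' s(2), of "\<lambda>_. 1" 1 0 0 "yt + (\<sigma> * t n) *\<^sub>R b"] by simp
    qed
    have "?A n = ((\<integral>z. u (z + t n *\<^sub>R b) \<partial>gauss) - (\<integral>z. u z \<partial>gauss)) / t n" using i1 i3 by simp
    also have "\<dots> = ((\<integral>z. u z * exp (t n * (z \<bullet> b) - (t n)\<^sup>2 / 2) \<partial>gauss) - (\<integral>z. u z \<partial>gauss)) / t n"
      by (simp add: gauss_cameron_martin[OF _ b])
    also have "\<dots> = (\<integral>z. (u z * exp (t n * (z \<bullet> b) - (t n)\<^sup>2 / 2) - u z) / t n \<partial>gauss)" using i1 i2 by simp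
    finally show ?thesis by (simp add: algebra_simps diff_divide_distrib)
  qed
  have lim2: "(\<lambda>n. \<integral>z. u z * ?e (t n) z \<partial>gauss) \<longlonglongrightarrow> (\<integral>z. u z * (z \<bullet> b) \<partial>gauss)"
  proof (rule integral_dominated_convergence)
    have "integrable gauss (\<lambda>z::'a. ((1 + norm z) * exp (norm z + 1)) * U (yt + \<sigma> *\<^sub>R z))"
      by (rule U_gauss_integrable[OF s' s(2), where K="exp 1" and k=1 and c=1]) (auto simp: exp_add)
    then have "integrable gauss (\<lambda>z. norm (((1 + norm z) * exp (norm z + 1)) * u z))"
      unfolding u_def by (rule integrable_norm)
    then show "integrable gauss (\<lambda>z. \<bar>u z\<bar> * ((1 + norm z) * exp (norm z + 1)))"
      by (simp add: abs_mult mult.commute)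
    show "AE z in gauss. (\<lambda>n. u z * ?e (t n) z) \<longlonglongrightarrow> u z * (z \<bullet> b)"
    proof (rule AE_I2)
      fix z
      have "((\<lambda>r. exp (r * (z \<bullet> b) - r\<^sup>2 / 2)) has_real_derivative z \<bullet> b) (at 0)"
        by (auto intro!: derivative_eq_intros)
      then have "((\<lambda>r. ?e r z) \<longlongrightarrow> z \<bullet> b) (at 0)" by (simp add: DERIV_def)
      then have "(\<lambda>n. ?e (t n) z) \<longlonglongrightarrow> z \<bullet> b" using t0 by (rule filterlim_compose)
      then show "(\<lambda>n. u z * ?e (t n) z) \<longlonglongrightarrow> u z * (z \<bullet> b)" by (intro tendsto_mult tendsto_const)
    qed
    fix n
    show "AE z in gauss. norm (u z * ?e (t n) z) \<le> \<bar>u z\<bar> * ((1 + norm z) * exp (norm z + 1))"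
    proof (rule AE_I2)
      fix z
      define x where "x = t n * (z \<bullet> b) - (t n)\<^sup>2 / 2"
      have "\<bar>x\<bar> \<le> t n * \<bar>z \<bullet> b\<bar> + (t n)\<^sup>2 / 2"
        unfolding x_def using abs_triangle_ineq4[of "t n * (z \<bullet> b)" "(t n)\<^sup>2 / 2"] t[of n] by (simp add: abs_mult)
      also have "\<dots> \<le> t n * norm z + t n * 1"
        using zb[of z] t[of n] by (intro add_mono mult_left_mono) (auto simp: power2_eq_square)
      finally have x: "\<bar>x\<bar> \<le> t n * (1 + norm z)" by (simp add: algebra_simps)
      also have "\<dots> \<le> 1 * (1 + norm z)" using t[of n] by (intro mult_right_mono) auto
      finally have x1: "x \<le> norm z + 1" using abs_ge_self[of x] by simp
      have "\<bar>exp x - 1\<bar> \<le> \<bar>x\<bar> * exp (norm z + 1)" by (rule abs_exp_minus_one_le[OF x1]) simp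
      also have "\<dots> \<le> (t n * (1 + norm z)) * exp (norm z + 1)" using x by (intro mult_right_mono) auto
      finally have "\<bar>exp x - 1\<bar> / t n \<le> (1 + norm z) * exp (norm z + 1)" using t[of n] by (simp add: pos_divide_le_eq mult_ac)
      then show "norm (u z * ?e (t n) z) \<le> \<bar>u z\<bar> * ((1 + norm z) * exp (norm z + 1))"
        unfolding x_def[symmetric] real_norm_def abs_mult abs_divide using t[of n]
        by (intro mult_left_mono) auto
    qed
  qed measurable
  have "(\<integral>z. \<sigma> * (g (yt + \<sigma> *\<^sub>R z) \<bullet> b) \<partial>gauss) = (\<integral>z. u z * (z \<bullet> b) \<partial>gauss)"
    using lim1 lim2 unfolding A by (rule LIMSEQ_unique)
  then show ?thesis by (simp add: u_def mult.commute)
qed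

text \<open>Constants that depend on \<open>U\<close>, \<open>\<beta>\<close> and the dimension only. The two integrals bound the error terms
and the normalising constant of a Gaussian tilted by \<open>exp (- h)\<close> with \<open>|h| \<le> growth_const (1 +
|z|)\<^sup>2\<close>; the fifth power arises as \<open>|z|\<close> times \<open>h\<^sup>2\<close>.\<close>

definition "growth_const = \<beta> * (C + L)"
definition "gauss_moment_const = (\<integral>z. (1 + norm z) ^ 5 * exp (growth_const * norm z) \<partial>(gauss :: 'a measure))"
definition "tilt_floor = (\<integral>z. exp (- growth_const * (1 + norm z)\<^sup>2) \<partial>(gauss :: 'a measure))"
definition "bias_const = DIM('a) * growth_const\<^sup>2 * (gauss_moment_const + gauss_moment_const\<^sup>2) / (tilt_floor * \<beta>)"

lemma growth_const_pos: "0 < growth_const" using \<beta> C L by (simp add: growth_const_def)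

lemma gauss_integral_pos:
  fixes f :: "'a \<Rightarrow> real"
  assumes f: "integrable gauss f" and pos: "\<And>s. 0 < f s"
  shows "0 < (\<integral>s. f s \<partial>gauss)"
proof -
  have [measurable]: "f \<in> borel_measurable borel" using f by auto
  have "integrable lborel (\<lambda>z. std_gaussian_density z * f z)"
    using f by (subst (asm) integrable_density) (auto simp: less_imp_le[OF std_gaussian_density_pos])
  then have "0 < (\<integral>z. std_gaussian_density z * f z \<partial>lborel)"
    by (rule integral_pos_density) (simp add: pos std_gaussian_density_pos)
  then show ?thesis by (subst integral_density) (auto simp: less_imp_le[OF std_gaussian_density_pos])
qed

lemma gauss_moment_integrable: "integrable gauss (\<lambda>z::'a. (1 + norm z) ^ k * exp (growth_const * norm z))"
  by (rule integrable_gauss_poly_exp)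

lemma tilt_floor_integrable: "integrable gauss (\<lambda>z::'a. exp (- growth_const * (1 + norm z)\<^sup>2))"
  by (rule gauss_bounded_growth_integrable[where K=1 and k=0 and c=0]) (auto simp: growth_const_pos less_imp_le)

lemma tilt_floor_pos: "0 < tilt_floor"
  unfolding tilt_floor_def by (rule gauss_integral_pos[OF tilt_floor_integrable]) simp

lemma gauss_moment_const_ge:
  assumes "k \<le> 5"
  shows "(\<integral>z. (1 + norm z) ^ k * exp (growth_const * norm z) \<partial>(gauss :: 'a measure)) \<le> gauss_moment_const"
  unfolding gauss_moment_const_def
  by (intro integral_mono gauss_moment_integrable mult_right_mono power_increasing assms) auto

lemma gauss_moment_const_pos: "0 < gauss_moment_const"
  unfolding gauss_moment_const_def
  by (rule gauss_integral_pos[OF gauss_moment_integrable]) (simp add: add_pos_nonneg)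

lemma bias_const_nonneg: "0 \<le> bias_const"
  unfolding bias_const_def using tilt_floor_pos gauss_moment_const_pos \<beta> by simp

end

context restricted_gaussian
begin

text \<open>\<open>\<gamma>\<close> times this vector is the difference between the gradient step from \<open>yt + \<sigma> z\<close> and the
swept point.\<close>

definition remainder :: "'a \<Rightarrow> 'a \<Rightarrow> 'a \<Rightarrow> 'a" where
  "remainder yt y z = - g (yt + \<sigma> *\<^sub>R z) + (1 / (\<beta> * \<sigma>\<^sup>2)) *\<^sub>R (\<sigma> *\<^sub>R z - (gibbs_sweep yt y z - yt))"

text \<open>In the coordinate \<open>(y - yt) / \<sigma>\<close> the proximal law is the standard Gaussian with the factor \<open>exp
(- tilt)\<close>.\<close>

definition tilt :: "'a \<Rightarrow> 'a \<Rightarrow> real" where "tilt yt z = \<beta> * (U (yt + \<sigma> *\<^sub>R z) - U yt)"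

lemma tilt_measurable[measurable]: "tilt yt \<in> borel_measurable borel"
  unfolding tilt_def[abs_def] by measurable

lemma tilt_ge: "- tilt yt z \<le> growth_const * (\<sigma> * (1 + norm yt)) * norm z"
proof -
  have "U yt - U (yt + \<sigma> *\<^sub>R z) \<le> (C + L * norm yt) * (\<sigma> * norm z)"
    using U_diff[of yt "yt + \<sigma> *\<^sub>R z"] \<sigma> by simp
  also have "\<dots> \<le> ((C + L) * (1 + norm yt)) * (\<sigma> * norm z)"
    using C L \<sigma> by (intro mult_right_mono) (auto simp: algebra_simps)
  finally have "\<beta> * (U yt - U (yt + \<sigma> *\<^sub>R z)) \<le> \<beta> * (((C + L) * (1 + norm yt)) * (\<sigma> * norm z))"
    using \<beta> by (intro mult_left_mono) auto
  then show ?thesis by (simp add: tilt_def growth_const_def algebra_simps)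
qed

lemma tilt_abs_le: "\<bar>tilt yt z\<bar> \<le> growth_const * (\<sigma> * (1 + norm yt)) * (1 + norm z)\<^sup>2"
proof -
  have n: "norm (yt + \<sigma> *\<^sub>R z) \<le> norm yt + norm z"
    using norm_triangle_ineq[of yt "\<sigma> *\<^sub>R z"] \<sigma> mult_right_mono[of \<sigma> 1 "norm z"] by simp
  have "\<bar>U (yt + \<sigma> *\<^sub>R z) - U yt\<bar> \<le> (C + L * (norm yt + norm z)) * norm ((yt + \<sigma> *\<^sub>R z) - yt)"
    by (rule U_lipschitz) (use n in auto)
  also have "norm ((yt + \<sigma> *\<^sub>R z) - yt) = \<sigma> * norm z" using \<sigma> by simp
  also have "(C + L * (norm yt + norm z)) * (\<sigma> * norm z) \<le> ((C + L) * (1 + norm yt) * (1 + norm z)) * (\<sigma> * (1 + norm z))"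
    using C L \<sigma> mult_nonneg_nonneg[of C "norm yt * norm z"] mult_nonneg_nonneg[of L "norm yt * norm z"]
     by (intro mult_mono) (auto simp: algebra_simps)
  finally have "\<beta> * \<bar>U (yt + \<sigma> *\<^sub>R z) - U yt\<bar> \<le> \<beta> * (((C + L) * (1 + norm yt) * (1 + norm z)) * (\<sigma> * (1 + norm z)))"
    using \<beta> by (intro mult_left_mono) auto
  then show ?thesis using \<beta> by (simp add: tilt_def growth_const_def abs_mult power2_eq_square mult_ac)
qed

lemma RG_integral_eq_tilted_gauss:
  obtains k where "0 < k" "\<And>f::'a \<Rightarrow> real. f \<in> borel_measurable borel \<Longrightarrow>
    (\<integral>y. f y * \<omega> yt y \<partial>lborel) = k * (\<integral>z. f (yt + \<sigma> *\<^sub>R z) * exp (- tilt yt z) \<partial>gauss)"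
proof
  let ?k = "\<sigma> ^ DIM('a) * (sqrt (2 * pi) ^ DIM('a) * exp (- \<beta> * U yt))"
  show "0 < ?k" using \<sigma> by simp
  fix f :: "'a \<Rightarrow> real" assume [measurable]: "f \<in> borel_measurable borel"
  have w: "\<omega> yt (yt + \<sigma> *\<^sub>R z) = (sqrt (2 * pi) ^ DIM('a) * exp (- \<beta> * U yt)) * (std_gaussian_density z * exp (- tilt yt z))" for z
  proof -
    have "exp (- \<beta> * U (yt + \<sigma> *\<^sub>R z)) = exp (- \<beta> * U yt) * exp (- tilt yt z)"
      unfolding exp_add[symmetric] tilt_def by (simp add: algebra_simps)
    moreover have "(norm (yt + \<sigma> *\<^sub>R z - yt))\<^sup>2 / (2 * \<sigma>\<^sup>2) = (norm z)\<^sup>2 / 2" using \<sigma> by (simp add: power_mult_distrib)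
    ultimately show ?thesis by (simp add: \<omega>_def std_gaussian_density_eq)
  qed
  have "(\<integral>y. f y * \<omega> yt y \<partial>lborel) = \<sigma> ^ DIM('a) * (\<integral>z. f (yt + \<sigma> *\<^sub>R z) * \<omega> yt (yt + \<sigma> *\<^sub>R z) \<partial>lborel)"
    using \<sigma> by (subst lborel_affine[of \<sigma> yt]) (auto simp: integral_density integral_distr)
  also have "\<dots> = ?k * (\<integral>z. std_gaussian_density z * (f (yt + \<sigma> *\<^sub>R z) * exp (- tilt yt z)) \<partial>lborel)"
  proof -
    have e: "f (yt + \<sigma> *\<^sub>R z) * \<omega> yt (yt + \<sigma> *\<^sub>R z) = (sqrt (2 * pi) ^ DIM('a) * exp (- \<beta> * U yt)) *
        (std_gaussian_density z * (f (yt + \<sigma> *\<^sub>R z) * exp (- tilt yt z)))" for z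
      unfolding w by (simp only: mult_ac)
    show ?thesis unfolding e integral_mult_right_zero by (simp only: mult.assoc)
  qed
  also have "(\<integral>z. std_gaussian_density z * (f (yt + \<sigma> *\<^sub>R z) * exp (- tilt yt z)) \<partial>lborel) = (\<integral>z. f (yt + \<sigma> *\<^sub>R z) * exp (- tilt yt z) \<partial>gauss)"
    by (subst integral_density) (auto simp: less_imp_le[OF std_gaussian_density_pos])
  finally show "(\<integral>y. f y * \<omega> yt y \<partial>lborel) = ?k * (\<integral>z. f (yt + \<sigma> *\<^sub>R z) * exp (- tilt yt z) \<partial>gauss)" .
qed

lemma RG_integrable:
  fixes f :: "'a \<Rightarrow> 'c::{banach, second_countable_topology}"
  assumes [measurable]: "f \<in> borel_measurable borel" and "\<And>y. norm (f y) \<le> K * (1 + norm y) ^ k"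
  shows "integrable (RG yt) f"
proof (rule Bochner_Integration.integrable_bound)
  have "integrable (RG yt) (\<lambda>y. (1 + norm y) ^ k)"
    unfolding RG_def using integrable_\<omega>_moment[of k yt] Zt_pos less_imp_le[OF \<omega>_pos]
    by (subst integrable_density) (auto simp: mult.commute divide_nonneg_pos)
  then show "integrable (RG yt) (\<lambda>y. K * (1 + norm y) ^ k)" by simp
  show "AE x in RG yt. norm (f x) \<le> norm (K * (1 + norm x) ^ k)"
    using assms(2) by (intro AE_I2) (auto intro: order.trans[OF _ abs_ge_self])
qed measurable

lemma RG_mean_displacement:
  assumes b: "b \<in> Basis"
  shows "(\<integral>y. (y - yt) \<bullet> b \<partial>RG yt) = \<sigma> * (\<integral>z. (z \<bullet> b) * exp (- tilt yt z) \<partial>gauss) / (\<integral>z. exp (- tilt yt z) \<partial>gauss)"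
proof -
  obtain k where k: "0 < k" "\<And>f::'a \<Rightarrow> real. f \<in> borel_measurable borel \<Longrightarrow>
    (\<integral>y. f y * \<omega> yt y \<partial>lborel) = k * (\<integral>z. f (yt + \<sigma> *\<^sub>R z) * exp (- tilt yt z) \<partial>gauss)"
    using RG_integral_eq_tilted_gauss[of yt] by blast
  have Z: "Zt yt = k * (\<integral>z. exp (- tilt yt z) \<partial>gauss)" unfolding Zt_def using k(2)[of "\<lambda>_. 1"] by simp
  have "(\<integral>y. (y - yt) \<bullet> b \<partial>RG yt) = (\<integral>y. ((y - yt) \<bullet> b) * \<omega> yt y / Zt yt \<partial>lborel)"
    unfolding RG_def using Zt_pos less_imp_le[OF \<omega>_pos]
    by (subst integral_density) (auto simp: divide_nonneg_pos mult.commute)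
  also have "\<dots> = (\<integral>y. ((y - yt) \<bullet> b) * \<omega> yt y \<partial>lborel) / Zt yt" by simp
  also have "(\<integral>y. ((y - yt) \<bullet> b) * \<omega> yt y \<partial>lborel) = k * (\<integral>z. \<sigma> * ((z \<bullet> b) * exp (- tilt yt z)) \<partial>gauss)"
    using k(2)[of "\<lambda>y. (y - yt) \<bullet> b"] by (simp add: mult.assoc)
  finally show ?thesis unfolding Z using k(1) by simp
qed

text \<open>The mean of the proximal law is \<open>yt + \<sigma> E(z exp (- h)) / E(exp (- h))\<close> with \<open>h\<close> the tilt. To
first order in \<open>h\<close> this is \<open>yt - \<sigma> E(z h)\<close>, and integration by parts turns \<open>E(z h)\<close> into \<open>\<beta>
\<sigma>\<close> times the Gaussian mean of the gradient, so that the leading term cancels. What remains is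
of second order in \<open>h\<close>, that is, of order \<open>\<sigma>\<^sup>2 (1 + |yt|)\<^sup>2\<close>, and is divided by
\<open>\<sigma>\<close>. Near points, for which \<open>\<sigma> (1 + |yt|) \<le> 1\<close>, keep the exponential moments bounded.\<close>

lemma remainder_mean_bound_coordinate:
  assumes b: "b \<in> Basis" and near: "\<sigma> * (1 + norm yt) \<le> 1"
  shows "\<bar>- (\<integral>z. g (yt + \<sigma> *\<^sub>R z) \<bullet> b \<partial>gauss) - (1 / (\<beta> * \<sigma>\<^sup>2)) * (\<integral>y. (y - yt) \<bullet> b \<partial>RG yt)\<bar>
    \<le> growth_const\<^sup>2 * (gauss_moment_const + gauss_moment_const\<^sup>2) / (tilt_floor * \<beta>) * (\<sigma> * (1 + norm yt)\<^sup>2)"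
proof -
  define s where "s = \<sigma> * (1 + norm yt)"
  define K where "K = growth_const"
  define M where "M = gauss_moment_const"
  define h where "h = tilt yt"
  have [measurable]: "h \<in> borel_measurable borel" by (simp add: h_def)
  have s: "0 < s" "s \<le> 1" using near \<sigma> by (auto simp: s_def add_pos_nonneg)
  have K: "0 < K" using growth_const_pos by (simp add: K_def)
  have M: "0 < M" using gauss_moment_const_pos by (simp add: M_def)
  have h1: "- h z \<le> K * norm z" for z
  proof -
    have "- h z \<le> K * s * norm z" using tilt_ge[of yt z] by (simp add: h_def s_def K_def)
    also have "\<dots> \<le> K * 1 * norm z" using s K by (intro mult_right_mono mult_left_mono) auto
    finally show ?thesis by simp
  qed
  have h2: "\<bar>h z\<bar> \<le> K * s * (1 + norm z)\<^sup>2" for z using tilt_abs_le[of yt z] by (simp add: h_def s_def K_def)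
  have E0: "\<bar>exp (- h z) - 1\<bar> \<le> \<bar>h z\<bar> * exp (K * norm z)" for z
    using abs_exp_minus_one_le[OF h1[of z]] K by simp
  have E1: "\<bar>exp (- h z) - 1 + h z\<bar> \<le> (h z)\<^sup>2 * exp (K * norm z)" for z
    using abs_exp_taylor_le[OF h1[of z]] K by simp
  have zb: "\<bar>z \<bullet> b\<bar> \<le> 1 + norm z" for z using Basis_le_norm[OF b, of z] by simp
  have Kexp: "1 \<le> exp (K * norm z)" for z :: 'a using K by simp
  have i0: "integrable gauss (\<lambda>z::'a. (1 + norm z) ^ k * exp (K * norm z))" for k
    unfolding K_def by (rule gauss_moment_integrable)
  have mom: "(\<integral>z. (1 + norm z) ^ k * exp (K * norm z) \<partial>(gauss::'a measure)) \<le> M" if "k \<le> 5" for k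
    unfolding K_def M_def by (rule gauss_moment_const_ge[OF that])
  have bnd: "integrable gauss f \<and> \<bar>\<integral>z. f z \<partial>gauss\<bar> \<le> c * M"
    if [measurable]: "f \<in> borel_measurable borel" and "\<And>z. \<bar>f z\<bar> \<le> c * ((1 + norm z) ^ k * exp (K * norm z))" "k \<le> 5" "0 \<le> c" for f :: "'a \<Rightarrow> real" and c k
  proof
    show i: "integrable gauss f" by (rule gauss_bounded_growth_integrable[where K=c and k=k and c=K]) (use that in auto)
    have "\<bar>\<integral>z. f z \<partial>gauss\<bar> \<le> (\<integral>z. \<bar>f z\<bar> \<partial>gauss)" using integral_norm_bound[of gauss f] by simp
    also have "\<dots> \<le> (\<integral>z. c * ((1 + norm z) ^ k * exp (K * norm z)) \<partial>(gauss::'a measure))"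
    proof (rule integral_mono)
      show "\<bar>f z\<bar> \<le> c * ((1 + norm z) ^ k * exp (K * norm z))" for z by (rule that(2))
    qed (use i i0[of k] in auto)
    also have "\<dots> = c * (\<integral>z. (1 + norm z) ^ k * exp (K * norm z) \<partial>(gauss::'a measure))" by simp
    also have "\<dots> \<le> c * M" using mom[OF that(3)] that(4) by (intro mult_left_mono) auto
    finally show "\<bar>\<integral>z. f z \<partial>gauss\<bar> \<le> c * M" .
  qed
  define Z where "Z = (\<integral>z. exp (- h z) \<partial>gauss)"
  have hK: "\<bar>h z\<bar> \<le> K * s * ((1 + norm z) ^ 2 * exp (K * norm z))" for z
  proof -
    have "K * s * (1 + norm z)\<^sup>2 * 1 \<le> K * s * (1 + norm z)\<^sup>2 * exp (K * norm z)"
      using Kexp[of z] K s by (intro mult_left_mono) auto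
    then show ?thesis using h2[of z] by (simp only: mult.assoc mult_1_right)
  qed
  have B1: "integrable gauss (\<lambda>z. exp (- h z) - 1) \<and> \<bar>\<integral>z. exp (- h z) - 1 \<partial>gauss\<bar> \<le> (K * s) * M"
  proof (rule bnd[where k=2])
    fix z
    have "\<bar>exp (- h z) - 1\<bar> \<le> (K * s * (1 + norm z)\<^sup>2) * exp (K * norm z)"
      by (rule order_trans[OF E0 mult_right_mono[OF h2]]) simp
    then show "\<bar>exp (- h z) - 1\<bar> \<le> K * s * ((1 + norm z)\<^sup>2 * exp (K * norm z))" by (simp add: mult_ac)
  qed (use K s in auto)
  have B2: "integrable gauss (\<lambda>z. (z \<bullet> b) * h z) \<and> \<bar>\<integral>z. (z \<bullet> b) * h z \<partial>gauss\<bar> \<le> (K * s) * M"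
  proof (rule bnd[where k=3])
    fix z
    have "\<bar>(z \<bullet> b) * h z\<bar> \<le> (1 + norm z) * (K * s * ((1 + norm z) ^ 2 * exp (K * norm z)))"
      unfolding abs_mult using zb[of z] hK[of z] by (intro mult_mono) auto
    then show "\<bar>(z \<bullet> b) * h z\<bar> \<le> K * s * ((1 + norm z) ^ 3 * exp (K * norm z))"
      by (simp add: power3_eq_cube power2_eq_square mult_ac)
  qed (use K s in auto)
  have B3: "integrable gauss (\<lambda>z. (z \<bullet> b) * (exp (- h z) - 1 + h z)) \<and> \<bar>\<integral>z. (z \<bullet> b) * (exp (- h z) - 1 + h z) \<partial>gauss\<bar> \<le> (K * s)\<^sup>2 * M"
  proof (rule bnd[where k=5])
    fix z
    have "(h z)\<^sup>2 \<le> (K * s * (1 + norm z)\<^sup>2)\<^sup>2" using h2[of z] by (simp add: abs_le_square_iff[symmetric])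
    then have "\<bar>exp (- h z) - 1 + h z\<bar> \<le> (K * s * (1 + norm z)\<^sup>2)\<^sup>2 * exp (K * norm z)"
      by (intro order_trans[OF E1 mult_right_mono]) auto
    then have "\<bar>(z \<bullet> b) * (exp (- h z) - 1 + h z)\<bar> \<le> (1 + norm z) * ((K * s * (1 + norm z)\<^sup>2)\<^sup>2 * exp (K * norm z))"
      unfolding abs_mult using zb[of z] by (intro mult_mono) auto
    then show "\<bar>(z \<bullet> b) * (exp (- h z) - 1 + h z)\<bar> \<le> (K * s)\<^sup>2 * ((1 + norm z) ^ 5 * exp (K * norm z))"
      by (simp add: power_mult_distrib power_mult[symmetric] power_Suc[symmetric] mult_ac numeral_eq_Suc)
  qed (use K s in auto)
  have zi: "integrable gauss (\<lambda>z::'a. z \<bullet> b)"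
    by (rule gauss_bounded_growth_integrable[where K=1 and k=1 and c=0]) (use zb in auto)
  have Zi: "integrable gauss (\<lambda>z. exp (- h z))"
  proof -
    have "integrable gauss (\<lambda>z. (exp (- h z) - 1) + 1)" using B1 by (intro Bochner_Integration.integrable_add) auto
    then show ?thesis by simp
  qed
  have Z1: "Z - 1 = (\<integral>z. exp (- h z) - 1 \<partial>gauss)"
    unfolding Z_def using Zi by (simp add: gauss.prob_space[simplified])
  have Zlow: "tilt_floor \<le> Z"
    unfolding Z_def tilt_floor_def
  proof (rule integral_mono[OF tilt_floor_integrable Zi])
    fix z :: 'a
    have "K * s * (1 + norm z)\<^sup>2 \<le> K * 1 * (1 + norm z)\<^sup>2" using s K by (intro mult_right_mono mult_left_mono) auto
    then show "exp (- growth_const * (1 + norm z)\<^sup>2) \<le> exp (- h z)" using h2[of z] by (simp add: K_def abs_le_iff)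
  qed
  then have Zpos: "0 < Z" using tilt_floor_pos by simp
  let ?I = "\<integral>z. (z \<bullet> b) * exp (- h z) \<partial>gauss"
  have I: "?I = (\<integral>z. (z \<bullet> b) * (exp (- h z) - 1 + h z) \<partial>gauss) - (\<integral>z. (z \<bullet> b) * h z \<partial>gauss)"
  proof -
    have "?I = (\<integral>z. (z \<bullet> b) * (exp (- h z) - 1 + h z) - (z \<bullet> b) * h z + z \<bullet> b \<partial>gauss)"
      by (simp add: algebra_simps)
    also have "\<dots> = (\<integral>z. (z \<bullet> b) * (exp (- h z) - 1 + h z) \<partial>gauss) - (\<integral>z. (z \<bullet> b) * h z \<partial>gauss) + (\<integral>z. z \<bullet> b \<partial>gauss)"
      using B2 B3 zi by (subst Bochner_Integration.integral_add) auto
    finally show ?thesis by (simp add: gauss_odd_zero[OF b])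
  qed
  have stein: "(\<integral>z. (z \<bullet> b) * h z \<partial>gauss) = \<beta> * \<sigma> * (\<integral>z. g (yt + \<sigma> *\<^sub>R z) \<bullet> b \<partial>gauss)"
  proof -
    have "integrable gauss (\<lambda>z. (z \<bullet> b) * U (yt + \<sigma> *\<^sub>R z))"
      by (rule U_gauss_integrable[where K=1 and k=1 and c=0]) (use \<sigma> zb in auto)
    then have "(\<integral>z. (z \<bullet> b) * h z \<partial>gauss) = \<beta> * ((\<integral>z. (z \<bullet> b) * U (yt + \<sigma> *\<^sub>R z) \<partial>gauss) - U yt * (\<integral>z. z \<bullet> b \<partial>gauss))"
      using zi by (simp add: h_def tilt_def right_diff_distrib mult.left_commute[of _ \<beta>] mult.commute[of _ "U yt"])
    then show ?thesis using gauss_stein_potential[OF \<sigma> b] gauss_odd_zero[OF b] by simp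
  qed
  let ?J = "\<integral>z. (z \<bullet> b) * h z \<partial>gauss" and ?T = "\<integral>z. (z \<bullet> b) * (exp (- h z) - 1 + h z) \<partial>gauss"
  have "- (\<integral>z. g (yt + \<sigma> *\<^sub>R z) \<bullet> b \<partial>gauss) - (1 / (\<beta> * \<sigma>\<^sup>2)) * (\<integral>y. (y - yt) \<bullet> b \<partial>RG yt) = - (1 / (\<beta> * \<sigma>)) * (?J + ?I / Z)"
    unfolding RG_mean_displacement[OF b] h_def[symmetric] Z_def[symmetric] stein
    using \<beta> \<sigma> Zpos by (simp add: power2_eq_square field_simps)
  also have "\<dots> = - (1 / (\<beta> * \<sigma>)) * ((?T + (Z - 1) * ?J) / Z)"
    unfolding I using Zpos by (simp add: field_simps)
  finally have eq: "- (\<integral>z. g (yt + \<sigma> *\<^sub>R z) \<bullet> b \<partial>gauss) - (1 / (\<beta> * \<sigma>\<^sup>2)) * (\<integral>y. (y - yt) \<bullet> b \<partial>RG yt) = - (1 / (\<beta> * \<sigma>)) * ((?T + (Z - 1) * ?J) / Z)" .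
  have "\<bar>?T + (Z - 1) * ?J\<bar> \<le> \<bar>?T\<bar> + \<bar>Z - 1\<bar> * \<bar>?J\<bar>" by (simp add: abs_mult[symmetric])
  also have "\<dots> \<le> (K * s)\<^sup>2 * M + ((K * s) * M) * ((K * s) * M)"
    using B1 B2 B3 K s M unfolding Z1 by (intro add_mono mult_mono) auto
  also have "\<dots> = (K * s)\<^sup>2 * (M + M\<^sup>2)" by (simp add: power2_eq_square algebra_simps)
  finally have num: "\<bar>?T + (Z - 1) * ?J\<bar> \<le> (K * s)\<^sup>2 * (M + M\<^sup>2)" .
  have "\<bar>- (1 / (\<beta> * \<sigma>)) * ((?T + (Z - 1) * ?J) / Z)\<bar> = (1 / (\<beta> * \<sigma>)) * (\<bar>?T + (Z - 1) * ?J\<bar> / Z)"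
    using \<beta> \<sigma> Zpos by (simp add: abs_mult)
  also have "\<dots> \<le> (1 / (\<beta> * \<sigma>)) * ((K * s)\<^sup>2 * (M + M\<^sup>2) / tilt_floor)"
    using num Zlow tilt_floor_pos \<beta> \<sigma> M by (intro mult_left_mono frac_le) auto
  also have "\<dots> = K\<^sup>2 * (M + M\<^sup>2) / (tilt_floor * \<beta>) * (\<sigma> * (1 + norm yt)\<^sup>2)"
    using \<beta> \<sigma> tilt_floor_pos by (simp add: s_def power_mult_distrib power2_eq_square mult_ac)
  finally show ?thesis unfolding eq K_def M_def .
qed

end

section \<open>Perturbed even powers of the norm\<close>

text \<open>Second-order Taylor expansion of an even power of the norm, by induction on the exponent.\<close>

lemma norm_power_expansion:
  "\<exists>c\<ge>0. \<forall>D M :: 'a::real_inner. norm (D + M) ^ (2 * m + 2) \<le> norm D ^ (2 * m + 2)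
     + 2 * real (m + 1) * norm D ^ (2 * m) * (D \<bullet> M) + c * (norm M)\<^sup>2 * (norm D + norm M) ^ (2 * m)"
proof (induction m)
  case 0
  have "(norm (D + M))\<^sup>2 = (norm D)\<^sup>2 + 2 * (D \<bullet> M) + (norm M)\<^sup>2" for D M :: 'a
    unfolding power2_norm_eq_inner by (simp add: inner_add_left inner_add_right inner_commute)
  then show ?case by (intro exI[of _ 1]) (simp add: power2_eq_square)
next
  case (Suc m)
  then obtain c where c: "0 \<le> c" "\<And>D M :: 'a. norm (D + M) ^ (2 * m + 2) \<le> norm D ^ (2 * m + 2)
     + 2 * real (m + 1) * norm D ^ (2 * m) * (D \<bullet> M) + c * (norm M)\<^sup>2 * (norm D + norm M) ^ (2 * m)" by blast
  show ?case
  proof (rule exI[of _ "c + 6 * real m + 7"], intro conjI allI)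
    show "0 \<le> c + 6 * real m + 7" using c by simp
    fix D M :: 'a
    define r s i P where "r = norm D" and "s = norm M" and "i = D \<bullet> M" and "P = norm D ^ (2 * m)"
    have nn: "0 \<le> r" "0 \<le> s" "0 \<le> P" by (auto simp: r_def s_def P_def)
    have i: "\<bar>i\<bar> \<le> r * s" unfolding i_def r_def s_def by (rule Cauchy_Schwarz_ineq2)
    have q: "(norm (D + M))\<^sup>2 = r\<^sup>2 + 2 * i + s\<^sup>2"
      unfolding r_def s_def i_def power2_norm_eq_inner by (simp add: inner_add_left inner_add_right inner_commute)
    have q2: "(norm (D + M))\<^sup>2 \<le> (r + s)\<^sup>2"
      unfolding r_def s_def by (intro power_mono norm_triangle_ineq) auto
    have "norm (D + M) ^ (2 * Suc m + 2) = norm (D + M) ^ (2 * m + 2) * (norm (D + M))\<^sup>2"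
      by (simp add: power_add[symmetric])
    also have "\<dots> \<le> (P * r\<^sup>2 + 2 * real (m + 1) * P * i + c * s\<^sup>2 * (r + s) ^ (2 * m)) * (norm (D + M))\<^sup>2"
      using c(2)[of D M, unfolded power_add[of "norm D" "2 * m" 2]] unfolding r_def s_def i_def P_def
      by (intro mult_right_mono) auto
    also have "\<dots> = (P * r\<^sup>2 + 2 * real (m + 1) * P * i) * (r\<^sup>2 + 2 * i + s\<^sup>2) + c * s\<^sup>2 * (r + s) ^ (2 * m) * (norm (D + M))\<^sup>2"
      unfolding q by (simp add: distrib_right)
    also have "\<dots> \<le> (P * r\<^sup>2 + 2 * real (m + 1) * P * i) * (r\<^sup>2 + 2 * i + s\<^sup>2) + c * s\<^sup>2 * (r + s) ^ (2 * m) * (r + s)\<^sup>2"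
      using c(1) nn q2 by (intro add_left_mono mult_left_mono) auto
    also have "(P * r\<^sup>2 + 2 * real (m + 1) * P * i) * (r\<^sup>2 + 2 * i + s\<^sup>2)
       = P * r\<^sup>2 * r\<^sup>2 + 2 * real (m + 2) * (P * r\<^sup>2) * i + P * (r\<^sup>2 * s\<^sup>2 + 4 * real (m + 1) * i\<^sup>2 + 2 * real (m + 1) * i * s\<^sup>2)"
      by (simp add: algebra_simps power2_eq_square)
    also have "P * (r\<^sup>2 * s\<^sup>2 + 4 * real (m + 1) * i\<^sup>2 + 2 * real (m + 1) * i * s\<^sup>2) \<le> (r + s) ^ (2 * m) * ((6 * real m + 7) * (s\<^sup>2 * (r + s)\<^sup>2))"
    proof (rule order_trans[OF mult_left_mono mult_right_mono])
      show "P \<le> (r + s) ^ (2 * m)" unfolding P_def r_def s_def by (intro power_mono) auto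
      have i2: "i\<^sup>2 \<le> r\<^sup>2 * s\<^sup>2" using i nn by (metis abs_le_square_iff abs_mult abs_of_nonneg power_mult_distrib)
      have rs: "r\<^sup>2 * s\<^sup>2 \<le> s\<^sup>2 * (r + s)\<^sup>2" using nn by (subst mult.commute) (intro mult_left_mono power_mono, auto)
      have isq: "i * s\<^sup>2 \<le> s\<^sup>2 * (r + s)\<^sup>2"
      proof -
        have "i \<le> r * s" using i by simp
        also have "\<dots> \<le> (r + s)\<^sup>2" using nn by (simp add: power2_sum)
        finally show ?thesis by (subst mult.commute) (intro mult_left_mono, auto)
      qed
      have "4 * real (m + 1) * i\<^sup>2 \<le> 4 * real (m + 1) * (s\<^sup>2 * (r + s)\<^sup>2)" using i2 rs by (intro mult_left_mono) auto
      moreover have "2 * real (m + 1) * (i * s\<^sup>2) \<le> 2 * real (m + 1) * (s\<^sup>2 * (r + s)\<^sup>2)" using isq by (intro mult_left_mono) auto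
      ultimately show "r\<^sup>2 * s\<^sup>2 + 4 * real (m + 1) * i\<^sup>2 + 2 * real (m + 1) * i * s\<^sup>2 \<le> (6 * real m + 7) * (s\<^sup>2 * (r + s)\<^sup>2)"
        using rs by (simp add: algebra_simps)
    qed (use nn in auto)
    finally show "norm (D + M) ^ (2 * Suc m + 2) \<le> norm D ^ (2 * Suc m + 2)
     + 2 * real (Suc m + 1) * norm D ^ (2 * Suc m) * (D \<bullet> M) + (c + 6 * real m + 7) * (norm M)\<^sup>2 * (norm D + norm M) ^ (2 * Suc m)"
      unfolding r_def[symmetric] s_def[symmetric] i_def[symmetric]
      by (simp add: P_def r_def[symmetric] power2_eq_square algebra_simps)
  qed
qed

lemma young_power:
  fixes x e \<delta> :: real
  assumes "0 \<le> x" "0 \<le> e" "0 < \<delta>"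
  shows "x ^ n * e \<le> \<delta> * x ^ (n + 1) + e ^ (n + 1) / \<delta> ^ n"
proof (cases "e \<le> \<delta> * x")
  case True
  then have "x ^ n * e \<le> x ^ n * (\<delta> * x)" using assms by (intro mult_left_mono) auto
  then show ?thesis using assms by (simp add: algebra_simps add_increasing2)
next
  case False
  then have "x \<le> e / \<delta>" using assms by (simp add: field_simps)
  then have "x ^ n * e \<le> (e / \<delta>) ^ n * e" using assms by (intro mult_right_mono power_mono) auto
  then show ?thesis using assms by (simp add: power_divide mult.commute add_increasing)
qed

text \<open>The second-order error \<open>\<gamma>\<^sup>2 |N|\<^sup>2 (|\<Delta>| + \<gamma> |N|) ^ (2 m)\<close> is split
according to whether \<open>|\<Delta>|\<close> dominates \<open>sqrt \<gamma> \<kappa>\<close>. If so, it is at most \<open>\<delta>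
\<gamma> |\<Delta>| ^ (2 m + 2)\<close> and can be absorbed by the drift; otherwise everything is bounded by
\<open>sqrt \<gamma> \<kappa>\<close>, which yields the power \<open>\<gamma> ^ (m + 2)\<close>.\<close>

lemma perturbed_power_bound:
  fixes L0 \<delta> :: real
  assumes "0 \<le> L0" "0 < \<delta>"
  shows "\<exists>\<gamma>1 c. 0 < \<gamma>1 \<and> \<gamma>1 \<le> 1 \<and> 0 \<le> c \<and> (\<forall>\<gamma> \<kappa> (\<Delta> :: 'a::real_inner) N. 0 < \<gamma> \<longrightarrow> \<gamma> \<le> \<gamma>1 \<longrightarrow> 0 \<le> \<kappa> \<longrightarrow>
    norm N \<le> L0 * norm \<Delta> + \<kappa> \<longrightarrow>
    norm (\<Delta> + \<gamma> *\<^sub>R N) ^ (2 * m + 2) \<le> (1 + \<delta> * \<gamma>) * norm \<Delta> ^ (2 * m + 2)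
       + 2 * real (m + 1) * \<gamma> * (norm \<Delta> ^ (2 * m) * (\<Delta> \<bullet> N)) + c * \<gamma> ^ (m + 2) * \<kappa> ^ (2 * m + 2))"
proof -
  obtain c where c: "0 \<le> c" "\<And>D M :: 'a. norm (D + M) ^ (2 * m + 2) \<le> norm D ^ (2 * m + 2)
     + 2 * real (m + 1) * norm D ^ (2 * m) * (D \<bullet> M) + c * (norm M)\<^sup>2 * (norm D + norm M) ^ (2 * m)"
    using norm_power_expansion[of m, where 'a='a] by blast
  define K where "K = c * 4 * 3 ^ (2 * m)"
  have K: "0 \<le> K" using c by (simp add: K_def)
  \<comment> \<open>\<open>\<epsilon>\<close> is chosen with \<open>K \<epsilon>\<^sup>2 \<le> \<delta>\<close>, and \<open>\<gamma>1\<close> with \<open>sqrt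
    \<gamma> L0 \<le> \<epsilon>\<close>.\<close>
  define \<epsilon> where "\<epsilon> = min 1 (sqrt (\<delta> / (K + 1)))"
  have \<epsilon>: "0 < \<epsilon>" "\<epsilon> \<le> 1" using assms K by (auto simp: \<epsilon>_def)
  have "\<epsilon>\<^sup>2 \<le> (sqrt (\<delta> / (K + 1)))\<^sup>2" using \<epsilon> by (intro power_mono) (auto simp: \<epsilon>_def)
  also have "\<dots> = \<delta> / (K + 1)" using assms K by simp
  finally have "K * \<epsilon>\<^sup>2 \<le> K * (\<delta> / (K + 1))" using K by (intro mult_left_mono)
  also have "\<dots> \<le> \<delta>" using K assms by (simp add: field_simps)
  finally have K\<epsilon>: "K * \<epsilon>\<^sup>2 \<le> \<delta>" .
  define \<gamma>1 where "\<gamma>1 = min 1 ((\<epsilon> / (L0 + 1))\<^sup>2)"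
  have \<gamma>1: "0 < \<gamma>1" "\<gamma>1 \<le> 1" using \<epsilon> assms by (auto simp: \<gamma>1_def)
  define c' where "c' = c * 4 * (3 / \<epsilon>) ^ (2 * m)"
  have c': "0 \<le> c'" using c \<epsilon> by (simp add: c'_def)
  have main: "norm (\<Delta> + \<gamma> *\<^sub>R N) ^ (2 * m + 2) \<le> (1 + \<delta> * \<gamma>) * norm \<Delta> ^ (2 * m + 2)
       + 2 * real (m + 1) * \<gamma> * (norm \<Delta> ^ (2 * m) * (\<Delta> \<bullet> N)) + c' * \<gamma> ^ (m + 2) * \<kappa> ^ (2 * m + 2)"
    if \<gamma>: "0 < \<gamma>" "\<gamma> \<le> \<gamma>1" and \<kappa>: "0 \<le> \<kappa>" and N: "norm N \<le> L0 * norm \<Delta> + \<kappa>" for \<gamma> \<kappa> and \<Delta> N :: 'a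
  proof -
    define w where "w = sqrt \<gamma>"
    have w: "0 < w" "w * w = \<gamma>" "w \<le> 1" using \<gamma> \<gamma>1 by (auto simp: w_def)
    have "w \<le> sqrt ((\<epsilon> / (L0 + 1))\<^sup>2)" unfolding w_def using \<gamma> by (intro real_sqrt_le_mono) (auto simp: \<gamma>1_def)
    then have "w \<le> \<epsilon> / (L0 + 1)" using \<epsilon> assms by simp
    then have "w * (L0 + 1) \<le> \<epsilon>" using assms by (simp add: pos_le_divide_eq)
    then have wL: "w * L0 \<le> \<epsilon>" using w by (simp add: algebra_simps)
    define r n where "r = norm \<Delta>" and "n = w * norm N"
    have rn: "0 \<le> r" "0 \<le> n" using w by (auto simp: r_def n_def)
    have "n \<le> w * (L0 * r + \<kappa>)" unfolding n_def r_def using N w by (intro mult_left_mono) auto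
    also have "\<dots> \<le> \<epsilon> * r + w * \<kappa>" using mult_right_mono[OF wL rn(1)] by (simp add: algebra_simps)
    finally have n: "n \<le> \<epsilon> * r + w * \<kappa>" .
    have gN: "norm (\<gamma> *\<^sub>R N) = w * n" using \<gamma> w by (simp add: n_def mult.assoc[symmetric])
    have gN1: "w * n \<le> n" using w rn mult_right_mono[of w 1 n] by simp
    have e2: "(w * n)\<^sup>2 = \<gamma> * n\<^sup>2" using w(2) by (simp add: power2_eq_square algebra_simps)
    have "c * (norm (\<gamma> *\<^sub>R N))\<^sup>2 * (norm \<Delta> + norm (\<gamma> *\<^sub>R N)) ^ (2 * m) \<le> c * (\<gamma> * n\<^sup>2) * (r + n) ^ (2 * m)"
      unfolding gN e2 r_def[symmetric] using c(1) rn gN1 w \<gamma> by (intro mult_left_mono power_mono) auto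
    also have "\<dots> \<le> \<delta> * \<gamma> * r ^ (2 * m + 2) + c' * \<gamma> ^ (m + 2) * \<kappa> ^ (2 * m + 2)"
    proof (cases "w * \<kappa> \<le> \<epsilon> * r")
      case True
      then have n2: "n \<le> 2 * \<epsilon> * r" using n by simp
      have n3: "n \<le> 2 * r" using n2 \<epsilon> rn mult_right_mono[of \<epsilon> 1 "2 * r"] by simp
      have "c * (\<gamma> * n\<^sup>2) * (r + n) ^ (2 * m) \<le> c * (\<gamma> * (2 * \<epsilon> * r)\<^sup>2) * (3 * r) ^ (2 * m)"
        using c(1) rn n2 n3 \<gamma> by (intro mult_mono mult_left_mono power_mono) auto
      also have "\<dots> = (K * \<epsilon>\<^sup>2) * \<gamma> * r ^ (2 * m + 2)" by (simp add: K_def power_mult_distrib power_add power2_eq_square)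
      also have "\<dots> \<le> \<delta> * \<gamma> * r ^ (2 * m + 2)" using K\<epsilon> \<gamma> rn by (intro mult_right_mono) auto
      finally show ?thesis using c' \<gamma> \<kappa> by (simp add: add_increasing2)
    next
      case False
      then have r1: "r \<le> w * \<kappa> / \<epsilon>" using \<epsilon> by (simp add: pos_le_divide_eq mult.commute)
      have n2: "n \<le> 2 * (w * \<kappa>)" using n False by simp
      define A where "A = w * \<kappa> / \<epsilon>"
      have "w * \<kappa> \<le> A" unfolding A_def using \<epsilon> w \<kappa> by (simp add: pos_le_divide_eq mult_left_le)
      then have "r + n \<le> 3 * A" using r1 n2 unfolding A_def[symmetric] by linarith
      then have rn2: "r + n \<le> 3 / \<epsilon> * (w * \<kappa>)" by (simp add: A_def)
      have "c * (\<gamma> * n\<^sup>2) * (r + n) ^ (2 * m) \<le> c * (\<gamma> * (2 * (w * \<kappa>))\<^sup>2) * (3 / \<epsilon> * (w * \<kappa>)) ^ (2 * m)"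
        using c(1) rn n2 rn2 \<gamma> w \<kappa> by (intro mult_mono mult_left_mono power_mono) auto
      also have "\<dots> = c' * \<gamma> * (w * \<kappa>) ^ (2 * m + 2)"
        by (simp add: c'_def power_mult_distrib power_divide power_add power2_eq_square)
      also have "(w * \<kappa>) ^ (2 * m + 2) = (w * w) ^ (m + 1) * \<kappa> ^ (2 * m + 2)"
        by (simp add: power_mult_distrib power_add power_mult power2_eq_square)
      finally have "c * (\<gamma> * n\<^sup>2) * (r + n) ^ (2 * m) \<le> c' * \<gamma> ^ (m + 2) * \<kappa> ^ (2 * m + 2)"
        unfolding w(2) by (simp add: mult_ac)
      then show ?thesis using assms \<gamma> rn by (simp add: add_increasing)
    qed
    finally show ?thesis using c(2)[of \<Delta> "\<gamma> *\<^sub>R N"] by (simp add: r_def algebra_simps)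
  qed
  show ?thesis by (rule exI[of _ \<gamma>1], rule exI[of _ c']) (use \<gamma>1 c' main in auto)
qed

section \<open>Moments of the remainder\<close>

context langevin_potential
begin

definition "gibbs_moment q = (\<integral>y. (1 + norm y) ^ q \<partial>\<pi>)"
definition "gauss_moment q = (\<integral>z. (1 + norm z) ^ q \<partial>(gauss :: 'a measure))"

lemma nn_gibbs_moment: "(\<integral>\<^sup>+y. ennreal ((1 + norm y) ^ q) \<partial>\<pi>) = ennreal (gibbs_moment q)"
  unfolding gibbs_moment_def by (rule nn_integral_eq_integral[OF integrable_gibbs_moment]) auto

lemma nn_gauss_moment: "(\<integral>\<^sup>+z. ennreal ((1 + norm z) ^ q) \<partial>(gauss :: 'a measure)) = ennreal (gauss_moment q)"
  unfolding gauss_moment_def using integrable_gauss_poly_exp[of q 0, where 'a='a]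
  by (intro nn_integral_eq_integral) auto

lemma gibbs_moment_nonneg: "0 \<le> gibbs_moment q" unfolding gibbs_moment_def by (rule Bochner_Integration.integral_nonneg) auto
lemma gauss_moment_nonneg: "0 \<le> gauss_moment q" unfolding gauss_moment_def by (rule Bochner_Integration.integral_nonneg) auto

text \<open>A bound for the moment of order \<open>q\<close> of \<open>sweep_size\<close> in the stationary chain, uniform in the step size.\<close>

definition "size_moment q = 2 ^ q * (((2 ^ q) ^ DIM('a) * DIM('a)) * gibbs_moment q
    + 2 ^ q * (2 ^ q * (gibbs_moment q + gauss_moment q) + gauss_moment q))"

lemma size_moment_nonneg: "0 \<le> size_moment q"
  unfolding size_moment_def using gibbs_moment_nonneg[of q] gauss_moment_nonneg[of q] by (intro mult_nonneg_nonneg add_nonneg_nonneg) auto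

definition "remainder_const = C + L + DIM('a) * (2 * C + 40 * L)"

lemma remainder_const_pos: "0 < remainder_const"
  unfolding remainder_const_def using C L by (simp add: add_pos_nonneg)

end

context restricted_gaussian
begin

lemma sweep_size_ge_1: "1 \<le> sweep_size yt y z" "1 + norm yt \<le> 2 * sweep_size yt y z"
proof -
  have "1 \<le> sweep_sum (\<lambda>y. 1 + norm y) yt basis_list y z"
  proof (cases "basis_list :: 'a list")
    case Nil
    then show ?thesis using basis_list(3) by simp
  next
    case (Cons b bs)
    have "0 \<le> sweep_sum (\<lambda>y. 1 + norm y) yt bs (refresh b yt y (z \<bullet> b)) z" by (rule sweep_sum_nonneg) simp
    then show ?thesis unfolding Cons sweep_sum.simps using norm_ge_zero[of y] by linarith
  qed
  then show "1 \<le> sweep_size yt y z" "1 + norm yt \<le> 2 * sweep_size yt y z"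
    unfolding sweep_size_def using norm_ge_zero[of yt] norm_ge_zero[of z] by (linarith, smt (verit))
qed

lemma remainder_le: "norm (remainder yt y z) \<le> remainder_const * sweep_size yt y z"
proof -
  let ?S = "sweep_size yt y z"
  have S: "1 \<le> ?S" "norm yt + norm z \<le> ?S" using sweep_size_ge_1
    unfolding sweep_size_def using sweep_sum_nonneg[of "\<lambda>y::'a. 1 + norm y" yt basis_list y z] by auto
  have "norm (yt + \<sigma> *\<^sub>R z) \<le> norm yt + norm z"
    using norm_triangle_ineq[of yt "\<sigma> *\<^sub>R z"] \<sigma> mult_right_mono[of \<sigma> 1 "norm z"] by simp
  then have "L * norm (yt + \<sigma> *\<^sub>R z) \<le> L * ?S" using L S(2) by (intro mult_left_mono) auto
  then have "norm (g (yt + \<sigma> *\<^sub>R z)) \<le> C + L * ?S" using growth[of "yt + \<sigma> *\<^sub>R z"] by linarith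
  also have "\<dots> \<le> (C + L) * ?S" using C S(1) by (simp add: distrib_right)
  finally have 1: "norm (g (yt + \<sigma> *\<^sub>R z)) \<le> (C + L) * ?S" .
  have "norm ((1 / (\<beta> * \<sigma>\<^sup>2)) *\<^sub>R (\<sigma> *\<^sub>R z - (gibbs_sweep yt y z - yt))) = norm (gibbs_sweep yt y z - yt - \<sigma> *\<^sub>R z) / (\<beta> * \<sigma>\<^sup>2)"
    using \<beta> \<sigma> by (simp add: norm_minus_commute[of "\<sigma> *\<^sub>R z"])
  also have "\<dots> \<le> (\<beta> * \<sigma>\<^sup>2 * (DIM('a) * (2 * C + 40 * L) * ?S)) / (\<beta> * \<sigma>\<^sup>2)"
    using gibbs_sweep_displacement \<beta> \<sigma> by (intro divide_right_mono) auto
  also have "\<dots> = DIM('a) * (2 * C + 40 * L) * ?S" using \<beta> \<sigma> by simp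
  finally have 2: "norm ((1 / (\<beta> * \<sigma>\<^sup>2)) *\<^sub>R (\<sigma> *\<^sub>R z - (gibbs_sweep yt y z - yt))) \<le> DIM('a) * (2 * C + 40 * L) * ?S" .
  show ?thesis unfolding remainder_def remainder_const_def
    using norm_triangle_ineq[of "- g (yt + \<sigma> *\<^sub>R z)" "(1 / (\<beta> * \<sigma>\<^sup>2)) *\<^sub>R (\<sigma> *\<^sub>R z - (gibbs_sweep yt y z - yt))"] 1 2
    by (simp add: distrib_right)
qed

text \<open>The randomness of one step given \<open>yt\<close>: the point from which the sweep starts and the Gaussian that
drives it.\<close>

definition noise :: "'a \<Rightarrow> ('a \<times> 'a) measure" where "noise yt = RG yt \<Otimes>\<^sub>M gauss"

lemma sets_noise[simp, measurable_cong]: "sets (noise yt) = sets (borel \<Otimes>\<^sub>M borel)"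
  unfolding noise_def by (intro sets_pair_measure_cong) auto

lemma pair_sigma_finite_noise: "pair_sigma_finite (RG yt) gauss"
proof -
  interpret RG: prob_space "RG yt" by (rule prob_space_RG)
  show ?thesis ..
qed

lemma prob_space_noise: "prob_space (noise yt)"
proof -
  interpret RG: prob_space "RG yt" by (rule prob_space_RG)
  interpret pair_prob_space "RG yt" gauss ..
  show ?thesis unfolding noise_def by unfold_locales
qed

lemma nn_integral_noise:
  assumes "F \<in> borel_measurable (borel \<Otimes>\<^sub>M borel)"
  shows "(\<integral>\<^sup>+p. F p \<partial>noise yt) = (\<integral>\<^sup>+z. \<integral>\<^sup>+y. F (y, z) \<partial>RG yt \<partial>gauss)"
proof -
  have "F \<in> borel_measurable (RG yt \<Otimes>\<^sub>M gauss)"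
    using assms by (subst measurable_cong_sets[OF sets_noise[unfolded noise_def] refl])
  then show ?thesis unfolding noise_def
    by (rule pair_sigma_finite.nn_integral_snd[OF pair_sigma_finite_noise, symmetric])
qed

lemma sweep_size_comp[measurable (raw)]:
  assumes "f \<in> borel_measurable M" "g' \<in> borel_measurable M" "h \<in> borel_measurable M"
  shows "(\<lambda>x. sweep_size (f x) (g' x) (h x)) \<in> borel_measurable M"
  using measurable_compose[OF measurable_Pair[OF measurable_Pair[OF assms(1,2)] assms(3)] sweep_size_measurable] by simp

lemma gibbs_sweep_comp[measurable (raw)]:
  assumes "f \<in> borel_measurable M" "g' \<in> borel_measurable M" "h \<in> borel_measurable M"
  shows "(\<lambda>x. gibbs_sweep (f x) (g' x) (h x)) \<in> borel_measurable M"
  using measurable_compose[OF measurable_Pair[OF measurable_Pair[OF assms(1,2)] assms(3)] gibbs_sweep_measurable] by simp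

lemma remainder_pair[measurable]: "(\<lambda>p. remainder yt (fst p) (snd p)) \<in> borel_measurable (borel \<Otimes>\<^sub>M borel)"
  unfolding remainder_def by measurable

text \<open>The conditional moments of \<open>sweep_size\<close> given \<open>yt\<close>; finite for every \<open>yt\<close>, so they also exist as Bochner
integrals (\<open>size_mean\<close>).\<close>

definition size_int :: "nat \<Rightarrow> 'a \<Rightarrow> ennreal" where
  "size_int q yt = (\<integral>\<^sup>+p. ennreal (sweep_size yt (fst p) (snd p) ^ q) \<partial>noise yt)"

lemma size_int_le:
  "size_int q yt \<le> ennreal (2 ^ q) * (ennreal ((2 ^ q) ^ DIM('a) * DIM('a)) * (\<integral>\<^sup>+y. ennreal ((1 + norm y) ^ q) \<partial>RG yt)
     + ennreal (2 ^ q) * (ennreal (norm yt ^ q) + ennreal (gauss_moment q)))"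
proof -
  interpret RG: prob_space "RG yt" by (rule prob_space_RG)
  let ?S = "\<lambda>y z. sweep_sum (\<lambda>y. 1 + norm y) yt basis_list y z"
  have [measurable]: "(\<lambda>(y, z). ?S y z) \<in> borel_measurable (borel \<Otimes>\<^sub>M borel)"
    using basis_list by (intro sweep_sum_fixed_measurable) auto
  have S0: "0 \<le> ?S y z" for y z by (rule sweep_sum_nonneg) auto
  have pt: "sweep_size yt y z ^ q \<le> 2 ^ q * (?S y z ^ q + 2 ^ q * (norm yt ^ q + (1 + norm z) ^ q))" for y z
  proof -
    have "sweep_size yt y z ^ q \<le> 2 ^ q * (?S y z ^ q + (norm yt + norm z) ^ q)"
      unfolding sweep_size_def add.assoc by (intro power_add_le_two_power S0) auto
    also have "(norm yt + norm z) ^ q \<le> 2 ^ q * (norm yt ^ q + norm z ^ q)" by (intro power_add_le_two_power) auto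
    also have "\<dots> \<le> 2 ^ q * (norm yt ^ q + (1 + norm z) ^ q)" by (intro mult_left_mono add_left_mono power_mono) auto
    finally show ?thesis by simp
  qed
  have "size_int q yt = (\<integral>\<^sup>+z. \<integral>\<^sup>+y. ennreal (sweep_size yt y z ^ q) \<partial>RG yt \<partial>gauss)"
    unfolding size_int_def by (subst nn_integral_noise) auto
  also have "\<dots> \<le> (\<integral>\<^sup>+z. \<integral>\<^sup>+y. ennreal (2 ^ q) * (ennreal (?S y z ^ q) + ennreal (2 ^ q) * (ennreal (norm yt ^ q) + ennreal ((1 + norm z) ^ q))) \<partial>RG yt \<partial>gauss)"
    using pt S0 by (intro nn_integral_mono) (auto simp: ennreal_mult[symmetric] ennreal_plus[symmetric] simp del: ennreal_plus intro!: ennreal_leI)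
  also have "\<dots> = ennreal (2 ^ q) * ((\<integral>\<^sup>+z. \<integral>\<^sup>+y. ennreal (?S y z ^ q) \<partial>RG yt \<partial>gauss) + ennreal (2 ^ q) * (ennreal (norm yt ^ q) + ennreal (gauss_moment q)))"
    by (simp add: nn_integral_cmult nn_integral_add RG.emeasure_space_1[simplified] gauss.emeasure_space_1[simplified] nn_gauss_moment del: ennreal_plus)
  also have "\<dots> \<le> ennreal (2 ^ q) * (ennreal ((2 ^ q) ^ DIM('a) * DIM('a)) * (\<integral>\<^sup>+y. ennreal ((1 + norm y) ^ q) \<partial>RG yt)
     + ennreal (2 ^ q) * (ennreal (norm yt ^ q) + ennreal (gauss_moment q)))"
    by (intro mult_left_mono add_right_mono sweep_sum_moment) auto
  finally show ?thesis .
qed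

lemma size_int_finite: "size_int q yt < \<top>"
proof -
  have "integrable (RG yt) (\<lambda>y. (1 + norm y) ^ q)" by (rule RG_integrable[where K=1 and k=q]) auto
  then have "(\<integral>\<^sup>+y. ennreal ((1 + norm y) ^ q) \<partial>RG yt) < \<top>"
    by (subst nn_integral_eq_integral) auto
  then show ?thesis
    by (intro le_less_trans[OF size_int_le]) (simp add: less_top[symmetric] ennreal_mult_eq_top_iff ennreal_add_eq_top del: ennreal_plus)
qed

lemma size_int_measurable[measurable]: "size_int q \<in> borel_measurable borel"
proof -
  have "size_int q yt = (\<integral>\<^sup>+z. \<integral>\<^sup>+y. ennreal (\<omega> yt y / Zt yt) * ennreal (sweep_size yt y z ^ q) \<partial>lborel \<partial>gauss)" for yt
  proof -
    have "size_int q yt = (\<integral>\<^sup>+z. \<integral>\<^sup>+y. ennreal (sweep_size yt y z ^ q) \<partial>RG yt \<partial>gauss)"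
      unfolding size_int_def by (subst nn_integral_noise) auto
    also have "\<dots> = (\<integral>\<^sup>+z. \<integral>\<^sup>+y. ennreal (\<omega> yt y / Zt yt) * ennreal (sweep_size yt y z ^ q) \<partial>lborel \<partial>gauss)"
      unfolding RG_def by (intro nn_integral_cong nn_integral_density) measurable
    finally show ?thesis .
  qed
  then have "size_int q = (\<lambda>yt. \<integral>\<^sup>+z. \<integral>\<^sup>+y. ennreal (\<omega> yt y / Zt yt) * ennreal (sweep_size yt y z ^ q) \<partial>lborel \<partial>gauss)"
    by (rule ext)
  also have "\<dots> \<in> borel_measurable borel" by measurable
  finally show ?thesis .
qed

text \<open>Although \<open>size_int\<close> may grow with \<open>yt\<close>, stationarity makes its mean computable: by exchangeability the
moments under the proximal law average to moments of \<open>\<pi>\<close>.\<close>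

lemma size_int_total:
  "(\<integral>\<^sup>+y. \<integral>\<^sup>+z. size_int q (y + \<sigma> *\<^sub>R z) \<partial>gauss \<partial>\<pi>) \<le> ennreal (size_moment q)"
proof -
  interpret P: prob_space \<pi> by (rule prob_space_gibbs)
  let ?h = "\<lambda>yt. \<integral>\<^sup>+y. ennreal ((1 + norm y) ^ q) \<partial>RG yt"
  have [measurable]: "?h \<in> borel_measurable borel"
    by (rule nn_integral_measurable_subprob_algebra2[where N=borel]) auto
  have ex: "(\<integral>\<^sup>+y. \<integral>\<^sup>+z. ?h (y + \<sigma> *\<^sub>R z) \<partial>gauss \<partial>\<pi>) = ennreal (gibbs_moment q)"
    using RG_exchangeable[of "\<lambda>yt y. ennreal ((1 + norm y) ^ q)"]
    by (simp add: gauss.emeasure_space_1[simplified] nn_gibbs_moment)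
  have pt: "ennreal (norm (y + \<sigma> *\<^sub>R z) ^ q) \<le> ennreal (2 ^ q) * (ennreal ((1 + norm y) ^ q) + ennreal ((1 + norm z) ^ q))" for y z :: 'a
  proof -
    have "norm (y + \<sigma> *\<^sub>R z) \<le> (1 + norm y) + (1 + norm z)"
      using norm_triangle_ineq[of y "\<sigma> *\<^sub>R z"] \<sigma> mult_right_mono[of \<sigma> 1 "norm z"] by simp
    then have "norm (y + \<sigma> *\<^sub>R z) ^ q \<le> ((1 + norm y) + (1 + norm z)) ^ q" by (intro power_mono) auto
    also have "\<dots> \<le> 2 ^ q * ((1 + norm y) ^ q + (1 + norm z) ^ q)" by (rule power_add_le_two_power) auto
    finally show ?thesis by (simp add: ennreal_mult[symmetric] ennreal_plus[symmetric] ennreal_leI del: ennreal_plus)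
  qed
  let ?a = "ennreal (2 ^ q)" and ?b = "ennreal ((2 ^ q) ^ DIM('a) * DIM('a))"
  have "(\<integral>\<^sup>+y. \<integral>\<^sup>+z. size_int q (y + \<sigma> *\<^sub>R z) \<partial>gauss \<partial>\<pi>)
    \<le> (\<integral>\<^sup>+y. \<integral>\<^sup>+z. ?a * (?b * ?h (y + \<sigma> *\<^sub>R z) + ?a * (?a * (ennreal ((1 + norm y) ^ q) + ennreal ((1 + norm z) ^ q)) + ennreal (gauss_moment q))) \<partial>gauss \<partial>\<pi>)"
    by (intro nn_integral_mono order_trans[OF size_int_le] mult_left_mono add_left_mono add_right_mono pt) auto
  also have "\<dots> = ?a * (?b * ennreal (gibbs_moment q) + ?a * (?a * (ennreal (gibbs_moment q) + ennreal (gauss_moment q)) + ennreal (gauss_moment q)))"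
    by (simp add: nn_integral_cmult nn_integral_add P.emeasure_space_1[simplified] gauss.emeasure_space_1[simplified] nn_gauss_moment nn_gibbs_moment ex del: ennreal_plus)
  also have "\<dots> = ennreal (size_moment q)"
    unfolding size_moment_def using gibbs_moment_nonneg[of q] gauss_moment_nonneg[of q]
    by (simp add: ennreal_mult[symmetric] ennreal_plus[symmetric] del: ennreal_plus)
  finally show ?thesis .
qed

lemma size_integrable: "integrable (noise yt) (\<lambda>p. sweep_size yt (fst p) (snd p) ^ q)"
  using size_int_finite[of q yt] sweep_size_ge_1(1) order_trans[OF zero_le_one sweep_size_ge_1(1)]
  by (intro integrableI_nonneg) (auto simp: size_int_def)

definition size_mean :: "nat \<Rightarrow> 'a \<Rightarrow> real" where
  "size_mean q yt = (\<integral>p. sweep_size yt (fst p) (snd p) ^ q \<partial>noise yt)"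

lemma size_int_eq: "size_int q yt = ennreal (size_mean q yt)"
  unfolding size_int_def size_mean_def using order_trans[OF zero_le_one sweep_size_ge_1(1)]
  by (intro nn_integral_eq_integral size_integrable) auto

lemma size_mean_nonneg: "0 \<le> size_mean q yt"
  unfolding size_mean_def using order_trans[OF zero_le_one sweep_size_ge_1(1)] by (intro Bochner_Integration.integral_nonneg) auto

lemma remainder_integrable: "integrable (noise yt) (\<lambda>p. remainder yt (fst p) (snd p))"
proof (rule Bochner_Integration.integrable_bound)
  show "integrable (noise yt) (\<lambda>p. remainder_const * sweep_size yt (fst p) (snd p))"
    using size_integrable[of yt 1] by simp
  show "AE p in noise yt. norm (remainder yt (fst p) (snd p)) \<le> norm (remainder_const * sweep_size yt (fst p) (snd p))"
    by (intro AE_I2 order_trans[OF remainder_le]) simp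
qed measurable

lemma remainder_mean_coordinate:
  assumes b: "b \<in> Basis"
  shows "(\<integral>p. remainder yt (fst p) (snd p) \<bullet> b \<partial>noise yt)
     = - (\<integral>z. g (yt + \<sigma> *\<^sub>R z) \<bullet> b \<partial>gauss) - (1 / (\<beta> * \<sigma>\<^sup>2)) * (\<integral>y. (y - yt) \<bullet> b \<partial>RG yt)"
proof -
  interpret RG: prob_space "RG yt" by (rule prob_space_RG)
  interpret N: prob_space "noise yt" by (rule prob_space_noise)
  have zb: "\<bar>z \<bullet> b\<bar> \<le> 1 + norm z" for z using Basis_le_norm[OF b, of z] by simp
  have law: "distr (noise yt) borel (\<lambda>p. gibbs_sweep yt (fst p) (snd p)) = RG yt"
  proof (rule measure_eqI)
    fix A assume "A \<in> sets (distr (noise yt) borel (\<lambda>p. gibbs_sweep yt (fst p) (snd p)))"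
    then have [measurable]: "A \<in> sets borel" by simp
    have "emeasure (distr (noise yt) borel (\<lambda>p. gibbs_sweep yt (fst p) (snd p))) A = (\<integral>\<^sup>+x. indicator A x \<partial>distr (noise yt) borel (\<lambda>p. gibbs_sweep yt (fst p) (snd p)))"
      by simp
    also have "\<dots> = (\<integral>\<^sup>+z. \<integral>\<^sup>+y. indicator A (gibbs_sweep yt y z) \<partial>RG yt \<partial>gauss)"
      by (subst nn_integral_distr, simp, simp, subst nn_integral_noise) auto
    also have "\<dots> = (\<integral>\<^sup>+y. indicator A y \<partial>RG yt)" by (rule gibbs_sweep_law) simp
    finally show "emeasure (distr (noise yt) borel (\<lambda>p. gibbs_sweep yt (fst p) (snd p))) A = emeasure (RG yt) A" by simp
  qed simp
  have yi: "integrable (RG yt) (\<lambda>y. (y - yt) \<bullet> b)"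
  proof (rule RG_integrable[where K="1 + norm yt" and k=1])
    fix y
    have "\<bar>(y - yt) \<bullet> b\<bar> \<le> norm y + norm yt" using Basis_le_norm[OF b, of "y - yt"] norm_triangle_ineq4[of y yt] by simp
    also have "\<dots> \<le> (1 + norm yt) * (1 + norm y)" by (simp add: algebra_simps)
    finally show "norm ((y - yt) \<bullet> b) \<le> (1 + norm yt) * (1 + norm y) ^ 1" by simp
  qed measurable
  have s1: "integrable (noise yt) (\<lambda>p. (gibbs_sweep yt (fst p) (snd p) - yt) \<bullet> b)"
    using yi unfolding law[symmetric] by (subst (asm) integrable_distr_eq) auto
  have s2: "(\<integral>p. (gibbs_sweep yt (fst p) (snd p) - yt) \<bullet> b \<partial>noise yt) = (\<integral>y. (y - yt) \<bullet> b \<partial>RG yt)"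
    unfolding law[symmetric] by (subst integral_distr) auto
  have snd: "integrable (noise yt) (\<lambda>p. f (snd p)) \<and> (\<integral>p. f (snd p) \<partial>noise yt) = (\<integral>z. f z \<partial>gauss)"
    if f: "integrable gauss f" for f :: "'a \<Rightarrow> real"
  proof
    have [measurable]: "f \<in> borel_measurable borel" using f by auto
    show i: "integrable (noise yt) (\<lambda>p. f (snd p))"
    proof (rule integrableI_bounded)
      have "(\<integral>\<^sup>+p. ennreal (norm (f (snd p))) \<partial>noise yt) = (\<integral>\<^sup>+z. ennreal (norm (f z)) \<partial>gauss)"
        by (subst nn_integral_noise) (auto simp: RG.emeasure_space_1[simplified])
      also have "\<dots> < \<infinity>" using f by (simp add: integrable_iff_bounded)
      finally show "(\<integral>\<^sup>+p. ennreal (norm (f (snd p))) \<partial>noise yt) < \<infinity>" .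
    qed measurable
    then show "(\<integral>p. f (snd p) \<partial>noise yt) = (\<integral>z. f z \<partial>gauss)"
      using pair_sigma_finite.integral_snd[OF pair_sigma_finite_noise[of yt], where f="\<lambda>y z. f z"]
      by (simp add: noise_def case_prod_unfold RG.prob_space[simplified])
  qed
  have z: "integrable gauss (\<lambda>z::'a. z \<bullet> b)"
    by (rule gauss_bounded_growth_integrable[where K=1 and k=1 and c=0]) (use zb in auto)
  have gi: "integrable gauss (\<lambda>z. g (yt + \<sigma> *\<^sub>R z) \<bullet> b)"
  proof (rule gauss_bounded_growth_integrable[where K="C + L * (1 + norm yt)" and k=1 and c=0])
    fix z
    have "norm (yt + \<sigma> *\<^sub>R z) \<le> norm yt + norm z"
      using norm_triangle_ineq[of yt "\<sigma> *\<^sub>R z"] \<sigma> mult_right_mono[of \<sigma> 1 "norm z"] by simp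
    then have "L * norm (yt + \<sigma> *\<^sub>R z) \<le> L * (norm yt + norm z)" using L by (intro mult_left_mono) auto
    then have "\<bar>g (yt + \<sigma> *\<^sub>R z) \<bullet> b\<bar> \<le> C + L * (norm yt + norm z)"
      using Basis_le_norm[OF b, of "g (yt + \<sigma> *\<^sub>R z)"] growth[of "yt + \<sigma> *\<^sub>R z"] by linarith
    also have "\<dots> \<le> (C + L * (1 + norm yt)) * (1 + norm z)"
      using C L mult_nonneg_nonneg[of C "norm z"] mult_nonneg_nonneg[of "L * norm yt" "norm z"] by (simp add: algebra_simps)
    finally show "norm (g (yt + \<sigma> *\<^sub>R z) \<bullet> b) \<le> (C + L * (1 + norm yt)) * ((1 + norm z) ^ 1 * exp (0 * norm z))" by simp
  qed measurable
  let ?c = "1 / (\<beta> * \<sigma>\<^sup>2)"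
  have "(\<integral>p. remainder yt (fst p) (snd p) \<bullet> b \<partial>noise yt) =
     (\<integral>p. - (g (yt + \<sigma> *\<^sub>R snd p) \<bullet> b) + ?c * (\<sigma> * (snd p \<bullet> b)) - ?c * ((gibbs_sweep yt (fst p) (snd p) - yt) \<bullet> b) \<partial>noise yt)"
    unfolding remainder_def by (intro Bochner_Integration.integral_cong refl) (simp add: inner_add_left inner_diff_left algebra_simps)
  also have "\<dots> = - (\<integral>z. g (yt + \<sigma> *\<^sub>R z) \<bullet> b \<partial>gauss) + ?c * (\<sigma> * (\<integral>z. z \<bullet> b \<partial>gauss)) - ?c * (\<integral>y. (y - yt) \<bullet> b \<partial>RG yt)"
    using snd[OF z] snd[OF gi] s1 s2 by simp
  finally show ?thesis by (simp add: gauss_odd_zero[OF b])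
qed

text \<open>The remainder itself is of order one, but its mean is small with \<open>\<sigma>\<close>. This cancellation is the
reason for the rate \<open>sqrt \<gamma>\<close>.\<close>

lemma remainder_mean_bound:
  assumes near: "\<sigma> * (1 + norm yt) \<le> 1"
  shows "norm (\<integral>p. remainder yt (fst p) (snd p) \<partial>noise yt) \<le> bias_const * (\<sigma> * (1 + norm yt)\<^sup>2)"
proof -
  have "norm (\<integral>p. remainder yt (fst p) (snd p) \<partial>noise yt) \<le> (\<Sum>b\<in>Basis. \<bar>(\<integral>p. remainder yt (fst p) (snd p) \<partial>noise yt) \<bullet> b\<bar>)"
    by (rule norm_le_l1)
  also have "\<dots> \<le> (\<Sum>b\<in>(Basis::'a set). growth_const\<^sup>2 * (gauss_moment_const + gauss_moment_const\<^sup>2) / (tilt_floor * \<beta>) * (\<sigma> * (1 + norm yt)\<^sup>2))"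
  proof (rule sum_mono)
    fix b :: 'a assume b: "b \<in> Basis"
    have "(\<integral>p. remainder yt (fst p) (snd p) \<partial>noise yt) \<bullet> b = (\<integral>p. remainder yt (fst p) (snd p) \<bullet> b \<partial>noise yt)"
      using remainder_integrable by (simp add: integral_inner_left)
    then show "\<bar>(\<integral>p. remainder yt (fst p) (snd p) \<partial>noise yt) \<bullet> b\<bar> \<le> growth_const\<^sup>2 * (gauss_moment_const + gauss_moment_const\<^sup>2) / (tilt_floor * \<beta>) * (\<sigma> * (1 + norm yt)\<^sup>2)"
      unfolding remainder_mean_coordinate[OF b] using remainder_mean_bound_coordinate[OF b near] by simp
  qed
  finally show ?thesis by (simp add: bias_const_def mult_ac)
qed

end

section \<open>Contraction of the stationary bias in one step\<close>

context langevin_potential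
begin

text \<open>These constants collect the error terms of one step. They do not depend on the step size.\<close>

definition "drift_const m = (4 * bias_const) ^ (2 * m + 2) + (2 * remainder_const) ^ (2 * m + 2)"
definition "step_const m c1 = 2 * real (m + 1) * (drift_const m / (\<mu> / 4) ^ (2 * m + 1)) / \<beta> ^ (m + 1) + c1 * (B + remainder_const) ^ (2 * m + 2)"

lemma drift_const_nonneg: "0 \<le> drift_const m"
  unfolding drift_const_def using bias_const_nonneg remainder_const_pos by simp

lemma step_const_nonneg: "0 \<le> c1 \<Longrightarrow> 0 \<le> step_const m c1"
  unfolding step_const_def using drift_const_nonneg[of m] \<mu> \<beta> B remainder_const_pos by simp

end

context restricted_gaussian
begin

lemma size_power_mono: "j \<le> k \<Longrightarrow> sweep_size yt y z ^ j \<le> sweep_size yt y z ^ k"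
  by (intro power_increasing sweep_size_ge_1)

text \<open>For near \<open>yt\<close> the small mean of the remainder and Young's inequality give the factor \<open>\<sigma> ^ (2 m
+ 2)\<close>. For far \<open>yt\<close>, where \<open>\<sigma> (1 + |yt|) > 1\<close>, this factor is paid for by a higher moment.\<close>

lemma drift_mean_bound:
  assumes \<delta>: "0 < \<delta>"
  shows "(\<integral>p. norm \<Delta> ^ (2 * m) * (\<Delta> \<bullet> remainder yt (fst p) (snd p)) \<partial>noise yt)
    \<le> \<delta> * norm \<Delta> ^ (2 * m + 2) + drift_const m / \<delta> ^ (2 * m + 1) * \<sigma> ^ (2 * m + 2) * size_mean (2 * (2 * m + 2)) yt"
proof -
  define q where "q = 2 * m + 2"
  define r where "r = norm \<Delta>"
  interpret N: prob_space "noise yt" by (rule prob_space_noise)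
  let ?R = "\<lambda>p. remainder yt (fst p) (snd p)" and ?S = "\<lambda>p. sweep_size yt (fst p) (snd p)"
  have q1: "q = (2 * m + 1) + 1" by (simp add: q_def)
  have yq: "r ^ (2 * m + 1) * e \<le> \<delta> * r ^ q + e ^ q / \<delta> ^ (2 * m + 1)" if "0 \<le> e" for e
    using young_power[of r e \<delta> "2 * m + 1"] that \<delta> by (simp add: q1 r_def)
  have si: "integrable (noise yt) (\<lambda>p. ?S p ^ k)" for k by (rule size_integrable)
  have s0: "0 \<le> ?S p" for p using order_trans[OF zero_le_one sweep_size_ge_1(1)] .
  have split: "drift_const m = (4 * bias_const) ^ q + (2 * remainder_const) ^ q" by (simp add: drift_const_def q_def)
  have bn: "0 \<le> (4 * bias_const) ^ q" "0 \<le> (2 * remainder_const) ^ q" using bias_const_nonneg remainder_const_pos by auto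
  have sm: "0 \<le> size_mean (2 * q) yt" by (rule size_mean_nonneg)
  have \<delta>p: "0 < \<delta> ^ (2 * m + 1)" using \<delta> by simp
  have yt2: "(1 + norm yt) ^ (2 * q) \<le> 4 ^ q * size_mean (2 * q) yt"
  proof -
    have "(1 + norm yt) ^ (2 * q) = (\<integral>p. (1 + norm yt) ^ (2 * q) \<partial>noise yt)" by (simp add: N.prob_space[simplified])
    also have "\<dots> \<le> (\<integral>p. 4 ^ q * ?S p ^ (2 * q) \<partial>noise yt)"
    proof (rule integral_mono)
      fix p
      have "(1 + norm yt) ^ (2 * q) \<le> (2 * ?S p) ^ (2 * q)" using sweep_size_ge_1(2) by (intro power_mono) auto
      then show "(1 + norm yt) ^ (2 * q) \<le> 4 ^ q * ?S p ^ (2 * q)" by (simp add: power_mult_distrib power_mult)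
    qed (use si in auto)
    finally show ?thesis by (simp add: size_mean_def)
  qed
  have mean: "(\<integral>p. r ^ (2 * m) * (\<Delta> \<bullet> ?R p) \<partial>noise yt) = r ^ (2 * m) * (\<Delta> \<bullet> (\<integral>p. ?R p \<partial>noise yt))"
    using remainder_integrable by simp
  have cs: "r ^ (2 * m) * (\<Delta> \<bullet> x) \<le> r ^ (2 * m + 1) * norm x" for x
    using mult_left_mono[OF Cauchy_Schwarz_ineq2[of \<Delta> x, THEN order_trans[OF abs_ge_self]], of "r ^ (2 * m)"] by (simp add: r_def mult_ac)
  have "(\<integral>p. r ^ (2 * m) * (\<Delta> \<bullet> ?R p) \<partial>noise yt) \<le> \<delta> * r ^ q + drift_const m / \<delta> ^ (2 * m + 1) * \<sigma> ^ q * size_mean (2 * q) yt"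
  proof (cases "\<sigma> * (1 + norm yt) \<le> 1")
    case True
    let ?e = "bias_const * (\<sigma> * (1 + norm yt)\<^sup>2)"
    have e0: "0 \<le> ?e" using bias_const_nonneg \<sigma> by simp
    have "(\<integral>p. r ^ (2 * m) * (\<Delta> \<bullet> ?R p) \<partial>noise yt) \<le> r ^ (2 * m + 1) * ?e"
      unfolding mean using remainder_mean_bound[OF True] by (intro order_trans[OF cs] mult_left_mono) (auto simp: r_def)
    also have "\<dots> \<le> \<delta> * r ^ q + ?e ^ q / \<delta> ^ (2 * m + 1)" by (rule yq[OF e0])
    also have "?e ^ q = bias_const ^ q * \<sigma> ^ q * (1 + norm yt) ^ (2 * q)"
      unfolding power_mult power_mult_distrib by (simp only: mult.assoc)
    also have "\<dots> \<le> bias_const ^ q * \<sigma> ^ q * (4 ^ q * size_mean (2 * q) yt)"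
      using yt2 bias_const_nonneg \<sigma> by (intro mult_left_mono) auto
    also have "\<dots> = (4 * bias_const) ^ q * \<sigma> ^ q * size_mean (2 * q) yt" by (simp add: power_mult_distrib)
    also have "\<dots> \<le> drift_const m * \<sigma> ^ q * size_mean (2 * q) yt"
      using bn sm \<sigma> unfolding split by (intro mult_right_mono) auto
    finally show ?thesis using \<delta>p by (simp add: divide_right_mono)
  next
    case False
    let ?c = "(2 * remainder_const) ^ q * \<sigma> ^ q / \<delta> ^ (2 * m + 1)"
    have "(\<integral>p. r ^ (2 * m) * (\<Delta> \<bullet> ?R p) \<partial>noise yt) \<le> (\<integral>p. \<delta> * r ^ q + ?c * ?S p ^ (2 * q) \<partial>noise yt)"
    proof (rule integral_mono)
      fix p
      have "norm (?R p) \<le> remainder_const * ?S p * (\<sigma> * (1 + norm yt))"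
      proof (rule order_trans[OF remainder_le])
        have "remainder_const * ?S p * 1 \<le> remainder_const * ?S p * (\<sigma> * (1 + norm yt))"
          using False s0[of p] remainder_const_pos by (intro mult_left_mono) auto
        then show "remainder_const * ?S p \<le> remainder_const * ?S p * (\<sigma> * (1 + norm yt))" by (simp only: mult_1_right)
      qed
      also have "\<dots> \<le> remainder_const * ?S p * (\<sigma> * (2 * ?S p))"
        using sweep_size_ge_1(2)[of yt "fst p" "snd p"] s0[of p] remainder_const_pos \<sigma> by (intro mult_left_mono) auto
      finally have n: "norm (?R p) ^ q \<le> (remainder_const * ?S p * (\<sigma> * (2 * ?S p))) ^ q" by (intro power_mono) auto
      have "r ^ (2 * m) * (\<Delta> \<bullet> ?R p) \<le> \<delta> * r ^ q + norm (?R p) ^ q / \<delta> ^ (2 * m + 1)"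
        by (rule order_trans[OF cs yq]) simp
      also have "\<dots> \<le> \<delta> * r ^ q + (remainder_const * ?S p * (\<sigma> * (2 * ?S p))) ^ q / \<delta> ^ (2 * m + 1)"
        using n \<delta>p by (intro add_left_mono divide_right_mono) auto
      also have "(remainder_const * ?S p * (\<sigma> * (2 * ?S p))) ^ q = (2 * remainder_const) ^ q * \<sigma> ^ q * ?S p ^ (2 * q)"
        by (simp add: power_mult_distrib power_mult power2_eq_square mult_ac)
      finally show "r ^ (2 * m) * (\<Delta> \<bullet> ?R p) \<le> \<delta> * r ^ q + ?c * ?S p ^ (2 * q)" by simp
    qed (use si remainder_integrable in auto)
    also have "\<dots> = \<delta> * r ^ q + ?c * size_mean (2 * q) yt"
      using si by (simp add: size_mean_def N.prob_space[simplified])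
    also have "?c * size_mean (2 * q) yt \<le> drift_const m / \<delta> ^ (2 * m + 1) * \<sigma> ^ q * size_mean (2 * q) yt"
    proof (rule mult_right_mono[OF _ sm])
      have "(2 * remainder_const) ^ q * \<sigma> ^ q \<le> drift_const m * \<sigma> ^ q" using bn \<sigma> unfolding split by (intro mult_right_mono) auto
      then show "?c \<le> drift_const m / \<delta> ^ (2 * m + 1) * \<sigma> ^ q" using \<delta>p by (simp add: divide_right_mono)
    qed
    finally show ?thesis by simp
  qed
  then show ?thesis unfolding q_def r_def .
qed

abbreviation "\<gamma> \<equiv> \<beta> * \<sigma>\<^sup>2"

text \<open>One step of the comparison between the gradient step from \<open>vt\<close> and the swept point, both driven by
the same noise: the new difference is \<open>\<Delta> + \<gamma> N\<close>, where \<open>N\<close> is the remainder minus the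
difference of the gradients. Monotonicity contributes \<open>- 2 (m + 1) \<mu> \<gamma>\<close>; half of the gain
is spent on error terms. The assumption \<open>key\<close> is the conclusion of \<open>perturbed_power_bound\<close>, kept as a
hypothesis because its constants must not depend on the step size.\<close>

lemma one_step_contraction:
  assumes c1: "0 \<le> c1" and small: "real (m + 1) * \<mu> * \<gamma> \<le> 1"
    and key: "\<And>\<kappa> (\<Delta> :: 'a) N. 0 \<le> \<kappa> \<Longrightarrow> norm N \<le> 2 * L * norm \<Delta> + \<kappa> \<Longrightarrow>
    norm (\<Delta> + \<gamma> *\<^sub>R N) ^ (2 * m + 2) \<le> (1 + (real (m + 1) * \<mu> / 2) * \<gamma>) * norm \<Delta> ^ (2 * m + 2)
       + 2 * real (m + 1) * \<gamma> * (norm \<Delta> ^ (2 * m) * (\<Delta> \<bullet> N)) + c1 * \<gamma> ^ (m + 2) * \<kappa> ^ (2 * m + 2)"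
  shows "(\<integral>\<^sup>+p. ennreal (norm ((vt + \<sigma> *\<^sub>R snd p - \<gamma> *\<^sub>R g (vt + \<sigma> *\<^sub>R snd p)) - gibbs_sweep yt (fst p) (snd p)) ^ (2 * m + 2)) \<partial>noise yt)
    \<le> ennreal ((1 - real (m + 1) * \<mu> * \<gamma>) * norm (vt - yt) ^ (2 * m + 2)) + ennreal (step_const m c1 * \<gamma> ^ (m + 2)) * size_int (2 * (2 * m + 2)) yt"
proof -
  interpret N: prob_space "noise yt" by (rule prob_space_noise)
  define \<Delta> where "\<Delta> = vt - yt"
  define q where "q = 2 * m + 2"
  let ?R = "\<lambda>p. remainder yt (fst p) (snd p)" and ?S = "\<lambda>p. sweep_size yt (fst p) (snd p)"
  let ?X = "\<lambda>p. norm ((vt + \<sigma> *\<^sub>R snd p - \<gamma> *\<^sub>R g (vt + \<sigma> *\<^sub>R snd p)) - gibbs_sweep yt (fst p) (snd p)) ^ q"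
  let ?A = "norm \<Delta> ^ q"
  let ?k = "real (m + 1)"
  have \<gamma>: "0 < \<gamma>" using \<beta> \<sigma> by simp
  have A: "norm \<Delta> ^ (2 * m) * (norm \<Delta>)\<^sup>2 = ?A" unfolding q_def power_add by simp
  have si: "integrable (noise yt) (\<lambda>p. ?S p ^ k)" for k by (rule size_integrable)
  have s0: "0 \<le> ?S p" for p using order_trans[OF zero_le_one sweep_size_ge_1(1)] .
  let ?c3 = "c1 * \<gamma> ^ (m + 2) * (B + remainder_const) ^ q"
  define rhs where "rhs p = (1 + (?k * \<mu> / 2) * \<gamma>) * ?A - 2 * ?k * \<gamma> * \<mu> * ?A
      + 2 * ?k * \<gamma> * (norm \<Delta> ^ (2 * m) * (\<Delta> \<bullet> ?R p)) + ?c3 * ?S p ^ (2 * q)" for p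
  have AED: "AE p in noise yt. a + \<sigma> *\<^sub>R snd p \<in> D" for a
  proof -
    have ae: "AE z in gauss. a + \<sigma> *\<^sub>R z \<in> D" using \<sigma> by (intro AE_gauss_affine[OF D_AE D_sets]) auto
    have "(\<integral>\<^sup>+p. indicator (- D) (a + \<sigma> *\<^sub>R snd p) \<partial>noise yt) = (\<integral>\<^sup>+z. \<integral>\<^sup>+y. indicator (- D) (a + \<sigma> *\<^sub>R z) \<partial>RG yt \<partial>gauss)"
      by (subst nn_integral_noise) auto
    also have "\<dots> = (\<integral>\<^sup>+z. 0 \<partial>(gauss :: 'a measure))"
      by (rule nn_integral_cong_AE) (use ae in \<open>auto elim!: eventually_mono\<close>)
    finally have "(\<integral>\<^sup>+p. indicator (- D) (a + \<sigma> *\<^sub>R snd p) \<partial>noise yt) = 0" by simp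
    then have "AE p in noise yt. indicator (- D) (a + \<sigma> *\<^sub>R snd p) = (0::ennreal)"
      by (subst (asm) nn_integral_0_iff_AE) auto
    then show ?thesis by (auto elim!: eventually_mono split: split_indicator_asm)
  qed
  have pt: "AE p in noise yt. ?X p \<le> rhs p"
    using AED[of vt] AED[of yt]
  proof eventually_elim
    case (elim p)
    define N where "N = ?R p - (g (vt + \<sigma> *\<^sub>R snd p) - g (yt + \<sigma> *\<^sub>R snd p))"
    have "\<gamma> *\<^sub>R ?R p = - (\<gamma> *\<^sub>R g (yt + \<sigma> *\<^sub>R snd p)) + (\<sigma> *\<^sub>R snd p - (gibbs_sweep yt (fst p) (snd p) - yt))"
      using \<beta> \<sigma> unfolding remainder_def by (simp add: scaleR_add_right scaleR_diff_right)
    then have eq: "(vt + \<sigma> *\<^sub>R snd p - \<gamma> *\<^sub>R g (vt + \<sigma> *\<^sub>R snd p)) - gibbs_sweep yt (fst p) (snd p) = \<Delta> + \<gamma> *\<^sub>R N"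
      unfolding N_def \<Delta>_def scaleR_diff_right by simp
    have d: "(vt + \<sigma> *\<^sub>R snd p) - (yt + \<sigma> *\<^sub>R snd p) = \<Delta>" by (simp add: \<Delta>_def)
    have gl: "norm (g (vt + \<sigma> *\<^sub>R snd p) - g (yt + \<sigma> *\<^sub>R snd p)) \<le> 2 * L * norm \<Delta> + B" using coarse_lipschitz[OF elim] unfolding d .
    have gm: "\<mu> * (norm \<Delta>)\<^sup>2 \<le> (g (vt + \<sigma> *\<^sub>R snd p) - g (yt + \<sigma> *\<^sub>R snd p)) \<bullet> \<Delta>" using mono[OF elim] unfolding d .
    have BS: "B \<le> B * ?S p" using B sweep_size_ge_1(1)[of yt "fst p" "snd p"] by (simp add: mult_le_cancel_left1)
    have Nn: "norm N \<le> 2 * L * norm \<Delta> + (B + remainder_const) * ?S p"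
      unfolding N_def using norm_triangle_ineq4[of "?R p" "g (vt + \<sigma> *\<^sub>R snd p) - g (yt + \<sigma> *\<^sub>R snd p)"] gl BS remainder_le[of yt "fst p" "snd p"]
      by (simp add: distrib_right)
    have Nd: "\<Delta> \<bullet> N \<le> \<Delta> \<bullet> ?R p - \<mu> * (norm \<Delta>)\<^sup>2" unfolding N_def using gm by (simp add: inner_diff_right inner_commute)
    have "norm \<Delta> ^ (2 * m) * (\<Delta> \<bullet> N) \<le> norm \<Delta> ^ (2 * m) * (\<Delta> \<bullet> ?R p - \<mu> * (norm \<Delta>)\<^sup>2)"
      using Nd by (intro mult_left_mono) auto
    also have "\<dots> = norm \<Delta> ^ (2 * m) * (\<Delta> \<bullet> ?R p) - \<mu> * ?A" unfolding A[symmetric] by (simp add: right_diff_distrib)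
    finally have "2 * ?k * \<gamma> * (norm \<Delta> ^ (2 * m) * (\<Delta> \<bullet> N)) \<le> 2 * ?k * \<gamma> * (norm \<Delta> ^ (2 * m) * (\<Delta> \<bullet> ?R p) - \<mu> * ?A)"
      using \<gamma> by (intro mult_left_mono) auto
    moreover have "c1 * \<gamma> ^ (m + 2) * ((B + remainder_const) * ?S p) ^ q \<le> ?c3 * ?S p ^ (2 * q)"
    proof -
      have "?S p ^ q \<le> ?S p ^ (2 * q)" by (rule size_power_mono) simp
      then have "?c3 * ?S p ^ q \<le> ?c3 * ?S p ^ (2 * q)" using c1 \<gamma> B remainder_const_pos by (intro mult_left_mono) auto
      then show ?thesis by (simp only: power_mult_distrib mult.assoc)
    qed
    moreover have "norm (\<Delta> + \<gamma> *\<^sub>R N) ^ q \<le> (1 + (?k * \<mu> / 2) * \<gamma>) * ?A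
       + 2 * ?k * \<gamma> * (norm \<Delta> ^ (2 * m) * (\<Delta> \<bullet> N)) + c1 * \<gamma> ^ (m + 2) * ((B + remainder_const) * ?S p) ^ q"
      unfolding q_def by (rule key[OF _ Nn]) (use B remainder_const_pos s0 in auto)
    ultimately have "norm (\<Delta> + \<gamma> *\<^sub>R N) ^ q \<le> (1 + (?k * \<mu> / 2) * \<gamma>) * ?A + 2 * ?k * \<gamma> * (norm \<Delta> ^ (2 * m) * (\<Delta> \<bullet> ?R p) - \<mu> * ?A) + ?c3 * ?S p ^ (2 * q)"
      by linarith
    also have "\<dots> = rhs p" unfolding rhs_def by (simp add: right_diff_distrib)
    finally show ?case unfolding eq .
  qed
  have ri: "integrable (noise yt) (\<lambda>p. norm \<Delta> ^ (2 * m) * (\<Delta> \<bullet> ?R p))" using remainder_integrable by simp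
  have rhs_i: "integrable (noise yt) rhs" unfolding rhs_def[abs_def] using si ri
    by (intro Bochner_Integration.integrable_add integrable_mult_right N.integrable_const) auto
  have X0: "0 \<le> ?X p" for p by simp
  have rhs0: "AE p in noise yt. 0 \<le> rhs p" using pt by eventually_elim (use X0 order_trans in blast)
  let ?c4 = "drift_const m / (\<mu> / 4) ^ (2 * m + 1)"
  have "(\<integral>p. rhs p \<partial>noise yt) = (1 + (?k * \<mu> / 2) * \<gamma>) * ?A - 2 * ?k * \<gamma> * \<mu> * ?A
      + 2 * ?k * \<gamma> * (\<integral>p. norm \<Delta> ^ (2 * m) * (\<Delta> \<bullet> ?R p) \<partial>noise yt) + ?c3 * size_mean (2 * q) yt"
    unfolding rhs_def using si ri by (simp add: size_mean_def N.prob_space[simplified])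
  also have "\<dots> \<le> (1 + (?k * \<mu> / 2) * \<gamma>) * ?A - 2 * ?k * \<gamma> * \<mu> * ?A
      + 2 * ?k * \<gamma> * ((\<mu> / 4) * ?A + ?c4 * \<sigma> ^ q * size_mean (2 * q) yt) + ?c3 * size_mean (2 * q) yt"
    using drift_mean_bound[where \<delta>="\<mu> / 4" and \<Delta>=\<Delta> and m=m and yt=yt] \<mu> \<gamma> unfolding q_def
    by (intro add_left_mono add_right_mono mult_left_mono) auto
  also have "\<dots> = (1 - ?k * \<mu> * \<gamma>) * ?A + (2 * ?k * \<gamma> * ?c4 * \<sigma> ^ q + ?c3) * size_mean (2 * q) yt"
    by (simp add: field_simps)
  also have "2 * ?k * \<gamma> * ?c4 * \<sigma> ^ q + ?c3 = step_const m c1 * \<gamma> ^ (m + 2)"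
  proof -
    have "q = 2 * (m + 1)" by (simp add: q_def)
    then have "\<sigma> ^ q = (\<sigma>\<^sup>2) ^ (m + 1)" by (simp only: power_mult)
    moreover have "\<gamma> ^ (m + 1) = \<beta> ^ (m + 1) * (\<sigma>\<^sup>2) ^ (m + 1)" by (rule power_mult_distrib)
    moreover have b: "\<beta> ^ (m + 1) \<noteq> 0" using \<beta> by simp
    ultimately have \<sigma>q: "\<sigma> ^ q = \<gamma> ^ (m + 1) / \<beta> ^ (m + 1)" by (simp only: nonzero_mult_div_cancel_left[OF b])
    have g: "\<gamma> ^ (m + 2) = \<gamma> * \<gamma> ^ (m + 1)" by simp
    have "2 * k * G * c * (X / Y) + c1 * (G * X) * K = (2 * k * c / Y + c1 * K) * (G * X)" for k G c X Y K :: real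
      by (simp add: algebra_simps)
    then show ?thesis unfolding step_const_def q_def[symmetric] \<sigma>q g .
  qed
  finally have fin: "(\<integral>p. rhs p \<partial>noise yt) \<le> (1 - ?k * \<mu> * \<gamma>) * ?A + step_const m c1 * \<gamma> ^ (m + 2) * size_mean (2 * q) yt" .
  have "(\<integral>\<^sup>+p. ennreal (?X p) \<partial>noise yt) \<le> (\<integral>\<^sup>+p. ennreal (rhs p) \<partial>noise yt)"
    using pt by (intro nn_integral_mono_AE) (auto elim!: eventually_mono intro: ennreal_leI)
  also have "\<dots> = ennreal (\<integral>p. rhs p \<partial>noise yt)" by (rule nn_integral_eq_integral[OF rhs_i rhs0])
  also have "\<dots> \<le> ennreal ((1 - ?k * \<mu> * \<gamma>) * ?A + step_const m c1 * \<gamma> ^ (m + 2) * size_mean (2 * q) yt)"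
    using fin by (rule ennreal_leI)
  also have "\<dots> = ennreal ((1 - ?k * \<mu> * \<gamma>) * ?A) + ennreal (step_const m c1 * \<gamma> ^ (m + 2)) * size_int (2 * q) yt"
    unfolding size_int_eq using small size_mean_nonneg[of "2 * q" yt] step_const_nonneg[OF c1, of m] \<gamma>
    by (simp add: ennreal_plus[symmetric] ennreal_mult[symmetric] del: ennreal_plus)
  finally show ?thesis unfolding q_def \<Delta>_def .
qed

end

section \<open>The coupled Markov chain\<close>

context langevin_potential
begin

text \<open>The deterministic part of a step. The variable \<open>gd \<gamma> x\<^sub>n\<close> will be tracked instead of
\<open>x\<^sub>n\<close>, so that each step of the chain ends with a gradient step and the Gaussian before it puts
its argument into \<open>D\<close> almost surely.\<close>

definition gd :: "real \<Rightarrow> 'a \<Rightarrow> 'a" where "gd \<gamma> x = x - \<gamma> *\<^sub>R g x"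

lemma gd_measurable[measurable]: "gd \<gamma> \<in> borel_measurable borel"
  unfolding gd_def[abs_def] by measurable

text \<open>The jumps of the gradient enter only through the additive term.\<close>

lemma gd_expansion:
  assumes x: "x \<in> D" and y: "y \<in> D" and \<gamma>: "0 \<le> \<gamma>"
  shows "(norm (gd \<gamma> x - gd \<gamma> y))\<^sup>2 \<le> (1 - 2 * \<mu> * \<gamma> + 8 * L\<^sup>2 * \<gamma>\<^sup>2) * (norm (x - y))\<^sup>2 + 2 * B\<^sup>2 * \<gamma>\<^sup>2"
proof -
  define d e where "d = x - y" and "e = g x - g y"
  have eq: "gd \<gamma> x - gd \<gamma> y = d - \<gamma> *\<^sub>R e" by (simp add: gd_def d_def e_def algebra_simps)
  have "(norm (gd \<gamma> x - gd \<gamma> y))\<^sup>2 = (norm d)\<^sup>2 - 2 * \<gamma> * (e \<bullet> d) + \<gamma>\<^sup>2 * (norm e)\<^sup>2"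
    unfolding eq power2_norm_eq_inner by (simp add: inner_diff_left inner_diff_right inner_commute power2_eq_square algebra_simps)
  moreover have "\<gamma> * (\<mu> * (norm d)\<^sup>2) \<le> \<gamma> * (e \<bullet> d)"
    using mono[OF x y] \<gamma> unfolding d_def e_def by (intro mult_left_mono)
  moreover have "\<gamma>\<^sup>2 * (norm e)\<^sup>2 \<le> \<gamma>\<^sup>2 * (8 * L\<^sup>2 * (norm d)\<^sup>2 + 2 * B\<^sup>2)"
  proof (rule mult_left_mono)
    have "(norm e)\<^sup>2 \<le> (2 * L * norm d + B)\<^sup>2" using coarse_lipschitz[OF x y] unfolding d_def e_def by (intro power_mono) auto
    also have "\<dots> \<le> 2 * ((2 * L * norm d)\<^sup>2 + B\<^sup>2)"
      using sum_squares_bound[of "2 * L * norm d" B] by (simp add: power2_sum)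
    finally show "(norm e)\<^sup>2 \<le> 8 * L\<^sup>2 * (norm d)\<^sup>2 + 2 * B\<^sup>2" by (simp add: power_mult_distrib)
  qed simp
  ultimately show ?thesis unfolding d_def[symmetric] by (simp add: algebra_simps)
qed

text \<open>If \<open>r'\<^sup>2 \<le> \<rho>\<^sup>2 r\<^sup>2 + b\<close> with \<open>b \<le> k (1 - \<rho>\<^sup>2)\<close>, then
\<open>r\<^sup>2 - k\<close> contracts by \<open>\<rho>\<^sup>2\<close>. Hence \<open>excess k\<close> contracts by the factor \<open>\<rho>\<close> at every
step without accumulating errors, and it differs from \<open>r\<close> by at most \<open>sqrt k\<close>.\<close>

definition excess :: "real \<Rightarrow> real \<Rightarrow> real" where "excess k r = sqrt (max 0 (r\<^sup>2 - k))"

lemma excess_measurable[measurable]: "excess k \<in> borel_measurable borel"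
  unfolding excess_def[abs_def] by measurable

lemma excess_nonneg: "0 \<le> excess k r" by (simp add: excess_def)

lemma le_excess_add: "0 \<le> r \<Longrightarrow> 0 \<le> k \<Longrightarrow> r \<le> excess k r + sqrt k"
proof -
  assume r: "0 \<le> r" "0 \<le> k"
  have "r\<^sup>2 \<le> (excess k r)\<^sup>2 + (sqrt k)\<^sup>2" using r by (simp add: excess_def)
  also have "\<dots> \<le> (excess k r + sqrt k)\<^sup>2" using r excess_nonneg[of k r] by (simp add: power2_sum)
  finally show ?thesis by (rule power2_le_imp_le) (use r excess_nonneg[of k r] in auto)
qed

lemma excess_le: "0 \<le> r \<Longrightarrow> 0 \<le> k \<Longrightarrow> excess k r \<le> r"
  unfolding excess_def by (rule real_le_lsqrt) auto

lemma excess_contracts: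
  assumes "r'\<^sup>2 \<le> \<rho>\<^sup>2 * r\<^sup>2 + b" "b \<le> k * (1 - \<rho>\<^sup>2)" "0 \<le> \<rho>"
  shows "excess k r' \<le> \<rho> * excess k r"
proof -
  have "r'\<^sup>2 - k \<le> \<rho>\<^sup>2 * (r\<^sup>2 - k)" using assms by (simp add: algebra_simps)
  also have "\<dots> \<le> \<rho>\<^sup>2 * max 0 (r\<^sup>2 - k)" by (intro mult_left_mono) auto
  finally have "max 0 (r'\<^sup>2 - k) \<le> \<rho>\<^sup>2 * max 0 (r\<^sup>2 - k)" by simp
  then have "excess k r' \<le> sqrt (\<rho>\<^sup>2 * max 0 (r\<^sup>2 - k))" unfolding excess_def by (rule real_sqrt_le_mono)
  then show ?thesis using assms(3) by (simp add: excess_def real_sqrt_mult)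
qed

end

context restricted_gaussian
begin

lemma noise_kernel[measurable]: "noise \<in> measurable borel (subprob_algebra (borel \<Otimes>\<^sub>M borel))"
proof -
  have "(\<lambda>_. gauss) \<in> measurable borel (subprob_algebra (borel :: 'a measure))"
    by (rule measurable_const) (auto simp: space_subprob_algebra prob_space_imp_subprob_space prob_space_gauss)
  from measurable_pair_measure[OF RG_kernel this] show ?thesis unfolding noise_def[abs_def] by simp
qed

text \<open>One step of the coupled chain \<open>(a, v, y)\<close>: \<open>a\<close> follows the algorithm, \<open>v\<close> is a copy of it started at a
stationary point, \<open>y\<close> is the stationary chain. All three receive the same Gaussian vectors.\<close>

definition update :: "('a \<times> 'a \<times> 'a) \<Rightarrow> 'a \<Rightarrow> ('a \<times> 'a) \<Rightarrow> 'a \<times> 'a \<times> 'a" where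
  "update s z1 p = (gd \<gamma> (fst s + \<sigma> *\<^sub>R (z1 + snd p)), gd \<gamma> (fst (snd s) + \<sigma> *\<^sub>R (z1 + snd p)),
      gibbs_sweep (snd (snd s) + \<sigma> *\<^sub>R z1) (fst p) (snd p))"

lemma update_measurable[measurable (raw)]:
  assumes [measurable]: "f \<in> measurable M (borel \<Otimes>\<^sub>M (borel \<Otimes>\<^sub>M borel))" "h \<in> borel_measurable M" "k \<in> measurable M (borel \<Otimes>\<^sub>M borel)"
  shows "(\<lambda>x. update (f x) (h x) (k x)) \<in> measurable M (borel \<Otimes>\<^sub>M (borel \<Otimes>\<^sub>M borel))"
  unfolding update_def by measurable

abbreviation state_space :: "('a \<times> 'a \<times> 'a) measure" where "state_space \<equiv> borel \<Otimes>\<^sub>M (borel \<Otimes>\<^sub>M borel)"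

definition step_kernel :: "'a \<times> 'a \<times> 'a \<Rightarrow> ('a \<times> 'a \<times> 'a) measure" where
  "step_kernel s = gauss \<bind> (\<lambda>z1. noise (snd (snd s) + \<sigma> *\<^sub>R z1) \<bind> (\<lambda>p. return state_space (update s z1 p)))"

lemma inner_kernel_measurable:
  "(\<lambda>x. noise (snd (snd (fst x)) + \<sigma> *\<^sub>R snd x) \<bind> (\<lambda>p. return state_space (update (fst x) (snd x) p)))
    \<in> measurable (state_space \<Otimes>\<^sub>M borel) (subprob_algebra state_space)"
proof (rule measurable_bind[where N="borel \<Otimes>\<^sub>M borel"])
  have "(\<lambda>x. snd (snd (fst x)) + \<sigma> *\<^sub>R snd x) \<in> borel_measurable (state_space \<Otimes>\<^sub>M (borel :: 'a measure))"
    by measurable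
  then show "(\<lambda>x. noise (snd (snd (fst x)) + \<sigma> *\<^sub>R snd x)) \<in> measurable (state_space \<Otimes>\<^sub>M borel) (subprob_algebra (borel \<Otimes>\<^sub>M borel))"
    by (rule measurable_compose[OF _ noise_kernel])
  have "(\<lambda>x. update (fst (fst x)) (snd (fst x)) (snd x)) \<in> measurable ((state_space \<Otimes>\<^sub>M borel) \<Otimes>\<^sub>M (borel \<Otimes>\<^sub>M borel)) state_space"
    by (intro update_measurable measurable_compose[OF measurable_fst measurable_fst] measurable_compose[OF measurable_fst measurable_snd] measurable_snd)
  then show "(\<lambda>x. return state_space (update (fst (fst x)) (snd (fst x)) (snd x))) \<in> measurable ((state_space \<Otimes>\<^sub>M borel) \<Otimes>\<^sub>M (borel \<Otimes>\<^sub>M borel)) (subprob_algebra state_space)"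
    by (rule measurable_compose[OF _ return_measurable])
qed

lemma step_kernel_measurable: "step_kernel \<in> measurable state_space (subprob_algebra state_space)"
  unfolding step_kernel_def[abs_def]
proof (rule measurable_bind[where N="borel"])
  show "(\<lambda>_. gauss) \<in> measurable state_space (subprob_algebra (borel :: 'a measure))"
    by (rule measurable_const) (auto simp: space_subprob_algebra prob_space_imp_subprob_space prob_space_gauss)
qed (rule inner_kernel_measurable)

lemma nn_integral_step_kernel:
  assumes F[measurable]: "F \<in> borel_measurable state_space"
  shows "(\<integral>\<^sup>+t. F t \<partial>step_kernel s) = (\<integral>\<^sup>+z1. \<integral>\<^sup>+p. F (update s z1 p) \<partial>noise (snd (snd s) + \<sigma> *\<^sub>R z1) \<partial>gauss)"
proof -
  have s: "s \<in> space state_space" by (simp add: space_pair_measure)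
  have m1: "(\<lambda>z1. noise (snd (snd s) + \<sigma> *\<^sub>R z1) \<bind> (\<lambda>p. return state_space (update s z1 p))) \<in> measurable gauss (subprob_algebra state_space)"
    using measurable_compose[OF measurable_Pair1'[OF s, of borel] inner_kernel_measurable] by simp
  have m2: "(\<lambda>p. return state_space (update s z1 p)) \<in> measurable (noise yt) (subprob_algebra state_space)" for z1 yt
  proof -
    have "(\<lambda>p. update s z1 p) \<in> measurable (noise yt) state_space"
      by (intro update_measurable measurable_const s) (auto simp: measurable_ident_sets)
    then show ?thesis by (rule measurable_compose[OF _ return_measurable])
  qed
  have "(\<integral>\<^sup>+t. F t \<partial>step_kernel s) = (\<integral>\<^sup>+z1. \<integral>\<^sup>+t. F t \<partial>(noise (snd (snd s) + \<sigma> *\<^sub>R z1) \<bind> (\<lambda>p. return state_space (update s z1 p))) \<partial>gauss)"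
    unfolding step_kernel_def by (rule nn_integral_bind[OF F m1])
  also have "\<dots> = (\<integral>\<^sup>+z1. \<integral>\<^sup>+p. F (update s z1 p) \<partial>noise (snd (snd s) + \<sigma> *\<^sub>R z1) \<partial>gauss)"
  proof (rule nn_integral_cong)
    fix z1
    show "(\<integral>\<^sup>+t. F t \<partial>(noise (snd (snd s) + \<sigma> *\<^sub>R z1) \<bind> (\<lambda>p. return state_space (update s z1 p)))) = (\<integral>\<^sup>+p. F (update s z1 p) \<partial>noise (snd (snd s) + \<sigma> *\<^sub>R z1))"
      by (subst nn_integral_bind[OF F m2]) (auto simp: nn_integral_return[OF _ F] space_pair_measure)
  qed
  finally show ?thesis .
qed

definition step :: "('a \<times> 'a \<times> 'a) measure \<Rightarrow> ('a \<times> 'a \<times> 'a) measure" where "step S = S \<bind> step_kernel"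

lemma step_properties:
  assumes S: "prob_space S" "sets S = sets state_space"
  shows "sets (step S) = sets state_space" "prob_space (step S)"
    "F \<in> borel_measurable state_space \<Longrightarrow> (\<integral>\<^sup>+t. F t \<partial>step S) = (\<integral>\<^sup>+s. \<integral>\<^sup>+z1. \<integral>\<^sup>+p. F (update s z1 p) \<partial>noise (snd (snd s) + \<sigma> *\<^sub>R z1) \<partial>gauss \<partial>S)"
proof -
  interpret S: prob_space S by fact
  have k: "step_kernel \<in> measurable S (subprob_algebra state_space)"
    using step_kernel_measurable measurable_cong_sets[OF S(2) refl] by blast
  show sets: "sets (step S) = sets state_space"
    unfolding step_def by (rule sets_bind[OF sets_kernel[OF k]]) (auto simp: S.not_empty)
  show F: "(\<integral>\<^sup>+t. F t \<partial>step S) = (\<integral>\<^sup>+s. \<integral>\<^sup>+z1. \<integral>\<^sup>+p. F (update s z1 p) \<partial>noise (snd (snd s) + \<sigma> *\<^sub>R z1) \<partial>gauss \<partial>S)"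
    if "F \<in> borel_measurable state_space" for F
    unfolding step_def by (subst nn_integral_bind[OF that k]) (simp add: nn_integral_step_kernel[OF that])
  show "prob_space (step S)"
  proof (rule prob_spaceI)
    have "emeasure (step S) (space (step S)) = (\<integral>\<^sup>+t. 1 \<partial>step S)" by simp
    also have "\<dots> = (\<integral>\<^sup>+s. \<integral>\<^sup>+z1. \<integral>\<^sup>+p. 1 \<partial>noise (snd (snd s) + \<sigma> *\<^sub>R z1) \<partial>gauss \<partial>S)"
      by (rule F) simp
    also have "\<dots> = 1"
      using prob_space.emeasure_space_1[OF prob_space_noise] gauss.emeasure_space_1 S.emeasure_space_1 by simp
    finally show "emeasure (step S) (space (step S)) = 1" .
  qed
qed

lemma nn_integral_noise_snd:
  assumes [measurable]: "F \<in> borel_measurable borel"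
  shows "(\<integral>\<^sup>+p. F (snd p) \<partial>noise yt) = (\<integral>\<^sup>+z. F z \<partial>gauss)"
  by (subst nn_integral_noise) (auto simp: prob_space.emeasure_space_1[OF prob_space_RG, simplified])

text \<open>The sweep does not change the proximal law, and drawing from the proximal law preserves \<open>\<pi>\<close>.\<close>

lemma step_gibbs_marginal:
  assumes S: "prob_space S" "sets S = sets state_space" and \<pi>: "distr S borel (\<lambda>s. snd (snd s)) = \<pi>"
  shows "distr (step S) borel (\<lambda>s. snd (snd s)) = \<pi>"
proof (rule measure_eqI)
  note [measurable_cong] = S(2)
  fix A assume "A \<in> sets (distr (step S) borel (\<lambda>s. snd (snd s)))"
  then have [measurable]: "A \<in> sets borel" by simp
  note [measurable_cong] = step_properties(1)[OF S]
  have [measurable]: "(\<lambda>yt. \<integral>\<^sup>+y. indicator A y \<partial>RG yt) \<in> borel_measurable borel"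
    by (rule nn_integral_measurable_subprob_algebra2[where N=borel]) auto
  have "emeasure (distr (step S) borel (\<lambda>s. snd (snd s))) A = (\<integral>\<^sup>+t. indicator A (snd (snd t)) \<partial>step S)"
    by (subst nn_integral_indicator[symmetric], simp, subst nn_integral_distr) auto
  also have "\<dots> = (\<integral>\<^sup>+s. \<integral>\<^sup>+z1. \<integral>\<^sup>+p. indicator A (gibbs_sweep (snd (snd s) + \<sigma> *\<^sub>R z1) (fst p) (snd p)) \<partial>noise (snd (snd s) + \<sigma> *\<^sub>R z1) \<partial>gauss \<partial>S)"
    by (subst step_properties(3)[OF S]) (auto simp: update_def)
  also have "\<dots> = (\<integral>\<^sup>+s. \<integral>\<^sup>+z1. \<integral>\<^sup>+y. indicator A y \<partial>RG (snd (snd s) + \<sigma> *\<^sub>R z1) \<partial>gauss \<partial>S)"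
    by (subst nn_integral_noise) (auto simp: gibbs_sweep_law[of "indicator A"])
  also have "\<dots> = (\<integral>\<^sup>+y0. \<integral>\<^sup>+z1. \<integral>\<^sup>+y. indicator A y \<partial>RG (y0 + \<sigma> *\<^sub>R z1) \<partial>gauss \<partial>\<pi>)"
    unfolding \<pi>[symmetric] by (subst nn_integral_distr) auto
  also have "\<dots> = (\<integral>\<^sup>+y0. \<integral>\<^sup>+z1. indicator A y0 \<partial>(gauss::'a measure) \<partial>\<pi>)"
    by (rule RG_exchangeable) measurable
  also have "\<dots> = emeasure \<pi> A" by (simp add: gauss.emeasure_space_1[simplified])
  finally show "emeasure (distr (step S) borel (\<lambda>s. snd (snd s))) A = emeasure \<pi> A" .
qed simp

text \<open>Marginally, the first component makes a step of the algorithm with noise \<open>sqrt 2 \<sigma> = sqrt (2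
\<gamma> / \<beta>)\<close>.\<close>

lemma step_first_marginal:
  assumes S: "prob_space S" "sets S = sets state_space" and [measurable]: "H \<in> borel_measurable borel"
  shows "(\<integral>\<^sup>+t. H (fst t) \<partial>step S) = (\<integral>\<^sup>+s. \<integral>\<^sup>+z. H (gd \<gamma> (fst s + (sqrt 2 * \<sigma>) *\<^sub>R z)) \<partial>gauss \<partial>S)"
proof -
  have "(\<integral>\<^sup>+t. H (fst t) \<partial>step S) = (\<integral>\<^sup>+s. \<integral>\<^sup>+z1. \<integral>\<^sup>+p. H (gd \<gamma> (fst s + \<sigma> *\<^sub>R (z1 + snd p))) \<partial>noise (snd (snd s) + \<sigma> *\<^sub>R z1) \<partial>gauss \<partial>S)"
    by (subst step_properties(3)[OF S]) (auto simp: update_def)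
  also have "\<dots> = (\<integral>\<^sup>+s. \<integral>\<^sup>+z1. \<integral>\<^sup>+z2. H (gd \<gamma> (fst s + \<sigma> *\<^sub>R (z1 + z2))) \<partial>gauss \<partial>gauss \<partial>S)"
    by (intro nn_integral_cong nn_integral_noise_snd) measurable
  also have "\<dots> = (\<integral>\<^sup>+s. \<integral>\<^sup>+z. H (gd \<gamma> (fst s + (sqrt 2 * \<sigma>) *\<^sub>R z)) \<partial>gauss \<partial>S)"
  proof (rule nn_integral_cong)
    fix s
    show "(\<integral>\<^sup>+z1. \<integral>\<^sup>+z2. H (gd \<gamma> (fst s + \<sigma> *\<^sub>R (z1 + z2))) \<partial>gauss \<partial>gauss) = (\<integral>\<^sup>+z. H (gd \<gamma> (fst s + (sqrt 2 * \<sigma>) *\<^sub>R z)) \<partial>gauss)"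
      using nn_integral_gauss_add[of "\<lambda>w. H (gd \<gamma> (fst s + \<sigma> *\<^sub>R w))"] by (simp add: mult.commute)
  qed
  finally show ?thesis .
qed

lemma step_synchronous_contraction:
  assumes S: "prob_space S" "sets S = sets state_space"
    and \<rho>: "0 \<le> \<rho>" "\<rho>\<^sup>2 = 1 - 2 * \<mu> * \<gamma> + 8 * L\<^sup>2 * \<gamma>\<^sup>2" and k: "2 * B\<^sup>2 * \<gamma>\<^sup>2 \<le> k * (1 - \<rho>\<^sup>2)" and p: "0 \<le> p"
  shows "(\<integral>\<^sup>+t. ennreal (excess k (norm (fst t - fst (snd t))) powr p) \<partial>step S)
     \<le> ennreal (\<rho> powr p) * (\<integral>\<^sup>+s. ennreal (excess k (norm (fst s - fst (snd s))) powr p) \<partial>S)"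
proof -
  have \<gamma>: "0 \<le> \<gamma>" using \<beta> by simp
  have AE2: "AE z2 in gauss. a + \<sigma> *\<^sub>R (z1 + z2) \<in> D" for a z1
    using AE_gauss_affine[OF D_AE D_sets, of \<sigma> "a + \<sigma> *\<^sub>R z1"] \<sigma> by (simp add: scaleR_add_right add.assoc)
  have pt: "(\<integral>\<^sup>+z2. ennreal (excess k (norm (gd \<gamma> (a + \<sigma> *\<^sub>R (z1 + z2)) - gd \<gamma> (v + \<sigma> *\<^sub>R (z1 + z2)))) powr p) \<partial>gauss)
      \<le> ennreal (\<rho> powr p) * ennreal (excess k (norm (a - v)) powr p)" for a v z1
  proof -
    have "(\<integral>\<^sup>+z2. ennreal (excess k (norm (gd \<gamma> (a + \<sigma> *\<^sub>R (z1 + z2)) - gd \<gamma> (v + \<sigma> *\<^sub>R (z1 + z2)))) powr p) \<partial>gauss)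
      \<le> (\<integral>\<^sup>+z2. ennreal (\<rho> powr p * excess k (norm (a - v)) powr p) \<partial>(gauss :: 'a measure))"
    proof (rule nn_integral_mono_AE)
      show "AE z2 in gauss. ennreal (excess k (norm (gd \<gamma> (a + \<sigma> *\<^sub>R (z1 + z2)) - gd \<gamma> (v + \<sigma> *\<^sub>R (z1 + z2)))) powr p) \<le> ennreal (\<rho> powr p * excess k (norm (a - v)) powr p)"
        using AE2[of a z1] AE2[of v z1]
      proof eventually_elim
        case (elim z2)
        have "(a + \<sigma> *\<^sub>R (z1 + z2)) - (v + \<sigma> *\<^sub>R (z1 + z2)) = a - v" by simp
        then have "(norm (gd \<gamma> (a + \<sigma> *\<^sub>R (z1 + z2)) - gd \<gamma> (v + \<sigma> *\<^sub>R (z1 + z2))))\<^sup>2 \<le> \<rho>\<^sup>2 * (norm (a - v))\<^sup>2 + 2 * B\<^sup>2 * \<gamma>\<^sup>2"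
          using gd_expansion[OF elim \<gamma>] unfolding \<rho>(2) by simp
        then have "excess k (norm (gd \<gamma> (a + \<sigma> *\<^sub>R (z1 + z2)) - gd \<gamma> (v + \<sigma> *\<^sub>R (z1 + z2)))) \<le> \<rho> * excess k (norm (a - v))"
          by (rule excess_contracts[OF _ k \<rho>(1)])
        then show ?case using \<rho>(1) p excess_nonneg
          by (intro ennreal_leI) (simp add: powr_mult[symmetric] powr_mono2)
      qed
    qed
    also have "\<dots> = ennreal (\<rho> powr p) * ennreal (excess k (norm (a - v)) powr p)"
      by (simp add: ennreal_mult gauss.emeasure_space_1[simplified])
    finally show ?thesis .
  qed
  have "(\<integral>\<^sup>+t. ennreal (excess k (norm (fst t - fst (snd t))) powr p) \<partial>step S) =
     (\<integral>\<^sup>+s. \<integral>\<^sup>+z1. \<integral>\<^sup>+q. ennreal (excess k (norm (gd \<gamma> (fst s + \<sigma> *\<^sub>R (z1 + snd q)) - gd \<gamma> (fst (snd s) + \<sigma> *\<^sub>R (z1 + snd q)))) powr p) \<partial>noise (snd (snd s) + \<sigma> *\<^sub>R z1) \<partial>gauss \<partial>S)"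
    by (subst step_properties(3)[OF S]) (auto simp: update_def)
  also have "\<dots> = (\<integral>\<^sup>+s. \<integral>\<^sup>+z1. \<integral>\<^sup>+z2. ennreal (excess k (norm (gd \<gamma> (fst s + \<sigma> *\<^sub>R (z1 + z2)) - gd \<gamma> (fst (snd s) + \<sigma> *\<^sub>R (z1 + z2)))) powr p) \<partial>gauss \<partial>gauss \<partial>S)"
    by (intro nn_integral_cong nn_integral_noise_snd) measurable
  also have "\<dots> \<le> (\<integral>\<^sup>+s. \<integral>\<^sup>+z1. ennreal (\<rho> powr p) * ennreal (excess k (norm (fst s - fst (snd s))) powr p) \<partial>(gauss::'a measure) \<partial>S)"
    by (intro nn_integral_mono pt)
  also have "\<dots> = ennreal (\<rho> powr p) * (\<integral>\<^sup>+s. ennreal (excess k (norm (fst s - fst (snd s))) powr p) \<partial>S)"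
    using S(2)[measurable_cong] by (simp add: gauss.emeasure_space_1[simplified] nn_integral_cmult)
  finally show ?thesis .
qed

text \<open>Average \<open>one_step_contraction\<close> over a state whose last component has law \<open>\<pi>\<close>; the common shift
\<open>\<sigma> z1\<close> cancels in the difference.\<close>

lemma step_bias_recursion:
  assumes S: "prob_space S" "sets S = sets state_space" and \<pi>: "distr S borel (\<lambda>s. snd (snd s)) = \<pi>"
    and c1: "0 \<le> c1" and small: "real (m + 1) * \<mu> * \<gamma> \<le> 1"
    and key: "\<And>\<kappa> (\<Delta> :: 'a) N. 0 \<le> \<kappa> \<Longrightarrow> norm N \<le> 2 * L * norm \<Delta> + \<kappa> \<Longrightarrow>
    norm (\<Delta> + \<gamma> *\<^sub>R N) ^ (2 * m + 2) \<le> (1 + (real (m + 1) * \<mu> / 2) * \<gamma>) * norm \<Delta> ^ (2 * m + 2)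
       + 2 * real (m + 1) * \<gamma> * (norm \<Delta> ^ (2 * m) * (\<Delta> \<bullet> N)) + c1 * \<gamma> ^ (m + 2) * \<kappa> ^ (2 * m + 2)"
  shows "(\<integral>\<^sup>+t. ennreal (norm (fst (snd t) - snd (snd t)) ^ (2 * m + 2)) \<partial>step S)
    \<le> ennreal (1 - real (m + 1) * \<mu> * \<gamma>) * (\<integral>\<^sup>+s. ennreal (norm (fst (snd s) - snd (snd s)) ^ (2 * m + 2)) \<partial>S)
       + ennreal (step_const m c1 * \<gamma> ^ (m + 2) * size_moment (2 * (2 * m + 2)))"
proof -
  note [measurable_cong] = S(2)
  let ?q = "2 * m + 2"
  let ?c = "ennreal (step_const m c1 * \<gamma> ^ (m + 2))"
  have \<gamma>: "0 \<le> \<gamma>" using \<beta> by simp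
  have "(\<integral>\<^sup>+t. ennreal (norm (fst (snd t) - snd (snd t)) ^ ?q) \<partial>step S) =
    (\<integral>\<^sup>+s. \<integral>\<^sup>+z1. \<integral>\<^sup>+p. ennreal (norm (gd \<gamma> (fst (snd s) + \<sigma> *\<^sub>R (z1 + snd p)) - gibbs_sweep (snd (snd s) + \<sigma> *\<^sub>R z1) (fst p) (snd p)) ^ ?q) \<partial>noise (snd (snd s) + \<sigma> *\<^sub>R z1) \<partial>gauss \<partial>S)"
    by (subst step_properties(3)[OF S]) (auto simp: update_def)
  also have "\<dots> \<le> (\<integral>\<^sup>+s. \<integral>\<^sup>+z1. ennreal ((1 - real (m + 1) * \<mu> * \<gamma>) * norm (fst (snd s) - snd (snd s)) ^ ?q) + ?c * size_int (2 * ?q) (snd (snd s) + \<sigma> *\<^sub>R z1) \<partial>gauss \<partial>S)"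
  proof (intro nn_integral_mono)
    fix s :: "'a \<times> 'a \<times> 'a" and z1 :: 'a
    show "(\<integral>\<^sup>+p. ennreal (norm (gd \<gamma> (fst (snd s) + \<sigma> *\<^sub>R (z1 + snd p)) - gibbs_sweep (snd (snd s) + \<sigma> *\<^sub>R z1) (fst p) (snd p)) ^ ?q) \<partial>noise (snd (snd s) + \<sigma> *\<^sub>R z1))
      \<le> ennreal ((1 - real (m + 1) * \<mu> * \<gamma>) * norm (fst (snd s) - snd (snd s)) ^ ?q) + ?c * size_int (2 * ?q) (snd (snd s) + \<sigma> *\<^sub>R z1)"
      using one_step_contraction[OF c1 small key, where vt="fst (snd s) + \<sigma> *\<^sub>R z1" and yt="snd (snd s) + \<sigma> *\<^sub>R z1"]
      by (simp only: gd_def scaleR_add_right add.assoc add_diff_add diff_self add_0_right add_diff_cancel_right)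
  qed
  also have "\<dots> = (\<integral>\<^sup>+s. ennreal ((1 - real (m + 1) * \<mu> * \<gamma>) * norm (fst (snd s) - snd (snd s)) ^ ?q) \<partial>S) + ?c * (\<integral>\<^sup>+s. \<integral>\<^sup>+z1. size_int (2 * ?q) (snd (snd s) + \<sigma> *\<^sub>R z1) \<partial>gauss \<partial>S)"
    by (simp add: nn_integral_add nn_integral_cmult gauss.emeasure_space_1[simplified])
  also have "(\<integral>\<^sup>+s. \<integral>\<^sup>+z1. size_int (2 * ?q) (snd (snd s) + \<sigma> *\<^sub>R z1) \<partial>gauss \<partial>S) = (\<integral>\<^sup>+y. \<integral>\<^sup>+z1. size_int (2 * ?q) (y + \<sigma> *\<^sub>R z1) \<partial>gauss \<partial>\<pi>)"
    unfolding \<pi>[symmetric] by (subst nn_integral_distr) auto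
  also have "(\<integral>\<^sup>+s. ennreal ((1 - real (m + 1) * \<mu> * \<gamma>) * norm (fst (snd s) - snd (snd s)) ^ ?q) \<partial>S) = ennreal (1 - real (m + 1) * \<mu> * \<gamma>) * (\<integral>\<^sup>+s. ennreal (norm (fst (snd s) - snd (snd s)) ^ ?q) \<partial>S)"
    using small by (simp add: ennreal_mult nn_integral_cmult)
  also have "?c * (\<integral>\<^sup>+y. \<integral>\<^sup>+z1. size_int (2 * ?q) (y + \<sigma> *\<^sub>R z1) \<partial>gauss \<partial>\<pi>) \<le> ?c * ennreal (size_moment (2 * ?q))"
    by (intro mult_left_mono size_int_total) auto
  also have "?c * ennreal (size_moment (2 * ?q)) = ennreal (step_const m c1 * \<gamma> ^ (m + 2) * size_moment (2 * ?q))"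
    using step_const_nonneg[OF c1] \<gamma> size_moment_nonneg by (simp add: ennreal_mult)
  finally show ?thesis by (simp add: add_left_mono)
qed

end

section \<open>Distance of the chain after many steps\<close>

lemma convex_on_powr_nonneg: "1 \<le> p \<Longrightarrow> convex_on {0..} (\<lambda>x::real. x powr p)"
proof (rule convex_onI)
  fix t x y :: real
  assume p: "1 \<le> p" and t: "0 < t" "t < 1" and xy: "x \<in> {0..}" "y \<in> {0..}"
  have shrink: "(s * u) powr p \<le> s * u powr p" if "0 < s" "s < 1" "0 \<le> u" for s u :: real
  proof -
    have "s powr p \<le> s powr 1" using that p by (intro powr_mono') auto
    then show ?thesis using that by (simp add: powr_mult mult_right_mono)
  qed
  show "((1 - t) *\<^sub>R x + t *\<^sub>R y) powr p \<le> (1 - t) * x powr p + t * y powr p"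
  proof (cases "x = 0 \<or> y = 0")
    case True
    then show ?thesis using shrink[of "1 - t" x] shrink[of t y] t xy p by auto
  next
    case False
    then show ?thesis using t xy convex_onD[OF powr_convex[OF p], of t x y] by auto
  qed
qed simp

lemma nn_integral_pair_gauss:
  fixes f :: "'b \<times> 'a::euclidean_space \<Rightarrow> ennreal"
  assumes "f \<in> borel_measurable (M \<Otimes>\<^sub>M (gauss :: 'a measure))"
  shows "(\<integral>\<^sup>+t. f t \<partial>(M \<Otimes>\<^sub>M gauss)) = (\<integral>\<^sup>+s. \<integral>\<^sup>+z. f (s, z) \<partial>gauss \<partial>M)"
  by (rule sigma_finite_measure.nn_integral_fst[OF prob_space_imp_sigma_finite[OF prob_space_gauss] assms, symmetric])

lemma nn_integral_pair_gauss_affine: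
  fixes v :: "'a::euclidean_space \<Rightarrow> ennreal"
  assumes "prob_space S" and [measurable]: "u \<in> borel_measurable S" "v \<in> borel_measurable borel"
  shows "(\<integral>\<^sup>+t. b1 * (b2 + b3 * (1 + b4 * u (fst t)) + b5 * v (snd t)) \<partial>(S \<Otimes>\<^sub>M gauss))
    = b1 * (b2 + b3 * (1 + b4 * (\<integral>\<^sup>+s. u s \<partial>S)) + b5 * (\<integral>\<^sup>+z. v z \<partial>gauss))"
proof -
  interpret S: prob_space S by fact
  have "(\<integral>\<^sup>+z. b1 * (b2 + b3 * (1 + b4 * u s) + b5 * v z) \<partial>gauss) = b1 * (b2 + b3 * (1 + b4 * u s) + b5 * (\<integral>\<^sup>+z. v z \<partial>gauss))" for s
    by (simp add: nn_integral_add nn_integral_cmult gauss.emeasure_space_1[simplified])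
  then show ?thesis
    by (subst nn_integral_pair_gauss) (simp_all add: nn_integral_add nn_integral_cmult S.emeasure_space_1)
qed

text \<open>Minkowski's inequality by convexity: \<open>f + h\<close> is a convex combination of \<open>f / l\<close> and \<open>h / (1 - l)\<close>, and \<open>l
= a / (a + b)\<close> is the optimal weight.\<close>

lemma nn_integral_minkowski:
  fixes f h :: "'b \<Rightarrow> real"
  assumes [measurable]: "f \<in> borel_measurable M" "h \<in> borel_measurable M"
    and f0: "\<And>x. 0 \<le> f x" and h0: "\<And>x. 0 \<le> h x" and p: "1 \<le> p" and ab: "0 < a" "0 < b"
    and f: "(\<integral>\<^sup>+x. ennreal (f x powr p) \<partial>M) \<le> ennreal (a powr p)"
    and h: "(\<integral>\<^sup>+x. ennreal (h x powr p) \<partial>M) \<le> ennreal (b powr p)"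
  shows "(\<integral>\<^sup>+x. ennreal ((f x + h x) powr p) \<partial>M) \<le> ennreal ((a + b) powr p)"
proof -
  define l where "l = a / (a + b)"
  have l: "0 < l" "l < 1" "1 - l = b / (a + b)" using ab by (auto simp: l_def field_simps)
  let ?s = "(a + b) powr p"
  have s: "0 < ?s" using ab by simp
  have pt: "(f x + h x) powr p \<le> l * (?s / a powr p) * f x powr p + (1 - l) * (?s / b powr p) * h x powr p" for x
  proof -
    have cv: "convex_on {0..} (\<lambda>u::real. u powr p)" by (rule convex_on_powr_nonneg[OF p])
    have "((1 - (1 - l)) *\<^sub>R (f x / l) + (1 - l) *\<^sub>R (h x / (1 - l))) powr p \<le> (1 - (1 - l)) * (f x / l) powr p + (1 - l) * (h x / (1 - l)) powr p"
      using l(1,2) f0[of x] h0[of x] by (intro convex_onD[OF cv]) auto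
    moreover have "(1 - (1 - l)) *\<^sub>R (f x / l) + (1 - l) *\<^sub>R (h x / (1 - l)) = f x + h x" using l(1,2) by simp
    moreover have "(f x / l) powr p = ?s / a powr p * f x powr p"
      using ab f0[of x] by (simp add: l_def powr_divide powr_mult)
    moreover have "(h x / (1 - l)) powr p = ?s / b powr p * h x powr p"
      using ab h0[of x] unfolding l(3) by (simp add: powr_divide powr_mult)
    ultimately show ?thesis by (simp add: mult.assoc)
  qed
  define A where "A = l * (?s / a powr p)"
  define K where "K = (1 - l) * (?s / b powr p)"
  have AB: "0 \<le> A" "0 \<le> K" using l(1,2) ab by (auto simp: A_def K_def)
  have split: "ennreal (A * u powr p + K * v powr p) = ennreal A * ennreal (u powr p) + ennreal K * ennreal (v powr p)" for u v
    using AB by (simp add: ennreal_mult[symmetric] ennreal_plus[symmetric] del: ennreal_plus)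
  have "(\<integral>\<^sup>+x. ennreal ((f x + h x) powr p) \<partial>M) \<le> (\<integral>\<^sup>+x. ennreal A * ennreal (f x powr p) + ennreal K * ennreal (h x powr p) \<partial>M)"
  proof (rule nn_integral_mono)
    fix x
    have "ennreal ((f x + h x) powr p) \<le> ennreal (A * f x powr p + K * h x powr p)" using pt[of x] unfolding A_def K_def by (rule ennreal_leI)
    also have "\<dots> = ennreal A * ennreal (f x powr p) + ennreal K * ennreal (h x powr p)" by (rule split)
    finally show "ennreal ((f x + h x) powr p) \<le> ennreal A * ennreal (f x powr p) + ennreal K * ennreal (h x powr p)" .
  qed
  also have "\<dots> = ennreal A * (\<integral>\<^sup>+x. ennreal (f x powr p) \<partial>M) + ennreal K * (\<integral>\<^sup>+x. ennreal (h x powr p) \<partial>M)"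
    by (simp add: nn_integral_add nn_integral_cmult)
  also have "\<dots> \<le> ennreal A * ennreal (a powr p) + ennreal K * ennreal (b powr p)"
    by (intro add_mono mult_left_mono f h) auto
  also have "\<dots> = ennreal (A * a powr p + K * b powr p)" by (rule split[symmetric])
  also have "A * a powr p + K * b powr p = ?s"
  proof -
    have "A * a powr p = l * ?s" "K * b powr p = (1 - l) * ?s" using ab by (auto simp: A_def K_def)
    then show ?thesis by (simp add: left_diff_distrib)
  qed
  finally show ?thesis .
qed

lemma powr_add3_le:
  fixes x y z p :: real
  assumes "0 \<le> x" "0 \<le> y" "0 \<le> z" "0 \<le> p"
  shows "(x + y + z) powr p \<le> 3 powr p * (x powr p + y powr p + z powr p)"
proof -
  define M where "M = max x (max y z)"
  have "(x + y + z) powr p \<le> (3 * M) powr p" using assms by (intro powr_mono2) (auto simp: M_def)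
  also have "\<dots> = 3 powr p * M powr p" using assms by (simp add: powr_mult M_def)
  also have "M powr p \<le> x powr p + y powr p + z powr p"
    by (auto simp: M_def max_def)
  finally show ?thesis by simp
qed

lemma powr_add2_le:
  fixes x y p :: real
  assumes "0 \<le> x" "0 \<le> y" "0 \<le> p"
  shows "(x + y) powr p \<le> 3 powr p * (x powr p + y powr p)"
  using powr_add3_le[of x y 0 p] assms by simp

lemma powr_le_one_plus_power:
  fixes x p :: real
  assumes "0 \<le> x" "0 < p" "p \<le> real q"
  shows "x powr p \<le> 1 + x ^ q"
proof (cases "x \<le> 1")
  case True
  then have "x powr p \<le> 1 powr p" using assms by (intro powr_mono2) auto
  then show ?thesis using assms by (simp add: add_increasing2)
next
  case False
  then have "x powr p \<le> x powr real q" using assms by (intro powr_mono) auto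
  then show ?thesis using False by (simp add: powr_realpow)
qed

lemma ennreal_root_le:
  assumes "x \<le> ennreal (a powr p)" "0 \<le> a" "1 \<le> p"
  shows "ennreal_root p x \<le> ennreal a"
proof -
  have "x \<noteq> \<top>" using assms(1) by (auto simp: top_unique)
  then obtain r where r: "x = ennreal r" "0 \<le> r" by (cases x) auto
  have "r \<le> a powr p" using assms(1) r by (simp add: ennreal_le_iff)
  then have "r powr (1 / p) \<le> (a powr p) powr (1 / p)" using r assms(3) by (intro powr_mono2) auto
  also have "\<dots> = a" using assms by (simp add: powr_powr)
  finally show ?thesis using r by (simp add: ennreal_root_def ennreal_leI)
qed

context langevin_potential
begin

text \<open>The sequence of laws of the algorithm, characterised by its transition kernel. Only the laws matter
for the Wasserstein distance.\<close>

definition ula_laws :: "real \<Rightarrow> (nat \<Rightarrow> 'a measure) \<Rightarrow> bool" where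
  "ula_laws \<gamma> \<nu> \<longleftrightarrow> (\<forall>n. prob_space (\<nu> n) \<and> sets (\<nu> n) = sets borel \<and>
     (\<forall>H\<in>borel_measurable borel. (\<integral>\<^sup>+x. H x \<partial>\<nu> (Suc n)) = (\<integral>\<^sup>+x. \<integral>\<^sup>+z. H (gd \<gamma> x + sqrt (2 * \<gamma> / \<beta>) *\<^sub>R z) \<partial>gauss \<partial>\<nu> n)))"

text \<open>The fixed point of the recursion in \<open>step_bias_recursion\<close>, divided by \<open>\<gamma> ^ (m + 1)\<close>.\<close>

definition "stationary_bias m c1 = step_const m c1 * size_moment (2 * (2 * m + 2)) / (real (m + 1) * \<mu>)"

definition "bias_rate p m c1 = 3 * ((B * sqrt (2 / \<mu>)) powr p + (1 + stationary_bias m c1) + (sqrt (2 / \<beta>)) powr p * gauss_moment (2 * m + 2)) powr (1 / p)"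

lemma stationary_bias_nonneg: "0 \<le> c1 \<Longrightarrow> 0 \<le> stationary_bias m c1"
  unfolding stationary_bias_def using step_const_nonneg size_moment_nonneg \<mu> by simp

lemma bias_rate_powr:
  assumes "0 \<le> c1" "1 \<le> p"
  shows "0 < bias_rate p m c1" "bias_rate p m c1 powr p = 3 powr p * ((B * sqrt (2 / \<mu>)) powr p + (1 + stationary_bias m c1) + (sqrt (2 / \<beta>)) powr p * gauss_moment (2 * m + 2))"
proof -
  let ?x = "(B * sqrt (2 / \<mu>)) powr p + (1 + stationary_bias m c1) + (sqrt (2 / \<beta>)) powr p * gauss_moment (2 * m + 2)"
  have "0 \<le> (sqrt (2 / \<beta>)) powr p * gauss_moment (2 * m + 2)" using gauss_moment_nonneg by simp
  then have x: "0 < ?x" using stationary_bias_nonneg[OF assms(1), of m] by (smt (verit) powr_ge_zero)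
  then show "0 < bias_rate p m c1" unfolding bias_rate_def by simp
  show "bias_rate p m c1 powr p = 3 powr p * ?x"
    unfolding bias_rate_def using x assms(2) by (simp add: powr_mult powr_powr)
qed

end

context restricted_gaussian
begin

text \<open>Given a coupling of \<open>x\<^sub>0\<close> and a stationary point, both other components start in the latter.\<close>

definition start :: "('a \<times> 'a) measure \<Rightarrow> ('a \<times> 'a \<times> 'a) measure" where
  "start Q = distr Q state_space (\<lambda>w. (gd \<gamma> (fst w), snd w, snd w))"

definition chain :: "('a \<times> 'a) measure \<Rightarrow> nat \<Rightarrow> ('a \<times> 'a \<times> 'a) measure" where
  "chain Q k = (step ^^ k) (start Q)"

lemma chain_simps: "chain Q 0 = start Q" "chain Q (Suc k) = step (chain Q k)"
  by (simp_all add: chain_def)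

lemma sqrt_step: "sqrt (2 * \<gamma> / \<beta>) = sqrt 2 * \<sigma>"
  using \<beta> \<sigma> by (simp add: real_sqrt_mult)

context
  fixes Q \<nu>
  assumes laws: "ula_laws \<gamma> \<nu>" and Q: "Q \<in> couplings (\<nu> 0) \<pi>"
begin

lemma Q_prob: "prob_space Q" and Q_sets[measurable_cong]: "sets Q = sets (borel \<Otimes>\<^sub>M borel)"
  and Q_fst: "distr Q borel fst = \<nu> 0" and Q_snd: "distr Q borel snd = \<pi>"
  using Q by (auto simp: couplings_def)

lemma law_sets[measurable_cong]: "sets (\<nu> n) = sets borel" and law_prob: "prob_space (\<nu> n)"
  and law_step: "H \<in> borel_measurable borel \<Longrightarrow> (\<integral>\<^sup>+x. H x \<partial>\<nu> (Suc n)) = (\<integral>\<^sup>+x. \<integral>\<^sup>+z. H (gd \<gamma> x + (sqrt 2 * \<sigma>) *\<^sub>R z) \<partial>gauss \<partial>\<nu> n)"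
  using laws unfolding ula_laws_def sqrt_step by auto

lemma start_measurable: "(\<lambda>w. (gd \<gamma> (fst w), snd w, snd w)) \<in> measurable Q state_space"
  by measurable

lemma chain_invariant:
  "sets (chain Q k) = sets state_space \<and> prob_space (chain Q k) \<and> distr (chain Q k) borel (\<lambda>s. snd (snd s)) = \<pi>
    \<and> (\<forall>H\<in>borel_measurable borel. (\<integral>\<^sup>+s. H (fst s) \<partial>chain Q k) = (\<integral>\<^sup>+x. H (gd \<gamma> x) \<partial>\<nu> k))"
proof (induction k)
  case 0
  have "prob_space (start Q)" unfolding start_def by (rule prob_space.prob_space_distr[OF Q_prob start_measurable])
  moreover have "distr (start Q) borel (\<lambda>s. snd (snd s)) = \<pi>"
    unfolding start_def Q_snd[symmetric] by (subst distr_distr[OF _ start_measurable]) (auto simp: comp_def)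
  moreover have "(\<integral>\<^sup>+s. H (fst s) \<partial>start Q) = (\<integral>\<^sup>+x. H (gd \<gamma> x) \<partial>\<nu> 0)" if [measurable]: "H \<in> borel_measurable borel" for H
  proof -
    have "(\<integral>\<^sup>+s. H (fst s) \<partial>start Q) = (\<integral>\<^sup>+w. H (gd \<gamma> (fst w)) \<partial>Q)"
      unfolding start_def by (subst nn_integral_distr[OF start_measurable]) auto
    then show ?thesis unfolding Q_fst[symmetric] by (subst nn_integral_distr) auto
  qed
  moreover have "sets (start Q) = sets state_space" by (simp add: start_def)
  ultimately show ?case unfolding chain_simps by blast
next
  case (Suc k)
  then have S: "prob_space (chain Q k)" "sets (chain Q k) = sets state_space" "distr (chain Q k) borel (\<lambda>s. snd (snd s)) = \<pi>"
    and H: "\<And>H. H \<in> borel_measurable borel \<Longrightarrow> (\<integral>\<^sup>+s. H (fst s) \<partial>chain Q k) = (\<integral>\<^sup>+x. H (gd \<gamma> x) \<partial>\<nu> k)" by auto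
  have "(\<integral>\<^sup>+s. H (fst s) \<partial>step (chain Q k)) = (\<integral>\<^sup>+x. H (gd \<gamma> x) \<partial>\<nu> (Suc k))" if [measurable]: "H \<in> borel_measurable borel" for H
  proof -
    have "(\<integral>\<^sup>+s. H (fst s) \<partial>step (chain Q k)) = (\<integral>\<^sup>+s. \<integral>\<^sup>+z. H (gd \<gamma> (fst s + (sqrt 2 * \<sigma>) *\<^sub>R z)) \<partial>gauss \<partial>chain Q k)"
      by (rule step_first_marginal[OF S(1,2)]) measurable
    also have "\<dots> = (\<integral>\<^sup>+x. \<integral>\<^sup>+z. H (gd \<gamma> (gd \<gamma> x + (sqrt 2 * \<sigma>) *\<^sub>R z)) \<partial>gauss \<partial>\<nu> k)"
      by (rule H[of "\<lambda>a. \<integral>\<^sup>+z. H (gd \<gamma> (a + (sqrt 2 * \<sigma>) *\<^sub>R z)) \<partial>gauss"]) measurable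
    also have "\<dots> = (\<integral>\<^sup>+x. H (gd \<gamma> x) \<partial>\<nu> (Suc k))"
      by (rule law_step[symmetric]) measurable
    finally show ?thesis .
  qed
  then show ?case unfolding chain_simps
    using step_properties(1,2)[OF S(1,2)] step_gibbs_marginal[OF S] by blast
qed

lemma chain_S: "prob_space (chain Q k)" "sets (chain Q k) = sets state_space" "distr (chain Q k) borel (\<lambda>s. snd (snd s)) = \<pi>"
  and chain_first: "H \<in> borel_measurable borel \<Longrightarrow> (\<integral>\<^sup>+s. H (fst s) \<partial>chain Q k) = (\<integral>\<^sup>+x. H (gd \<gamma> x) \<partial>\<nu> k)"
  using chain_invariant[of k] by auto

lemma chain_contraction:
  assumes \<rho>: "0 \<le> \<rho>" "\<rho>\<^sup>2 = 1 - 2 * \<mu> * \<gamma> + 8 * L\<^sup>2 * \<gamma>\<^sup>2" and k: "0 \<le> k" "2 * B\<^sup>2 * \<gamma>\<^sup>2 \<le> k * (1 - \<rho>\<^sup>2)" and p: "0 \<le> p"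
    and F: "(\<integral>\<^sup>+w. ennreal (norm (gd \<gamma> (fst w) - snd w) powr p) \<partial>Q) \<le> ennreal (F powr p)" "0 \<le> F"
  shows "(\<integral>\<^sup>+s. ennreal (excess k (norm (fst s - fst (snd s))) powr p) \<partial>chain Q j) \<le> ennreal ((\<rho> ^ j * F) powr p)"
proof (induction j)
  case 0
  have "(\<integral>\<^sup>+s. ennreal (excess k (norm (fst s - fst (snd s))) powr p) \<partial>chain Q 0) = (\<integral>\<^sup>+w. ennreal (excess k (norm (gd \<gamma> (fst w) - snd w)) powr p) \<partial>Q)"
    unfolding chain_simps start_def by (subst nn_integral_distr[OF start_measurable]) auto
  also have "\<dots> \<le> (\<integral>\<^sup>+w. ennreal (norm (gd \<gamma> (fst w) - snd w) powr p) \<partial>Q)"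
    using k p excess_nonneg by (intro nn_integral_mono ennreal_leI powr_mono2 excess_le) auto
  finally show ?case using F by simp
next
  case (Suc j)
  have "(\<integral>\<^sup>+s. ennreal (excess k (norm (fst s - fst (snd s))) powr p) \<partial>chain Q (Suc j)) \<le> ennreal (\<rho> powr p) * ennreal ((\<rho> ^ j * F) powr p)"
    unfolding chain_simps
    by (rule order_trans[OF step_synchronous_contraction[OF chain_S(1,2) \<rho> k(2) p] mult_left_mono[OF Suc]]) simp
  also have "\<dots> = ennreal ((\<rho> ^ Suc j * F) powr p)" using \<rho>(1) F(2) by (simp add: ennreal_mult[symmetric] powr_mult mult.assoc)
  finally show ?case .
qed

lemma chain_bias:
  assumes c1: "0 \<le> c1" and small: "real (m + 1) * \<mu> * \<gamma> \<le> 1"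
    and key: "\<And>\<kappa> (\<Delta> :: 'a) N. 0 \<le> \<kappa> \<Longrightarrow> norm N \<le> 2 * L * norm \<Delta> + \<kappa> \<Longrightarrow>
    norm (\<Delta> + \<gamma> *\<^sub>R N) ^ (2 * m + 2) \<le> (1 + (real (m + 1) * \<mu> / 2) * \<gamma>) * norm \<Delta> ^ (2 * m + 2)
       + 2 * real (m + 1) * \<gamma> * (norm \<Delta> ^ (2 * m) * (\<Delta> \<bullet> N)) + c1 * \<gamma> ^ (m + 2) * \<kappa> ^ (2 * m + 2)"
  shows "(\<integral>\<^sup>+s. ennreal (norm (fst (snd s) - snd (snd s)) ^ (2 * m + 2)) \<partial>chain Q j) \<le> ennreal (stationary_bias m c1 * \<gamma> ^ (m + 1))"
proof (induction j)
  case 0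
  have "(\<integral>\<^sup>+s. ennreal (norm (fst (snd s) - snd (snd s)) ^ (2 * m + 2)) \<partial>chain Q 0) = 0"
    unfolding chain_simps start_def by (subst nn_integral_distr[OF start_measurable]) auto
  then show ?case by simp
next
  case (Suc j)
  let ?V = "stationary_bias m c1" and ?a = "real (m + 1) * \<mu>"
  let ?b = "step_const m c1 * size_moment (2 * (2 * m + 2))"
  have V: "0 \<le> ?V" by (rule stationary_bias_nonneg[OF c1])
  have b: "0 \<le> ?b" "?b = ?V * ?a" using step_const_nonneg[OF c1, of m] size_moment_nonneg \<mu> by (auto simp: stationary_bias_def)
  have \<gamma>: "0 \<le> \<gamma>" using \<beta> by simp
  have "(\<integral>\<^sup>+s. ennreal (norm (fst (snd s) - snd (snd s)) ^ (2 * m + 2)) \<partial>chain Q (Suc j))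
     \<le> ennreal (1 - ?a * \<gamma>) * ennreal (?V * \<gamma> ^ (m + 1)) + ennreal (step_const m c1 * \<gamma> ^ (m + 2) * size_moment (2 * (2 * m + 2)))"
    unfolding chain_simps
    by (rule order_trans[OF step_bias_recursion[OF chain_S c1 small key] add_right_mono[OF mult_left_mono[OF Suc]]]) auto
  also have "\<dots> = ennreal ((1 - ?a * \<gamma>) * (?V * \<gamma> ^ (m + 1)) + step_const m c1 * \<gamma> ^ (m + 2) * size_moment (2 * (2 * m + 2)))"
    using small V \<gamma> step_const_nonneg[OF c1, of m] size_moment_nonneg[of "2 * (2 * m + 2)"]
    by (simp add: ennreal_mult[symmetric] ennreal_plus[symmetric] del: ennreal_plus)
  also have "(1 - ?a * \<gamma>) * (?V * \<gamma> ^ (m + 1)) + step_const m c1 * \<gamma> ^ (m + 2) * size_moment (2 * (2 * m + 2)) = ?V * \<gamma> ^ (m + 1)"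
  proof -
    have "step_const m c1 * \<gamma> ^ (m + 2) * size_moment (2 * (2 * m + 2)) = ?b * (\<gamma> * \<gamma> ^ (m + 1))" by simp
    then show ?thesis unfolding b(2) by (simp only:) (simp add: algebra_simps)
  qed
  finally show ?case .
qed

text \<open>A fresh Gaussian turns the first component, which has the law of \<open>gd \<gamma> x\<^sub>k\<close>, into a
variable with the law of the next iterate. The stationary component stays as it is; the
displacement, of size \<open>sqrt \<gamma>\<close>, is within the error that is allowed.\<close>

lemma chain_coupling:
  "distr (chain Q k \<Otimes>\<^sub>M (gauss::'a measure)) (borel \<Otimes>\<^sub>M borel) (\<lambda>t. (snd (snd (fst t)), fst (fst t) + (sqrt 2 * \<sigma>) *\<^sub>R snd t)) \<in> couplings \<pi> (\<nu> (Suc k))"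
proof -
  note [measurable_cong] = chain_S(2)[of k]
  interpret S: prob_space "chain Q k" by (rule chain_S)
  interpret SG: pair_prob_space "chain Q k" "gauss::'a measure" ..
  let ?T = "\<lambda>t. (snd (snd (fst t)), fst (fst t) + (sqrt 2 * \<sigma>) *\<^sub>R snd t)"
  have T[measurable]: "?T \<in> measurable (chain Q k \<Otimes>\<^sub>M (gauss::'a measure)) (borel \<Otimes>\<^sub>M borel)" by measurable
  have "distr (chain Q k \<Otimes>\<^sub>M (gauss::'a measure)) borel (\<lambda>t. snd (snd (fst t))) = \<pi>"
  proof -
    have "distr (chain Q k \<Otimes>\<^sub>M (gauss::'a measure)) borel (\<lambda>t. snd (snd (fst t))) = distr (distr (chain Q k \<Otimes>\<^sub>M (gauss::'a measure)) (chain Q k) fst) borel (\<lambda>s. snd (snd s))"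
      by (subst distr_distr) (auto simp: comp_def)
    also have "distr (chain Q k \<Otimes>\<^sub>M (gauss::'a measure)) (chain Q k) fst = chain Q k" by (rule prob_space.distr_pair_fst[OF gauss.prob_space_axioms])
    finally show ?thesis using chain_S(3) by simp
  qed
  moreover have "distr (chain Q k \<Otimes>\<^sub>M (gauss::'a measure)) borel (\<lambda>t. fst (fst t) + (sqrt 2 * \<sigma>) *\<^sub>R snd t) = \<nu> (Suc k)"
  proof (rule measure_eqI)
    fix A assume "A \<in> sets (distr (chain Q k \<Otimes>\<^sub>M (gauss::'a measure)) borel (\<lambda>t. fst (fst t) + (sqrt 2 * \<sigma>) *\<^sub>R snd t))"
    then have [measurable]: "A \<in> sets borel" by simp
    have "emeasure (distr (chain Q k \<Otimes>\<^sub>M (gauss::'a measure)) borel (\<lambda>t. fst (fst t) + (sqrt 2 * \<sigma>) *\<^sub>R snd t)) A = (\<integral>\<^sup>+t. indicator A (fst (fst t) + (sqrt 2 * \<sigma>) *\<^sub>R snd t) \<partial>(chain Q k \<Otimes>\<^sub>M (gauss::'a measure)))"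
      by (subst nn_integral_indicator[symmetric], simp, subst nn_integral_distr) auto
    also have "\<dots> = (\<integral>\<^sup>+s. \<integral>\<^sup>+z. indicator A (fst s + (sqrt 2 * \<sigma>) *\<^sub>R z) \<partial>gauss \<partial>chain Q k)"
      by (subst nn_integral_pair_gauss) auto
    also have "\<dots> = (\<integral>\<^sup>+x. \<integral>\<^sup>+z. indicator A (gd \<gamma> x + (sqrt 2 * \<sigma>) *\<^sub>R z) \<partial>gauss \<partial>\<nu> k)"
      by (rule chain_first[of "\<lambda>a. \<integral>\<^sup>+z. indicator A (a + (sqrt 2 * \<sigma>) *\<^sub>R z) \<partial>gauss"]) measurable
    also have "\<dots> = (\<integral>\<^sup>+x. indicator A x \<partial>\<nu> (Suc k))" by (rule law_step[symmetric]) measurable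
    also have "\<dots> = emeasure (\<nu> (Suc k)) A" by (rule nn_integral_indicator) measurable
    finally show "emeasure (distr (chain Q k \<Otimes>\<^sub>M (gauss::'a measure)) borel (\<lambda>t. fst (fst t) + (sqrt 2 * \<sigma>) *\<^sub>R snd t)) A = emeasure (\<nu> (Suc k)) A" .
  qed (simp add: law_sets)
  ultimately show ?thesis
    unfolding couplings_def using SG.prob_space_distr[OF T] by (simp add: distr_distr[OF _ T] comp_def)
qed

text \<open>The distance is at most the excess of \<open>|a - v|\<close>, which contracts, plus three terms of order \<open>sqrt
\<gamma>\<close>: the jumps of the gradient, the bias \<open>|v - y|\<close> and the last Gaussian. The exponent is raised
from \<open>p\<close> to \<open>2 m + 2\<close> because the bias is estimated for even powers.\<close>

lemma chain_cost:
  assumes c1: "0 \<le> c1" and small: "real (m + 1) * \<mu> * \<gamma> \<le> 1"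
    and key: "\<And>\<kappa> (\<Delta> :: 'a) N. 0 \<le> \<kappa> \<Longrightarrow> norm N \<le> 2 * L * norm \<Delta> + \<kappa> \<Longrightarrow>
    norm (\<Delta> + \<gamma> *\<^sub>R N) ^ (2 * m + 2) \<le> (1 + (real (m + 1) * \<mu> / 2) * \<gamma>) * norm \<Delta> ^ (2 * m + 2)
       + 2 * real (m + 1) * \<gamma> * (norm \<Delta> ^ (2 * m) * (\<Delta> \<bullet> N)) + c1 * \<gamma> ^ (m + 2) * \<kappa> ^ (2 * m + 2)"
    and p: "1 \<le> p" "p \<le> real (2 * m + 2)"
    and \<rho>: "0 < \<rho>" "\<rho>\<^sup>2 = 1 - 2 * \<mu> * \<gamma> + 8 * L\<^sup>2 * \<gamma>\<^sup>2" and \<rho>': "\<rho>\<^sup>2 \<le> 1 - \<mu> * \<gamma>"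
    and F: "(\<integral>\<^sup>+w. ennreal (norm (gd \<gamma> (fst w) - snd w) powr p) \<partial>Q) \<le> ennreal (F powr p)" "0 < F"
  shows "\<exists>R\<in>couplings \<pi> (\<nu> (Suc j)). (\<integral>\<^sup>+w. ennreal (norm (fst w - snd w) powr p) \<partial>R) \<le> ennreal ((\<rho> ^ j * F + bias_rate p m c1 * sqrt \<gamma>) powr p)"
proof -
  note [measurable_cong] = chain_S(2)[of j]
  interpret S: prob_space "chain Q j" by (rule chain_S)
  interpret SG: pair_prob_space "chain Q j" "gauss::'a measure" ..
  have \<gamma>: "0 < \<gamma>" using \<beta> \<sigma> by simp
  \<comment> \<open>The level below which the jumps of the gradient may prevent contraction.\<close>
  define k where "k = 2 * B\<^sup>2 * \<gamma> / \<mu>"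
  have k: "0 \<le> k" using \<gamma> \<mu> by (simp add: k_def)
  have "2 * B\<^sup>2 * \<gamma>\<^sup>2 = k * (\<mu> * \<gamma>)" using \<mu> by (simp add: k_def power2_eq_square)
  also have "\<dots> \<le> k * (1 - \<rho>\<^sup>2)" using \<rho>' k by (intro mult_left_mono) auto
  finally have kb: "2 * B\<^sup>2 * \<gamma>\<^sup>2 \<le> k * (1 - \<rho>\<^sup>2)" .
  have sk: "sqrt k = sqrt \<gamma> * (B * sqrt (2 / \<mu>))"
  proof -
    have "k = \<gamma> * (B\<^sup>2 * (2 / \<mu>))" by (simp add: k_def)
    then show ?thesis using B by (simp only: real_sqrt_mult real_sqrt_abs abs_of_nonneg)
  qed
  let ?f = "\<lambda>t::('a \<times> 'a \<times> 'a) \<times> 'a. excess k (norm (fst (fst t) - fst (snd (fst t))))"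
  let ?h = "\<lambda>t::('a \<times> 'a \<times> 'a) \<times> 'a. sqrt k + norm (fst (snd (fst t)) - snd (snd (fst t))) + sqrt 2 * \<sigma> * norm (snd t)"
  let ?M = "chain Q j \<Otimes>\<^sub>M (gauss::'a measure)"
  have f: "(\<integral>\<^sup>+t. ennreal (?f t powr p) \<partial>?M) \<le> ennreal ((\<rho> ^ j * F) powr p)"
  proof -
    have "(\<integral>\<^sup>+t. ennreal (?f t powr p) \<partial>?M) = (\<integral>\<^sup>+s. \<integral>\<^sup>+z. ennreal (excess k (norm (fst s - fst (snd s))) powr p) \<partial>(gauss::'a measure) \<partial>chain Q j)"
      by (subst nn_integral_pair_gauss) auto
    also have "\<dots> = (\<integral>\<^sup>+s. ennreal (excess k (norm (fst s - fst (snd s))) powr p) \<partial>chain Q j)"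
      by (simp add: gauss.emeasure_space_1[simplified])
    also have "\<dots> \<le> ennreal ((\<rho> ^ j * F) powr p)"
      using \<rho> k kb p F by (intro chain_contraction) auto
    finally show ?thesis .
  qed
  let ?V = "stationary_bias m c1" and ?q = "2 * m + 2"
  let ?sg = "(sqrt \<gamma>) powr p"
  have sgq: "(sqrt \<gamma>) ^ ?q = \<gamma> ^ (m + 1)"
  proof -
    have "?q = 2 * (m + 1)" by simp
    then have "(sqrt \<gamma>) ^ ?q = ((sqrt \<gamma>)\<^sup>2) ^ (m + 1)" by (simp only: power_mult)
    then show ?thesis using \<gamma> by simp
  qed
  have v: "norm x powr p \<le> ?sg * (1 + norm x ^ ?q / \<gamma> ^ (m + 1))" for x :: 'a
  proof -
    have "(norm x / sqrt \<gamma>) powr p \<le> 1 + (norm x / sqrt \<gamma>) ^ ?q"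
      using p \<gamma> by (intro powr_le_one_plus_power) auto
    then have "norm x powr p / ?sg \<le> 1 + norm x ^ ?q / \<gamma> ^ (m + 1)"
      using \<gamma> by (simp only: powr_divide norm_ge_zero real_sqrt_ge_zero less_imp_le power_divide sgq)
    moreover have "0 < ?sg" using \<beta> \<sigma> by simp
    ultimately show ?thesis by (simp only: pos_divide_le_eq mult.commute[of _ ?sg])
  qed
  have s: "sqrt 2 * \<sigma> = sqrt \<gamma> * sqrt (2 / \<beta>)" using \<beta> \<sigma> by (simp add: real_sqrt_mult real_sqrt_divide)
  have hpt: "?h t powr p \<le> 3 powr p * (?sg * (B * sqrt (2 / \<mu>)) powr p + ?sg * (1 + norm (fst (snd (fst t)) - snd (snd (fst t))) ^ ?q / \<gamma> ^ (m + 1))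
       + ?sg * (sqrt (2 / \<beta>)) powr p * (1 + norm (snd t)) ^ ?q)" for t
  proof -
    have "?h t powr p \<le> 3 powr p * (sqrt k powr p + norm (fst (snd (fst t)) - snd (snd (fst t))) powr p + (sqrt 2 * \<sigma> * norm (snd t)) powr p)"
      using k \<sigma> p by (intro powr_add3_le) auto
    also have "\<dots> \<le> 3 powr p * (?sg * (B * sqrt (2 / \<mu>)) powr p + ?sg * (1 + norm (fst (snd (fst t)) - snd (snd (fst t))) ^ ?q / \<gamma> ^ (m + 1))
       + ?sg * (sqrt (2 / \<beta>)) powr p * (1 + norm (snd t)) ^ ?q)"
    proof (intro mult_left_mono add_mono v)
      show "sqrt k powr p \<le> ?sg * (B * sqrt (2 / \<mu>)) powr p" unfolding sk using \<gamma> B \<mu> by (simp add: powr_mult)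
      have "norm (snd t) powr p \<le> (1 + norm (snd t)) powr p" using p by (intro powr_mono2) auto
      also have "\<dots> \<le> (1 + norm (snd t)) powr real ?q" using p by (intro powr_mono) auto
      also have "\<dots> = (1 + norm (snd t)) ^ ?q" by (rule powr_realpow) (simp add: add_pos_nonneg)
      finally have "?sg * (sqrt (2 / \<beta>)) powr p * norm (snd t) powr p \<le> ?sg * (sqrt (2 / \<beta>)) powr p * (1 + norm (snd t)) ^ ?q"
        by (intro mult_left_mono) auto
      then show "(sqrt 2 * \<sigma> * norm (snd t)) powr p \<le> ?sg * (sqrt (2 / \<beta>)) powr p * (1 + norm (snd t)) ^ ?q"
        unfolding s using \<gamma> \<beta> by (simp add: powr_mult)
    qed auto
    finally show ?thesis .
  qed
  have h: "(\<integral>\<^sup>+t. ennreal (?h t powr p) \<partial>?M) \<le> ennreal ((bias_rate p m c1 * sqrt \<gamma>) powr p)"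
  proof -
    let ?b1 = "ennreal (3 powr p)" and ?b2 = "ennreal (?sg * (B * sqrt (2 / \<mu>)) powr p)" and ?b3 = "ennreal ?sg"
      and ?b4 = "ennreal (1 / \<gamma> ^ (m + 1))" and ?b5 = "ennreal (?sg * (sqrt (2 / \<beta>)) powr p)"
    have "(\<integral>\<^sup>+t. ennreal (?h t powr p) \<partial>?M) \<le> (\<integral>\<^sup>+t. ?b1 * (?b2 + ?b3 * (1 + ?b4 * ennreal (norm (fst (snd (fst t)) - snd (snd (fst t))) ^ ?q)) + ?b5 * ennreal ((1 + norm (snd t)) ^ ?q)) \<partial>?M)"
    proof (rule nn_integral_mono)
      fix t
      show "ennreal (?h t powr p) \<le> ?b1 * (?b2 + ?b3 * (1 + ?b4 * ennreal (norm (fst (snd (fst t)) - snd (snd (fst t))) ^ ?q)) + ?b5 * ennreal ((1 + norm (snd t)) ^ ?q))"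
        using ennreal_leI[OF hpt[of t]] \<gamma>
        by (simp add: ennreal_mult[symmetric] ennreal_plus[symmetric] ennreal_1[symmetric] del: ennreal_plus ennreal_1)
    qed
    also have "\<dots> = ?b1 * (?b2 + ?b3 * (1 + ?b4 * (\<integral>\<^sup>+s. ennreal (norm (fst (snd s) - snd (snd s)) ^ ?q) \<partial>chain Q j)) + ?b5 * ennreal (gauss_moment ?q))"
      unfolding nn_gauss_moment[symmetric] by (rule nn_integral_pair_gauss_affine[OF chain_S(1)]) measurable
    also have "\<dots> \<le> ?b1 * (?b2 + ?b3 * (1 + ?b4 * ennreal (?V * \<gamma> ^ (m + 1))) + ?b5 * ennreal (gauss_moment ?q))"
      by (intro mult_left_mono add_left_mono add_right_mono chain_bias[OF c1 small key]) auto
    also have "\<dots> = ennreal (3 powr p * (?sg * (B * sqrt (2 / \<mu>)) powr p + ?sg * (1 + 1 / \<gamma> ^ (m + 1) * (?V * \<gamma> ^ (m + 1))) + ?sg * (sqrt (2 / \<beta>)) powr p * gauss_moment ?q))"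
      using \<gamma> stationary_bias_nonneg[OF c1, of m] gauss_moment_nonneg[of ?q]
      by (simp add: ennreal_mult[symmetric] ennreal_plus[symmetric] ennreal_1[symmetric] del: ennreal_plus ennreal_1)
    also have "3 powr p * (?sg * (B * sqrt (2 / \<mu>)) powr p + ?sg * (1 + 1 / \<gamma> ^ (m + 1) * (?V * \<gamma> ^ (m + 1))) + ?sg * (sqrt (2 / \<beta>)) powr p * gauss_moment ?q) = (bias_rate p m c1 * sqrt \<gamma>) powr p"
    proof -
      have e: "1 / \<gamma> ^ (m + 1) * (?V * \<gamma> ^ (m + 1)) = ?V"
      proof -
        have "\<gamma> ^ (m + 1) \<noteq> 0" using \<beta> \<sigma> by simp
        from nonzero_mult_div_cancel_right[OF this, of "stationary_bias m c1"] show ?thesis by (simp only: times_divide_eq_left mult_1_left)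
      qed
      have "(bias_rate p m c1 * sqrt \<gamma>) powr p = bias_rate p m c1 powr p * ?sg"
        using bias_rate_powr(1)[OF c1 p(1), of m] \<gamma> by (simp only: powr_mult)
      then show ?thesis unfolding e bias_rate_powr(2)[OF c1 p(1)] by (simp only:) (simp add: algebra_simps)
    qed
    finally show ?thesis .
  qed
  have fh: "(\<integral>\<^sup>+t. ennreal ((?f t + ?h t) powr p) \<partial>?M) \<le> ennreal ((\<rho> ^ j * F + bias_rate p m c1 * sqrt \<gamma>) powr p)"
  proof (rule nn_integral_minkowski[OF _ _ _ _ p(1) _ _ f h])
    show "0 < bias_rate p m c1 * sqrt \<gamma>" using bias_rate_powr(1)[OF c1 p(1)] \<gamma> by simp
    show "0 < \<rho> ^ j * F" using \<rho>(1) F(2) by simp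
    show "0 \<le> ?f t" for t by (rule excess_nonneg)
    show "0 \<le> ?h t" for t using k \<sigma> by simp
  qed measurable
  let ?T = "\<lambda>t. (snd (snd (fst t)), fst (fst t) + (sqrt 2 * \<sigma>) *\<^sub>R snd t)"
  have "(\<integral>\<^sup>+w. ennreal (norm (fst w - snd w) powr p) \<partial>distr ?M (borel \<Otimes>\<^sub>M borel) ?T) = (\<integral>\<^sup>+t. ennreal (norm (snd (snd (fst t)) - (fst (fst t) + (sqrt 2 * \<sigma>) *\<^sub>R snd t)) powr p) \<partial>?M)"
    by (subst nn_integral_distr) auto
  also have "\<dots> \<le> (\<integral>\<^sup>+t. ennreal ((?f t + ?h t) powr p) \<partial>?M)"
  proof (intro nn_integral_mono ennreal_leI powr_mono2)
    fix t :: "('a \<times> 'a \<times> 'a) \<times> 'a"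
    obtain a v y z where t: "t = ((a, v, y), z)" by (metis prod.collapse)
    have "norm (y - (a + (sqrt 2 * \<sigma>) *\<^sub>R z)) \<le> norm (a - v) + norm (v - y) + norm ((sqrt 2 * \<sigma>) *\<^sub>R z)"
    proof -
      have "y - (a + (sqrt 2 * \<sigma>) *\<^sub>R z) = - ((a - v) + (v - y) + (sqrt 2 * \<sigma>) *\<^sub>R z)" by simp
      then show ?thesis using norm_triangle_ineq[of "(a - v) + (v - y)" "(sqrt 2 * \<sigma>) *\<^sub>R z"] norm_triangle_ineq[of "a - v" "v - y"]
        by (simp only: norm_minus_cancel)
    qed
    moreover have "norm (a - v) \<le> excess k (norm (a - v)) + sqrt k" by (rule le_excess_add[OF _ k]) simp
    moreover have "norm ((sqrt 2 * \<sigma>) *\<^sub>R z) = sqrt 2 * \<sigma> * norm z" using \<sigma> by simp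
    ultimately show "norm (snd (snd (fst t)) - (fst (fst t) + (sqrt 2 * \<sigma>) *\<^sub>R snd t)) \<le> ?f t + ?h t"
      unfolding t fst_conv snd_conv by linarith
  qed (use p in auto)
  also note fh
  finally show ?thesis using chain_coupling[of j] by blast
qed

end

end

section \<open>Wasserstein distances and laws of the algorithm\<close>

lemma nn_integral_powr_bound_exists:
  assumes "(\<integral>\<^sup>+x. ennreal (f x powr p) \<partial>M) < \<top>" "1 \<le> p"
  obtains a :: real where "0 < a" "(\<integral>\<^sup>+x. ennreal (f x powr p) \<partial>M) \<le> ennreal (a powr p)"
proof -
  obtain r where r: "(\<integral>\<^sup>+x. ennreal (f x powr p) \<partial>M) = ennreal r" "0 \<le> r"
    using assms(1) by (cases "\<integral>\<^sup>+x. ennreal (f x powr p) \<partial>M") auto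
  have "((r + 1) powr (1 / p)) powr p = r + 1" using r(2) assms(2) by (simp add: powr_powr)
  then have "(\<integral>\<^sup>+x. ennreal (f x powr p) \<partial>M) \<le> ennreal (((r + 1) powr (1 / p)) powr p)"
    using r by (simp add: ennreal_leI)
  moreover have "0 < (r + 1) powr (1 / p)" using r by simp
  ultimately show ?thesis using that by blast
qed

lemma nn_integral_powr_scale:
  assumes [measurable]: "f \<in> borel_measurable M" and "\<And>x. 0 \<le> f x" "0 \<le> k" "0 \<le> a" "1 \<le> p"
    and "(\<integral>\<^sup>+x. ennreal (f x powr p) \<partial>M) \<le> ennreal (a powr p)"
    and "\<And>x. h x \<le> k * f x" "\<And>x. 0 \<le> h x"
  shows "(\<integral>\<^sup>+x. ennreal (h x powr p) \<partial>M) \<le> ennreal ((k * a) powr p)"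
proof -
  have "(\<integral>\<^sup>+x. ennreal (h x powr p) \<partial>M) \<le> (\<integral>\<^sup>+x. ennreal (k powr p) * ennreal (f x powr p) \<partial>M)"
  proof (rule nn_integral_mono)
    fix x
    have "h x powr p \<le> (k * f x) powr p" using assms(5,7,8) by (intro powr_mono2) auto
    also have "\<dots> = k powr p * f x powr p" using assms(2,3) by (simp add: powr_mult)
    finally show "ennreal (h x powr p) \<le> ennreal (k powr p) * ennreal (f x powr p)"
      by (simp add: ennreal_mult[symmetric] ennreal_leI)
  qed
  also have "\<dots> \<le> ennreal (k powr p) * ennreal (a powr p)"
    using assms(6) by (simp add: nn_integral_cmult mult_left_mono)
  also have "\<dots> = ennreal ((k * a) powr p)" using assms(3,4) by (simp add: powr_mult ennreal_mult)
  finally show ?thesis .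
qed

lemma couplings_swap:
  assumes "Q \<in> couplings \<nu>1 \<nu>2"
  shows "distr Q (borel \<Otimes>\<^sub>M borel) (\<lambda>w. (snd w, fst w)) \<in> couplings \<nu>2 \<nu>1"
proof -
  have Q: "prob_space Q" "distr Q borel fst = \<nu>1" "distr Q borel snd = \<nu>2" and [measurable_cong]: "sets Q = sets (borel \<Otimes>\<^sub>M borel)"
    using assms by (auto simp: couplings_def)
  have T: "(\<lambda>w. (snd w, fst w)) \<in> measurable Q (borel \<Otimes>\<^sub>M borel)" by measurable
  show ?thesis
    using prob_space.prob_space_distr[OF Q(1) T] Q(2,3) by (simp add: couplings_def distr_distr[OF _ T] comp_def)
qed

lemma wasserstein_swap_le: "wasserstein p \<nu>2 \<nu>1 \<le> wasserstein p \<nu>1 \<nu>2"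
  unfolding wasserstein_def
proof (rule INF_greatest)
  fix Q assume Q: "Q \<in> couplings \<nu>1 \<nu>2"
  then have [measurable_cong]: "sets Q = sets (borel \<Otimes>\<^sub>M borel)" by (simp add: couplings_def)
  have "(\<integral>\<^sup>+w. ennreal (norm (fst w - snd w) powr p) \<partial>distr Q (borel \<Otimes>\<^sub>M borel) (\<lambda>w. (snd w, fst w))) = (\<integral>\<^sup>+w. ennreal (norm (fst w - snd w) powr p) \<partial>Q)"
    by (subst nn_integral_distr) (auto simp: norm_minus_commute)
  then show "(INF Q\<in>couplings \<nu>2 \<nu>1. ennreal_root p (\<integral>\<^sup>+w. ennreal (norm (fst w - snd w) powr p) \<partial>Q)) \<le> ennreal_root p (\<integral>\<^sup>+w. ennreal (norm (fst w - snd w) powr p) \<partial>Q)"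
    using INF_lower[OF couplings_swap[OF Q], of "\<lambda>Q. ennreal_root p (\<integral>\<^sup>+w. ennreal (norm (fst w - snd w) powr p) \<partial>Q)"] by simp
qed

lemma wasserstein_le:
  assumes "Q \<in> couplings \<nu>1 \<nu>2" "(\<integral>\<^sup>+w. ennreal (norm (fst w - snd w) powr p) \<partial>Q) \<le> ennreal (a powr p)" "0 \<le> a" "1 \<le> p"
  shows "wasserstein p \<nu>1 \<nu>2 \<le> ennreal a"
  unfolding wasserstein_def using assms by (intro INF_lower2[OF assms(1)] ennreal_root_le)

text \<open>Holds for every coupling, hence bounds the Wasserstein distance by moments.\<close>

lemma coupling_cost_le:
  fixes \<nu>1 \<nu>2 :: "'a::euclidean_space measure"
  assumes Q: "Q \<in> couplings \<nu>1 \<nu>2" and p: "1 \<le> p" and ab: "0 < a" "0 < b"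
    and a: "(\<integral>\<^sup>+x. ennreal (norm (x - x0) powr p) \<partial>\<nu>1) \<le> ennreal (a powr p)"
    and b: "(\<integral>\<^sup>+x. ennreal (norm (x - x0) powr p) \<partial>\<nu>2) \<le> ennreal (b powr p)"
  shows "(\<integral>\<^sup>+w. ennreal (norm (fst w - snd w) powr p) \<partial>Q) \<le> ennreal ((a + b) powr p)"
proof -
  have Q': "distr Q borel fst = \<nu>1" "distr Q borel snd = \<nu>2" and [measurable_cong]: "sets Q = sets (borel \<Otimes>\<^sub>M borel)"
    using Q by (auto simp: couplings_def)
  have fst: "(\<integral>\<^sup>+w. ennreal (norm (fst w - x0) powr p) \<partial>Q) \<le> ennreal (a powr p)"
    using a unfolding Q'(1)[symmetric] by (subst (asm) nn_integral_distr) auto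
  have snd: "(\<integral>\<^sup>+w. ennreal (norm (snd w - x0) powr p) \<partial>Q) \<le> ennreal (b powr p)"
    using b unfolding Q'(2)[symmetric] by (subst (asm) nn_integral_distr) auto
  have "(\<integral>\<^sup>+w. ennreal (norm (fst w - snd w) powr p) \<partial>Q) \<le> (\<integral>\<^sup>+w. ennreal ((norm (fst w - x0) + norm (snd w - x0)) powr p) \<partial>Q)"
  proof (intro nn_integral_mono ennreal_leI powr_mono2)
    fix w
    show "norm (fst w - snd w) \<le> norm (fst w - x0) + norm (snd w - x0)"
      using norm_triangle_ineq4[of "fst w - x0" "snd w - x0"] by simp
  qed (use p in auto)
  also have "\<dots> \<le> ennreal ((a + b) powr p)"
    by (rule nn_integral_minkowski[OF _ _ _ _ p ab fst snd]) auto
  finally show ?thesis .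
qed

lemma product_coupling:
  fixes \<nu>1 \<nu>2 :: "'a::euclidean_space measure"
  assumes "prob_space \<nu>1" "prob_space \<nu>2" and s[measurable_cong]: "sets \<nu>1 = sets borel" "sets \<nu>2 = sets borel"
  shows "\<nu>1 \<Otimes>\<^sub>M \<nu>2 \<in> couplings \<nu>1 \<nu>2"
proof -
  interpret N1: prob_space \<nu>1 by fact
  interpret N2: prob_space \<nu>2 by fact
  interpret pair_prob_space \<nu>1 \<nu>2 ..
  have "distr (\<nu>1 \<Otimes>\<^sub>M \<nu>2) borel fst = distr (\<nu>1 \<Otimes>\<^sub>M \<nu>2) \<nu>1 fst" by (rule distr_cong) (auto simp: s)
  then have 1: "distr (\<nu>1 \<Otimes>\<^sub>M \<nu>2) borel fst = \<nu>1" using N2.distr_pair_fst by simp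
  have "distr (\<nu>1 \<Otimes>\<^sub>M \<nu>2) borel snd = \<nu>2"
  proof (rule measure_eqI)
    fix A assume "A \<in> sets (distr (\<nu>1 \<Otimes>\<^sub>M \<nu>2) borel snd)"
    then have [measurable]: "A \<in> sets borel" by simp
    have "emeasure (distr (\<nu>1 \<Otimes>\<^sub>M \<nu>2) borel snd) A = (\<integral>\<^sup>+w. indicator A (snd w) \<partial>(\<nu>1 \<Otimes>\<^sub>M \<nu>2))"
      by (subst nn_integral_indicator[symmetric], simp, subst nn_integral_distr) auto
    also have "\<dots> = (\<integral>\<^sup>+x. \<integral>\<^sup>+y. indicator A y \<partial>\<nu>2 \<partial>\<nu>1)"
      by (subst N2.nn_integral_fst[symmetric]) auto
    also have "\<dots> = emeasure \<nu>2 A" by (simp add: N1.emeasure_space_1 s)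
    finally show "emeasure (distr (\<nu>1 \<Otimes>\<^sub>M \<nu>2) borel snd) A = emeasure \<nu>2 A" .
  qed (simp add: s)
  moreover have "prob_space (\<nu>1 \<Otimes>\<^sub>M \<nu>2)" by unfold_locales
  moreover have "sets (\<nu>1 \<Otimes>\<^sub>M \<nu>2) = sets (borel \<Otimes>\<^sub>M borel)" by (rule sets_pair_measure_cong) (fact s)+
  ultimately show ?thesis using 1 by (simp add: couplings_def)
qed

context langevin_potential
begin

text \<open>The iterate \<open>x\<^sub>n\<close> is a function of \<open>\<xi>, z\<^sub>1, ..., z\<^sub>n\<close>, hence independent of the
next Gaussian. The function is the algorithm itself, run on the coordinates of the product space.\<close>

lemma ula_laws_ula:
  fixes P :: "'b measure"
  assumes g: "g = gradient U" and P: "prob_space P" and \<xi>[measurable]: "\<xi> \<in> borel_measurable P" and noise: "gaussian_noise P \<xi> z"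
  shows "ula_laws \<gamma> (\<lambda>n. distr P borel (ula U \<beta> \<gamma> \<xi> z n))"
proof -
  interpret P: prob_space P by fact
  let ?X = "ula U \<beta> \<gamma> \<xi> z" and ?Y = "\<lambda>n. if n = 0 then \<xi> else z n"
  let ?h = "\<lambda>n. ula U \<beta> \<gamma> (\<lambda>f::nat \<Rightarrow> 'a. f 0) (\<lambda>n f. f n) n"
  let ?s = "sqrt (2 * \<gamma> / \<beta>)"
  have ind: "P.indep_vars (\<lambda>_. borel) ?Y UNIV"
    and dist: "\<And>n. distributed P lborel (z (Suc n)) (\<lambda>x. ennreal (std_gaussian_density x))"
    using noise by (auto simp: gaussian_noise_def)
  have z[measurable]: "z (Suc n) \<in> borel_measurable P" for n
    using distributed_measurable[OF dist[of n]] by simp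
  have [measurable]: "gradient U \<in> borel_measurable borel" using g_meas g by simp
  have X[measurable]: "?X n \<in> borel_measurable P" for n
  proof (induction n)
    case 0
    have "?X 0 = \<xi>" by (rule ext) simp
    then show ?case by simp
  next
    case (Suc n)
    note [measurable] = Suc
    have "?X (Suc n) = (\<lambda>\<omega>. ?X n \<omega> - \<gamma> *\<^sub>R gradient U (?X n \<omega>) + ?s *\<^sub>R z (Suc n) \<omega>)" by (rule ext) simp
    then show ?case by simp
  qed
  have h: "?h n \<in> borel_measurable (PiM {..m} (\<lambda>_. borel))" if "n \<le> m" for n m
    using that
  proof (induction n)
    case 0
    have "?h 0 = (\<lambda>f. f 0)" by (rule ext) simp
    then show ?case by simp
  next
    case (Suc n)
    then have [measurable]: "?h n \<in> borel_measurable (PiM {..m} (\<lambda>_. borel))" by simp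
    have [measurable]: "(\<lambda>f. f (Suc n)) \<in> borel_measurable (PiM {..m} (\<lambda>_. borel :: 'a measure))"
      using Suc by (intro measurable_component_singleton) auto
    have "?h (Suc n) = (\<lambda>f. ?h n f - \<gamma> *\<^sub>R gradient U (?h n f) + ?s *\<^sub>R f (Suc n))" by (rule ext) simp
    then show ?case by simp
  qed
  have hX: "?h n (restrict (\<lambda>i. ?Y i \<omega>) {..m}) = ?X n \<omega>" if "n \<le> m" for n m \<omega>
    using that by (induction n) auto
  have iv: "P.indep_var borel (?X n) borel (z (Suc n))" for n
  proof -
    have "P.indep_var borel (?h n \<circ> (\<lambda>\<omega>. restrict (\<lambda>i. ?Y i \<omega>) {..n})) borel ((\<lambda>f. f (Suc n)) \<circ> (\<lambda>\<omega>. restrict (\<lambda>i. ?Y i \<omega>) {Suc n}))"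
      by (rule P.indep_var_compose[OF P.indep_var_restrict[OF ind]]) (auto intro!: h measurable_component_singleton)
    moreover have "?h n \<circ> (\<lambda>\<omega>. restrict (\<lambda>i. ?Y i \<omega>) {..n}) = ?X n"
      using hX[of n n] by (simp add: comp_def fun_eq_iff)
    moreover have "(\<lambda>f. f (Suc n)) \<circ> (\<lambda>\<omega>. restrict (\<lambda>i. ?Y i \<omega>) {Suc n}) = z (Suc n)"
      by (simp add: comp_def fun_eq_iff)
    ultimately show ?thesis by simp
  qed
  have dz: "distr P borel (z (Suc n)) = gauss" for n
  proof -
    have "distr P borel (z (Suc n)) = distr P lborel (z (Suc n))" by (rule distr_cong) auto
    then show ?thesis using distributed_distr_eq_density[OF dist[of n]] by simp
  qed
  have "(\<integral>\<^sup>+x. H x \<partial>distr P borel (?X (Suc n))) = (\<integral>\<^sup>+x. \<integral>\<^sup>+w. H (gd \<gamma> x + ?s *\<^sub>R w) \<partial>gauss \<partial>distr P borel (?X n))"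
    if [measurable]: "H \<in> borel_measurable borel" for H n
  proof -
    have e: "?X (Suc n) \<omega> = gd \<gamma> (?X n \<omega>) + ?s *\<^sub>R z (Suc n) \<omega>" for \<omega> by (simp add: gd_def g[symmetric])
    have j: "distr P borel (?X n) \<Otimes>\<^sub>M gauss = distr P (borel \<Otimes>\<^sub>M borel) (\<lambda>\<omega>. (?X n \<omega>, z (Suc n) \<omega>))"
      using iv[of n] unfolding P.indep_var_distribution_eq dz by simp
    have "(\<integral>\<^sup>+x. H x \<partial>distr P borel (?X (Suc n))) = (\<integral>\<^sup>+\<omega>. H (gd \<gamma> (?X n \<omega>) + ?s *\<^sub>R z (Suc n) \<omega>) \<partial>P)"
      by (subst nn_integral_distr) (auto simp: e simp del: ula.simps)
    also have "\<dots> = (\<integral>\<^sup>+t. H (gd \<gamma> (fst t) + ?s *\<^sub>R snd t) \<partial>(distr P borel (?X n) \<Otimes>\<^sub>M gauss))"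
      unfolding j by (subst nn_integral_distr) auto
    also have "\<dots> = (\<integral>\<^sup>+x. \<integral>\<^sup>+w. H (gd \<gamma> x + ?s *\<^sub>R w) \<partial>gauss \<partial>distr P borel (?X n))"
      by (subst nn_integral_pair_gauss) auto
    finally show ?thesis .
  qed
  then show ?thesis unfolding ula_laws_def using P.prob_space_distr[OF X] by simp
qed

lemma ula_laws_simps:
  assumes "ula_laws \<gamma> \<nu>"
  shows "prob_space (\<nu> n)" "sets (\<nu> n) = sets borel"
    "H \<in> borel_measurable borel \<Longrightarrow> (\<integral>\<^sup>+x. H x \<partial>\<nu> (Suc n)) = (\<integral>\<^sup>+x. \<integral>\<^sup>+z. H (gd \<gamma> x + sqrt (2 * \<gamma> / \<beta>) *\<^sub>R z) \<partial>gauss \<partial>\<nu> n)"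
  using assms by (auto simp: ula_laws_def)

lemma gibbs_powr_moment:
  assumes "1 \<le> p"
  obtains a where "0 < a" "(\<integral>\<^sup>+x. ennreal ((1 + norm x) powr p) \<partial>\<pi>) \<le> ennreal (a powr p)"
proof -
  define q where "q = nat \<lceil>p\<rceil>"
  have q: "p \<le> real q" unfolding q_def by (rule real_nat_ceiling_ge)
  have "(\<integral>\<^sup>+x. ennreal ((1 + norm x) powr p) \<partial>\<pi>) \<le> (\<integral>\<^sup>+x. ennreal ((1 + norm x) ^ q) \<partial>\<pi>)"
    using q by (intro nn_integral_mono ennreal_leI) (simp add: powr_realpow[symmetric] add_pos_nonneg powr_mono)
  also have "\<dots> < \<top>" unfolding nn_gibbs_moment by simp
  finally show ?thesis using nn_integral_powr_bound_exists[OF _ assms] that by metis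
qed

lemma gauss_powr_moment:
  assumes "1 \<le> p"
  obtains a where "0 < a" "(\<integral>\<^sup>+x. ennreal ((1 + norm x) powr p) \<partial>(gauss::'a measure)) \<le> ennreal (a powr p)"
proof -
  define q where "q = nat \<lceil>p\<rceil>"
  have q: "p \<le> real q" unfolding q_def by (rule real_nat_ceiling_ge)
  have "(\<integral>\<^sup>+x. ennreal ((1 + norm x) powr p) \<partial>(gauss::'a measure)) \<le> (\<integral>\<^sup>+x. ennreal ((1 + norm x) ^ q) \<partial>(gauss::'a measure))"
    using q by (intro nn_integral_mono ennreal_leI) (simp add: powr_realpow[symmetric] add_pos_nonneg powr_mono)
  also have "\<dots> < \<top>" unfolding nn_gauss_moment by simp
  finally show ?thesis using nn_integral_powr_bound_exists[OF _ assms] that by metis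
qed

end

section \<open>Small step sizes\<close>

context langevin_potential
begin

text \<open>The chain contracts at the rate \<open>\<rho> \<le> exp (- \<mu> \<gamma> + 4 L\<^sup>2 \<gamma>\<^sup>2)\<close>
and makes one step less than the algorithm. Both defects cost only \<open>O(\<gamma>)\<close> uniformly in the
number of steps, since \<open>x exp (- x) \<le> 1\<close>.\<close>

lemma synchronous_rate_vs_exponential:
  assumes \<gamma>: "0 < \<gamma>" "8 * L\<^sup>2 * \<gamma> \<le> \<mu>" and \<rho>: "0 \<le> \<rho>" "\<rho>\<^sup>2 = 1 - 2 * \<mu> * \<gamma> + 8 * L\<^sup>2 * \<gamma>\<^sup>2"
  shows "\<rho> ^ j \<le> exp (- \<mu> * \<gamma> * real (Suc j)) + (\<mu> + 8 * L\<^sup>2 / \<mu>) * \<gamma>"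
proof -
  define b where "b = 4 * L\<^sup>2 * \<gamma>\<^sup>2"
  define x where "x = real j * (\<mu> * \<gamma> / 2)"
  define E where "E = exp (real j * (b - \<mu> * \<gamma>))"
  have x: "0 \<le> x" using \<gamma> \<mu> by (simp add: x_def)
  have b: "0 \<le> b" by (simp add: b_def)
  have "8 * L\<^sup>2 * \<gamma> * \<gamma> \<le> \<mu> * \<gamma>" using \<gamma> by (intro mult_right_mono) auto
  then have b2: "b \<le> \<mu> * \<gamma> / 2" by (simp add: b_def power2_eq_square)
  have "\<rho>\<^sup>2 \<le> exp (2 * (b - \<mu> * \<gamma>))" using exp_ge_add_one_self[of "2 * (b - \<mu> * \<gamma>)"] unfolding \<rho>(2) b_def by (simp add: algebra_simps)
  also have "\<dots> = (exp (b - \<mu> * \<gamma>))\<^sup>2" by (rule exp_double)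
  finally have "\<rho> \<le> exp (b - \<mu> * \<gamma>)" by (rule power2_le_imp_le) simp
  then have "\<rho> ^ j \<le> exp (b - \<mu> * \<gamma>) ^ j" using \<rho>(1) by (rule power_mono)
  also have "\<dots> = E" unfolding E_def exp_of_nat_mult ..
  finally have 1: "\<rho> ^ j \<le> E" .
  have "real j * (b - \<mu> * \<gamma>) \<le> real j * (- (\<mu> * \<gamma> / 2))" using b2 by (intro mult_left_mono) auto
  then have Ex: "E \<le> exp (- x)" unfolding E_def x_def by simp
  then have E1: "E \<le> 1" "0 \<le> E" using x by (auto simp: E_def intro: order_trans)
  have "E * (1 - (\<mu> * \<gamma> + real j * b)) \<le> E * exp (- (\<mu> * \<gamma> + real j * b))"
  proof (rule mult_left_mono[OF _ E1(2)])
    have one: "1 - t \<le> exp (- t)" for t :: real using exp_ge_add_one_self[of "- t"] by simp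
    show "1 - (\<mu> * \<gamma> + real j * b) \<le> exp (- (\<mu> * \<gamma> + real j * b))" by (rule one)
  qed
  also have "\<dots> = exp (- \<mu> * \<gamma> * real (Suc j))" unfolding E_def exp_add[symmetric] by (simp add: algebra_simps)
  finally have 2: "E \<le> exp (- \<mu> * \<gamma> * real (Suc j)) + E * (\<mu> * \<gamma>) + E * (real j * b)" by (simp add: algebra_simps)
  have 3: "E * (\<mu> * \<gamma>) \<le> \<mu> * \<gamma>" using E1 \<mu> \<gamma> by (intro mult_left_le_one_le) auto
  have jb: "real j * b = x * (8 * L\<^sup>2 / \<mu> * \<gamma>)" using \<mu> by (simp add: x_def b_def power2_eq_square)
  have "x \<le> exp x" using exp_ge_add_one_self[of x] by linarith
  then have "x * exp (- x) \<le> 1" by (simp add: exp_minus field_simps)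
  have "E * (real j * b) \<le> exp (- x) * (real j * b)" using Ex b by (intro mult_right_mono) auto
  also have "\<dots> = (x * exp (- x)) * (8 * L\<^sup>2 / \<mu> * \<gamma>)" unfolding jb by simp
  also have "\<dots> \<le> 1 * (8 * L\<^sup>2 / \<mu> * \<gamma>)"
    using \<open>x * exp (- x) \<le> 1\<close> \<mu> \<gamma> by (intro mult_right_mono) auto
  finally show ?thesis using 1 2 3 by (simp add: distrib_right)
qed

text \<open>The constants are chosen before the coupling \<open>Q\<close>, so that the infimum over \<open>Q\<close> can be taken afterwards.
The bound \<open>K\<close> for its cost lets the defect of the rate be absorbed into the error term.\<close>

lemma small_step_bound:
  fixes \<nu>0 :: "'a measure"
  assumes p: "1 \<le> p" and s0: "sets \<nu>0 = sets borel" and M: "0 < M" "(\<integral>\<^sup>+x. ennreal ((1 + norm x) powr p) \<partial>\<nu>0) \<le> ennreal (M powr p)" and K: "0 \<le> K"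
  obtains \<gamma>1 c where "0 < \<gamma>1" "0 \<le> c"
    "\<And>\<gamma> \<nu> n Q F. 0 < \<gamma> \<Longrightarrow> \<gamma> \<le> \<gamma>1 \<Longrightarrow> ula_laws \<gamma> \<nu> \<Longrightarrow> \<nu> 0 = \<nu>0 \<Longrightarrow> Q \<in> couplings \<nu>0 \<pi> \<Longrightarrow> 0 \<le> F \<Longrightarrow> F \<le> K \<Longrightarrow>
      (\<integral>\<^sup>+w. ennreal (norm (fst w - snd w) powr p) \<partial>Q) \<le> ennreal (F powr p) \<Longrightarrow>
      wasserstein p \<pi> (\<nu> (Suc n)) \<le> ennreal (F * exp (- \<mu> * \<gamma> * real (Suc n)) + c * sqrt \<gamma>)"
proof -
  define m where "m = nat \<lceil>p\<rceil>"
  have "p \<le> real m" unfolding m_def by (rule real_nat_ceiling_ge)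
  then have pm: "p \<le> real (2 * m + 2)" by simp
  have d: "0 \<le> 2 * L" "0 < real (m + 1) * \<mu> / 2" using L \<mu> by auto
  obtain \<gamma>k c1 where \<gamma>k: "0 < \<gamma>k" "\<gamma>k \<le> 1" and c1: "0 \<le> c1"
    and key: "\<And>\<gamma> \<kappa> (\<Delta> :: 'a) N. 0 < \<gamma> \<Longrightarrow> \<gamma> \<le> \<gamma>k \<Longrightarrow> 0 \<le> \<kappa> \<Longrightarrow> norm N \<le> 2 * L * norm \<Delta> + \<kappa> \<Longrightarrow>
      norm (\<Delta> + \<gamma> *\<^sub>R N) ^ (2 * m + 2) \<le> (1 + (real (m + 1) * \<mu> / 2) * \<gamma>) * norm \<Delta> ^ (2 * m + 2)
       + 2 * real (m + 1) * \<gamma> * (norm \<Delta> ^ (2 * m) * (\<Delta> \<bullet> N)) + c1 * \<gamma> ^ (m + 2) * \<kappa> ^ (2 * m + 2)"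
    using perturbed_power_bound[OF d, where m=m and 'a='a] by blast
  define \<gamma>1 where "\<gamma>1 = Min {\<gamma>k, \<beta>, 1 / (32 * L), 1 / (real (m + 1) * \<mu>), \<mu> / (8 * L\<^sup>2), 1 / (4 * \<mu>)}"
  define \<Gamma> where "\<Gamma> = (C + L) * M"
  define k where "k = \<mu> + 8 * L\<^sup>2 / \<mu>"
  define c where "c = K * k + 1 + \<Gamma> + bias_rate p m c1"
  have \<Gamma>: "0 < \<Gamma>" using C L M by (simp add: \<Gamma>_def)
  have k: "0 \<le> k" using \<mu> by (simp add: k_def)
  have br: "0 < bias_rate p m c1" by (rule bias_rate_powr(1)[OF c1 p])
  show ?thesis
  proof (rule that[of \<gamma>1 c])
    show "0 < \<gamma>1" unfolding \<gamma>1_def using \<gamma>k \<beta> L \<mu> by simp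
    show "0 \<le> c" unfolding c_def using K k \<Gamma> br by simp
    fix \<gamma> \<nu> n Q F
    assume \<gamma>: "0 < \<gamma>" "\<gamma> \<le> \<gamma>1" and laws: "ula_laws \<gamma> \<nu>" and \<nu>0: "\<nu> 0 = \<nu>0" and Q: "Q \<in> couplings \<nu>0 \<pi>"
      and F: "0 \<le> F" "F \<le> K" "(\<integral>\<^sup>+w. ennreal (norm (fst w - snd w) powr p) \<partial>Q) \<le> ennreal (F powr p)"
    have le: "\<gamma> \<le> \<gamma>k" "\<gamma> \<le> \<beta>" "\<gamma> \<le> 1 / (32 * L)" "\<gamma> \<le> 1 / (real (m + 1) * \<mu>)" "\<gamma> \<le> \<mu> / (8 * L\<^sup>2)" "\<gamma> \<le> 1 / (4 * \<mu>)"
      using \<gamma>(2) unfolding \<gamma>1_def by simp_all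
    have L\<gamma>: "L * \<gamma> \<le> 1 / 32" using le(3) L by (simp add: pos_le_divide_eq mult.commute mult.left_commute)
    have small: "real (m + 1) * \<mu> * \<gamma> \<le> 1"
    proof -
      have "0 < real (m + 1) * \<mu>" using \<mu> by simp
      then show ?thesis using le(4) by (simp only: pos_le_divide_eq mult.commute)
    qed
    have L2: "8 * L\<^sup>2 * \<gamma> \<le> \<mu>" using le(5) L by (simp add: pos_le_divide_eq mult.commute mult.left_commute)
    have \<mu>\<gamma>: "4 * \<mu> * \<gamma> \<le> 1" using le(6) \<mu> by (simp add: pos_le_divide_eq mult.commute mult.left_commute)
    \<comment> \<open>With this choice the step size of the locale \<open>restricted_gaussian\<close> is \<open>\<gamma>\<close>.\<close>
    define \<sigma> where "\<sigma> = sqrt (\<gamma> / \<beta>)"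
    have \<sigma>: "0 < \<sigma>" "\<sigma> \<le> 1" "\<beta> * \<sigma>\<^sup>2 = \<gamma>" using \<gamma>(1) \<beta> le(2) by (auto simp: \<sigma>_def)
    interpret RG: restricted_gaussian U g D \<beta> L \<mu> C B \<kappa> \<sigma>
    proof unfold_locales
      have e: "\<beta> * L * \<sigma>\<^sup>2 = L * \<gamma>" unfolding \<sigma>(3)[symmetric] by (simp only: mult_ac)
      show "\<beta> * L * \<sigma>\<^sup>2 \<le> 1 / 32" unfolding e by (rule L\<gamma>)
    qed (use \<sigma> in auto)
    have nn: "0 < 1 - 2 * \<mu> * \<gamma> + 8 * L\<^sup>2 * \<gamma>\<^sup>2"
    proof -
      have "0 \<le> 8 * L\<^sup>2 * \<gamma>\<^sup>2" by simp
      then show ?thesis using \<mu>\<gamma> by linarith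
    qed
    define \<rho> where "\<rho> = sqrt (1 - 2 * \<mu> * \<gamma> + 8 * L\<^sup>2 * \<gamma>\<^sup>2)"
    have \<rho>: "0 < \<rho>" "\<rho>\<^sup>2 = 1 - 2 * \<mu> * \<gamma> + 8 * L\<^sup>2 * \<gamma>\<^sup>2" using nn by (auto simp: \<rho>_def)
    have "8 * L\<^sup>2 * \<gamma> * \<gamma> \<le> \<mu> * \<gamma>" using L2 \<gamma>(1) by (intro mult_right_mono) auto
    then have \<rho>': "\<rho>\<^sup>2 \<le> 1 - \<mu> * \<gamma>" unfolding \<rho>(2) power2_eq_square[of \<gamma>] by (simp add: mult_ac)
    have "0 \<le> \<mu> * \<gamma>" using \<mu> \<gamma> by simp
    then have "\<rho>\<^sup>2 \<le> 1" using \<rho>' by linarith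
    then have "\<rho> \<le> 1" using power2_le_imp_le[of \<rho> 1] by simp
    then have \<rho>1: "\<rho> ^ n \<le> 1" using \<rho>(1) by (intro power_le_one) auto
    have "\<gamma> \<le> 1" using le(1) \<gamma>k by simp
    have "sqrt \<gamma> * sqrt \<gamma> \<le> 1 * sqrt \<gamma>" using \<gamma>(1) \<open>\<gamma> \<le> 1\<close> by (intro mult_right_mono) auto
    then have sq: "\<gamma> \<le> sqrt \<gamma>" using \<gamma>(1) by simp
    have sq0: "0 < sqrt \<gamma>" using \<gamma>(1) by simp
    have Qs[measurable_cong]: "sets Q = sets (borel \<Otimes>\<^sub>M borel)" and Q1: "distr Q borel fst = \<nu>0" using Q by (auto simp: couplings_def)
    have mf[measurable]: "fst \<in> borel_measurable Q" and ms[measurable]: "snd \<in> borel_measurable Q"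
      unfolding measurable_cong_sets[OF Qs refl] by measurable
    \<comment> \<open>The chain starts after a gradient step, which costs \<open>\<gamma> (C + L) M\<close>. The summand \<open>sqrt
      \<gamma>\<close> only makes the bound positive when \<open>F = 0\<close>.\<close>
    define F' where "F' = (F + sqrt \<gamma>) + \<gamma> * (C + L) * M"
    have F': "0 < F'" unfolding F'_def using F(1) sq0 \<gamma>(1) C L M by (intro add_pos_pos add_nonneg_pos) auto
    have i1: "(\<integral>\<^sup>+w. ennreal (norm (fst w - snd w) powr p) \<partial>Q) \<le> ennreal ((F + sqrt \<gamma>) powr p)"
      using F(1) sq0 p by (intro order_trans[OF F(3)] ennreal_leI powr_mono2) auto
    have i2: "(\<integral>\<^sup>+w. ennreal ((\<gamma> * norm (g (fst w))) powr p) \<partial>Q) \<le> ennreal ((\<gamma> * (C + L) * M) powr p)"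
    proof (rule nn_integral_powr_scale[where f="\<lambda>w. 1 + norm (fst w)"])
      show "(\<integral>\<^sup>+w. ennreal ((1 + norm (fst w)) powr p) \<partial>Q) \<le> ennreal (M powr p)"
        using M(2) unfolding Q1[symmetric] by (subst (asm) nn_integral_distr[OF mf]) auto
      fix w :: "'a \<times> 'a"
      have "0 \<le> C * norm (fst w)" using C by simp
      then have "norm (g (fst w)) \<le> (C + L) * (1 + norm (fst w))"
        using growth[of "fst w"] L by (simp add: algebra_simps)
      then show "\<gamma> * norm (g (fst w)) \<le> \<gamma> * (C + L) * (1 + norm (fst w))"
        using \<gamma>(1) by (simp add: mult.assoc)
    qed (use \<gamma> C L M p in auto)
    have "(\<integral>\<^sup>+w. ennreal (norm (gd \<gamma> (fst w) - snd w) powr p) \<partial>Q) \<le> (\<integral>\<^sup>+w. ennreal ((norm (fst w - snd w) + \<gamma> * norm (g (fst w))) powr p) \<partial>Q)"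
    proof (intro nn_integral_mono ennreal_leI powr_mono2)
      fix w
      have eq: "gd \<gamma> (fst w) - snd w = (fst w - snd w) - \<gamma> *\<^sub>R g (fst w)" by (simp add: gd_def)
      show "norm (gd \<gamma> (fst w) - snd w) \<le> norm (fst w - snd w) + \<gamma> * norm (g (fst w))"
        unfolding eq using norm_triangle_ineq4[of "fst w - snd w" "\<gamma> *\<^sub>R g (fst w)"] \<gamma>(1) by simp
    qed (use p in auto)
    also have "\<dots> \<le> ennreal (F' powr p)" unfolding F'_def
      by (rule nn_integral_minkowski[OF _ _ _ _ p _ _ i1 i2]) (use F(1) sq0 \<gamma> C L M in \<open>auto intro!: add_nonneg_pos\<close>)
    finally have start: "(\<integral>\<^sup>+w. ennreal (norm (gd \<gamma> (fst w) - snd w) powr p) \<partial>Q) \<le> ennreal (F' powr p)" .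
    have Q0: "Q \<in> couplings (\<nu> 0) \<pi>" using Q \<nu>0 by simp
    obtain R where R: "R \<in> couplings \<pi> (\<nu> (Suc n))" "(\<integral>\<^sup>+w. ennreal (norm (fst w - snd w) powr p) \<partial>R) \<le> ennreal ((\<rho> ^ n * F' + bias_rate p m c1 * sqrt \<gamma>) powr p)"
      using RG.chain_cost[unfolded \<sigma>(3), OF laws Q0 c1 small key[OF \<gamma>(1) le(1)] p pm \<rho> \<rho>' start F'] by blast
    have "wasserstein p \<pi> (\<nu> (Suc n)) \<le> ennreal (\<rho> ^ n * F' + bias_rate p m c1 * sqrt \<gamma>)"
      using \<rho>(1) F' br sq0 by (intro wasserstein_le[OF R _ p]) auto
    also have "\<dots> \<le> ennreal (F * exp (- \<mu> * \<gamma> * real (Suc n)) + c * sqrt \<gamma>)"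
    proof (rule ennreal_leI)
      have "F * \<rho> ^ n \<le> F * (exp (- \<mu> * \<gamma> * real (Suc n)) + k * \<gamma>)"
        using synchronous_rate_vs_exponential[OF \<gamma>(1) L2 _ \<rho>(2), of n] \<rho>(1) F(1) unfolding k_def by (intro mult_left_mono) auto
      moreover have "F * (k * \<gamma>) \<le> K * (k * sqrt \<gamma>)"
        using F K k sq \<gamma>(1) by (intro mult_mono) auto
      moreover have "\<rho> ^ n * (sqrt \<gamma> + \<gamma> * \<Gamma>) \<le> 1 * (sqrt \<gamma> + sqrt \<gamma> * \<Gamma>)"
        using \<rho>1 \<rho>(1) sq \<Gamma> \<gamma>(1) by (intro mult_mono add_mono) auto
      moreover have "\<rho> ^ n * F' = F * \<rho> ^ n + \<rho> ^ n * (sqrt \<gamma> + \<gamma> * \<Gamma>)" by (simp add: F'_def \<Gamma>_def algebra_simps)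
      moreover have "c * sqrt \<gamma> = K * (k * sqrt \<gamma>) + 1 * (sqrt \<gamma> + sqrt \<gamma> * \<Gamma>) + bias_rate p m c1 * sqrt \<gamma>" by (simp add: c_def algebra_simps)
      moreover have "F * (exp (- \<mu> * \<gamma> * real (Suc n)) + k * \<gamma>) = F * exp (- \<mu> * \<gamma> * real (Suc n)) + F * (k * \<gamma>)" by (simp add: distrib_left)
      ultimately show "\<rho> ^ n * F' + bias_rate p m c1 * sqrt \<gamma> \<le> F * exp (- \<mu> * \<gamma> * real (Suc n)) + c * sqrt \<gamma>"
        by linarith
    qed
    finally show "wasserstein p \<pi> (\<nu> (Suc n)) \<le> ennreal (F * exp (- \<mu> * \<gamma> * real (Suc n)) + c * sqrt \<gamma>)" .
  qed
qed

end

section \<open>Large step sizes and the main estimate\<close>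

context langevin_potential
begin

text \<open>A contraction towards a fixed point of \<open>D\<close> for all step sizes up to \<open>\<mu> / (2 L\<^sup>2)\<close>. Against a
fixed point the growth bound has slope \<open>L\<close> instead of \<open>2 L\<close>, which is what this range of step sizes
requires.\<close>

lemma gd_toward_reference_point:
  assumes x: "x \<in> D" and x0: "x0 \<in> D" and \<gamma>: "0 < \<gamma>" "2 * L\<^sup>2 * \<gamma> \<le> \<mu>" and r: "0 \<le> r" "1 - \<mu> * \<gamma> \<le> r\<^sup>2"
  shows "norm (gd \<gamma> x - x0) \<le> r * norm (x - x0) + \<gamma> * (2 * (C + L * norm x0 + norm (g x0)) + norm (g x0))"
proof -
  define d e b where "d = x - x0" and "e = g x - g x0" and "b = C + L * norm x0 + norm (g x0)"
  have b: "0 \<le> b" using C L by (simp add: b_def)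
  have "norm (g x) \<le> C + L * norm x" by (rule growth)
  also have "\<dots> \<le> C + L * (norm d + norm x0)" using L norm_triangle_sub[of x x0] unfolding d_def by simp
  finally have "norm e \<le> L * norm d + b" unfolding e_def b_def using norm_triangle_ineq4[of "g x" "g x0"] by (simp add: algebra_simps)
  then have "(norm e)\<^sup>2 \<le> (L * norm d + b)\<^sup>2" by (intro power_mono) auto
  also have "\<dots> \<le> 2 * ((L * norm d)\<^sup>2 + b\<^sup>2)" using sum_squares_bound[of "L * norm d" b] by (simp add: power2_sum)
  finally have e2: "(norm e)\<^sup>2 \<le> 2 * L\<^sup>2 * (norm d)\<^sup>2 + 2 * b\<^sup>2" by (simp add: power_mult_distrib)
  have eq: "gd \<gamma> x - gd \<gamma> x0 = d - \<gamma> *\<^sub>R e" by (simp add: gd_def d_def e_def algebra_simps)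
  have "(norm (d - \<gamma> *\<^sub>R e))\<^sup>2 = (norm d)\<^sup>2 - 2 * \<gamma> * (e \<bullet> d) + \<gamma>\<^sup>2 * (norm e)\<^sup>2"
    unfolding power2_norm_eq_inner by (simp add: inner_diff_left inner_diff_right inner_commute power2_eq_square algebra_simps)
  moreover have "\<gamma> * (\<mu> * (norm d)\<^sup>2) \<le> \<gamma> * (e \<bullet> d)"
    using mono[OF x x0] \<gamma> unfolding d_def e_def by (intro mult_left_mono) auto
  moreover have "\<gamma>\<^sup>2 * (norm e)\<^sup>2 \<le> \<gamma>\<^sup>2 * (2 * L\<^sup>2 * (norm d)\<^sup>2 + 2 * b\<^sup>2)" using e2 by (rule mult_left_mono) simp
  moreover have "\<gamma>\<^sup>2 * (2 * L\<^sup>2 * (norm d)\<^sup>2 + 2 * b\<^sup>2) = (2 * L\<^sup>2 * \<gamma>) * (\<gamma> * (norm d)\<^sup>2) + 2 * (\<gamma> * b)\<^sup>2"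
    by (simp add: power2_eq_square algebra_simps)
  moreover have "(2 * L\<^sup>2 * \<gamma>) * (\<gamma> * (norm d)\<^sup>2) \<le> \<mu> * (\<gamma> * (norm d)\<^sup>2)" using \<gamma> by (intro mult_right_mono) auto
  moreover have "2 * (\<gamma> * b)\<^sup>2 \<le> (2 * (\<gamma> * b))\<^sup>2" by (simp add: power_mult_distrib)
  moreover have "(1 - \<mu> * \<gamma>) * (norm d)\<^sup>2 \<le> r\<^sup>2 * (norm d)\<^sup>2" using r(2) by (rule mult_right_mono) simp
  moreover have "(1 - \<mu> * \<gamma>) * (norm d)\<^sup>2 = (norm d)\<^sup>2 - \<mu> * (\<gamma> * (norm d)\<^sup>2)" by (simp add: left_diff_distrib)
  moreover have "\<gamma> * (\<mu> * (norm d)\<^sup>2) = \<mu> * (\<gamma> * (norm d)\<^sup>2)" by simp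
  ultimately have "(norm (d - \<gamma> *\<^sub>R e))\<^sup>2 \<le> r\<^sup>2 * (norm d)\<^sup>2 + (2 * (\<gamma> * b))\<^sup>2" by linarith
  also have "\<dots> = (r * norm d)\<^sup>2 + (2 * (\<gamma> * b))\<^sup>2" by (simp add: power_mult_distrib)
  also have "\<dots> \<le> (r * norm d + 2 * (\<gamma> * b))\<^sup>2" using r(1) \<gamma> b by (simp add: power2_sum)
  finally have "norm (d - \<gamma> *\<^sub>R e) \<le> r * norm d + 2 * (\<gamma> * b)"
    by (rule power2_le_imp_le) (use r(1) \<gamma> b in auto)
  moreover have "norm (gd \<gamma> x - x0) \<le> norm (d - \<gamma> *\<^sub>R e) + \<gamma> * norm (g x0)"
  proof -
    have "gd \<gamma> x - x0 = (d - \<gamma> *\<^sub>R e) - \<gamma> *\<^sub>R g x0" by (simp add: gd_def d_def e_def algebra_simps)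
    then show ?thesis using norm_triangle_ineq4[of "d - \<gamma> *\<^sub>R e" "\<gamma> *\<^sub>R g x0"] \<gamma> by simp
  qed
  moreover have "\<gamma> * (2 * b + norm (g x0)) = 2 * (\<gamma> * b) + \<gamma> * norm (g x0)" by (simp add: distrib_left)
  ultimately show ?thesis unfolding d_def[symmetric] b_def[symmetric] by linarith
qed

lemma ula_law_AE:
  assumes laws: "ula_laws \<gamma> \<nu>" and \<gamma>: "0 < \<gamma>"
  shows "AE x in \<nu> (Suc n). x \<in> D"
proof -
  note [measurable_cong] = ula_laws_simps(2)[OF laws]
  have "(\<integral>\<^sup>+x. indicator (- D) x \<partial>\<nu> (Suc n)) = (\<integral>\<^sup>+x. \<integral>\<^sup>+z. indicator (- D) (gd \<gamma> x + sqrt (2 * \<gamma> / \<beta>) *\<^sub>R z) \<partial>gauss \<partial>\<nu> n)"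
    by (rule ula_laws_simps(3)[OF laws]) measurable
  also have "\<dots> = (\<integral>\<^sup>+x. 0 \<partial>\<nu> n)"
  proof (intro nn_integral_cong)
    fix x
    have "AE z in gauss. gd \<gamma> x + sqrt (2 * \<gamma> / \<beta>) *\<^sub>R z \<in> D"
      using \<gamma> \<beta> by (intro AE_gauss_affine[OF D_AE D_sets]) auto
    then have "AE z in gauss. (indicator (- D) (gd \<gamma> x + sqrt (2 * \<gamma> / \<beta>) *\<^sub>R z) :: ennreal) = 0"
      by eventually_elim simp
    then show "(\<integral>\<^sup>+z. indicator (- D) (gd \<gamma> x + sqrt (2 * \<gamma> / \<beta>) *\<^sub>R z) \<partial>gauss) = 0"
      by (subst nn_integral_cong_AE) auto
  qed
  finally have "(\<integral>\<^sup>+x. indicator (- D) x \<partial>\<nu> (Suc n)) = 0" by simp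
  then have "AE x in \<nu> (Suc n). (indicator (- D) x :: ennreal) = 0"
    by (subst (asm) nn_integral_0_iff_AE) auto
  then show ?thesis by eventually_elim (simp add: indicator_eq_0_iff)
qed

text \<open>Minkowski's inequality on the product of \<open>\<nu>\<close> with the Gaussian law.\<close>

lemma gaussian_perturbation_moment:
  fixes f :: "'a \<Rightarrow> real" and F :: "'a \<Rightarrow> 'a \<Rightarrow> real"
  assumes \<nu>: "prob_space \<nu>" "sets \<nu> = sets borel" and [measurable]: "f \<in> borel_measurable borel" and f0: "\<And>x. 0 \<le> f x" and p: "1 \<le> p"
    and pos: "0 < k" "0 < a" "0 < l" "0 < b"
    and fa: "(\<integral>\<^sup>+x. ennreal (f x powr p) \<partial>\<nu>) \<le> ennreal (a powr p)"
    and gb: "(\<integral>\<^sup>+z. ennreal ((1 + norm z) powr p) \<partial>(gauss::'a measure)) \<le> ennreal (b powr p)"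
    and F: "AE x in \<nu>. \<forall>z. F x z \<le> k * f x + l * (1 + norm z)" "\<And>x z. 0 \<le> F x z"
  shows "(\<integral>\<^sup>+x. \<integral>\<^sup>+z. ennreal (F x z powr p) \<partial>gauss \<partial>\<nu>) \<le> ennreal ((k * a + l * b) powr p)"
proof -
  note [measurable_cong] = \<nu>(2)
  interpret N: prob_space \<nu> by fact
  let ?M = "\<nu> \<Otimes>\<^sub>M (gauss :: 'a measure)"
  have i1: "(\<integral>\<^sup>+t. ennreal ((k * f (fst t)) powr p) \<partial>?M) \<le> ennreal ((k * a) powr p)"
  proof (rule nn_integral_powr_scale[where f="\<lambda>t. f (fst t)"])
    have "(\<integral>\<^sup>+t. ennreal (f (fst t) powr p) \<partial>?M) = (\<integral>\<^sup>+x. ennreal (f x powr p) \<partial>\<nu>)"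
      by (subst nn_integral_pair_gauss) (auto simp: gauss.emeasure_space_1[simplified])
    then show "(\<integral>\<^sup>+t. ennreal (f (fst t) powr p) \<partial>?M) \<le> ennreal (a powr p)" using fa by simp
  qed (use f0 pos p in auto)
  have i2: "(\<integral>\<^sup>+t. ennreal ((l * (1 + norm (snd t))) powr p) \<partial>?M) \<le> ennreal ((l * b) powr p)"
  proof (rule nn_integral_powr_scale[where f="\<lambda>t. 1 + norm (snd t)"])
    have "(\<integral>\<^sup>+t. ennreal ((1 + norm (snd t)) powr p) \<partial>?M) = (\<integral>\<^sup>+z. ennreal ((1 + norm z) powr p) \<partial>(gauss::'a measure))"
      by (subst nn_integral_pair_gauss) (auto simp: N.emeasure_space_1)
    then show "(\<integral>\<^sup>+t. ennreal ((1 + norm (snd t)) powr p) \<partial>?M) \<le> ennreal (b powr p)" using gb by simp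
  qed (use pos p in auto)
  have "(\<integral>\<^sup>+x. \<integral>\<^sup>+z. ennreal (F x z powr p) \<partial>gauss \<partial>\<nu>) \<le> (\<integral>\<^sup>+x. \<integral>\<^sup>+z. ennreal ((k * f x + l * (1 + norm z)) powr p) \<partial>(gauss::'a measure) \<partial>\<nu>)"
  proof (rule nn_integral_mono_AE)
    show "AE x in \<nu>. (\<integral>\<^sup>+z. ennreal (F x z powr p) \<partial>gauss) \<le> (\<integral>\<^sup>+z. ennreal ((k * f x + l * (1 + norm z)) powr p) \<partial>(gauss::'a measure))"
      using F(1)
    proof eventually_elim
      case (elim x)
      then show ?case using F(2) p by (intro nn_integral_mono ennreal_leI powr_mono2) auto
    qed
  qed
  also have "\<dots> = (\<integral>\<^sup>+t. ennreal ((k * f (fst t) + l * (1 + norm (snd t))) powr p) \<partial>?M)"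
    by (subst nn_integral_pair_gauss) auto
  also have "\<dots> \<le> ennreal ((k * a + l * b) powr p)"
    by (rule nn_integral_minkowski[OF _ _ _ _ p _ _ i1 i2]) (use f0 pos in auto)
  finally show ?thesis .
qed

text \<open>After the first step the iterates lie in \<open>D\<close> almost surely, and the distance to \<open>x0\<close> in \<open>L\<^sup>p\<close>
satisfies \<open>a' \<le> r a + const\<close> with \<open>r < 1\<close> uniformly in the step size. The first step is estimated by
growth alone.\<close>

lemma uniform_moment_bound:
  fixes \<nu>0 :: "'a measure"
  assumes p: "1 \<le> p" and M: "0 < M" "(\<integral>\<^sup>+x. ennreal ((1 + norm x) powr p) \<partial>\<nu>0) \<le> ennreal (M powr p)"
    and \<gamma>1: "0 < \<gamma>1" and \<gamma>0: "0 < \<gamma>0" "\<gamma>0 < \<mu> / (2 * L\<^sup>2)" and x0: "x0 \<in> D"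
  obtains a where "0 < a" "\<And>\<gamma> \<nu> n. \<gamma>1 \<le> \<gamma> \<Longrightarrow> \<gamma> < \<gamma>0 \<Longrightarrow> ula_laws \<gamma> \<nu> \<Longrightarrow> \<nu> 0 = \<nu>0 \<Longrightarrow>
    (\<integral>\<^sup>+x. ennreal (norm (x - x0) powr p) \<partial>\<nu> (Suc n)) \<le> ennreal (a powr p)"
proof -
  obtain b where b: "0 < b" "(\<integral>\<^sup>+z. ennreal ((1 + norm z) powr p) \<partial>(gauss::'a measure)) \<le> ennreal (b powr p)"
    using gauss_powr_moment[OF p] .
  \<comment> \<open>The maximum keeps \<open>r\<close> positive, as Minkowski's inequality is applied with the bound \<open>r a\<close>.\<close>
  define r where "r = sqrt (max (1 / 4) (1 - \<mu> * \<gamma>1))"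
  define s where "s = sqrt (2 * \<gamma>0 / \<beta>)"
  define l where "l = \<gamma>0 * (2 * (C + L * norm x0 + norm (g x0)) + norm (g x0)) + s"
  define k where "k = 1 + \<gamma>0 * L + \<gamma>0 * C + norm x0 + s"
  define a where "a = max (k * M + k * b) (l * b / (1 - r))"
  have "max (1 / 4) (1 - \<mu> * \<gamma>1) < 1" using \<mu> \<gamma>1 by simp
  then have r: "0 < r" "r < 1" "1 - \<mu> * \<gamma>1 \<le> r\<^sup>2" by (auto simp: r_def)
  have s: "0 < s" using \<gamma>0 \<beta> by (simp add: s_def)
  have l: "0 < l" using \<gamma>0 C L s by (simp add: l_def add_nonneg_pos)
  have k: "0 < k" using \<gamma>0 C L s by (simp add: k_def add_pos_nonneg)
  have "0 < k * M + k * b" using k M(1) b(1) by (intro add_pos_pos mult_pos_pos)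
  then have a: "0 < a" "k * M + k * b \<le> a" by (auto simp: a_def)
  have "l * b / (1 - r) \<le> a" by (simp add: a_def)
  then have ar: "r * a + l * b \<le> a" using r by (simp add: pos_divide_le_eq algebra_simps)
  show ?thesis
  proof (rule that[OF a(1)])
    fix \<gamma> \<nu> n
    assume \<gamma>: "\<gamma>1 \<le> \<gamma>" "\<gamma> < \<gamma>0" and laws: "ula_laws \<gamma> \<nu>" and \<nu>0: "\<nu> 0 = \<nu>0"
    note [measurable_cong] = ula_laws_simps(2)[OF laws]
    let ?s = "sqrt (2 * \<gamma> / \<beta>)"
    have \<gamma>': "0 < \<gamma>" using \<gamma> \<gamma>1 by simp
    have ss: "?s \<le> s" unfolding s_def using \<gamma> \<beta> by (simp add: divide_right_mono)
    have "\<gamma> \<le> \<mu> / (2 * L\<^sup>2)" using \<gamma> \<gamma>0 by simp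
    then have L\<gamma>: "2 * L\<^sup>2 * \<gamma> \<le> \<mu>" using L by (simp add: pos_le_divide_eq mult.commute mult.left_commute)
    have "\<mu> * \<gamma>1 \<le> \<mu> * \<gamma>" using \<mu> \<gamma> by simp
    then have r2: "1 - \<mu> * \<gamma> \<le> r\<^sup>2" using r(3) by linarith
    have snz: "?s * norm z \<le> s * norm z" for z :: 'a using ss by (rule mult_right_mono) simp
    have split: "norm (gd \<gamma> x + ?s *\<^sub>R z - x0) \<le> norm (gd \<gamma> x - x0) + s * norm z" for x z :: 'a
    proof -
      have eq: "gd \<gamma> x + ?s *\<^sub>R z - x0 = (gd \<gamma> x - x0) + ?s *\<^sub>R z" by simp
      have "norm (?s *\<^sub>R z) = ?s * norm z" using \<gamma>' \<beta> by simp
      then show ?thesis unfolding eq using norm_triangle_ineq[of "gd \<gamma> x - x0" "?s *\<^sub>R z"] snz[of z] by linarith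
    qed
    show "(\<integral>\<^sup>+x. ennreal (norm (x - x0) powr p) \<partial>\<nu> (Suc n)) \<le> ennreal (a powr p)"
    proof (induction n)
      case 0
      have pt: "norm (gd \<gamma> x + ?s *\<^sub>R z - x0) \<le> k * (1 + norm x) + k * (1 + norm z)" for x z :: 'a
      proof -
        have "norm (gd \<gamma> x - x0) \<le> norm x + \<gamma> * norm (g x) + norm x0"
          unfolding gd_def using norm_triangle_ineq4[of "x - \<gamma> *\<^sub>R g x" x0] norm_triangle_ineq4[of x "\<gamma> *\<^sub>R g x"] \<gamma>' by simp
        moreover have "\<gamma> * norm (g x) \<le> \<gamma>0 * (C + L * norm x)" using growth[of x] \<gamma> \<gamma>' by (intro mult_mono) auto
        moreover have "\<gamma>0 * (C + L * norm x) = \<gamma>0 * C + \<gamma>0 * L * norm x" by (simp add: algebra_simps)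
        moreover have "(1 + \<gamma>0 * L) * norm x \<le> k * norm x"
          unfolding k_def using \<gamma>0 C s by (intro mult_right_mono) (auto intro!: add_nonneg_nonneg)
        moreover have "s * norm z \<le> k * norm z"
          unfolding k_def using \<gamma>0 C L by (intro mult_right_mono) (auto intro!: add_nonneg_nonneg)
        moreover have "\<gamma>0 * C + norm x0 \<le> k" unfolding k_def using \<gamma>0 L s by simp
        moreover have "(1 + \<gamma>0 * L) * norm x = norm x + \<gamma>0 * L * norm x" by (simp add: distrib_right)
        ultimately show ?thesis using split[of x z] k by (simp add: distrib_left)
      qed
      have "(\<integral>\<^sup>+x. ennreal (norm (x - x0) powr p) \<partial>\<nu> (Suc 0)) = (\<integral>\<^sup>+x. \<integral>\<^sup>+z. ennreal (norm (gd \<gamma> x + ?s *\<^sub>R z - x0) powr p) \<partial>gauss \<partial>\<nu>0)"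
        unfolding \<nu>0[symmetric] by (rule ula_laws_simps(3)[OF laws]) measurable
      also have "\<dots> \<le> ennreal ((k * M + k * b) powr p)"
        using ula_laws_simps(1,2)[OF laws, of 0] M k b pt p unfolding \<nu>0
        by (intro gaussian_perturbation_moment[where f="\<lambda>x. 1 + norm x"]) auto
      also have "\<dots> \<le> ennreal (a powr p)" using a \<open>0 < k * M + k * b\<close> p by (intro ennreal_leI powr_mono2) auto
      finally show ?case .
    next
      case (Suc n)
      have pt: "AE x in \<nu> (Suc n). \<forall>z. norm (gd \<gamma> x + ?s *\<^sub>R z - x0) \<le> r * norm (x - x0) + l * (1 + norm z)"
        using ula_law_AE[OF laws \<gamma>']
      proof eventually_elim
        case (elim x)
        show ?case
        proof
          fix z :: 'a
          let ?q = "2 * (C + L * norm x0 + norm (g x0)) + norm (g x0)"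
          have q: "0 \<le> ?q" using C L by simp
          have "\<gamma> * ?q \<le> \<gamma>0 * ?q" using \<gamma> q by (intro mult_right_mono) auto
          moreover have "s * norm z \<le> l * norm z" unfolding l_def using \<gamma>0 q by (intro mult_right_mono) auto
          moreover have "l = \<gamma>0 * ?q + s" by (simp add: l_def)
          ultimately show "norm (gd \<gamma> x + ?s *\<^sub>R z - x0) \<le> r * norm (x - x0) + l * (1 + norm z)"
            using gd_toward_reference_point[OF elim x0 \<gamma>' L\<gamma> less_imp_le[OF r(1)] r2] split[of x z] s
              distrib_left[of l 1 "norm z"] by linarith
        qed
      qed
      have "(\<integral>\<^sup>+x. ennreal (norm (x - x0) powr p) \<partial>\<nu> (Suc (Suc n))) = (\<integral>\<^sup>+x. \<integral>\<^sup>+z. ennreal (norm (gd \<gamma> x + ?s *\<^sub>R z - x0) powr p) \<partial>gauss \<partial>\<nu> (Suc n))"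
        by (rule ula_laws_simps(3)[OF laws]) measurable
      also have "\<dots> \<le> ennreal ((r * a + l * b) powr p)"
        by (rule gaussian_perturbation_moment[OF ula_laws_simps(1,2)[OF laws] _ _ p r(1) a(1) l b(1) Suc b(2) pt]) auto
      also have "\<dots> \<le> ennreal (a powr p)" using a ar r l b p by (intro ennreal_leI powr_mono2) auto
      finally show ?case .
    qed
  qed
qed

text \<open>For small step sizes the estimate holds for every initial coupling, and the infimum over these
couplings produces the Wasserstein distance on the right. For large ones the product coupling
suffices.\<close>

lemma ula_wasserstein_bound:
  fixes \<nu>0 :: "'a measure"
  assumes p: "1 \<le> p" and \<nu>0: "prob_space \<nu>0" "sets \<nu>0 = sets borel"
    and M: "0 < M" "(\<integral>\<^sup>+x. ennreal ((1 + norm x) powr p) \<partial>\<nu>0) \<le> ennreal (M powr p)"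
    and \<gamma>0: "0 < \<gamma>0" "\<gamma>0 < \<mu> / (2 * L\<^sup>2)"
  shows "\<exists>c>0. \<forall>\<gamma>\<in>{0<..<\<gamma>0}. \<forall>n \<nu>. ula_laws \<gamma> \<nu> \<longrightarrow> \<nu> 0 = \<nu>0 \<longrightarrow>
    wasserstein p \<pi> (\<nu> n) \<le> wasserstein p \<nu>0 \<pi> * ennreal (exp (- \<mu> * \<gamma> * real n)) + ennreal (c * sqrt \<gamma>)"
proof -
  obtain N where N: "0 < N" "(\<integral>\<^sup>+x. ennreal ((1 + norm x) powr p) \<partial>\<pi>) \<le> ennreal (N powr p)"
    using gibbs_powr_moment[OF p] .
  obtain x0 where x0: "x0 \<in> D" using D_ne by blast
  have "0 \<le> M + N" using M N by simp
  obtain \<gamma>1 c where \<gamma>1: "0 < \<gamma>1" and c: "0 \<le> c"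
    and small: "\<And>\<gamma> \<nu> n Q F. 0 < \<gamma> \<Longrightarrow> \<gamma> \<le> \<gamma>1 \<Longrightarrow> ula_laws \<gamma> \<nu> \<Longrightarrow> \<nu> 0 = \<nu>0 \<Longrightarrow> Q \<in> couplings \<nu>0 \<pi> \<Longrightarrow> 0 \<le> F \<Longrightarrow> F \<le> M + N \<Longrightarrow>
      (\<integral>\<^sup>+w. ennreal (norm (fst w - snd w) powr p) \<partial>Q) \<le> ennreal (F powr p) \<Longrightarrow>
      wasserstein p \<pi> (\<nu> (Suc n)) \<le> ennreal (F * exp (- \<mu> * \<gamma> * real (Suc n)) + c * sqrt \<gamma>)"
    using small_step_bound[OF p \<nu>0(2) M \<open>0 \<le> M + N\<close>] by blast
  obtain a where a: "0 < a" and large: "\<And>\<gamma> \<nu> n. \<gamma>1 \<le> \<gamma> \<Longrightarrow> \<gamma> < \<gamma>0 \<Longrightarrow> ula_laws \<gamma> \<nu> \<Longrightarrow> \<nu> 0 = \<nu>0 \<Longrightarrow>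
    (\<integral>\<^sup>+x. ennreal (norm (x - x0) powr p) \<partial>\<nu> (Suc n)) \<le> ennreal (a powr p)"
    using uniform_moment_bound[OF p M \<gamma>1 \<gamma>0 x0] by blast
  define b where "b = (1 + norm x0) * N"
  have b: "0 < b" using N by (simp add: b_def add_pos_nonneg)
  have \<pi>b: "(\<integral>\<^sup>+x. ennreal (norm (x - x0) powr p) \<partial>\<pi>) \<le> ennreal (b powr p)"
    unfolding b_def
  proof (rule nn_integral_powr_scale[OF _ _ _ _ p N(2)])
    fix x
    have "norm (x - x0) \<le> norm x + norm x0" by (rule norm_triangle_ineq4)
    also have "\<dots> \<le> (1 + norm x0) * (1 + norm x)" by (simp add: algebra_simps)
    finally show "norm (x - x0) \<le> (1 + norm x0) * (1 + norm x)" .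
  qed (use N in auto)
  define c' where "c' = c + (b + a) / sqrt \<gamma>1 + 1"
  have c': "0 < c'" "c \<le> c'" "(b + a) / sqrt \<gamma>1 \<le> c'" using c a b \<gamma>1 by (auto simp: c'_def add_nonneg_pos)
  let ?cost = "\<lambda>Q. \<integral>\<^sup>+w. ennreal (norm (fst w - snd w :: 'a) powr p) \<partial>Q"
  show ?thesis
  proof (intro exI[of _ c'] conjI c'(1) ballI allI impI)
    fix \<gamma> n \<nu>
    assume "\<gamma> \<in> {0<..<\<gamma>0}" and laws: "ula_laws \<gamma> \<nu>" and init: "\<nu> 0 = \<nu>0"
    then have \<gamma>: "0 < \<gamma>" "\<gamma> < \<gamma>0" by auto
    show "wasserstein p \<pi> (\<nu> n) \<le> wasserstein p \<nu>0 \<pi> * ennreal (exp (- \<mu> * \<gamma> * real n)) + ennreal (c' * sqrt \<gamma>)"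
    proof (cases n)
      case 0
      then show ?thesis using wasserstein_swap_le[of p \<pi> \<nu>0] by (simp add: init add_increasing2)
    next
      case (Suc j)
      let ?e = "exp (- \<mu> * \<gamma> * real n)"
      show ?thesis
      proof (cases "\<gamma> \<le> \<gamma>1")
        case True
        let ?y = "wasserstein p \<pi> (\<nu> n) - ennreal (c' * sqrt \<gamma>)"
        have "?y / ennreal ?e \<le> ennreal_root p (?cost Q)" if Q: "Q \<in> couplings \<nu>0 \<pi>" for Q
        proof -
          have "(\<integral>\<^sup>+x. ennreal (norm (x - 0) powr p) \<partial>\<nu>0) \<le> ennreal (M powr p)"
            using p by (intro order_trans[OF _ M(2)] nn_integral_mono ennreal_leI powr_mono2) auto
          moreover have "(\<integral>\<^sup>+x. ennreal (norm (x - 0) powr p) \<partial>\<pi>) \<le> ennreal (N powr p)"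
            using p by (intro order_trans[OF _ N(2)] nn_integral_mono ennreal_leI powr_mono2) auto
          ultimately have cost: "?cost Q \<le> ennreal ((M + N) powr p)" by (rule coupling_cost_le[OF Q p M(1) N(1)])
          then have "?cost Q \<noteq> \<top>" by (auto simp: top_unique)
          then obtain t where t: "?cost Q = ennreal t" "0 \<le> t" by (cases "?cost Q") auto
          define F where "F = t powr (1 / p)"
          have F: "0 \<le> F" "F powr p = t" using t p by (auto simp: F_def powr_powr)
          have root: "ennreal_root p (?cost Q) = ennreal F" using t by (simp add: ennreal_root_def F_def)
          have "ennreal F \<le> ennreal (M + N)" unfolding root[symmetric] using M N p by (intro ennreal_root_le[OF cost]) auto
          then have "F \<le> M + N" using M N by (simp add: ennreal_le_iff del: ennreal_plus)
          then have "wasserstein p \<pi> (\<nu> n) \<le> ennreal (F * ?e + c * sqrt \<gamma>)"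
            unfolding Suc using t F by (intro small[OF \<gamma>(1) True laws init Q]) auto
          also have "\<dots> \<le> ennreal (F * ?e + c' * sqrt \<gamma>)" using c' \<gamma> by (intro ennreal_leI add_left_mono mult_right_mono) auto
          also have "\<dots> = ennreal (c' * sqrt \<gamma>) + ennreal F * ennreal ?e"
            using F c' \<gamma> by (simp add: ennreal_mult[symmetric] ennreal_plus[symmetric] add.commute del: ennreal_plus)
          finally have "?y \<le> ennreal F * ennreal ?e" by (subst ennreal_minus_le_iff) auto
          then show ?thesis unfolding root by (intro divide_le_posI_ennreal) (auto simp: mult.commute)
        qed
        then have "?y / ennreal ?e \<le> wasserstein p \<nu>0 \<pi>" unfolding wasserstein_def by (intro INF_greatest)
        then have "?y / ennreal ?e * ennreal ?e \<le> wasserstein p \<nu>0 \<pi> * ennreal ?e" by (rule mult_right_mono) simp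
        also have "?y / ennreal ?e * ennreal ?e = ?y"
          by (simp add: ennreal_divide_times)
        finally have "?y \<le> wasserstein p \<nu>0 \<pi> * ennreal ?e" .
        then show ?thesis by (subst (asm) ennreal_minus_le_iff) (simp add: add.commute)
      next
        case False
        then have \<gamma>': "\<gamma>1 \<le> \<gamma>" by simp
        have Q: "\<pi> \<Otimes>\<^sub>M \<nu> n \<in> couplings \<pi> (\<nu> n)"
          using ula_laws_simps(1,2)[OF laws] prob_space_gibbs sets_gibbs by (intro product_coupling) auto
        have "?cost (\<pi> \<Otimes>\<^sub>M \<nu> n) \<le> ennreal ((b + a) powr p)"
          by (rule coupling_cost_le[OF Q p b a \<pi>b]) (use large[OF \<gamma>' \<gamma>(2) laws init, of j] Suc in simp)
        then have "wasserstein p \<pi> (\<nu> n) \<le> ennreal (b + a)" using a b p by (intro wasserstein_le[OF Q]) auto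
        also have "\<dots> \<le> ennreal (c' * sqrt \<gamma>)"
        proof (rule ennreal_leI)
          have "b + a = (b + a) / sqrt \<gamma>1 * sqrt \<gamma>1" using \<gamma>1 by simp
          also have "\<dots> \<le> c' * sqrt \<gamma>" using c' \<gamma>' \<gamma>1 a b by (intro mult_mono) auto
          finally show "b + a \<le> c' * sqrt \<gamma>" .
        qed
        finally show ?thesis by (simp add: add_increasing)
      qed
    qed
  qed
qed

end

theorem theorem1:
  fixes U :: "'a::euclidean_space \<Rightarrow> real"
    and P :: "'b measure"
    and \<xi> :: "'b \<Rightarrow> 'a"
    and L \<mu> p \<beta> \<gamma>0 :: real
  assumes "strongly_convex U"
    and "piecewise_lipschitz_gradient U L"
    and "strongly_monotone_gradient U \<mu>"
    and "prob_space P"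
    and "admissible_initial P U \<xi>"
    and "p \<ge> 1"
    and "\<beta> > 0"
    and "\<gamma>0 \<in> {0 <..< \<mu> / (2 * L\<^sup>2)}"
  shows "\<exists>c>0. \<forall>\<gamma>\<in>{0 <..< \<gamma>0}. \<forall>n::nat. \<forall>z :: nat \<Rightarrow> 'b \<Rightarrow> 'a. gaussian_noise P \<xi> z \<longrightarrow>
    wasserstein p (gibbs_measure U \<beta>) (distr P borel (ula U \<beta> \<gamma> \<xi> z n))
      \<le> wasserstein p (distr P borel \<xi>) (gibbs_measure U \<beta>) * ennreal (exp (- \<mu> * \<gamma> * real n))
        + ennreal (c * \<gamma> powr (1 / 2))"
proof -
  obtain D C B m where "langevin_potential U (gradient U) D \<beta> L \<mu> C B m"
    by (rule langevin_potential_gradient[OF assms(1-3,7)]) (rule that)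
  then interpret langevin_potential U "gradient U" D \<beta> L \<mu> C B m .
  interpret P: prob_space P by fact
  have \<xi>[measurable]: "\<xi> \<in> borel_measurable P" and mom: "integrable P (\<lambda>\<omega>. norm (\<xi> \<omega>) powr p)"
    using assms(5,6) by (auto simp: admissible_initial_def)
  have "(\<integral>\<^sup>+x. ennreal ((1 + norm x) powr p) \<partial>distr P borel \<xi>) = (\<integral>\<^sup>+\<omega>. ennreal ((1 + norm (\<xi> \<omega>)) powr p) \<partial>P)"
    by (subst nn_integral_distr) auto
  also have "\<dots> \<le> (\<integral>\<^sup>+\<omega>. ennreal (3 powr p * (1 + norm (\<xi> \<omega>) powr p)) \<partial>P)"
    using assms(6) by (intro nn_integral_mono ennreal_leI) (use powr_add2_le[of 1 _ p] in auto)
  also have "\<dots> < \<top>"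
  proof -
    have "integrable P (\<lambda>\<omega>. 3 powr p * (1 + norm (\<xi> \<omega>) powr p))" using mom by simp
    then show ?thesis by (subst nn_integral_eq_integral) auto
  qed
  finally obtain M where M: "0 < M" "(\<integral>\<^sup>+x. ennreal ((1 + norm x) powr p) \<partial>distr P borel \<xi>) \<le> ennreal (M powr p)"
    using nn_integral_powr_bound_exists[OF _ assms(6)] by metis
  have "prob_space (distr P borel \<xi>)" by (rule P.prob_space_distr) simp
  then obtain c where c: "c > 0" "\<And>\<gamma> n \<nu>. \<gamma> \<in> {0<..<\<gamma>0} \<Longrightarrow> ula_laws \<gamma> \<nu> \<Longrightarrow> \<nu> 0 = distr P borel \<xi> \<Longrightarrow>
    wasserstein p (gibbs_measure U \<beta>) (\<nu> n) \<le> wasserstein p (distr P borel \<xi>) (gibbs_measure U \<beta>) * ennreal (exp (- \<mu> * \<gamma> * real n)) + ennreal (c * sqrt \<gamma>)"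
    using ula_wasserstein_bound[OF assms(6) _ _ M, of \<gamma>0] assms(8) by auto
  show ?thesis
  proof (intro exI[of _ c] conjI c(1) ballI allI impI)
    fix \<gamma> n and z :: "nat \<Rightarrow> 'b \<Rightarrow> 'a"
    assume \<gamma>: "\<gamma> \<in> {0<..<\<gamma>0}" and z: "gaussian_noise P \<xi> z"
    have "ula_laws \<gamma> (\<lambda>n. distr P borel (ula U \<beta> \<gamma> \<xi> z n))"
      by (rule ula_laws_ula[OF refl assms(4) \<xi> z])
    moreover have "ula U \<beta> \<gamma> \<xi> z 0 = \<xi>" by (rule ext) simp
    ultimately show "wasserstein p (gibbs_measure U \<beta>) (distr P borel (ula U \<beta> \<gamma> \<xi> z n))
      \<le> wasserstein p (distr P borel \<xi>) (gibbs_measure U \<beta>) * ennreal (exp (- \<mu> * \<gamma> * real n)) + ennreal (c * \<gamma> powr (1 / 2))"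
      using c(2)[OF \<gamma>, of "\<lambda>n. distr P borel (ula U \<beta> \<gamma> \<xi> z n)" n] \<gamma> by (simp add: powr_half_sqrt)
  qed
qed

end
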